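(* A map $(f,f_\#):(M,\mathscr{A})\to(N,\mathscr{B})$ of $C^\infty$-ringed spaces induces a map $$\bar f:\mathbf{\Omega}^\bullet_{\mathscr{B}}\to f_*(\mathbf{\Omega}^\bullet_{\mathscr{A}})$$ of sheaves of commutative differential graded algebras.
   Context: A $C^\infty$-ring is a nonempty set $\mathscr{C}$ with, for every $m\ge 0$ and every $g\in C^\infty(\mathbb{R}^m)$, an operation $g_{\mathscr{C}}:\mathscr{C}^m\to\mathscr{C}$, such that coordinate functions act as projections and the operations are compatible with composition of smooth functions; maps of $C^\infty$-rings preserve all operations. Modules over a $C^\infty$-ring are modules over its underlying commutative unital $\mathbb{R}$-algebra. A $C^\infty$-ringed space $(M,\mathscr{A})$ is a topological space $M$ with a sheaf $\mathscr{A}$ of $C^\infty$-rings; a map $(f,f_\#):(M,\mathscr{A})\to(N,\mathscr{B})$ is a continuous map $f:M\to N$ with a map $f_\#:\mathscr{B}\to f_*\mathscr{A}$ of sheaves of $C^\infty$-rings on $N$, where $(f_*\mathscr{S})(U)=\mathscr{S}(f^{-1}(U))$. A $C^\infty$-derivation of $\mathscr{C}$ with values in a $\mathscr{C}$-module $\mathscr{M}$ is a map $X:\mathscr{C}\to\mathscr{M}$ with $X(h_{\mathscr{C}}(a_1,\ldots,a_n))=\sum_{i}(\partial_i h)_{\mathscr{C}}(a_1,\ldots,a_n)\cdot X(a_i)$ for all $n>0$, $h\in C^\infty(\mathbb{R}^n)$, $a_i\in\mathscr{C}$. $d_{\mathscr{C}}:\mathscr{C}\to\Omega^1_{\mathscr{C}}$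 denotes the universal $C^\infty$-derivation: every $C^\infty$-derivation $X:\mathscr{C}\to\mathscr{N}$ factors as $\varphi_X\circ d_{\mathscr{C}}$ for a unique $\mathscr{C}$-linear $\varphi_X$. $\Lambda^\bullet\Omega^1_{\mathscr{C}}=\{\Lambda^k\Omega^1_{\mathscr{C}}\}_{k\in\mathbb{Z}}$ is the exterior algebra over $\mathscr{C}$ ($\Lambda^0=\mathscr{C}$, $\Lambda^k=0$ for $k<0$), with the unique degree $+1$ graded derivation $d$ extending $d_{\mathscr{C}}$ with $d\circ d=0$. It is functorial: $g:\mathscr{C}\to\mathscr{D}$ induces $a_0d_{\mathscr{C}}a_1\wedge\cdots\wedge d_{\mathscr{C}}a_k\mapsto g(a_0)d_{\mathscr{D}}g(a_1)\wedge\cdots\wedge d_{\mathscr{D}}g(a_k)$. For a $C^\infty$-ringed space $(M,\mathscr{A})$, $\Lambda^\bullet\Omega^1_{\mathscr{A}}$ is the presheaf $U\mapsto\Lambda^\bullet\Omega^1_{\mathscr{A}(U)}$ of commutative differential graded algebras (CDGAs), and $\mathbf{\Omega}^\bullet_{\mathscr{A}}=\{\mathbf{\Omega}^k_{\mathscr{A}}\}_{k\in\mathbb{Z}}$ is its degreewise sheafification with the sheafified product and differential; it is a sheaf of CDGAs over $\mathscr{A}$. Here a (pre)sheaf of CDGAs over $\mathscr{A}$ is a sequence, indexed by $k\in\mathbb{Z}$, of (pre)sheaves of $\mathscr{A}$-modules with associative graded-commutative $\mathscr{A}$-bilinear products and an $\mathbb{R}$-linear degree $+1$ graded derivation of square zero.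 A map of sheaves of CDGAs is, in each degree, a map of sheaves linear over the given map of structure sheaves, and it preserves products and commutes with the differentials. *)

theory Defs
  imports "HOL-Analysis.Analysis" "HOL-Algebra.AbelCoset" "HOL-Algebra.Module"
begin

section \<open>Smooth functions of $m$ real variables\<close>

text \<open>
  A function on $\mathbb{R}^m$ is represented by a function of type \<open>(nat \<Rightarrow> real) \<Rightarrow> real\<close>
  that depends only on the coordinates with index \<open>< m\<close>.  The topology on \<open>nat \<Rightarrow> real\<close> is
  the product topology, so for such functions continuity is continuity on $\mathbb{R}^m$.
  Smooth means that all iterated partial derivatives exist everywhere and are continuous.
\<close>

definition pderivative :: "nat \<Rightarrow> ((nat \<Rightarrow> real) \<Rightarrow> real) \<Rightarrow> (nat \<Rightarrow> real) \<Rightarrow> real" where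
  "pderivative i h x = deriv (\<lambda>t. h (x(i := t))) (x i)"

definition smooth_fun :: "nat \<Rightarrow> ((nat \<Rightarrow> real) \<Rightarrow> real) set" where
  "smooth_fun m = {h.
     (\<forall>x y. (\<forall>i<m. x i = y i) \<longrightarrow> h x = h y) \<and>
     (\<forall>ps. set ps \<subseteq> {..<m} \<longrightarrow>
        continuous_on UNIV (foldr pderivative ps h) \<and>
        (\<forall>i<m. \<forall>x. (\<lambda>t. foldr pderivative ps h (x(i := t))) differentiable (at (x i))))}"


section \<open>Smooth rings\<close>

text \<open>
  \<open>cop C h as\<close> is the operation of a smooth function \<open>h\<close> of \<open>length as\<close> variables.
\<close>

record 'a cinf_ring = "'a partial_object" +
  cop :: "((nat \<Rightarrow> real) \<Rightarrow> real) \<Rightarrow> 'a list \<Rightarrow> 'a"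

definition cinf_ring :: "'a cinf_ring \<Rightarrow> bool" where
  "cinf_ring C \<longleftrightarrow>
     carrier C \<noteq> {} \<and>
     (\<forall>h as. set as \<subseteq> carrier C \<and> h \<in> smooth_fun (length as) \<longrightarrow> cop C h as \<in> carrier C) \<and>
     (\<forall>as i. set as \<subseteq> carrier C \<and> i < length as \<longrightarrow> cop C (\<lambda>x. x i) as = as ! i) \<and>
     (\<forall>m g h as. set as \<subseteq> carrier C \<and> g \<in> smooth_fun m \<and>
        (\<forall>i<m. h i \<in> smooth_fun (length as)) \<longrightarrow>
        cop C (\<lambda>x. g (\<lambda>i. h i x)) as = cop C g (map (\<lambda>i. cop C (h i) as) [0..<m]))"

definition cinf_hom :: "'a cinf_ring \<Rightarrow> 'b cinf_ring \<Rightarrow> ('a \<Rightarrow> 'b) \<Rightarrow> bool" where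
  "cinf_hom C D g \<longleftrightarrow>
     g \<in> carrier C \<rightarrow> carrier D \<and>
     (\<forall>h as. set as \<subseteq> carrier C \<and> h \<in> smooth_fun (length as) \<longrightarrow>
        g (cop C h as) = cop D h (map g as))"

definition cconst :: "'a cinf_ring \<Rightarrow> real \<Rightarrow> 'a" where
  "cconst C r = cop C (\<lambda>_. r) []"

text \<open>
  The underlying commutative unital $\mathbb{R}$-algebra; scalars act through \<open>cconst C\<close>.
\<close>

definition alg :: "'a cinf_ring \<Rightarrow> 'a ring" where
  "alg C = \<lparr> carrier = carrier C,
     mult = (\<lambda>a b. cop C (\<lambda>x. x 0 * x 1) [a, b]), one = cconst C 1,
     zero = cconst C 0, add = (\<lambda>a b. cop C (\<lambda>x. x 0 + x 1) [a, b]) \<rparr>"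


section \<open>Free modules, generated submodules, quotients\<close>

text \<open>
  The record type of modules extends that of rings; its fields \<open>mult\<close> and \<open>one\<close> play no role
  for modules and are left unspecified.
\<close>

definition free_module :: "('a, 'r) ring_scheme \<Rightarrow> 'x set \<Rightarrow> ('a, 'x \<Rightarrow> 'a) module" where
  "free_module R S =
     \<lparr> carrier = {u. (\<forall>x. u x \<in> carrier R) \<and> (\<forall>x. x \<notin> S \<longrightarrow> u x = \<zero>\<^bsub>R\<^esub>) \<and>
                     finite {x. u x \<noteq> \<zero>\<^bsub>R\<^esub>}},
       mult = undefined, one = undefined,
       zero = (\<lambda>_. \<zero>\<^bsub>R\<^esub>), add = (\<lambda>u v x. u x \<oplus>\<^bsub>R\<^esub> v x),
       smult = (\<lambda>r u x. r \<otimes>\<^bsub>R\<^esub> u x) \<rparr>"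

definition basis_vec :: "('a, 'r) ring_scheme \<Rightarrow> 'x \<Rightarrow> 'x \<Rightarrow> 'a" where
  "basis_vec R x = (\<lambda>y. if y = x then \<one>\<^bsub>R\<^esub> else \<zero>\<^bsub>R\<^esub>)"

definition gen_submodule ::
    "('a, 'r) ring_scheme \<Rightarrow> ('a, 'm, 's) module_scheme \<Rightarrow> 'm set \<Rightarrow> 'm set" where
  "gen_submodule R M S = \<Inter>{H. submodule H R M \<and> S \<subseteq> H}"

definition quot_module ::
    "('a, 'm, 's) module_scheme \<Rightarrow> 'm set \<Rightarrow> ('a, 'm set) module" where
  "quot_module M N =
     \<lparr> carrier = a_rcosets\<^bsub>M\<^esub> N, mult = undefined, one = undefined,
       zero = N, add = (\<lambda>K L. K <+>\<^bsub>M\<^esub> L),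
       smult = (\<lambda>r K. \<Union>x\<in>K. N +>\<^bsub>M\<^esub> (r \<odot>\<^bsub>M\<^esub> x)) \<rparr>"


section \<open>Smooth derivations and Kaehler differentials\<close>

definition cinf_derivation ::
    "'a cinf_ring \<Rightarrow> ('a, 'm, 's) module_scheme \<Rightarrow> ('a \<Rightarrow> 'm) \<Rightarrow> bool" where
  "cinf_derivation C M X \<longleftrightarrow>
     X \<in> carrier C \<rightarrow> carrier M \<and>
     (\<forall>h as. as \<noteq> [] \<and> set as \<subseteq> carrier C \<and> h \<in> smooth_fun (length as) \<longrightarrow>
        X (cop C h as) =
          (\<Oplus>\<^bsub>M\<^esub>i\<in>{..<length as}. cop C (pderivative i h) as \<odot>\<^bsub>M\<^esub> X (as ! i)))"

text \<open>
  The module of Kaehler differentials is the free module on symbols indexed by the elements of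
  \<open>C\<close>, modulo the relations that make the class of the symbol a smooth derivation.
  Its universal property is \<open>kaehler_universal\<close> below.
\<close>

definition kaehler_relations :: "'a cinf_ring \<Rightarrow> ('a \<Rightarrow> 'a) set" where
  "kaehler_relations C =
     (let R = alg C; E = free_module R (carrier C); e = basis_vec R in
      gen_submodule R E
        {e (cop C h as) \<ominus>\<^bsub>E\<^esub>
           (\<Oplus>\<^bsub>E\<^esub>i\<in>{..<length as}. cop C (pderivative i h) as \<odot>\<^bsub>E\<^esub> e (as ! i)) | h as.
         as \<noteq> [] \<and> set as \<subseteq> carrier C \<and> h \<in> smooth_fun (length as)})"

definition kaehler :: "'a cinf_ring \<Rightarrow> ('a, ('a \<Rightarrow> 'a) set) module" where
  "kaehler C = quot_module (free_module (alg C) (carrier C)) (kaehler_relations C)"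

definition kaehler_d :: "'a cinf_ring \<Rightarrow> 'a \<Rightarrow> ('a \<Rightarrow> 'a) set" where
  "kaehler_d C a =
     kaehler_relations C +>\<^bsub>free_module (alg C) (carrier C)\<^esub> basis_vec (alg C) a"


section \<open>Exterior powers\<close>

text \<open>
  The \<open>k\<close>-th exterior power is the free module on lists of \<open>k\<close> elements of \<open>M\<close> modulo
  multilinearity and \<open>x \<and> x = 0\<close>.  For \<open>k < 0\<close> there are no such lists and the module is zero;
  for \<open>k = 0\<close> the only list is \<open>[]\<close> and the module is free of rank one on its class,
  which identifies it with the base ring.
\<close>

definition ext_free :: "('a, 'r) ring_scheme \<Rightarrow> ('a, 'm, 's) module_scheme \<Rightarrow> int \<Rightarrow>
    ('a, 'm list \<Rightarrow> 'a) module" where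
  "ext_free R M k = free_module R {xs. set xs \<subseteq> carrier M \<and> int (length xs) = k}"

definition ext_relations :: "('a, 'r) ring_scheme \<Rightarrow> ('a, 'm, 's) module_scheme \<Rightarrow> int \<Rightarrow>
    ('m list \<Rightarrow> 'a) set" where
  "ext_relations R M k =
     (let E = ext_free R M k; e = basis_vec R in
      gen_submodule R E
        ({e (xs @ (x \<oplus>\<^bsub>M\<^esub> y) # ys) \<ominus>\<^bsub>E\<^esub> (e (xs @ x # ys) \<oplus>\<^bsub>E\<^esub> e (xs @ y # ys)) | xs x y ys.
            set xs \<subseteq> carrier M \<and> x \<in> carrier M \<and> y \<in> carrier M \<and> set ys \<subseteq> carrier M \<and>
            int (length xs + 1 + length ys) = k} \<union>
         {e (xs @ (r \<odot>\<^bsub>M\<^esub> x) # ys) \<ominus>\<^bsub>E\<^esub> r \<odot>\<^bsub>E\<^esub> e (xs @ x # ys) | xs r x ys.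
            set xs \<subseteq> carrier M \<and> r \<in> carrier R \<and> x \<in> carrier M \<and> set ys \<subseteq> carrier M \<and>
            int (length xs + 1 + length ys) = k} \<union>
         {e (xs @ x # x # ys) | xs x ys.
            set xs \<subseteq> carrier M \<and> x \<in> carrier M \<and> set ys \<subseteq> carrier M \<and>
            int (length xs + 2 + length ys) = k}))"

definition ext_power :: "('a, 'r) ring_scheme \<Rightarrow> ('a, 'm, 's) module_scheme \<Rightarrow> int \<Rightarrow>
    ('a, ('m list \<Rightarrow> 'a) set) module" where
  "ext_power R M k = quot_module (ext_free R M k) (ext_relations R M k)"

text \<open>\<open>wedge_list R M [x\<^sub>1, \<dots>, x\<^sub>k]\<close> is \<open>x\<^sub>1 \<and> \<dots> \<and> x\<^sub>k\<close>.\<close>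

definition wedge_list :: "('a, 'r) ring_scheme \<Rightarrow> ('a, 'm, 's) module_scheme \<Rightarrow> 'm list \<Rightarrow>
    ('m list \<Rightarrow> 'a) set" where
  "wedge_list R M xs =
     ext_relations R M (int (length xs)) +>\<^bsub>ext_free R M (int (length xs))\<^esub> basis_vec R xs"

text \<open>
  The product is induced by concatenation of lists, extended bilinearly: the coefficient of
  the product of \<open>u\<close> and \<open>v\<close> at a list \<open>zs\<close> of length \<open>k + l\<close> is the coefficient of \<open>u\<close> at the
  first \<open>k\<close> entries times that of \<open>v\<close> at the last \<open>l\<close>.
\<close>

definition ext_mult :: "('a, 'r) ring_scheme \<Rightarrow> ('a, 'm, 's) module_scheme \<Rightarrow> int \<Rightarrow> int \<Rightarrow>
    ('m list \<Rightarrow> 'a) set \<Rightarrow> ('m list \<Rightarrow> 'a) set \<Rightarrow> ('m list \<Rightarrow> 'a) set" where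
  "ext_mult R M k l \<omega> \<eta> =
     (\<Union>u\<in>\<omega>. \<Union>v\<in>\<eta>. ext_relations R M (k + l) +>\<^bsub>ext_free R M (k + l)\<^esub>
        (\<lambda>zs. u (take (nat k) zs) \<otimes>\<^bsub>R\<^esub> v (drop (nat k) zs)))"


section \<open>Commutative differential graded algebras over a smooth ring\<close>

record ('a, 'w) cdga =
  deg :: "int \<Rightarrow> ('a, 'w) module"
  prd :: "int \<Rightarrow> int \<Rightarrow> 'w \<Rightarrow> 'w \<Rightarrow> 'w"
  dif :: "int \<Rightarrow> 'w \<Rightarrow> 'w"

definition signed :: "('a, 'w, 's) module_scheme \<Rightarrow> int \<Rightarrow> 'w \<Rightarrow> 'w" where
  "signed M n x = (if even n then x else \<ominus>\<^bsub>M\<^esub> x)"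

definition graded_algebra ::
    "'a cinf_ring \<Rightarrow> (int \<Rightarrow> ('a, 'w) module) \<Rightarrow> (int \<Rightarrow> int \<Rightarrow> 'w \<Rightarrow> 'w \<Rightarrow> 'w) \<Rightarrow> bool" where
  "graded_algebra C E P \<longleftrightarrow>
     (\<forall>k. Module.module (alg C) (E k)) \<and>
     (\<forall>k l. \<forall>x\<in>carrier (E k). \<forall>y\<in>carrier (E l).
        P k l x y \<in> carrier (E (k + l)) \<and>
        P k l x y = signed (E (k + l)) (k * l) (P l k y x)) \<and>
     (\<forall>k l. \<forall>x\<in>carrier (E k). \<forall>x'\<in>carrier (E k). \<forall>y\<in>carrier (E l).
        P k l (x \<oplus>\<^bsub>E k\<^esub> x') y = P k l x y \<oplus>\<^bsub>E (k + l)\<^esub> P k l x' y) \<and>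
     (\<forall>k l. \<forall>x\<in>carrier (E k). \<forall>y\<in>carrier (E l). \<forall>y'\<in>carrier (E l).
        P k l x (y \<oplus>\<^bsub>E l\<^esub> y') = P k l x y \<oplus>\<^bsub>E (k + l)\<^esub> P k l x y') \<and>
     (\<forall>k l. \<forall>a\<in>carrier C. \<forall>x\<in>carrier (E k). \<forall>y\<in>carrier (E l).
        P k l (a \<odot>\<^bsub>E k\<^esub> x) y = a \<odot>\<^bsub>E (k + l)\<^esub> P k l x y \<and>
        P k l x (a \<odot>\<^bsub>E l\<^esub> y) = a \<odot>\<^bsub>E (k + l)\<^esub> P k l x y) \<and>
     (\<forall>k l m. \<forall>x\<in>carrier (E k). \<forall>y\<in>carrier (E l). \<forall>z\<in>carrier (E m).
        P (k + l) m (P k l x y) z = P k (l + m) x (P l m y z))"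

definition graded_derivation ::
    "'a cinf_ring \<Rightarrow> (int \<Rightarrow> ('a, 'w) module) \<Rightarrow> (int \<Rightarrow> int \<Rightarrow> 'w \<Rightarrow> 'w \<Rightarrow> 'w) \<Rightarrow>
     (int \<Rightarrow> 'w \<Rightarrow> 'w) \<Rightarrow> bool" where
  "graded_derivation C E P D \<longleftrightarrow>
     (\<forall>k. D k \<in> carrier (E k) \<rightarrow> carrier (E (k + 1))) \<and>
     (\<forall>k. \<forall>x\<in>carrier (E k). \<forall>y\<in>carrier (E k). D k (x \<oplus>\<^bsub>E k\<^esub> y) = D k x \<oplus>\<^bsub>E (k + 1)\<^esub> D k y) \<and>
     (\<forall>k r. \<forall>x\<in>carrier (E k).
        D k (cconst C r \<odot>\<^bsub>E k\<^esub> x) = cconst C r \<odot>\<^bsub>E (k + 1)\<^esub> D k x) \<and>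
     (\<forall>k l. \<forall>x\<in>carrier (E k). \<forall>y\<in>carrier (E l).
        D (k + l) (P k l x y) =
          P (k + 1) l (D k x) y \<oplus>\<^bsub>E (k + l + 1)\<^esub>
          signed (E (k + l + 1)) k (P k (l + 1) x (D l y)))"

definition square_zero :: "(int \<Rightarrow> ('a, 'w) module) \<Rightarrow> (int \<Rightarrow> 'w \<Rightarrow> 'w) \<Rightarrow> bool" where
  "square_zero E D \<longleftrightarrow> (\<forall>k. \<forall>x\<in>carrier (E k). D (k + 1) (D k x) = \<zero>\<^bsub>E (k + 2)\<^esub>)"

definition is_cdga :: "'a cinf_ring \<Rightarrow> ('a, 'w) cdga \<Rightarrow> bool" where
  "is_cdga C E \<longleftrightarrow>
     graded_algebra C (deg E) (prd E) \<and>
     graded_derivation C (deg E) (prd E) (dif E) \<and>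
     square_zero (deg E) (dif E)"

definition cdga_hom ::
    "'a cinf_ring \<Rightarrow> ('a, 'v) cdga \<Rightarrow> ('b, 'w) cdga \<Rightarrow> ('a \<Rightarrow> 'b) \<Rightarrow> (int \<Rightarrow> 'v \<Rightarrow> 'w) \<Rightarrow> bool" where
  "cdga_hom C E E' \<phi> F \<longleftrightarrow>
     (\<forall>k. F k \<in> carrier (deg E k) \<rightarrow> carrier (deg E' k)) \<and>
     (\<forall>k. \<forall>x\<in>carrier (deg E k). \<forall>y\<in>carrier (deg E k).
        F k (x \<oplus>\<^bsub>deg E k\<^esub> y) = F k x \<oplus>\<^bsub>deg E' k\<^esub> F k y) \<and>
     (\<forall>k. \<forall>a\<in>carrier C. \<forall>x\<in>carrier (deg E k).
        F k (a \<odot>\<^bsub>deg E k\<^esub> x) = \<phi> a \<odot>\<^bsub>deg E' k\<^esub> F k x) \<and>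
     (\<forall>k l. \<forall>x\<in>carrier (deg E k). \<forall>y\<in>carrier (deg E l).
        F (k + l) (prd E k l x y) = prd E' k l (F k x) (F l y)) \<and>
     (\<forall>k. \<forall>x\<in>carrier (deg E k). F (k + 1) (dif E k x) = dif E' k (F k x))"


section \<open>The algebra of forms of a smooth ring\<close>

definition form_deg :: "'a cinf_ring \<Rightarrow> int \<Rightarrow> ('a, (('a \<Rightarrow> 'a) set list \<Rightarrow> 'a) set) module" where
  "form_deg C = ext_power (alg C) (kaehler C)"

definition form_prd :: "'a cinf_ring \<Rightarrow> int \<Rightarrow> int \<Rightarrow> (('a \<Rightarrow> 'a) set list \<Rightarrow> 'a) set \<Rightarrow>
    (('a \<Rightarrow> 'a) set list \<Rightarrow> 'a) set \<Rightarrow> (('a \<Rightarrow> 'a) set list \<Rightarrow> 'a) set" where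
  "form_prd C = ext_mult (alg C) (kaehler C)"

text \<open>\<open>simple_form C a\<^sub>0 [a\<^sub>1, \<dots>, a\<^sub>k]\<close> is \<open>a\<^sub>0 da\<^sub>1 \<and> \<dots> \<and> da\<^sub>k\<close>; for \<open>k = 0\<close> it is \<open>a\<^sub>0\<close> as a \<open>0\<close>-form.\<close>

definition simple_form :: "'a cinf_ring \<Rightarrow> 'a \<Rightarrow> 'a list \<Rightarrow> (('a \<Rightarrow> 'a) set list \<Rightarrow> 'a) set" where
  "simple_form C a as =
     a \<odot>\<^bsub>form_deg C (int (length as))\<^esub> wedge_list (alg C) (kaehler C) (map (kaehler_d C) as)"

text \<open>
  The differential is the unique graded derivation of square zero that sends a \<open>0\<close>-form \<open>a\<close>
  to the \<open>1\<close>-form \<open>da\<close>; membership in \<open>\<rightarrow>\<^sub>E\<close> fixes the values outside the carriers.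
\<close>

definition form_dif :: "'a cinf_ring \<Rightarrow> int \<Rightarrow> (('a \<Rightarrow> 'a) set list \<Rightarrow> 'a) set \<Rightarrow>
    (('a \<Rightarrow> 'a) set list \<Rightarrow> 'a) set" where
  "form_dif C = (THE D.
     (\<forall>k. D k \<in> carrier (form_deg C k) \<rightarrow>\<^sub>E carrier (form_deg C (k + 1))) \<and>
     graded_derivation C (form_deg C) (form_prd C) D \<and>
     square_zero (form_deg C) D \<and>
     (\<forall>a\<in>carrier C. D 0 (simple_form C a []) = simple_form C (cconst C 1) [a]))"

definition forms :: "'a cinf_ring \<Rightarrow> ('a, (('a \<Rightarrow> 'a) set list \<Rightarrow> 'a) set) cdga" where
  "forms C = \<lparr> deg = form_deg C, prd = form_prd C, dif = form_dif C \<rparr>"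

text \<open>
  Functoriality: the unique additive map with
  \<open>a\<^sub>0 da\<^sub>1 \<and> \<dots> \<and> da\<^sub>k \<mapsto> g(a\<^sub>0) dg(a\<^sub>1) \<and> \<dots> \<and> dg(a\<^sub>k)\<close>.
\<close>

definition forms_map :: "'a cinf_ring \<Rightarrow> 'b cinf_ring \<Rightarrow> ('a \<Rightarrow> 'b) \<Rightarrow> int \<Rightarrow>
    (('a \<Rightarrow> 'a) set list \<Rightarrow> 'a) set \<Rightarrow> (('b \<Rightarrow> 'b) set list \<Rightarrow> 'b) set" where
  "forms_map C D g k = (THE \<phi>.
     \<phi> \<in> carrier (form_deg C k) \<rightarrow>\<^sub>E carrier (form_deg D k) \<and>
     (\<forall>x\<in>carrier (form_deg C k). \<forall>y\<in>carrier (form_deg C k).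
        \<phi> (x \<oplus>\<^bsub>form_deg C k\<^esub> y) = \<phi> x \<oplus>\<^bsub>form_deg D k\<^esub> \<phi> y) \<and>
     (\<forall>a as. a \<in> carrier C \<and> set as \<subseteq> carrier C \<and> int (length as) = k \<longrightarrow>
        \<phi> (simple_form C a as) = simple_form D (g a) (map g as)))"


section \<open>Smooth ringed spaces\<close>

text \<open>\<open>r U V\<close> is the restriction from \<open>U\<close> to \<open>V\<close>; only open sets \<open>V \<subseteq> U\<close> matter.\<close>

definition set_presheaf ::
    "'p topology \<Rightarrow> ('p set \<Rightarrow> 'x set) \<Rightarrow> ('p set \<Rightarrow> 'p set \<Rightarrow> 'x \<Rightarrow> 'x) \<Rightarrow> bool" where
  "set_presheaf X S r \<longleftrightarrow>
     (\<forall>U V. openin X U \<and> openin X V \<and> V \<subseteq> U \<longrightarrow> r U V \<in> S U \<rightarrow> S V) \<and>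
     (\<forall>U. openin X U \<longrightarrow> (\<forall>s\<in>S U. r U U s = s)) \<and>
     (\<forall>U V W. openin X U \<and> openin X V \<and> openin X W \<and> V \<subseteq> U \<and> W \<subseteq> V \<longrightarrow>
        (\<forall>s\<in>S U. r V W (r U V s) = r U W s))"

definition set_sheaf ::
    "'p topology \<Rightarrow> ('p set \<Rightarrow> 'x set) \<Rightarrow> ('p set \<Rightarrow> 'p set \<Rightarrow> 'x \<Rightarrow> 'x) \<Rightarrow> bool" where
  "set_sheaf X S r \<longleftrightarrow>
     set_presheaf X S r \<and>
     (\<forall>\<U> s. (\<forall>U\<in>\<U>. openin X U \<and> s U \<in> S U) \<and>
        (\<forall>U\<in>\<U>. \<forall>V\<in>\<U>. r U (U \<inter> V) (s U) = r V (U \<inter> V) (s V)) \<longrightarrow>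
        (\<exists>!t. t \<in> S (\<Union>\<U>) \<and> (\<forall>U\<in>\<U>. r (\<Union>\<U>) U t = s U)))"

record ('p, 'a) cinf_presheaf =
  rng :: "'p set \<Rightarrow> 'a cinf_ring"
  rst :: "'p set \<Rightarrow> 'p set \<Rightarrow> 'a \<Rightarrow> 'a"

definition cinf_ringed_space :: "'p topology \<Rightarrow> ('p, 'a) cinf_presheaf \<Rightarrow> bool" where
  "cinf_ringed_space X A \<longleftrightarrow>
     (\<forall>U. openin X U \<longrightarrow> cinf_ring (rng A U)) \<and>
     (\<forall>U V. openin X U \<and> openin X V \<and> V \<subseteq> U \<longrightarrow> cinf_hom (rng A U) (rng A V) (rst A U V)) \<and>
     set_sheaf X (\<lambda>U. carrier (rng A U)) (rst A)"

definition preim :: "'p topology \<Rightarrow> ('p \<Rightarrow> 'q) \<Rightarrow> 'q set \<Rightarrow> 'p set" where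
  "preim X f U = {x \<in> topspace X. f x \<in> U}"

definition push_cinf ::
    "'p topology \<Rightarrow> ('p \<Rightarrow> 'q) \<Rightarrow> ('p, 'a) cinf_presheaf \<Rightarrow> ('q, 'a) cinf_presheaf" where
  "push_cinf X f A =
     \<lparr> rng = (\<lambda>U. rng A (preim X f U)), rst = (\<lambda>U V. rst A (preim X f U) (preim X f V)) \<rparr>"

definition cinf_sheaf_map :: "'q topology \<Rightarrow> ('q, 'b) cinf_presheaf \<Rightarrow> ('q, 'a) cinf_presheaf \<Rightarrow>
    ('q set \<Rightarrow> 'b \<Rightarrow> 'a) \<Rightarrow> bool" where
  "cinf_sheaf_map Y B A \<phi> \<longleftrightarrow>
     (\<forall>U. openin Y U \<longrightarrow> cinf_hom (rng B U) (rng A U) (\<phi> U)) \<and>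
     (\<forall>U V. openin Y U \<and> openin Y V \<and> V \<subseteq> U \<longrightarrow>
        (\<forall>b\<in>carrier (rng B U). \<phi> V (rst B U V b) = rst A U V (\<phi> U b)))"

definition ringed_space_map ::
    "'p topology \<Rightarrow> ('p, 'a) cinf_presheaf \<Rightarrow> 'q topology \<Rightarrow> ('q, 'b) cinf_presheaf \<Rightarrow>
     ('p \<Rightarrow> 'q) \<Rightarrow> ('q set \<Rightarrow> 'b \<Rightarrow> 'a) \<Rightarrow> bool" where
  "ringed_space_map X A Y B f f_sh \<longleftrightarrow>
     continuous_map X Y f \<and> cinf_sheaf_map Y B (push_cinf X f A) f_sh"


section \<open>Sheaves of CDGAs\<close>

record ('p, 'a, 'w) cdga_presheaf =
  sec :: "'p set \<Rightarrow> ('a, 'w) cdga"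
  res :: "'p set \<Rightarrow> 'p set \<Rightarrow> int \<Rightarrow> 'w \<Rightarrow> 'w"

definition is_cdga_presheaf ::
    "'p topology \<Rightarrow> ('p, 'a) cinf_presheaf \<Rightarrow> ('p, 'a, 'w) cdga_presheaf \<Rightarrow> bool" where
  "is_cdga_presheaf X A P \<longleftrightarrow>
     (\<forall>U. openin X U \<longrightarrow> is_cdga (rng A U) (sec P U)) \<and>
     (\<forall>U V. openin X U \<and> openin X V \<and> V \<subseteq> U \<longrightarrow>
        cdga_hom (rng A U) (sec P U) (sec P V) (rst A U V) (res P U V)) \<and>
     (\<forall>k. set_presheaf X (\<lambda>U. carrier (deg (sec P U) k)) (\<lambda>U V. res P U V k))"

definition is_cdga_sheaf ::
    "'p topology \<Rightarrow> ('p, 'a) cinf_presheaf \<Rightarrow> ('p, 'a, 'w) cdga_presheaf \<Rightarrow> bool" where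
  "is_cdga_sheaf X A P \<longleftrightarrow>
     is_cdga_presheaf X A P \<and>
     (\<forall>k. set_sheaf X (\<lambda>U. carrier (deg (sec P U) k)) (\<lambda>U V. res P U V k))"

text \<open>
  A map of sheaves of CDGAs on \<open>Y\<close> over the map \<open>\<phi>\<close> of structure sheaves from \<open>B\<close> to \<open>A\<close>.
\<close>

definition cdga_sheaf_map ::
    "'q topology \<Rightarrow> ('q, 'b) cinf_presheaf \<Rightarrow> ('q, 'b, 'v) cdga_presheaf \<Rightarrow>
     ('q, 'a) cinf_presheaf \<Rightarrow> ('q, 'a, 'w) cdga_presheaf \<Rightarrow>
     ('q set \<Rightarrow> 'b \<Rightarrow> 'a) \<Rightarrow> ('q set \<Rightarrow> int \<Rightarrow> 'v \<Rightarrow> 'w) \<Rightarrow> bool" where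
  "cdga_sheaf_map Y B Q A P \<phi> F \<longleftrightarrow>
     is_cdga_sheaf Y B Q \<and> is_cdga_sheaf Y A P \<and>
     (\<forall>U. openin Y U \<longrightarrow> cdga_hom (rng B U) (sec Q U) (sec P U) (\<phi> U) (F U)) \<and>
     (\<forall>U V k. openin Y U \<and> openin Y V \<and> V \<subseteq> U \<longrightarrow>
        (\<forall>x\<in>carrier (deg (sec Q U) k). F V k (res Q U V k x) = res P U V k (F U k x)))"

definition push_cdga ::
    "'p topology \<Rightarrow> ('p \<Rightarrow> 'q) \<Rightarrow> ('p, 'a, 'w) cdga_presheaf \<Rightarrow> ('q, 'a, 'w) cdga_presheaf" where
  "push_cdga X f P =
     \<lparr> sec = (\<lambda>U. sec P (preim X f U)), res = (\<lambda>U V. res P (preim X f U) (preim X f V)) \<rparr>"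


section \<open>Sheafification\<close>

text \<open>
  The germ at \<open>p\<close> of a section \<open>\<sigma>\<close> over \<open>V\<close> is the class of \<open>(V, \<sigma>)\<close>, and a section of the
  sheafification over \<open>U\<close> assigns to each point of \<open>U\<close> a germ there, given locally by
  sections of the presheaf (and is \<open>undefined\<close> outside \<open>U\<close>).
\<close>

definition germ :: "'p topology \<Rightarrow> ('p, 'a, 'w) cdga_presheaf \<Rightarrow> int \<Rightarrow> 'p \<Rightarrow> 'p set \<Rightarrow> 'w \<Rightarrow>
    ('p set \<times> 'w) set" where
  "germ X P k p V \<sigma> = {(W, \<tau>). openin X W \<and> p \<in> W \<and> \<tau> \<in> carrier (deg (sec P W) k) \<and>
     (\<exists>Z. openin X Z \<and> p \<in> Z \<and> Z \<subseteq> V \<inter> W \<and> res P V Z k \<sigma> = res P W Z k \<tau>)}"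

definition sheafified_sections :: "'p topology \<Rightarrow> ('p, 'a, 'w) cdga_presheaf \<Rightarrow> int \<Rightarrow> 'p set \<Rightarrow>
    ('p \<Rightarrow> ('p set \<times> 'w) set) set" where
  "sheafified_sections X P k U = {s \<in> extensional U. \<forall>p\<in>U. \<exists>V \<sigma>.
     openin X V \<and> p \<in> V \<and> V \<subseteq> U \<and> \<sigma> \<in> carrier (deg (sec P V) k) \<and>
     (\<forall>q\<in>V. s q = germ X P k q V \<sigma>)}"

definition sheafify_unit :: "'p topology \<Rightarrow> ('p, 'a, 'w) cdga_presheaf \<Rightarrow> 'p set \<Rightarrow> int \<Rightarrow> 'w \<Rightarrow>
    'p \<Rightarrow> ('p set \<times> 'w) set" where
  "sheafify_unit X P U k \<sigma> = (\<lambda>p\<in>U. germ X P k p U \<sigma>)"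

text \<open>
  Operations on germs are computed on representatives (for binary ones, over a common open
  set); the unions below are over representatives that all give the same germ.
\<close>

definition sheafified_deg :: "'p topology \<Rightarrow> ('p, 'a) cinf_presheaf \<Rightarrow>
    ('p, 'a, 'w) cdga_presheaf \<Rightarrow> 'p set \<Rightarrow> int \<Rightarrow> ('a, 'p \<Rightarrow> ('p set \<times> 'w) set) module" where
  "sheafified_deg X A P U k =
     \<lparr> carrier = sheafified_sections X P k U, mult = undefined, one = undefined,
       zero = sheafify_unit X P U k \<zero>\<^bsub>deg (sec P U) k\<^esub>,
       add = (\<lambda>s t. \<lambda>p\<in>U. \<Union>{germ X P k p V (\<sigma> \<oplus>\<^bsub>deg (sec P V) k\<^esub> \<tau>) | V \<sigma> \<tau>.
                (V, \<sigma>) \<in> s p \<and> (V, \<tau>) \<in> t p}),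
       smult = (\<lambda>a s. \<lambda>p\<in>U. \<Union>{germ X P k p V (rst A U V a \<odot>\<^bsub>deg (sec P V) k\<^esub> \<sigma>) | V \<sigma>.
                V \<subseteq> U \<and> (V, \<sigma>) \<in> s p}) \<rparr>"

definition sheafify :: "'p topology \<Rightarrow> ('p, 'a) cinf_presheaf \<Rightarrow> ('p, 'a, 'w) cdga_presheaf \<Rightarrow>
    ('p, 'a, 'p \<Rightarrow> ('p set \<times> 'w) set) cdga_presheaf" where
  "sheafify X A P =
     \<lparr> sec = (\<lambda>U. \<lparr> deg = sheafified_deg X A P U,
          prd = (\<lambda>k l s t. \<lambda>p\<in>U. \<Union>{germ X P (k + l) p V (prd (sec P V) k l \<sigma> \<tau>) | V \<sigma> \<tau>.
                   (V, \<sigma>) \<in> s p \<and> (V, \<tau>) \<in> t p}),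
          dif = (\<lambda>k s. \<lambda>p\<in>U. \<Union>{germ X P (k + 1) p V (dif (sec P V) k \<sigma>) | V \<sigma>.
                   (V, \<sigma>) \<in> s p}) \<rparr>),
       res = (\<lambda>U V k s. restrict s V) \<rparr>"


section \<open>Differential forms on a smooth ringed space\<close>

definition forms_presheaf :: "('p, 'a) cinf_presheaf \<Rightarrow>
    ('p, 'a, (('a \<Rightarrow> 'a) set list \<Rightarrow> 'a) set) cdga_presheaf" where
  "forms_presheaf A =
     \<lparr> sec = (\<lambda>U. forms (rng A U)), res = (\<lambda>U V. forms_map (rng A U) (rng A V) (rst A U V)) \<rparr>"

definition forms_sheaf :: "'p topology \<Rightarrow> ('p, 'a) cinf_presheaf \<Rightarrow>
    ('p, 'a, 'p \<Rightarrow> ('p set \<times> (('a \<Rightarrow> 'a) set list \<Rightarrow> 'a) set) set) cdga_presheaf" where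
  "forms_sheaf X A = sheafify X A (forms_presheaf A)"

text \<open>
  The map that \<open>f_sh\<close> induces on presheaves of forms, followed by sheafification, determines
  the map of sheaves: \<open>F\<close> is induced by \<open>(f, f_sh)\<close> if it agrees with that composite on the
  images of presheaf sections.
\<close>

definition induced_by :: "'p topology \<Rightarrow> ('p, 'a) cinf_presheaf \<Rightarrow>
    'q topology \<Rightarrow> ('q, 'b) cinf_presheaf \<Rightarrow> ('p \<Rightarrow> 'q) \<Rightarrow> ('q set \<Rightarrow> 'b \<Rightarrow> 'a) \<Rightarrow>
    ('q set \<Rightarrow> int \<Rightarrow> ('q \<Rightarrow> ('q set \<times> (('b \<Rightarrow> 'b) set list \<Rightarrow> 'b) set) set) \<Rightarrow>
       ('p \<Rightarrow> ('p set \<times> (('a \<Rightarrow> 'a) set list \<Rightarrow> 'a) set) set)) \<Rightarrow> bool" where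
  "induced_by X A Y B f f_sh F \<longleftrightarrow>
     (\<forall>U k. openin Y U \<longrightarrow> (\<forall>\<omega>\<in>carrier (form_deg (rng B U) k).
        F U k (sheafify_unit Y (forms_presheaf B) U k \<omega>) =
        sheafify_unit X (forms_presheaf A) (preim X f U) k
          (forms_map (rng B U) (rng A (preim X f U)) (f_sh U) k \<omega>)))"


section \<open>The universal property of the Kaehler differentials\<close>

lemma smooth_funI:
  assumes "h \<in> Q"
    and dep: "\<And>h x y. h \<in> Q \<Longrightarrow> (\<forall>i<m. x i = y i) \<Longrightarrow> h x = h y"
    and cont: "\<And>h. h \<in> Q \<Longrightarrow> continuous_on UNIV h"
    and der: "\<And>h i x. h \<in> Q \<Longrightarrow> i < m \<Longrightarrow> (\<lambda>t. h (x(i := t))) differentiable (at (x i))"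
    and pd: "\<And>h i. h \<in> Q \<Longrightarrow> i < m \<Longrightarrow> pderivative i h \<in> Q"
  shows "h \<in> smooth_fun m"
proof -
  have "foldr pderivative ps h \<in> Q" if "set ps \<subseteq> {..<m}" for ps
    using that by (induction ps) (auto simp: assms(1) pd)
  then show ?thesis
    unfolding smooth_fun_def using assms(1) dep cont der by blast
qed

lemma smooth_bilinear:
  assumes "i < m" "j < m" "i \<noteq> j"
  shows "(\<lambda>x. a + b * x i + c * x j + e * (x i * x j)) \<in> smooth_fun m"
proof (rule smooth_funI)
  let ?f = "\<lambda>(a, b, c, e) x::nat \<Rightarrow> real. a + b * x i + c * x j + e * (x i * x j)"
  let ?Q = "range ?f"
  have D: "\<exists>D\<in>?Q. \<forall>x. ((\<lambda>t. h (x(k := t))) has_field_derivative D x) (at (x k))"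
    if "h \<in> ?Q" for h k
  proof -
    from that obtain p where "h = ?f p" by (rule imageE)
    then obtain a b c e where h: "h = ?f (a, b, c, e)" by (cases p) blast
    define q :: "real \<times> real \<times> real \<times> real" where
      "q = (if k = i then (b, 0, e, 0) else if k = j then (c, e, 0, 0) else (0, 0, 0, 0))"
    have "((\<lambda>t. h (x(k := t))) has_field_derivative ?f q x) (at (x k))" for x
      unfolding h q_def using assms(3)
      by (auto intro!: derivative_eq_intros)
    then show ?thesis by blast
  qed
  show "(\<lambda>x. a + b * x i + c * x j + e * (x i * x j)) \<in> ?Q"
    by (rule image_eqI[of _ _ "(a, b, c, e)"]) auto
  show "h x = h y" if "h \<in> ?Q" "\<forall>i<m. x i = y i" for h x y
    using that assms by auto
  show "continuous_on UNIV h" if "h \<in> ?Q" for h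
    using that by (auto intro!: continuous_intros continuous_on_product_coordinates)
  show "(\<lambda>t. h (x(k := t))) differentiable (at (x k))" if "h \<in> ?Q" for h k x
    using D[OF that, of k] real_differentiable_def by blast
  show "pderivative k h \<in> ?Q" if "h \<in> ?Q" for h k
  proof -
    from D[OF that, of k]
    obtain D where "D \<in> ?Q" "\<And>x. ((\<lambda>t. h (x(k := t))) has_field_derivative D x) (at (x k))"
      by blast
    moreover from this(2) have "pderivative k h = D"
      by (auto simp: pderivative_def fun_eq_iff intro!: DERIV_imp_deriv)
    ultimately show ?thesis by simp
  qed
qed

lemma smooth_const: "(\<lambda>x. r) \<in> smooth_fun m"
  by (rule smooth_funI[of _ "range (\<lambda>r x. r)"]) (auto simp: pderivative_def image_iff fun_eq_iff)

lemma smooth_scale: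
  assumes "i < m" shows "(\<lambda>x. b * x i) \<in> smooth_fun m"
proof (rule smooth_funI)
  let ?Q = "insert (\<lambda>x. b * x i) (range (\<lambda>(r::real) (x::nat \<Rightarrow> real). r))"
  have *: "((\<lambda>t. b * (x(k := t)) i) has_field_derivative (if k = i then b else 0)) (at (x k))"
    for x k
    by (auto intro!: derivative_eq_intros)
  have "pderivative k (\<lambda>x. b * x i) = (\<lambda>x. if k = i then b else 0)" for k
    using DERIV_imp_deriv[OF *] by (simp add: pderivative_def fun_eq_iff)
  moreover have "pderivative k (\<lambda>x. r) = (\<lambda>x. 0)" for k r
    by (auto simp: pderivative_def)
  ultimately show "pderivative k h \<in> ?Q" if "h \<in> ?Q" for h k
    using that by auto
  show "(\<lambda>x. b * x i) \<in> ?Q" by blast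
  show "h x = h y" if "h \<in> ?Q" "\<forall>i<m. x i = y i" for h x y
    using that assms by auto
  show "continuous_on UNIV h" if "h \<in> ?Q" for h
    using that by (auto intro!: continuous_intros continuous_on_product_coordinates)
  show "(\<lambda>t. h (x(k := t))) differentiable (at (x k))" if "h \<in> ?Q" for h k x
  proof -
    consider "h = (\<lambda>x. b * x i)" | r where "h = (\<lambda>x. r)" using \<open>h \<in> ?Q\<close> by blast
    then show ?thesis using *[of x k] by cases (auto simp only: real_differentiable_def differentiable_const)
  qed
qed

lemma smooth_coord: "i < m \<Longrightarrow> (\<lambda>x. x i) \<in> smooth_fun m"
  using smooth_scale[of i m 1] by simp

lemma cop_comp:
  assumes "cinf_ring C" "set as \<subseteq> carrier C" "g \<in> smooth_fun m" "\<And>i. i < m \<Longrightarrow> h i \<in> smooth_fun (length as)"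
  shows "cop C g (map (\<lambda>i. cop C (h i) as) [0..<m]) = cop C (\<lambda>x. g (\<lambda>i. h i x)) as"
  using assms unfolding cinf_ring_def by metis


context
  fixes C :: "'a cinf_ring"
  assumes C: "cinf_ring C"
begin

lemma cop_closed: "set as \<subseteq> carrier C \<Longrightarrow> h \<in> smooth_fun (length as) \<Longrightarrow> cop C h as \<in> carrier C"
  using C unfolding cinf_ring_def by blast

lemma cop_coord: "set as \<subseteq> carrier C \<Longrightarrow> i < length as \<Longrightarrow> cop C (\<lambda>x. x i) as = as ! i"
  using C unfolding cinf_ring_def by blast

lemma cconst_cop: "set as \<subseteq> carrier C \<Longrightarrow> cconst C r = cop C (\<lambda>_. r) as"
  using cop_comp[OF C, of as "\<lambda>_. r" 0] smooth_const by (simp add: cconst_def)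

lemma alg_add_cop:
  assumes "set as \<subseteq> carrier C" "u \<in> smooth_fun (length as)" "v \<in> smooth_fun (length as)"
  shows "cop C u as \<oplus>\<^bsub>alg C\<^esub> cop C v as = cop C (\<lambda>x. u x + v x) as"
  using cop_comp[OF C assms(1), of "\<lambda>x. x 0 + x 1" 2 "\<lambda>i. if i = 0 then u else v"] assms
    smooth_bilinear[of 0 2 1 0 1 1 0]
  by (simp add: alg_def numeral_2_eq_2)

lemma alg_mult_cop:
  assumes "set as \<subseteq> carrier C" "u \<in> smooth_fun (length as)" "v \<in> smooth_fun (length as)"
  shows "cop C u as \<otimes>\<^bsub>alg C\<^esub> cop C v as = cop C (\<lambda>x. u x * v x) as"
  using cop_comp[OF C assms(1), of "\<lambda>x. x 0 * x 1" 2 "\<lambda>i. if i = 0 then u else v"] assms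
    smooth_bilinear[of 0 2 1 0 0 0 1]
  by (simp add: alg_def numeral_2_eq_2)

lemma alg_carrier [simp]: "carrier (alg C) = carrier C"
  by (simp add: alg_def)

lemma alg_cring: "cring (alg C)"
proof -
  have sm: "(\<lambda>x. x i) \<in> smooth_fun m" "(\<lambda>x. x i + x j) \<in> smooth_fun m"
      "(\<lambda>x. x i * x j) \<in> smooth_fun m" if "i < m" "j < m" "i \<noteq> j" for i j m
    using smooth_bilinear[OF that, of 0 1 0 0] smooth_bilinear[OF that, of 0 1 1 0]
      smooth_bilinear[OF that, of 0 0 0 1] by simp_all
  have zo: "\<zero>\<^bsub>alg C\<^esub> = cconst C 0" "\<one>\<^bsub>alg C\<^esub> = cconst C 1" by (simp_all add: alg_def)
  have two: "(a \<oplus>\<^bsub>alg C\<^esub> b) = cop C (\<lambda>x. x 0 + x 1) [a, b]"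
     "(a \<otimes>\<^bsub>alg C\<^esub> b) = cop C (\<lambda>x. x 0 * x 1) [a, b]" for a b
    by (simp_all add: alg_def)
  have cl: "a \<oplus>\<^bsub>alg C\<^esub> b \<in> carrier C" "a \<otimes>\<^bsub>alg C\<^esub> b \<in> carrier C"
    if "a \<in> carrier C" "b \<in> carrier C" for a b
    unfolding two using that by (auto intro!: cop_closed sm simp: numeral_2_eq_2)
  have cc: "cconst C r \<in> carrier C" for r
    unfolding cconst_def by (rule cop_closed) (auto intro: smooth_const)
  have un: "cconst C 0 \<oplus>\<^bsub>alg C\<^esub> a = a" "cconst C 1 \<otimes>\<^bsub>alg C\<^esub> a = a"
      "cop C (\<lambda>x. - 1 * x 0) [a] \<oplus>\<^bsub>alg C\<^esub> a = cconst C 0"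
      "cop C (\<lambda>x. - 1 * x 0) [a] \<in> carrier C"
    if "a \<in> carrier C" for a
  proof -
    have a: "a = cop C (\<lambda>x. x 0) [a]" using cop_coord[of "[a]" 0] that by simp
    have c: "cconst C r = cop C (\<lambda>_. r) [a]" for r by (rule cconst_cop) (use that in auto)
    have s: "(\<lambda>x. x 0) \<in> smooth_fun (length [a])" "(\<lambda>x. - 1 * x 0) \<in> smooth_fun (length [a])"
      by (rule smooth_coord smooth_scale, simp)+
    show "cconst C 0 \<oplus>\<^bsub>alg C\<^esub> a = a" "cconst C 1 \<otimes>\<^bsub>alg C\<^esub> a = a"
      using alg_add_cop[OF _ smooth_const s(1), of 0] alg_mult_cop[OF _ smooth_const s(1), of 1] that
      by (simp_all add: a[symmetric] c[symmetric])
    show "cop C (\<lambda>x. - 1 * x 0) [a] \<oplus>\<^bsub>alg C\<^esub> a = cconst C 0"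
      using alg_add_cop[OF _ s(2) s(1)] that by (simp add: a[symmetric] c[symmetric])
    show "cop C (\<lambda>x. - 1 * x 0) [a] \<in> carrier C"
      by (rule cop_closed) (use that s in auto)
  qed
  have com: "a \<oplus>\<^bsub>alg C\<^esub> b = b \<oplus>\<^bsub>alg C\<^esub> a" "a \<otimes>\<^bsub>alg C\<^esub> b = b \<otimes>\<^bsub>alg C\<^esub> a"
    if "a \<in> carrier C" "b \<in> carrier C" for a b
  proof -
    have ab: "a = cop C (\<lambda>x. x 0) [a, b]" "b = cop C (\<lambda>x. x 1) [a, b]"
      using cop_coord[of "[a, b]" 0] cop_coord[of "[a, b]" 1] that by simp_all
    have s: "(\<lambda>x. x 0) \<in> smooth_fun (length [a, b])" "(\<lambda>x. x 1) \<in> smooth_fun (length [a, b])"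
      by (rule smooth_coord, simp)+
    show "a \<oplus>\<^bsub>alg C\<^esub> b = b \<oplus>\<^bsub>alg C\<^esub> a" "a \<otimes>\<^bsub>alg C\<^esub> b = b \<otimes>\<^bsub>alg C\<^esub> a"
      using alg_add_cop[OF _ s] alg_add_cop[OF _ s(2,1)] alg_mult_cop[OF _ s]
        alg_mult_cop[OF _ s(2,1)] that
      by (simp_all add: ab[symmetric] add.commute mult.commute del: One_nat_def)
  qed
  have three: "(a \<oplus>\<^bsub>alg C\<^esub> b) \<oplus>\<^bsub>alg C\<^esub> c = a \<oplus>\<^bsub>alg C\<^esub> (b \<oplus>\<^bsub>alg C\<^esub> c)"
      "(a \<otimes>\<^bsub>alg C\<^esub> b) \<otimes>\<^bsub>alg C\<^esub> c = a \<otimes>\<^bsub>alg C\<^esub> (b \<otimes>\<^bsub>alg C\<^esub> c)"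
      "(a \<oplus>\<^bsub>alg C\<^esub> b) \<otimes>\<^bsub>alg C\<^esub> c = a \<otimes>\<^bsub>alg C\<^esub> c \<oplus>\<^bsub>alg C\<^esub> b \<otimes>\<^bsub>alg C\<^esub> c"
    if "a \<in> carrier C" "b \<in> carrier C" "c \<in> carrier C" for a b c
  proof -
    define as where "as = [a, b, c]"
    have as: "set as \<subseteq> carrier C" "length as = 3" using that by (auto simp: as_def)
    note A = alg_add_cop[OF as(1), unfolded as(2)] and M = alg_mult_cop[OF as(1), unfolded as(2)]
    have abc: "a = cop C (\<lambda>x. x 0) as" "b = cop C (\<lambda>x. x 1) as" "c = cop C (\<lambda>x. x 2) as"
      using cop_coord[of as 0] cop_coord[of as 1] cop_coord[of as 2] as by (simp_all add: as_def)
    show "(a \<oplus>\<^bsub>alg C\<^esub> b) \<oplus>\<^bsub>alg C\<^esub> c = a \<oplus>\<^bsub>alg C\<^esub> (b \<oplus>\<^bsub>alg C\<^esub> c)"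
      "(a \<otimes>\<^bsub>alg C\<^esub> b) \<otimes>\<^bsub>alg C\<^esub> c = a \<otimes>\<^bsub>alg C\<^esub> (b \<otimes>\<^bsub>alg C\<^esub> c)"
      "(a \<oplus>\<^bsub>alg C\<^esub> b) \<otimes>\<^bsub>alg C\<^esub> c = a \<otimes>\<^bsub>alg C\<^esub> c \<oplus>\<^bsub>alg C\<^esub> b \<otimes>\<^bsub>alg C\<^esub> c"
      unfolding abc
      by (simp_all add: A M sm smooth_coord algebra_simps)
  qed
  show ?thesis
  proof (intro cringI abelian_groupI comm_monoidI)
    fix a assume "a \<in> carrier (alg C)"
    then show "\<exists>y\<in>carrier (alg C). y \<oplus>\<^bsub>alg C\<^esub> a = \<zero>\<^bsub>alg C\<^esub>"
      using un(3,4) zo by (metis alg_carrier)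
  qed (auto simp: zo cl cc un three intro: com)
qed

end

lemma free_module_module:
  assumes "cring R" shows "Module.module R (free_module R S)"
proof -
  interpret cring R by fact
  let ?M = "free_module R S"
  have fin: "finite {x. u x \<oplus>\<^bsub>R\<^esub> v x \<noteq> \<zero>\<^bsub>R\<^esub>}"
    if "finite {x. u x \<noteq> \<zero>\<^bsub>R\<^esub>}" "finite {x. v x \<noteq> \<zero>\<^bsub>R\<^esub>}" for u v :: "'c \<Rightarrow> 'a"
    by (rule finite_subset[OF _ finite_UnI[OF that]]) auto
  have fin2: "finite {x. r \<otimes>\<^bsub>R\<^esub> u x \<noteq> \<zero>\<^bsub>R\<^esub>}"
    if "finite {x. u x \<noteq> \<zero>\<^bsub>R\<^esub>}" "r \<in> carrier R" for u :: "'c \<Rightarrow> 'a" and r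
    by (rule finite_subset[OF _ that(1)]) (use that in auto)
  have fin3: "finite {x. \<ominus>\<^bsub>R\<^esub> u x \<noteq> \<zero>\<^bsub>R\<^esub>}"
    if "finite {x. u x \<noteq> \<zero>\<^bsub>R\<^esub>}" for u :: "'c \<Rightarrow> 'a"
    by (rule finite_subset[OF _ that(1)]) auto
  show ?thesis
  proof (rule moduleI)
    show "cring R" by fact
    show "abelian_group ?M"
    proof (rule abelian_groupI)
      fix u assume "u \<in> carrier ?M"
      then show "\<exists>v\<in>carrier ?M. v \<oplus>\<^bsub>?M\<^esub> u = \<zero>\<^bsub>?M\<^esub>"
        by (intro bexI[of _ "\<lambda>x. \<ominus>\<^bsub>R\<^esub> u x"]) (auto simp: free_module_def fin3 l_neg)
    qed (auto simp: free_module_def fin a_ac)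
  qed (auto simp: free_module_def fin2 l_distr r_distr m_assoc)
qed

lemma gen_submodule_submodule:
  assumes "Module.module R M" "S \<subseteq> carrier M"
  shows "submodule (gen_submodule R M S) R M"
proof -
  interpret Module.module R M by fact
  note E = submoduleE
  have *: "submodule (carrier M) R M \<and> S \<subseteq> carrier M"
    using carrier_is_submodule assms by blast
  show ?thesis
  proof (rule submoduleI)
    show "gen_submodule R M S \<subseteq> carrier M"
      unfolding gen_submodule_def using * by blast
    show "\<zero>\<^bsub>M\<^esub> \<in> gen_submodule R M S"
      unfolding gen_submodule_def
      using subgroup.one_closed[OF submodule.axioms(1)] by fastforce
  qed (auto simp: gen_submodule_def E)
qed

lemma a_r_coset_iff: "y \<in> N +>\<^bsub>M\<^esub> x \<longleftrightarrow> (\<exists>n\<in>N. y = n \<oplus>\<^bsub>M\<^esub> x)"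
  by (simp add: a_r_coset_def r_coset_def)

lemma quot_module_module:
  assumes "Module.module R M" "submodule N R M"
  shows "Module.module R (quot_module M N)"
    and "\<And>x. x \<in> carrier M \<Longrightarrow> N +>\<^bsub>M\<^esub> x \<in> carrier (quot_module M N)"
    and "\<And>x y. x \<in> carrier M \<Longrightarrow> y \<in> carrier M \<Longrightarrow>
       (N +>\<^bsub>M\<^esub> x) \<oplus>\<^bsub>quot_module M N\<^esub> (N +>\<^bsub>M\<^esub> y) = N +>\<^bsub>M\<^esub> (x \<oplus>\<^bsub>M\<^esub> y)"
    and "\<And>r x. r \<in> carrier R \<Longrightarrow> x \<in> carrier M \<Longrightarrow>
       r \<odot>\<^bsub>quot_module M N\<^esub> (N +>\<^bsub>M\<^esub> x) = N +>\<^bsub>M\<^esub> (r \<odot>\<^bsub>M\<^esub> x)"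
    and "\<And>x. x \<in> carrier M \<Longrightarrow> N +>\<^bsub>M\<^esub> x = \<zero>\<^bsub>quot_module M N\<^esub> \<longleftrightarrow> x \<in> N"
    and "\<And>K. K \<in> carrier (quot_module M N) \<Longrightarrow> \<exists>x\<in>carrier M. K = N +>\<^bsub>M\<^esub> x"
proof -
  interpret Module.module R M by fact
  interpret submodule N R M by fact
  interpret abelian_subgroup N M
    by (intro abelian_subgroupI3 additive_subgroup.intro subgroup_axioms M.abelian_group_axioms)
  let ?Q = "quot_module M N"
  show cl: "\<And>x. x \<in> carrier M \<Longrightarrow> N +>\<^bsub>M\<^esub> x \<in> carrier ?Q"
    by (auto simp: quot_module_def A_RCOSETS_def')
  show ex: "\<And>K. K \<in> carrier ?Q \<Longrightarrow> \<exists>x\<in>carrier M. K = N +>\<^bsub>M\<^esub> x"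
    by (auto simp: quot_module_def A_RCOSETS_def')
  show ad: "\<And>x y. x \<in> carrier M \<Longrightarrow> y \<in> carrier M \<Longrightarrow>
       (N +>\<^bsub>M\<^esub> x) \<oplus>\<^bsub>?Q\<^esub> (N +>\<^bsub>M\<^esub> y) = N +>\<^bsub>M\<^esub> (x \<oplus>\<^bsub>M\<^esub> y)"
    by (simp add: quot_module_def a_rcos_sum)
  have eq: "N +>\<^bsub>M\<^esub> x = N +>\<^bsub>M\<^esub> y" if "y \<in> N +>\<^bsub>M\<^esub> x" "x \<in> carrier M" for x y
    by (rule a_repr_independence'[OF that])
  show sm: "\<And>r x. r \<in> carrier R \<Longrightarrow> x \<in> carrier M \<Longrightarrow>
       r \<odot>\<^bsub>?Q\<^esub> (N +>\<^bsub>M\<^esub> x) = N +>\<^bsub>M\<^esub> (r \<odot>\<^bsub>M\<^esub> x)"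
  proof -
    fix r x assume rx: "r \<in> carrier R" "x \<in> carrier M"
    have *: "N +>\<^bsub>M\<^esub> (r \<odot>\<^bsub>M\<^esub> y) = N +>\<^bsub>M\<^esub> (r \<odot>\<^bsub>M\<^esub> x)" if y: "y \<in> N +>\<^bsub>M\<^esub> x" for y
    proof -
      obtain n where n: "n \<in> N" "y = n \<oplus>\<^bsub>M\<^esub> x" using y unfolding a_r_coset_iff by blast
      have "n \<in> carrier M" using n(1) subset by auto
      then have "r \<odot>\<^bsub>M\<^esub> y = r \<odot>\<^bsub>M\<^esub> n \<oplus>\<^bsub>M\<^esub> r \<odot>\<^bsub>M\<^esub> x"
        unfolding n(2) by (rule smult_r_distr[OF rx(1) _ rx(2)])
      moreover have "r \<odot>\<^bsub>M\<^esub> n \<in> N" by (rule smult_closed[OF rx(1) n(1)])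
      ultimately have "r \<odot>\<^bsub>M\<^esub> y \<in> N +>\<^bsub>M\<^esub> (r \<odot>\<^bsub>M\<^esub> x)" unfolding a_r_coset_iff by blast
      then show ?thesis
        by (rule eq[symmetric]) (rule Module.module.smult_closed[OF assms(1) rx])
    qed
    have "x \<in> N +>\<^bsub>M\<^esub> x" by (rule a_rcos_self[OF rx(2)])
    with * have "(\<Union>y\<in>N +>\<^bsub>M\<^esub> x. N +>\<^bsub>M\<^esub> (r \<odot>\<^bsub>M\<^esub> y)) = N +>\<^bsub>M\<^esub> (r \<odot>\<^bsub>M\<^esub> x)" by blast
    then show "r \<odot>\<^bsub>?Q\<^esub> (N +>\<^bsub>M\<^esub> x) = N +>\<^bsub>M\<^esub> (r \<odot>\<^bsub>M\<^esub> x)"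
      by (simp add: quot_module_def)
  qed
  have z: "\<zero>\<^bsub>?Q\<^esub> = N +>\<^bsub>M\<^esub> \<zero>\<^bsub>M\<^esub>"
    by (simp add: quot_module_def a_coset_add_zero a_subset)
  show "\<And>x. x \<in> carrier M \<Longrightarrow> N +>\<^bsub>M\<^esub> x = \<zero>\<^bsub>?Q\<^esub> \<longleftrightarrow> x \<in> N"
    using a_rcos_self a_rcos_const by (auto simp: quot_module_def)
  show "Module.module R ?Q"
  proof (rule moduleI)
    show "cring R" by (rule R.is_cring)
    show "abelian_group ?Q"
    proof (rule abelian_groupI)
      fix K assume "K \<in> carrier ?Q"
      then obtain x where "x \<in> carrier M" "K = N +>\<^bsub>M\<^esub> x" using ex by blast
      then show "\<exists>L\<in>carrier ?Q. L \<oplus>\<^bsub>?Q\<^esub> K = \<zero>\<^bsub>?Q\<^esub>"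
        by (intro bexI[of _ "N +>\<^bsub>M\<^esub> (\<ominus>\<^bsub>M\<^esub> x)"]) (auto simp: ad z cl M.l_neg)
    qed (auto dest!: ex simp: ad z cl M.a_ac)
  qed (auto dest!: ex simp: ad sm z cl smult_l_distr smult_r_distr smult_assoc1)
qed

definition module_map :: "('a, 'r) ring_scheme \<Rightarrow> ('a, 'm, 's) module_scheme \<Rightarrow>
    ('a, 'n, 't) module_scheme \<Rightarrow> ('m \<Rightarrow> 'n) \<Rightarrow> bool" where
  "module_map R M N \<phi> \<longleftrightarrow>
     \<phi> \<in> carrier M \<rightarrow> carrier N \<and>
     (\<forall>x\<in>carrier M. \<forall>y\<in>carrier M. \<phi> (x \<oplus>\<^bsub>M\<^esub> y) = \<phi> x \<oplus>\<^bsub>N\<^esub> \<phi> y) \<and>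
     (\<forall>r\<in>carrier R. \<forall>x\<in>carrier M. \<phi> (r \<odot>\<^bsub>M\<^esub> x) = r \<odot>\<^bsub>N\<^esub> \<phi> x)"

lemma module_diff_zero_iff:
  assumes "Module.module R M" "x \<in> carrier M" "y \<in> carrier M"
  shows "x \<ominus>\<^bsub>M\<^esub> y = \<zero>\<^bsub>M\<^esub> \<longleftrightarrow> x = y"
proof -
  interpret M: Module.module R M by fact
  show ?thesis
  proof
    assume "x \<ominus>\<^bsub>M\<^esub> y = \<zero>\<^bsub>M\<^esub>"
    then have "\<ominus>\<^bsub>M\<^esub> (\<ominus>\<^bsub>M\<^esub> y) = x"
      using assms(2,3) by (intro M.minus_equality) (auto simp: a_minus_def)
    then show "x = y" using assms(3) by simp
  qed (use assms(3) in \<open>simp add: a_minus_def M.r_neg\<close>)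
qed

lemma module_mapD:
  assumes "module_map R M N \<phi>"
  shows "x \<in> carrier M \<Longrightarrow> \<phi> x \<in> carrier N"
    and "r \<in> carrier R \<Longrightarrow> x \<in> carrier M \<Longrightarrow> \<phi> (r \<odot>\<^bsub>M\<^esub> x) = r \<odot>\<^bsub>N\<^esub> \<phi> x"
  using assms by (auto simp: module_map_def)

lemma module_map_zero:
  assumes "Module.module R M" "Module.module R N" "module_map R M N \<phi>"
  shows "\<phi> \<zero>\<^bsub>M\<^esub> = \<zero>\<^bsub>N\<^esub>"
proof -
  interpret M: Module.module R M by fact
  interpret N: Module.module R N by fact
  have "\<phi> (\<zero>\<^bsub>R\<^esub> \<odot>\<^bsub>M\<^esub> \<zero>\<^bsub>M\<^esub>) = \<zero>\<^bsub>R\<^esub> \<odot>\<^bsub>N\<^esub> \<phi> \<zero>\<^bsub>M\<^esub>"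
    using assms(3) unfolding module_map_def by blast
  moreover have "\<phi> \<zero>\<^bsub>M\<^esub> \<in> carrier N" using assms(3) unfolding module_map_def by blast
  ultimately show ?thesis by simp
qed

lemma module_map_minus:
  assumes "Module.module R M" "Module.module R N" "module_map R M N \<phi>"
    and "x \<in> carrier M" "y \<in> carrier M"
  shows "\<phi> (x \<ominus>\<^bsub>M\<^esub> y) = \<phi> x \<ominus>\<^bsub>N\<^esub> \<phi> y"
proof -
  interpret M: Module.module R M by fact
  interpret N: Module.module R N by fact
  have m: "\<ominus>\<^bsub>M\<^esub> y = (\<ominus>\<^bsub>R\<^esub> \<one>\<^bsub>R\<^esub>) \<odot>\<^bsub>M\<^esub> y" using assms by (simp add: M.smult_l_minus)
  have py: "\<phi> y \<in> carrier N" using assms unfolding module_map_def by blast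
  have "\<phi> (\<ominus>\<^bsub>M\<^esub> y) = (\<ominus>\<^bsub>R\<^esub> \<one>\<^bsub>R\<^esub>) \<odot>\<^bsub>N\<^esub> \<phi> y" unfolding m using assms unfolding module_map_def by blast
  also have "\<dots> = \<ominus>\<^bsub>N\<^esub> \<phi> y" using py by (simp add: N.smult_l_minus)
  finally show ?thesis using assms unfolding module_map_def a_minus_def by simp
qed

lemma module_map_finsum:
  assumes "Module.module R M" "Module.module R N" "module_map R M N \<phi>"
    and "finite I" "g \<in> I \<rightarrow> carrier M"
  shows "\<phi> (\<Oplus>\<^bsub>M\<^esub>i\<in>I. g i) = (\<Oplus>\<^bsub>N\<^esub>i\<in>I. \<phi> (g i))"
proof -
  interpret M: Module.module R M by fact
  interpret N: Module.module R N by fact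
  have cl: "\<And>x. x \<in> carrier M \<Longrightarrow> \<phi> x \<in> carrier N" using assms(3) unfolding module_map_def by blast
  show ?thesis using assms(4,5)
  proof (induction I)
    case empty
    then show ?case using module_map_zero[OF assms(1-3)] by simp
  next
    case (insert i I)
    then have "g i \<in> carrier M" "g \<in> I \<rightarrow> carrier M" "(\<Oplus>\<^bsub>M\<^esub>i\<in>I. g i) \<in> carrier M" by auto
    then show ?case using insert assms(3) unfolding module_map_def
      by (simp add: M.finsum_insert N.finsum_insert Pi_def cl)
  qed
qed

lemma basis_vec_carrier: "cring R \<Longrightarrow> x \<in> S \<Longrightarrow> basis_vec R x \<in> carrier (free_module R S)"
proof -
  assume "cring R" "x \<in> S"
  interpret cring R by fact
  have "finite {y. basis_vec R x y \<noteq> \<zero>\<^bsub>R\<^esub>}"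
    by (rule finite_subset[of _ "{x}"]) (auto simp: basis_vec_def)
  with \<open>x \<in> S\<close> show ?thesis by (auto simp: free_module_def basis_vec_def)
qed

lemma free_module_expand:
  assumes "cring R" "u \<in> carrier (free_module R S)"
  shows "u = (\<Oplus>\<^bsub>free_module R S\<^esub>x\<in>{x. u x \<noteq> \<zero>\<^bsub>R\<^esub>}. u x \<odot>\<^bsub>free_module R S\<^esub> basis_vec R x)"
proof -
  interpret cring R by fact
  let ?E = "free_module R S"
  interpret E: Module.module R ?E by (rule free_module_module[OF assms(1)])
  have u: "\<And>x. u x \<in> carrier R" "finite {x. u x \<noteq> \<zero>\<^bsub>R\<^esub>}" "{x. u x \<noteq> \<zero>\<^bsub>R\<^esub>} \<subseteq> S"
    using assms(2) by (auto simp: free_module_def)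
  have "(\<Oplus>\<^bsub>?E\<^esub>x\<in>T. u x \<odot>\<^bsub>?E\<^esub> basis_vec R x) = (\<lambda>y. if y \<in> T then u y else \<zero>\<^bsub>R\<^esub>)"
    if "finite T" "T \<subseteq> S" for T
    using that
  proof (induction T)
    case empty
    have "\<zero>\<^bsub>?E\<^esub> = (\<lambda>_. \<zero>\<^bsub>R\<^esub>)" by (simp add: free_module_def)
    then show ?case by simp
  next
    case (insert x T)
    have c: "(\<lambda>x. u x \<odot>\<^bsub>?E\<^esub> basis_vec R x) \<in> T \<rightarrow> carrier ?E"
        "u x \<odot>\<^bsub>?E\<^esub> basis_vec R x \<in> carrier ?E"
      using insert u(1) basis_vec_carrier[OF assms(1), of _ S] by auto
    have "(\<Oplus>\<^bsub>?E\<^esub>x\<in>insert x T. u x \<odot>\<^bsub>?E\<^esub> basis_vec R x)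
        = u x \<odot>\<^bsub>?E\<^esub> basis_vec R x \<oplus>\<^bsub>?E\<^esub> (\<lambda>y. if y \<in> T then u y else \<zero>\<^bsub>R\<^esub>)"
      using insert c by (simp add: E.finsum_insert)
    also have "\<dots> = (\<lambda>y. if y \<in> insert x T then u y else \<zero>\<^bsub>R\<^esub>)"
      using insert u(1) by (auto simp: free_module_def basis_vec_def fun_eq_iff)
    finally show ?case .
  qed
  from this[OF u(2,3)] show ?thesis by (auto simp: fun_eq_iff)
qed

lemma free_module_lift:
  assumes "cring R" "Module.module R N" "X \<in> S \<rightarrow> carrier N"
  shows "\<exists>\<phi>. module_map R (free_module R S) N \<phi> \<and> (\<forall>x\<in>S. \<phi> (basis_vec R x) = X x)"
proof -
  interpret cring R by fact
  interpret N: Module.module R N by fact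
  let ?E = "free_module R S"
  define \<phi> where "\<phi> u = (\<Oplus>\<^bsub>N\<^esub>x\<in>{x. u x \<noteq> \<zero>\<^bsub>R\<^esub>}. u x \<odot>\<^bsub>N\<^esub> X x)" for u
  have E: "u x \<in> carrier R" "finite {x. u x \<noteq> \<zero>\<^bsub>R\<^esub>}" "x \<notin> S \<Longrightarrow> u x = \<zero>\<^bsub>R\<^esub>"
    if "u \<in> carrier ?E" for u x
    using that by (auto simp: free_module_def)
  have XS: "X x \<in> carrier N" if "x \<in> S" for x using assms(3) that by (rule funcset_mem)
  have \<phi>: "\<phi> u = (\<Oplus>\<^bsub>N\<^esub>x\<in>T. u x \<odot>\<^bsub>N\<^esub> X x)"
    if "u \<in> carrier ?E" "finite T" "{x. u x \<noteq> \<zero>\<^bsub>R\<^esub>} \<subseteq> T" "T \<subseteq> S" for u T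
    unfolding \<phi>_def
    by (rule N.add.finprod_mono_neutral_cong_left) (use that E[OF that(1)] XS in auto)
  have sup: "{x. u x \<noteq> \<zero>\<^bsub>R\<^esub>} \<subseteq> S" if "u \<in> carrier ?E" for u using E(3)[OF that] by blast
  interpret E: Module.module R ?E by (rule free_module_module[OF assms(1)])
  have "module_map R ?E N \<phi>"
    unfolding module_map_def
  proof (intro conjI ballI)
    show "\<phi> \<in> carrier ?E \<rightarrow> carrier N"
      unfolding \<phi>_def using E sup assms(3) by (auto intro!: N.finsum_closed N.smult_closed)
    fix u v assume uv: "u \<in> carrier ?E" "v \<in> carrier ?E"
    define T where "T = {x. u x \<noteq> \<zero>\<^bsub>R\<^esub>} \<union> {x. v x \<noteq> \<zero>\<^bsub>R\<^esub>}"
    have T: "finite T" "T \<subseteq> S" using uv sup E by (auto simp: T_def)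
    have XT: "\<And>x. x \<in> T \<Longrightarrow> X x \<in> carrier N" using T assms(3) by blast
    have s: "(u \<oplus>\<^bsub>?E\<^esub> v) x = u x \<oplus>\<^bsub>R\<^esub> v x" for x by (simp add: free_module_def)
    have "{x. (u \<oplus>\<^bsub>?E\<^esub> v) x \<noteq> \<zero>\<^bsub>R\<^esub>} \<subseteq> T" unfolding s T_def by auto
    then have "\<phi> (u \<oplus>\<^bsub>?E\<^esub> v) = (\<Oplus>\<^bsub>N\<^esub>x\<in>T. (u x \<oplus>\<^bsub>R\<^esub> v x) \<odot>\<^bsub>N\<^esub> X x)"
      using \<phi>[of "u \<oplus>\<^bsub>?E\<^esub> v" T] T uv by (simp add: s)
    also have "\<dots> = (\<Oplus>\<^bsub>N\<^esub>x\<in>T. u x \<odot>\<^bsub>N\<^esub> X x \<oplus>\<^bsub>N\<^esub> v x \<odot>\<^bsub>N\<^esub> X x)"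
      by (rule N.finsum_cong') (auto simp: N.smult_l_distr E uv XT)
    also have "\<dots> = (\<Oplus>\<^bsub>N\<^esub>x\<in>T. u x \<odot>\<^bsub>N\<^esub> X x) \<oplus>\<^bsub>N\<^esub> (\<Oplus>\<^bsub>N\<^esub>x\<in>T. v x \<odot>\<^bsub>N\<^esub> X x)"
      by (rule N.finsum_addf) (auto simp: E uv XT)
    also have "\<dots> = \<phi> u \<oplus>\<^bsub>N\<^esub> \<phi> v"
      using \<phi>[OF uv(1) T(1) _ T(2)] \<phi>[OF uv(2) T(1) _ T(2)] by (simp add: T_def)
    finally show "\<phi> (u \<oplus>\<^bsub>?E\<^esub> v) = \<phi> u \<oplus>\<^bsub>N\<^esub> \<phi> v" .
  next
    fix r u assume ru: "r \<in> carrier R" "u \<in> carrier ?E"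
    define T where "T = {x. u x \<noteq> \<zero>\<^bsub>R\<^esub>}"
    have T: "finite T" "T \<subseteq> S" using ru sup E by (auto simp: T_def)
    have XT: "\<And>x. x \<in> T \<Longrightarrow> X x \<in> carrier N" using T assms(3) by blast
    have s: "(r \<odot>\<^bsub>?E\<^esub> u) x = r \<otimes>\<^bsub>R\<^esub> u x" for x by (simp add: free_module_def)
    have "{x. (r \<odot>\<^bsub>?E\<^esub> u) x \<noteq> \<zero>\<^bsub>R\<^esub>} \<subseteq> T" unfolding s T_def using ru by auto
    then have "\<phi> (r \<odot>\<^bsub>?E\<^esub> u) = (\<Oplus>\<^bsub>N\<^esub>x\<in>T. (r \<otimes>\<^bsub>R\<^esub> u x) \<odot>\<^bsub>N\<^esub> X x)"
      using \<phi>[of "r \<odot>\<^bsub>?E\<^esub> u" T] T ru by (simp add: s)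
    also have "\<dots> = (\<Oplus>\<^bsub>N\<^esub>x\<in>T. r \<odot>\<^bsub>N\<^esub> (u x \<odot>\<^bsub>N\<^esub> X x))"
      by (rule N.finsum_cong') (auto simp: N.smult_assoc1 E ru XT)
    also have "\<dots> = r \<odot>\<^bsub>N\<^esub> (\<Oplus>\<^bsub>N\<^esub>x\<in>T. u x \<odot>\<^bsub>N\<^esub> X x)"
      by (rule N.finsum_smult_ldistr[symmetric]) (auto simp: E ru XT T)
    also have "\<dots> = r \<odot>\<^bsub>N\<^esub> \<phi> u"
      using \<phi>[OF ru(2) T(1) _ T(2)] by (simp add: T_def)
    finally show "\<phi> (r \<odot>\<^bsub>?E\<^esub> u) = r \<odot>\<^bsub>N\<^esub> \<phi> u" .
  qed
  moreover have "\<phi> (basis_vec R x) = X x" if "x \<in> S" for x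
  proof -
    have "\<phi> (basis_vec R x) = (\<Oplus>\<^bsub>N\<^esub>y\<in>{x}. basis_vec R x y \<odot>\<^bsub>N\<^esub> X y)"
      by (rule \<phi>[OF basis_vec_carrier[OF assms(1) that]])
         (use that in \<open>auto simp: basis_vec_def split: if_splits\<close>)
    then show ?thesis using XS[OF that] by (simp add: basis_vec_def)
  qed
  ultimately show ?thesis by blast
qed

lemma module_map_kernel:
  assumes "Module.module R M" "Module.module R N" "module_map R M N \<phi>"
  shows "submodule {x \<in> carrier M. \<phi> x = \<zero>\<^bsub>N\<^esub>} R M"
proof -
  interpret M: Module.module R M by fact
  interpret N: Module.module R N by fact
  show ?thesis
  proof (rule M.submoduleI)
    fix x assume "x \<in> {x \<in> carrier M. \<phi> x = \<zero>\<^bsub>N\<^esub>}"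
    then show "\<ominus>\<^bsub>M\<^esub> x \<in> {x \<in> carrier M. \<phi> x = \<zero>\<^bsub>N\<^esub>}"
      using module_map_minus[OF assms, of "\<zero>\<^bsub>M\<^esub>" x] module_map_zero[OF assms]
      by (simp add: a_minus_def)
  qed (use assms(3) module_map_zero[OF assms] in \<open>auto simp: module_map_def\<close>)
qed

context
  fixes C :: "'a cinf_ring"
  assumes C: "cinf_ring C"
begin

abbreviation "kaehler_free \<equiv> free_module (alg C) (carrier C)"
abbreviation "kaehler_rel h as \<equiv> basis_vec (alg C) (cop C h as) \<ominus>\<^bsub>kaehler_free\<^esub>
  (\<Oplus>\<^bsub>kaehler_free\<^esub>i\<in>{..<length as}. cop C (pderivative i h) as \<odot>\<^bsub>kaehler_free\<^esub> basis_vec (alg C) (as ! i))"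

lemma pderivative_smooth:
  assumes "h \<in> smooth_fun m" "i < m" shows "pderivative i h \<in> smooth_fun m"
proof -
  have "pderivative i h x = pderivative i h y" if "\<forall>i<m. x i = y i" for x y
  proof -
    have "h (x(i := t)) = h (y(i := t))" for t
      using assms(1) that unfolding smooth_fun_def by simp
    then show ?thesis using that assms(2) by (simp add: pderivative_def)
  qed
  moreover have "continuous_on UNIV (foldr pderivative ps (pderivative i h)) \<and>
     (\<forall>j<m. \<forall>x. (\<lambda>t. foldr pderivative ps (pderivative i h) (x(j := t))) differentiable (at (x j)))"
    if "set ps \<subseteq> {..<m}" for ps
  proof -
    have "set (ps @ [i]) \<subseteq> {..<m}" using that assms(2) by auto
    then have "continuous_on UNIV (foldr pderivative (ps @ [i]) h) \<and>
       (\<forall>j<m. \<forall>x. (\<lambda>t. foldr pderivative (ps @ [i]) h (x(j := t))) differentiable (at (x j)))"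
      using assms(1) unfolding smooth_fun_def by blast
    then show ?thesis by simp
  qed
  ultimately show ?thesis unfolding smooth_fun_def by blast
qed

lemma rel_facts:
  assumes "set as \<subseteq> carrier C" "h \<in> smooth_fun (length as)"
  shows "cop C h as \<in> carrier C" "i < length as \<Longrightarrow> cop C (pderivative i h) as \<in> carrier C"
    "i < length as \<Longrightarrow> as ! i \<in> carrier C"
    "i < length as \<Longrightarrow> basis_vec (alg C) (as ! i) \<in> carrier kaehler_free"
    "basis_vec (alg C) (cop C h as) \<in> carrier kaehler_free"
    "(\<lambda>i. cop C (pderivative i h) as \<odot>\<^bsub>kaehler_free\<^esub> basis_vec (alg C) (as ! i)) \<in> {..<length as} \<rightarrow> carrier kaehler_free"
proof -
  interpret E: Module.module "alg C" kaehler_free by (rule free_module_module[OF alg_cring[OF C]])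
  show 1: "cop C h as \<in> carrier C" by (rule cop_closed[OF C assms])
  show 2: "cop C (pderivative i h) as \<in> carrier C" if "i < length as" for i
    by (rule cop_closed[OF C assms(1) pderivative_smooth[OF assms(2) that]])
  show 3: "as ! i \<in> carrier C" if "i < length as" for i using assms that nth_mem by blast
  show 4: "basis_vec (alg C) (as ! i) \<in> carrier kaehler_free" if "i < length as" for i
    by (rule basis_vec_carrier[OF alg_cring[OF C] 3[OF that]])
  show "basis_vec (alg C) (cop C h as) \<in> carrier kaehler_free"
    by (rule basis_vec_carrier[OF alg_cring[OF C] 1])
  show "(\<lambda>i. cop C (pderivative i h) as \<odot>\<^bsub>kaehler_free\<^esub> basis_vec (alg C) (as ! i)) \<in> {..<length as} \<rightarrow> carrier kaehler_free"
    using 2 4 C by (auto intro!: E.smult_closed)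
qed

lemma rel_carrier:
  assumes "set as \<subseteq> carrier C" "h \<in> smooth_fun (length as)"
  shows "kaehler_rel h as \<in> carrier kaehler_free"
proof -
  interpret E: Module.module "alg C" kaehler_free by (rule free_module_module[OF alg_cring[OF C]])
  show ?thesis by (rule E.minus_closed[OF rel_facts(5)[OF assms] E.finsum_closed[OF rel_facts(6)[OF assms]]])
qed

lemma kaehler_relations_submodule: "submodule (kaehler_relations C) (alg C) kaehler_free"
proof -
  interpret E: Module.module "alg C" kaehler_free by (rule free_module_module[OF alg_cring[OF C]])
  show ?thesis
    unfolding kaehler_relations_def Let_def
    by (rule gen_submodule_submodule[OF E.module_axioms])
       (use rel_carrier in blast)
qed

lemma kaehler_module: "Module.module (alg C) (kaehler C)"
  unfolding kaehler_def
  by (rule quot_module_module[OF free_module_module[OF alg_cring[OF C]] kaehler_relations_submodule])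

lemma kaehler_proj: "module_map (alg C) kaehler_free (kaehler C) (\<lambda>u. kaehler_relations C +>\<^bsub>kaehler_free\<^esub> u)"
  using quot_module_module[OF free_module_module[OF alg_cring[OF C]] kaehler_relations_submodule]
  unfolding module_map_def kaehler_def by auto

theorem kaehler_d_derivation: "cinf_derivation C (kaehler C) (kaehler_d C)"
  unfolding cinf_derivation_def
proof (intro conjI allI impI)
  let ?\<pi> = "\<lambda>u. kaehler_relations C +>\<^bsub>kaehler_free\<^esub> u"
  note Q = quot_module_module[OF free_module_module[OF alg_cring[OF C]] kaehler_relations_submodule]
  note fm = free_module_module[OF alg_cring[OF C]]
  interpret E: Module.module "alg C" kaehler_free by (rule fm)
  interpret K: Module.module "alg C" "kaehler C" by (rule kaehler_module)
  show "kaehler_d C \<in> carrier C \<rightarrow> carrier (kaehler C)"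
    unfolding kaehler_d_def kaehler_def by (intro Pi_I Q(2) basis_vec_carrier[OF alg_cring[OF C]])
  fix h as assume a: "as \<noteq> [] \<and> set as \<subseteq> carrier C \<and> h \<in> smooth_fun (length as)"
  then have a': "set as \<subseteq> carrier C" "h \<in> smooth_fun (length as)" by auto
  note f = rel_facts[OF a']
  let ?s = "\<Oplus>\<^bsub>kaehler_free\<^esub>i\<in>{..<length as}. cop C (pderivative i h) as \<odot>\<^bsub>kaehler_free\<^esub> basis_vec (alg C) (as ! i)"
  have s: "?s \<in> carrier kaehler_free" by (rule E.finsum_closed[OF f(6)])
  have "kaehler_rel h as \<in> kaehler_relations C"
    unfolding kaehler_relations_def Let_def gen_submodule_def using a by blast
  then have "?\<pi> (kaehler_rel h as) = \<zero>\<^bsub>kaehler C\<^esub>"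
    using Q(5)[of "kaehler_rel h as"] f(5) s by (simp add: kaehler_def)
  then have "?\<pi> (basis_vec (alg C) (cop C h as)) \<ominus>\<^bsub>kaehler C\<^esub> ?\<pi> ?s = \<zero>\<^bsub>kaehler C\<^esub>"
    using module_map_minus[OF fm kaehler_module kaehler_proj f(5) s] by simp
  then have "?\<pi> (basis_vec (alg C) (cop C h as)) = ?\<pi> ?s"
    using kaehler_proj f(5) s unfolding module_map_def by (auto simp: module_diff_zero_iff[OF kaehler_module] Pi_def)
  also have "\<dots> = (\<Oplus>\<^bsub>kaehler C\<^esub>i\<in>{..<length as}.
      ?\<pi> (cop C (pderivative i h) as \<odot>\<^bsub>kaehler_free\<^esub> basis_vec (alg C) (as ! i)))"
    by (rule module_map_finsum[OF fm kaehler_module kaehler_proj _ f(6)]) simp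
  also have "\<dots> = (\<Oplus>\<^bsub>kaehler C\<^esub>i\<in>{..<length as}.
      cop C (pderivative i h) as \<odot>\<^bsub>kaehler C\<^esub> kaehler_d C (as ! i))"
    by (rule K.finsum_cong')
       (use f kaehler_proj C in \<open>auto simp: kaehler_d_def module_map_def Q(2)[folded kaehler_def]\<close>)
  finally show "kaehler_d C (cop C h as) = \<dots>" by (simp add: kaehler_d_def)
qed

theorem kaehler_universal:
  assumes "Module.module (alg C) N" "cinf_derivation C N X"
  shows "\<exists>!\<phi>. \<phi> \<in> extensional (carrier (kaehler C)) \<and> module_map (alg C) (kaehler C) N \<phi> \<and>
              (\<forall>a\<in>carrier C. \<phi> (kaehler_d C a) = X a)"
proof -
  let ?\<pi> = "\<lambda>u. kaehler_relations C +>\<^bsub>kaehler_free\<^esub> u"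
  note fm = free_module_module[OF alg_cring[OF C]]
  note Q = quot_module_module[OF fm kaehler_relations_submodule, folded kaehler_def]
  interpret E: Module.module "alg C" kaehler_free by (rule fm)
  interpret K: Module.module "alg C" "kaehler C" by (rule kaehler_module)
  interpret N: Module.module "alg C" N by fact
  have X: "X \<in> carrier C \<rightarrow> carrier N" using assms(2) unfolding cinf_derivation_def by blast
  obtain \<psi> where \<psi>: "module_map (alg C) kaehler_free N \<psi>" "\<And>x. x \<in> carrier C \<Longrightarrow> \<psi> (basis_vec (alg C) x) = X x"
    using free_module_lift[OF alg_cring[OF C] assms(1) X] by blast
  have "\<psi> (kaehler_rel h as) = \<zero>\<^bsub>N\<^esub>"
    if a: "as \<noteq> []" "set as \<subseteq> carrier C" "h \<in> smooth_fun (length as)" for h as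
  proof -
    note f = rel_facts[OF a(2,3)]
    let ?t = "\<lambda>i. cop C (pderivative i h) as \<odot>\<^bsub>kaehler_free\<^esub> basis_vec (alg C) (as ! i)"
    have "\<psi> (kaehler_rel h as) = \<psi> (basis_vec (alg C) (cop C h as)) \<ominus>\<^bsub>N\<^esub> \<psi> (\<Oplus>\<^bsub>kaehler_free\<^esub>i\<in>{..<length as}. ?t i)"
      by (rule module_map_minus[OF fm assms(1) \<psi>(1) f(5) E.finsum_closed[OF f(6)]])
    also have "\<psi> (\<Oplus>\<^bsub>kaehler_free\<^esub>i\<in>{..<length as}. ?t i) = (\<Oplus>\<^bsub>N\<^esub>i\<in>{..<length as}. \<psi> (?t i))"
      by (rule module_map_finsum[OF fm assms(1) \<psi>(1) _ f(6)]) simp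
    also have "\<dots> = (\<Oplus>\<^bsub>N\<^esub>i\<in>{..<length as}. cop C (pderivative i h) as \<odot>\<^bsub>N\<^esub> X (as ! i))"
      by (rule N.finsum_cong') (use f \<psi> C X in \<open>auto simp: module_map_def Pi_def\<close>)
    also have "\<dots> = X (cop C h as)" using assms(2) a unfolding cinf_derivation_def by simp
    also have "\<psi> (basis_vec (alg C) (cop C h as)) = X (cop C h as)" by (rule \<psi>(2)[OF f(1)])
    finally have "\<psi> (kaehler_rel h as) = X (cop C h as) \<ominus>\<^bsub>N\<^esub> X (cop C h as)" .
    moreover have "X (cop C h as) \<in> carrier N" by (rule funcset_mem[OF X f(1)])
    ultimately show ?thesis by (simp only: module_diff_zero_iff[OF assms(1)])
  qed
  then have ker: "kaehler_relations C \<subseteq> {u \<in> carrier kaehler_free. \<psi> u = \<zero>\<^bsub>N\<^esub>}"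
    unfolding kaehler_relations_def Let_def gen_submodule_def
    by (intro Inter_lower CollectI conjI module_map_kernel[OF fm assms(1) \<psi>(1)])
       (use rel_carrier in blast)
  define \<phi> where "\<phi> = (\<lambda>K\<in>carrier (kaehler C). \<psi> (SOME u. u \<in> carrier kaehler_free \<and> K = ?\<pi> u))"
  have \<phi>: "\<phi> (?\<pi> u) = \<psi> u" if u: "u \<in> carrier kaehler_free" for u
  proof -
    define v where "v = (SOME v. v \<in> carrier kaehler_free \<and> ?\<pi> u = ?\<pi> v)"
    have v: "v \<in> carrier kaehler_free" "?\<pi> u = ?\<pi> v"
      using someI[of "\<lambda>v. v \<in> carrier kaehler_free \<and> ?\<pi> u = ?\<pi> v" u] u unfolding v_def by auto
    have \<pi>: "?\<pi> u \<in> carrier (kaehler C)" "?\<pi> v \<in> carrier (kaehler C)" using Q(2) u v(1) by blast+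
    have "?\<pi> (u \<ominus>\<^bsub>kaehler_free\<^esub> v) = \<zero>\<^bsub>kaehler C\<^esub>"
      using module_map_minus[OF fm kaehler_module kaehler_proj u v(1)] v(2) \<pi>
      by (simp add: module_diff_zero_iff[OF kaehler_module])
    then have "u \<ominus>\<^bsub>kaehler_free\<^esub> v \<in> kaehler_relations C" using Q(5) u v(1) by simp
    then have "\<psi> u \<ominus>\<^bsub>N\<^esub> \<psi> v = \<zero>\<^bsub>N\<^esub>"
      using ker module_map_minus[OF fm assms(1) \<psi>(1) u v(1)] by auto
    then have "\<psi> u = \<psi> v" using \<psi>(1) u v(1) by (auto simp: module_diff_zero_iff[OF assms(1)] module_map_def Pi_def)
    then show ?thesis using \<pi> by (simp add: \<phi>_def v_def)
  qed
  have \<pi>d: "kaehler_d C a = ?\<pi> (basis_vec (alg C) a)" for a by (simp add: kaehler_d_def)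
  show ?thesis
  proof (rule ex1I[of _ \<phi>], intro conjI ballI)
    show "\<phi> \<in> extensional (carrier (kaehler C))" by (simp add: \<phi>_def)
    show "module_map (alg C) (kaehler C) N \<phi>"
      unfolding module_map_def
      using \<psi>(1) Q(3,4) by (auto dest!: Q(6) simp: \<phi> module_map_def Pi_def C)
    show "\<phi> (kaehler_d C a) = X a" if "a \<in> carrier C" for a
      using that \<phi>[OF basis_vec_carrier[OF alg_cring[OF C] that]] \<psi>(2) by (simp add: \<pi>d)
    fix \<xi> assume \<xi>: "\<xi> \<in> extensional (carrier (kaehler C)) \<and> module_map (alg C) (kaehler C) N \<xi> \<and>
              (\<forall>a\<in>carrier C. \<xi> (kaehler_d C a) = X a)"
    then have mm: "module_map (alg C) kaehler_free N (\<lambda>u. \<xi> (?\<pi> u))"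
      using kaehler_proj unfolding module_map_def by (auto simp: Pi_def)
    have "\<xi> (?\<pi> u) = \<psi> u" if u: "u \<in> carrier kaehler_free" for u
    proof -
      let ?T = "{x. u x \<noteq> \<zero>\<^bsub>alg C\<^esub>}"
      have T: "finite ?T" "?T \<subseteq> carrier C" "\<And>x. u x \<in> carrier C"
        using u C by (auto simp: free_module_def)
      have e: "(\<lambda>x. u x \<odot>\<^bsub>kaehler_free\<^esub> basis_vec (alg C) x) \<in> ?T \<rightarrow> carrier kaehler_free"
      proof (rule Pi_I)
        fix x assume "x \<in> ?T"
        then have "x \<in> carrier C" using T(2) by blast
        then show "u x \<odot>\<^bsub>kaehler_free\<^esub> basis_vec (alg C) x \<in> carrier kaehler_free"
          using T(3)[of x] C by (intro E.smult_closed basis_vec_carrier[OF alg_cring[OF C]]) simp_all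
      qed
      have "\<xi> (?\<pi> (\<Oplus>\<^bsub>kaehler_free\<^esub>x\<in>?T. u x \<odot>\<^bsub>kaehler_free\<^esub> basis_vec (alg C) x)) =
            \<psi> (\<Oplus>\<^bsub>kaehler_free\<^esub>x\<in>?T. u x \<odot>\<^bsub>kaehler_free\<^esub> basis_vec (alg C) x)"
        unfolding module_map_finsum[OF fm assms(1) mm T(1) e]
          module_map_finsum[OF fm assms(1) \<psi>(1) T(1) e]
      proof (rule N.finsum_cong')
        fix x assume "x \<in> ?T"
        then have x1: "x \<in> carrier C" using T(2) by (rule subsetD[rotated])
        note x = x1 basis_vec_carrier[OF alg_cring[OF C] x1]
        show "\<xi> (?\<pi> (u x \<odot>\<^bsub>kaehler_free\<^esub> basis_vec (alg C) x)) = \<psi> (u x \<odot>\<^bsub>kaehler_free\<^esub> basis_vec (alg C) x)"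
        proof -
          have u: "u x \<in> carrier (alg C)" using T(3)[of x] C by simp
          have "\<xi> (kaehler_d C x) = X x" using \<xi> x(1) by simp
          then have "\<xi> (?\<pi> (basis_vec (alg C) x)) = X x" by (simp only: \<pi>d)
          moreover have "\<psi> (basis_vec (alg C) x) = X x" by (rule \<psi>(2)[OF x(1)])
          moreover have "\<xi> (?\<pi> (u x \<odot>\<^bsub>kaehler_free\<^esub> basis_vec (alg C) x)) =
              u x \<odot>\<^bsub>N\<^esub> \<xi> (?\<pi> (basis_vec (alg C) x))"
            by (rule module_mapD(2)[OF mm u x(2)])
          moreover have "\<psi> (u x \<odot>\<^bsub>kaehler_free\<^esub> basis_vec (alg C) x) = u x \<odot>\<^bsub>N\<^esub> \<psi> (basis_vec (alg C) x)"
            by (rule module_mapD(2)[OF \<psi>(1) u x(2)])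
          ultimately show ?thesis by (simp only:)
        qed
      next
        show "(\<lambda>x. \<psi> (u x \<odot>\<^bsub>kaehler_free\<^esub> basis_vec (alg C) x)) \<in> ?T \<rightarrow> carrier N"
          by (rule Pi_I) (rule module_mapD(1)[OF \<psi>(1) funcset_mem[OF e]])
      qed simp
      then show ?thesis unfolding free_module_expand[OF alg_cring[OF C] u, symmetric] .
    qed
    then have "\<xi> (?\<pi> u) = \<phi> (?\<pi> u)" if "u \<in> carrier kaehler_free" for u
      by (simp only: that \<phi>)
    then show "\<xi> = \<phi>"
    proof (intro extensionalityI[of _ "carrier (kaehler C)"])
      show "\<xi> K = \<phi> K" if *: "K \<in> carrier (kaehler C)"
          "\<And>u. u \<in> carrier kaehler_free \<Longrightarrow> \<xi> (?\<pi> u) = \<phi> (?\<pi> u)" for K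
        using Q(6)[OF *(1)] *(2) by blast
    qed (use \<xi> in \<open>simp_all add: \<phi>_def\<close>)
  qed
qed

end

end

theory Submission
  imports Defs
begin

text \<open>
  On Kaehler differentials the differential is \<open>r da \<mapsto> dr \<and> da\<close>.  It respects the relation
  \<open>dh(a\<^sub>1, \<dots>, a\<^sub>n) = \<Sum>\<^sub>i \<partial>\<^sub>ih(a) da\<^sub>i\<close> because the mixed second derivatives of \<open>h\<close> commute while
  \<open>da\<^sub>j \<and> da\<^sub>i\<close> is alternating.  On exterior powers the Leibniz rule then leaves no choice.  Every
  form is a sum of forms \<open>a\<^sub>0 da\<^sub>1 \<and> \<dots> \<and> da\<^sub>k\<close>, so the differential and the map of forms induced by a
  homomorphism are unique, and products, differentials and compositions of induced maps need only
  be compared on such forms.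

  Locally every section of the sheafification comes from the presheaf, and the operations are
  computed locally.  Hence all identities pass from presheaves to sheafifications.  The map
  induced by \<open>(f, f\<^sub>#)\<close> sends the germ at \<open>f p\<close> of \<open>\<sigma>\<close> over \<open>V\<close> to the germ at \<open>p\<close> of the image of
  \<open>\<sigma>\<close> over the preimage of \<open>V\<close>; for the same local reason it is determined by its values on
  sections of the presheaf.
\<close>

section \<open>Mixed partial derivatives\<close>

text \<open>The obstacle is that no decisive map is linear over one ring. The differential obeys a
  product rule and a homomorphism changes the ring, so universal properties that produce linear maps
  do not apply directly. All lifts are made for additive maps with the coefficient \<open>r\<close>
  as an extra argument, and a relation must be killed together with all its multiples. Smoothness is
  given through iterated partial derivatives along coordinate lines, so the symmetry of second
  derivatives is derived from mean values and continuity. \<open>form_dif\<close> and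
  \<open>forms_map\<close> are definite descriptions: nothing is known about either before existence
  and uniqueness are both settled, and uniqueness of the differential rests on its square being
  zero. Operations on the sheafification are unions over representatives of germs. Stalks never
  receive an algebraic structure; instead \<open>rep\<close> records that a section comes from a
  presheaf section over an open set, each operation gets a rule for \<open>rep\<close>, and an
  identity of sections becomes the same identity over a small open set.\<close>

lemma smooth_fun_pderivative:
  assumes "h \<in> smooth_fun m" "i < m"
  shows "((\<lambda>t. h (x(i := t))) has_field_derivative pderivative i h (x(i := s))) (at s)"
proof -
  have "\<forall>ps. set ps \<subseteq> {..<m} \<longrightarrow>
      (\<forall>i<m. \<forall>x. (\<lambda>t. foldr pderivative ps h (x(i := t))) differentiable (at (x i)))"
    using assms(1) unfolding smooth_fun_def by blast
  \<comment> \<open>The definition gives differentiability along a line only at the point's own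
    coordinate; the base point \<open>x(i := s)\<close> moves this to an arbitrary
    \<open>s\<close>.\<close>
  from this[rule_format, of "[]" i "x(i := s)"] have "(\<lambda>t. h (x(i := t))) differentiable (at s)"
    using assms(2) by simp
  then show ?thesis
    unfolding pderivative_def
    by (simp add: DERIV_deriv_iff_real_differentiable)
qed

lemma smooth_fun_continuous: "h \<in> smooth_fun m \<Longrightarrow> continuous_on UNIV h"
  unfolding smooth_fun_def by (force dest: spec[of _ "[]"])

lemma smooth_fun_pderivative_closed:
  assumes "h \<in> smooth_fun m" "i < m"
  shows "pderivative i h \<in> smooth_fun m"
proof -
  \<comment> \<open>\<open>pderivative_smooth\<close> is stated relative to some smooth ring; the zero ring will do.\<close>
  have "cinf_ring \<lparr>carrier = {()}, cop = \<lambda>_ _. ()\<rparr>" by (simp add: cinf_ring_def)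
  from pderivative_smooth[OF this assms] show ?thesis .
qed

text \<open>The second difference of \<open>h\<close> over a square of side \<open>k\<close> treats
  \<open>i\<close> and \<open>j\<close> alike. The mean value theorem along \<open>i\<close>,
  applied to the difference across the square in direction \<open>j\<close>, and then along
  \<open>j\<close>, expresses it by one mixed derivative at an inner point; exchanging
  \<open>i\<close> and \<open>j\<close> will yield the other.\<close>

lemma mixed_difference:
  assumes h: "h \<in> smooth_fun m" and ij: "i < m" "j < m" "i \<noteq> j" and k: "0 < k"
  shows "\<exists>\<xi> \<eta>. x i < \<xi> \<and> \<xi> < x i + k \<and> x j < \<eta> \<and> \<eta> < x j + k \<and>
    h (x(i := x i + k, j := x j + k)) - h (x(i := x i + k)) - h (x(j := x j + k)) + h x
      = k * (k * pderivative j (pderivative i h) (x(i := \<xi>, j := \<eta>)))"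
proof -
  let ?F = "\<lambda>s. h (x(j := x j + k, i := s)) - h (x(i := s))"
  let ?F' = "\<lambda>s. pderivative i h (x(j := x j + k, i := s)) - pderivative i h (x(i := s))"
  have "\<exists>\<xi>>x i. \<xi> < x i + k \<and> ?F (x i + k) - ?F (x i) = (x i + k - x i) * ?F' \<xi>"
    using k by (intro MVT2 DERIV_diff smooth_fun_pderivative[OF h ij(1)]) simp
  then obtain \<xi> where \<xi>: "x i < \<xi>" "\<xi> < x i + k" "?F (x i + k) - ?F (x i) = k * ?F' \<xi>" by auto
  let ?G = "\<lambda>t. pderivative i h (x(i := \<xi>, j := t))"
  have "\<exists>\<eta>>x j. \<eta> < x j + k \<and> ?G (x j + k) - ?G (x j) =
      (x j + k - x j) * pderivative j (pderivative i h) (x(i := \<xi>, j := \<eta>))"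
    using k by (intro MVT2 smooth_fun_pderivative[OF smooth_fun_pderivative_closed[OF h ij(1)] ij(2)]) simp
  then obtain \<eta> where \<eta>: "x j < \<eta>" "\<eta> < x j + k"
    "?G (x j + k) - ?G (x j) = k * pderivative j (pderivative i h) (x(i := \<xi>, j := \<eta>))" by auto
  have "x(i := \<xi>, j := x j) = x(i := \<xi>)" "x(j := x j + k, i := x i) = x(j := x j + k)"
    "x(i := x i) = x" using ij(3) by auto
  with \<xi>(3) \<eta>(3) have "h (x(j := x j + k, i := x i + k)) - h (x(i := x i + k)) - (h (x(j := x j + k)) - h x) =
      k * (k * pderivative j (pderivative i h) (x(i := \<xi>, j := \<eta>)))"
    by (simp add: fun_upd_twist[OF ij(3)])
  then have "h (x(i := x i + k, j := x j + k)) - h (x(i := x i + k)) - h (x(j := x j + k)) + h x =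
      k * (k * pderivative j (pderivative i h) (x(i := \<xi>, j := \<eta>)))"
    using fun_upd_twist[OF ij(3), of x "x i + k" "x j + k"] by simp
  with \<xi> \<eta> show ?thesis by blast
qed

text \<open>Over squares of side \<open>1 / real (Suc n)\<close> at \<open>x\<close> the two mixed
  derivatives share a value at inner points, by \<open>mixed_difference\<close> used in both orders.
  The inner points tend to \<open>x\<close>, and both mixed derivatives are continuous.\<close>

lemma pderivative_commute:
  assumes h: "h \<in> smooth_fun m" and ij: "i < m" "j < m"
  shows "pderivative i (pderivative j h) = pderivative j (pderivative i h)"
proof (cases "i = j")
  case False
  show ?thesis
  proof
    fix x
    let ?k = "\<lambda>n. 1 / real (Suc n)"
    have "\<exists>\<xi> \<eta> \<xi>' \<eta>'. x i < \<xi> \<and> \<xi> < x i + ?k n \<and> x j < \<eta> \<and> \<eta> < x j + ?k n \<and>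
        x i < \<xi>' \<and> \<xi>' < x i + ?k n \<and> x j < \<eta>' \<and> \<eta>' < x j + ?k n \<and>
        pderivative j (pderivative i h) (x(i := \<xi>, j := \<eta>)) =
        pderivative i (pderivative j h) (x(i := \<xi>', j := \<eta>'))" for n
    proof -
      have k: "0 < ?k n" by simp
      obtain \<xi> \<eta> where 1: "x i < \<xi>" "\<xi> < x i + ?k n" "x j < \<eta>" "\<eta> < x j + ?k n"
        "h (x(i := x i + ?k n, j := x j + ?k n)) - h (x(i := x i + ?k n)) - h (x(j := x j + ?k n)) + h x
          = ?k n * (?k n * pderivative j (pderivative i h) (x(i := \<xi>, j := \<eta>)))"
        using mixed_difference[OF h ij False k, of x] by blast
      obtain \<eta>' \<xi>' where 2: "x j < \<eta>'" "\<eta>' < x j + ?k n" "x i < \<xi>'" "\<xi>' < x i + ?k n"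
        "h (x(j := x j + ?k n, i := x i + ?k n)) - h (x(j := x j + ?k n)) - h (x(i := x i + ?k n)) + h x
          = ?k n * (?k n * pderivative i (pderivative j h) (x(j := \<eta>', i := \<xi>')))"
        using mixed_difference[OF h ij(2,1) False[symmetric] k, of x] by blast
      have "?k n * (?k n * pderivative j (pderivative i h) (x(i := \<xi>, j := \<eta>))) =
          ?k n * (?k n * pderivative i (pderivative j h) (x(i := \<xi>', j := \<eta>')))"
        using 1(5) 2(5) unfolding fun_upd_twist[OF False[symmetric]] by linarith
      then have "pderivative j (pderivative i h) (x(i := \<xi>, j := \<eta>)) =
          pderivative i (pderivative j h) (x(i := \<xi>', j := \<eta>'))"
        using k by (metis mult_left_cancel less_irrefl)
      with 1(1-4) 2(1-4) show ?thesis by blast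
    qed
    then obtain \<xi> \<eta> \<xi>' \<eta>' where *: "\<And>n. x i < \<xi> n" "\<And>n. \<xi> n < x i + ?k n" "\<And>n. x j < \<eta> n" "\<And>n. \<eta> n < x j + ?k n"
      "\<And>n. x i < \<xi>' n" "\<And>n. \<xi>' n < x i + ?k n" "\<And>n. x j < \<eta>' n" "\<And>n. \<eta>' n < x j + ?k n"
      "\<And>n. pderivative j (pderivative i h) (x(i := \<xi> n, j := \<eta> n)) =
        pderivative i (pderivative j h) (x(i := \<xi>' n, j := \<eta>' n))"
      by metis
    have k0: "(\<lambda>n. c + ?k n) \<longlonglongrightarrow> c" for c :: real
      using tendsto_add[OF tendsto_const LIMSEQ_Suc[OF lim_1_over_n]] by fastforce
    have sq: "u \<longlonglongrightarrow> c" if "\<And>n. c < u n" "\<And>n. u n < c + ?k n" for u and c :: real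
      by (rule tendsto_sandwich[OF _ _ tendsto_const k0])
         (use that in \<open>auto intro!: always_eventually less_imp_le simp del: of_nat_Suc\<close>)
    have lim: "(\<lambda>n. g (x(i := u n, j := v n))) \<longlonglongrightarrow> g x"
      if g: "continuous_on UNIV g" and u: "u \<longlonglongrightarrow> x i" and v: "v \<longlonglongrightarrow> x j"
      for g :: "(nat \<Rightarrow> real) \<Rightarrow> real" and u v
    proof -
      \<comment> \<open>Continuity of \<open>g\<close> refers to the product topology, so it is
        pulled back to the plane along the map that fills in the coordinates \<open>i\<close> and
        \<open>j\<close>.\<close>
      have "continuous_on UNIV (\<lambda>p::real \<times> real. x(i := fst p, j := snd p))"
      proof (rule continuous_on_coordinatewise_then_product)
        fix l show "continuous_on UNIV (\<lambda>p::real \<times> real. (x(i := fst p, j := snd p)) l)"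
          by (cases "l = j"; cases "l = i") (auto intro!: continuous_intros)
      qed
      then have "continuous_on UNIV (\<lambda>p::real \<times> real. g (x(i := fst p, j := snd p)))"
        by (rule continuous_on_compose2[OF g]) auto
      from continuous_on_tendsto_compose[OF this tendsto_Pair[OF u v]]
      show ?thesis by simp
    qed
    have sm: "continuous_on UNIV (pderivative j (pderivative i h))"
      "continuous_on UNIV (pderivative i (pderivative j h))"
      by (rule smooth_fun_continuous[of _ m], intro smooth_fun_pderivative_closed h ij)+
    have "(\<lambda>n. pderivative j (pderivative i h) (x(i := \<xi> n, j := \<eta> n))) \<longlonglongrightarrow> pderivative j (pderivative i h) x"
      by (rule lim[OF sm(1) sq[OF *(1,2)] sq[OF *(3,4)]])
    moreover have "(\<lambda>n. pderivative i (pderivative j h) (x(i := \<xi>' n, j := \<eta>' n))) \<longlonglongrightarrow> pderivative i (pderivative j h) x"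
      by (rule lim[OF sm(2) sq[OF *(5,6)] sq[OF *(7,8)]])
    ultimately show "pderivative i (pderivative j h) x = pderivative j (pderivative i h) x"
      unfolding *(9) by (metis LIMSEQ_unique)
  qed
qed simp

section \<open>Additive maps on free modules and quotients\<close>

text \<open>Stated for \<open>ring_scheme\<close>, which modules extend, so that the source may also
  be the coefficient ring itself: \<open>add_map R A c\<close> then says how a value depends on its
  coefficient. Source and target may live over different rings.\<close>

definition add_map :: "('a, 'r) ring_scheme \<Rightarrow> ('b, 's) ring_scheme \<Rightarrow> ('a \<Rightarrow> 'b) \<Rightarrow> bool" where
  "add_map M N \<phi> \<longleftrightarrow> \<phi> \<in> carrier M \<rightarrow> carrier N \<and>
     (\<forall>x\<in>carrier M. \<forall>y\<in>carrier M. \<phi> (x \<oplus>\<^bsub>M\<^esub> y) = \<phi> x \<oplus>\<^bsub>N\<^esub> \<phi> y)"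

lemma add_mapI:
  assumes "\<And>x. x \<in> carrier M \<Longrightarrow> \<phi> x \<in> carrier N"
    and "\<And>x y. x \<in> carrier M \<Longrightarrow> y \<in> carrier M \<Longrightarrow> \<phi> (x \<oplus>\<^bsub>M\<^esub> y) = \<phi> x \<oplus>\<^bsub>N\<^esub> \<phi> y"
  shows "add_map M N \<phi>"
  using assms by (auto simp: add_map_def)

lemma add_map_closed: "add_map M N \<phi> \<Longrightarrow> x \<in> carrier M \<Longrightarrow> \<phi> x \<in> carrier N"
  and add_map_add: "add_map M N \<phi> \<Longrightarrow> x \<in> carrier M \<Longrightarrow> y \<in> carrier M \<Longrightarrow> \<phi> (x \<oplus>\<^bsub>M\<^esub> y) = \<phi> x \<oplus>\<^bsub>N\<^esub> \<phi> y"
  by (auto simp: add_map_def)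

lemma module_map_add_map: "module_map R M N \<phi> \<Longrightarrow> add_map M N \<phi>"
  by (auto simp: add_map_def module_map_def)

lemma add_map_comp: "add_map M N \<phi> \<Longrightarrow> add_map N L \<psi> \<Longrightarrow> add_map M L (\<lambda>x. \<psi> (\<phi> x))"
  by (auto simp: add_map_def Pi_iff)

lemma add_map_zero:
  assumes "abelian_group M" "abelian_group N" "add_map M N \<phi>"
  shows "\<phi> \<zero>\<^bsub>M\<^esub> = \<zero>\<^bsub>N\<^esub>"
proof -
  interpret M: abelian_group M by fact
  interpret N: abelian_group N by fact
  have "\<phi> \<zero>\<^bsub>M\<^esub> \<oplus>\<^bsub>N\<^esub> \<phi> \<zero>\<^bsub>M\<^esub> = \<phi> \<zero>\<^bsub>M\<^esub>"
    using add_map_add[OF assms(3), of "\<zero>\<^bsub>M\<^esub>" "\<zero>\<^bsub>M\<^esub>"] by simp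
  then show ?thesis using add_map_closed[OF assms(3) M.zero_closed] using N.add.r_cancel_one[of "\<phi> \<zero>\<^bsub>M\<^esub>" "\<phi> \<zero>\<^bsub>M\<^esub>"] by simp
qed

lemma add_map_minus:
  assumes "abelian_group M" "abelian_group N" "add_map M N \<phi>" "x \<in> carrier M"
  shows "\<phi> (\<ominus>\<^bsub>M\<^esub> x) = \<ominus>\<^bsub>N\<^esub> \<phi> x"
proof -
  interpret M: abelian_group M by fact
  interpret N: abelian_group N by fact
  have "\<phi> (\<ominus>\<^bsub>M\<^esub> x) \<oplus>\<^bsub>N\<^esub> \<phi> x = \<zero>\<^bsub>N\<^esub>"
    using add_map_add[OF assms(3), of "\<ominus>\<^bsub>M\<^esub> x" x] assms(4) add_map_zero[OF assms(1-3)] by (simp add: M.l_neg)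
  then show ?thesis using add_map_closed[OF assms(3)] assms(4) by (metis M.a_inv_closed N.minus_equality)
qed

lemma add_map_diff:
  assumes "abelian_group M" "abelian_group N" "add_map M N \<phi>" "x \<in> carrier M" "y \<in> carrier M"
  shows "\<phi> (x \<ominus>\<^bsub>M\<^esub> y) = \<phi> x \<ominus>\<^bsub>N\<^esub> \<phi> y"
proof -
  interpret M: abelian_group M by fact
  show ?thesis using assms add_map_add[OF assms(3), of x "\<ominus>\<^bsub>M\<^esub> y"]
    by (simp add: a_minus_def add_map_minus[OF assms(1-3)])
qed

lemma add_map_finsum:
  assumes "abelian_group M" "abelian_group N" "add_map M N \<phi>" "finite I" "g \<in> I \<rightarrow> carrier M"
  shows "\<phi> (\<Oplus>\<^bsub>M\<^esub>i\<in>I. g i) = (\<Oplus>\<^bsub>N\<^esub>i\<in>I. \<phi> (g i))"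
proof -
  interpret M: abelian_group M by fact
  interpret N: abelian_group N by fact
  show ?thesis using assms(4,5)
  proof (induction I)
    case empty
    then show ?case using add_map_zero[OF assms(1-3)] by simp
  next
    case (insert i I)
    then have "g i \<in> carrier M" "g \<in> I \<rightarrow> carrier M" "(\<Oplus>\<^bsub>M\<^esub>i\<in>I. g i) \<in> carrier M" by auto
    then show ?case using insert
      by (simp add: M.finsum_insert N.finsum_insert Pi_def add_map_closed[OF assms(3)] add_map_add[OF assms(3)])
  qed
qed

text \<open>The expansion in basis vectors recast as an induction rule, so that later arguments need
  no sums over supports.\<close>

lemma free_module_induct [consumes 2, case_names zero basis add]:
  assumes "cring R" "u \<in> carrier (free_module R S)"
    and zero: "Q \<zero>\<^bsub>free_module R S\<^esub>"
    and basis: "\<And>r x. r \<in> carrier R \<Longrightarrow> x \<in> S \<Longrightarrow> Q (r \<odot>\<^bsub>free_module R S\<^esub> basis_vec R x)"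
    and add: "\<And>u v. u \<in> carrier (free_module R S) \<Longrightarrow> v \<in> carrier (free_module R S) \<Longrightarrow> Q u \<Longrightarrow> Q v \<Longrightarrow> Q (u \<oplus>\<^bsub>free_module R S\<^esub> v)"
  shows "Q u"
proof -
  let ?E = "free_module R S"
  interpret E: Module.module R ?E by (rule free_module_module[OF assms(1)])
  have u: "\<And>x. u x \<in> carrier R" "finite {x. u x \<noteq> \<zero>\<^bsub>R\<^esub>}" "{x. u x \<noteq> \<zero>\<^bsub>R\<^esub>} \<subseteq> S"
    using assms(2) by (auto simp: free_module_def)
  have "Q (\<Oplus>\<^bsub>?E\<^esub>x\<in>T. u x \<odot>\<^bsub>?E\<^esub> basis_vec R x)" if "finite T" "T \<subseteq> S" for T
    using that
  proof (induction T)
    case empty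
    then show ?case using zero by simp
  next
    case (insert x T)
    have c: "u x \<odot>\<^bsub>?E\<^esub> basis_vec R x \<in> carrier ?E" if "x \<in> S" for x
      using u(1) basis_vec_carrier[OF assms(1) that] by simp
    then have f: "(\<lambda>x. u x \<odot>\<^bsub>?E\<^esub> basis_vec R x) \<in> T \<rightarrow> carrier ?E" using insert by blast
    show ?case using insert c f by (simp add: E.finsum_insert add basis u)
  qed
  from this[OF u(2,3)] show ?thesis using free_module_expand[OF assms(1,2)] by simp
qed

text \<open>Each \<open>c x\<close> sends zero to zero, so the sum that defines the lift may run
  over any finite set containing the support. Two elements can therefore be summed over a common
  set, and additivity follows termwise.\<close>

lemma free_module_add_lift:
  assumes R: "cring R" and A: "abelian_group A" and c: "\<And>x. x \<in> S \<Longrightarrow> add_map R A (c x)"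
  shows "\<exists>\<phi>. add_map (free_module R S) A \<phi> \<and> (\<forall>r\<in>carrier R. \<forall>x\<in>S. \<phi> (r \<odot>\<^bsub>free_module R S\<^esub> basis_vec R x) = c x r)"
proof -
  interpret cring R by fact
  interpret A: abelian_group A by fact
  let ?E = "free_module R S"
  have c0: "c x \<zero>\<^bsub>R\<^esub> = \<zero>\<^bsub>A\<^esub>" if "x \<in> S" for x
    by (rule add_map_zero[OF is_abelian_group A c[OF that]])
  define \<phi> where "\<phi> u = (\<Oplus>\<^bsub>A\<^esub>x\<in>{x. u x \<noteq> \<zero>\<^bsub>R\<^esub>}. c x (u x))" for u
  have E: "u x \<in> carrier R" "finite {x. u x \<noteq> \<zero>\<^bsub>R\<^esub>}" "x \<notin> S \<Longrightarrow> u x = \<zero>\<^bsub>R\<^esub>"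
    if "u \<in> carrier ?E" for u x
    using that by (auto simp: free_module_def)
  have cl: "c x (u x) \<in> carrier A" if "u \<in> carrier ?E" "x \<in> S" for u x
    by (rule add_map_closed[OF c[OF that(2)] E(1)[OF that(1)]])
  have \<phi>: "\<phi> u = (\<Oplus>\<^bsub>A\<^esub>x\<in>T. c x (u x))"
    if "u \<in> carrier ?E" "finite T" "{x. u x \<noteq> \<zero>\<^bsub>R\<^esub>} \<subseteq> T" "T \<subseteq> S" for u T
    unfolding \<phi>_def
    by (rule A.add.finprod_mono_neutral_cong_left) (use that E[OF that(1)] cl[OF that(1)] c0 in auto)
  have sup: "{x. u x \<noteq> \<zero>\<^bsub>R\<^esub>} \<subseteq> S" if "u \<in> carrier ?E" for u using E(3)[OF that] by blast
  interpret E: Module.module R ?E by (rule free_module_module[OF assms(1)])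
  have "add_map ?E A \<phi>"
  proof (rule add_mapI)
    show "\<phi> u \<in> carrier A" if "u \<in> carrier ?E" for u
      unfolding \<phi>_def using cl[OF that] sup[OF that] by (intro A.finsum_closed) auto
    fix u v assume uv: "u \<in> carrier ?E" "v \<in> carrier ?E"
    define T where "T = {x. u x \<noteq> \<zero>\<^bsub>R\<^esub>} \<union> {x. v x \<noteq> \<zero>\<^bsub>R\<^esub>}"
    have T: "finite T" "T \<subseteq> S" using uv sup E by (auto simp: T_def)
    have s: "(u \<oplus>\<^bsub>?E\<^esub> v) x = u x \<oplus>\<^bsub>R\<^esub> v x" for x by (simp add: free_module_def)
    have "{x. (u \<oplus>\<^bsub>?E\<^esub> v) x \<noteq> \<zero>\<^bsub>R\<^esub>} \<subseteq> T" unfolding s T_def by auto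
    then have "\<phi> (u \<oplus>\<^bsub>?E\<^esub> v) = (\<Oplus>\<^bsub>A\<^esub>x\<in>T. c x (u x \<oplus>\<^bsub>R\<^esub> v x))"
      using \<phi>[of "u \<oplus>\<^bsub>?E\<^esub> v" T] T uv by (simp add: s)
    also have "\<dots> = (\<Oplus>\<^bsub>A\<^esub>x\<in>T. c x (u x) \<oplus>\<^bsub>A\<^esub> c x (v x))"
      by (rule A.finsum_cong') (use T cl[OF uv(1)] cl[OF uv(2)] add_map_add[OF c] E(1)[OF uv(1)] E(1)[OF uv(2)] in auto)
    also have "\<dots> = (\<Oplus>\<^bsub>A\<^esub>x\<in>T. c x (u x)) \<oplus>\<^bsub>A\<^esub> (\<Oplus>\<^bsub>A\<^esub>x\<in>T. c x (v x))"
      by (rule A.finsum_addf) (use T cl[OF uv(1)] cl[OF uv(2)] in auto)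
    also have "\<dots> = \<phi> u \<oplus>\<^bsub>A\<^esub> \<phi> v"
      using \<phi>[OF uv(1) T(1) _ T(2)] \<phi>[OF uv(2) T(1) _ T(2)] by (simp add: T_def)
    finally show "\<phi> (u \<oplus>\<^bsub>?E\<^esub> v) = \<phi> u \<oplus>\<^bsub>A\<^esub> \<phi> v" .
  qed
  moreover have "\<phi> (r \<odot>\<^bsub>?E\<^esub> basis_vec R x) = c x r" if "r \<in> carrier R" "x \<in> S" for r x
  proof -
    have v: "(r \<odot>\<^bsub>?E\<^esub> basis_vec R x) y = (if y = x then r else \<zero>\<^bsub>R\<^esub>)" for y
      using that by (auto simp: free_module_def basis_vec_def)
    have "\<phi> (r \<odot>\<^bsub>?E\<^esub> basis_vec R x) = (\<Oplus>\<^bsub>A\<^esub>y\<in>{x}. c y ((r \<odot>\<^bsub>?E\<^esub> basis_vec R x) y))"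
      by (rule \<phi>) (use that basis_vec_carrier[OF R, of x S] in \<open>auto simp: v split: if_splits\<close>)
    then show ?thesis using add_map_closed[OF c[OF that(2)] that(1)] by (simp add: v)
  qed
  ultimately show ?thesis by blast
qed

text \<open>The kernel of an additive map is only a subgroup, and killing \<open>S\<close> does not
  force it to contain the submodule generated by \<open>S\<close>. The elements all of whose
  multiples are killed do form a submodule, and \<open>ker\<close> places \<open>S\<close> inside
  it.\<close>

lemma quot_gen_add_lift:
  assumes M: "Module.module R M" and S: "S \<subseteq> carrier M" and A: "abelian_group A"
    and \<psi>: "add_map M A \<psi>" and ker: "\<And>r x. r \<in> carrier R \<Longrightarrow> x \<in> S \<Longrightarrow> \<psi> (r \<odot>\<^bsub>M\<^esub> x) = \<zero>\<^bsub>A\<^esub>"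
  shows "\<exists>\<phi>. add_map (quot_module M (gen_submodule R M S)) A \<phi> \<and>
    (\<forall>x\<in>carrier M. \<phi> (gen_submodule R M S +>\<^bsub>M\<^esub> x) = \<psi> x)"
proof -
  interpret M: Module.module R M by fact
  interpret A: abelian_group A by fact
  let ?N = "gen_submodule R M S"
  let ?Q = "quot_module M ?N"
  note N = gen_submodule_submodule[OF M S]
  note Q = quot_module_module[OF M N]
  interpret Q: Module.module R ?Q by (rule Q(1))
  let ?H = "{x \<in> carrier M. \<forall>r\<in>carrier R. \<psi> (r \<odot>\<^bsub>M\<^esub> x) = \<zero>\<^bsub>A\<^esub>}"
  have z: "\<psi> \<zero>\<^bsub>M\<^esub> = \<zero>\<^bsub>A\<^esub>" by (rule add_map_zero[OF M.abelian_group_axioms A \<psi>])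
  have "submodule ?H R M"
    by (rule M.submoduleI)
       (auto simp: z M.smult_r_distr add_map_add[OF \<psi>] M.smult_assoc1[symmetric] M.smult_r_minus
         add_map_minus[OF M.abelian_group_axioms A \<psi>])
  then have "?N \<subseteq> ?H" unfolding gen_submodule_def using S ker by blast
  \<comment> \<open>The multiplier one shows that the map itself vanishes on the generated
    submodule.\<close>
  then have kill: "\<psi> x = \<zero>\<^bsub>A\<^esub>" if "x \<in> ?N" for x
    using that M.smult_one[of x] M.R.one_closed by force
  define \<phi> where "\<phi> K = \<psi> (SOME u. u \<in> carrier M \<and> K = ?N +>\<^bsub>M\<^esub> u)" for K
  have \<phi>: "\<phi> (?N +>\<^bsub>M\<^esub> u) = \<psi> u" if u: "u \<in> carrier M" for u
  proof -
    define v where "v = (SOME v. v \<in> carrier M \<and> ?N +>\<^bsub>M\<^esub> u = ?N +>\<^bsub>M\<^esub> v)"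
    have v: "v \<in> carrier M" "?N +>\<^bsub>M\<^esub> u = ?N +>\<^bsub>M\<^esub> v"
      using someI[of "\<lambda>v. v \<in> carrier M \<and> ?N +>\<^bsub>M\<^esub> u = ?N +>\<^bsub>M\<^esub> v" u] u unfolding v_def by auto
    have am: "add_map M ?Q (\<lambda>x. ?N +>\<^bsub>M\<^esub> x)" by (rule add_mapI) (auto simp: Q(2,3))
    have "?N +>\<^bsub>M\<^esub> (u \<ominus>\<^bsub>M\<^esub> v) = \<zero>\<^bsub>?Q\<^esub>"
      unfolding add_map_diff[OF M.abelian_group_axioms Q.abelian_group_axioms am u v(1)] v(2)
      using Q(2)[OF v(1)] by (simp add: a_minus_def Q.r_neg)
    then have "\<psi> (u \<ominus>\<^bsub>M\<^esub> v) = \<zero>\<^bsub>A\<^esub>" using Q(5) kill u v(1) by simp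
    then have "\<psi> u \<ominus>\<^bsub>A\<^esub> \<psi> v = \<zero>\<^bsub>A\<^esub>"
      by (simp add: add_map_diff[OF M.abelian_group_axioms A \<psi> u v(1)])
    then have "\<psi> u = \<psi> v" using add_map_closed[OF \<psi>] u v(1)
      by (metis A.a_inv_closed A.add.inv_inv A.minus_equality a_minus_def)
    then show ?thesis by (simp add: \<phi>_def v_def)
  qed
  have "add_map ?Q A \<phi>"
    by (rule add_mapI) (use Q(3) in \<open>auto dest!: Q(6) simp: \<phi> add_map_closed[OF \<psi>] add_map_add[OF \<psi>]\<close>)
  with \<phi> show ?thesis by blast
qed

section \<open>Exterior powers\<close>

lemma (in Module.module) smult_diff:
  "r \<in> carrier R \<Longrightarrow> x \<in> carrier M \<Longrightarrow> y \<in> carrier M \<Longrightarrow> r \<odot>\<^bsub>M\<^esub> (x \<ominus>\<^bsub>M\<^esub> y) = r \<odot>\<^bsub>M\<^esub> x \<ominus>\<^bsub>M\<^esub> r \<odot>\<^bsub>M\<^esub> y"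
  by (simp add: a_minus_def smult_r_distr smult_r_minus)

lemma (in abelian_group) diff_zero_imp_eq:
  "x \<ominus> y = \<zero> \<Longrightarrow> x \<in> carrier G \<Longrightarrow> y \<in> carrier G \<Longrightarrow> x = y"
  by (metis a_inv_closed add.inv_inv minus_equality a_minus_def)

text \<open>The generators that stand unnamed inside \<open>ext_relations\<close>; with a name, maps
  and products can be checked on them case by case.\<close>

definition ext_gens :: "('a, 'r) ring_scheme \<Rightarrow> ('a, 'm, 's) module_scheme \<Rightarrow> int \<Rightarrow> ('m list \<Rightarrow> 'a) set" where
  "ext_gens R M k =
     (let E = ext_free R M k; e = basis_vec R in
        ({e (xs @ (x \<oplus>\<^bsub>M\<^esub> y) # ys) \<ominus>\<^bsub>E\<^esub> (e (xs @ x # ys) \<oplus>\<^bsub>E\<^esub> e (xs @ y # ys)) | xs x y ys.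
            set xs \<subseteq> carrier M \<and> x \<in> carrier M \<and> y \<in> carrier M \<and> set ys \<subseteq> carrier M \<and>
            int (length xs + 1 + length ys) = k} \<union>
         {e (xs @ (r \<odot>\<^bsub>M\<^esub> x) # ys) \<ominus>\<^bsub>E\<^esub> r \<odot>\<^bsub>E\<^esub> e (xs @ x # ys) | xs r x ys.
            set xs \<subseteq> carrier M \<and> r \<in> carrier R \<and> x \<in> carrier M \<and> set ys \<subseteq> carrier M \<and>
            int (length xs + 1 + length ys) = k} \<union>
         {e (xs @ x # x # ys) | xs x ys.
            set xs \<subseteq> carrier M \<and> x \<in> carrier M \<and> set ys \<subseteq> carrier M \<and>
            int (length xs + 2 + length ys) = k}))"

lemma ext_relations_gens: "ext_relations R M k = gen_submodule R (ext_free R M k) (ext_gens R M k)"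
  by (simp add: ext_relations_def ext_gens_def Let_def)

lemma gen_submodule_least: "submodule H R M \<Longrightarrow> S \<subseteq> H \<Longrightarrow> gen_submodule R M S \<subseteq> H"
  by (auto simp: gen_submodule_def)

lemma gen_submodule_incl: "S \<subseteq> gen_submodule R M S"
  by (auto simp: gen_submodule_def)

locale ext_alg = Module.module R M for R (structure) and M (structure)
begin

abbreviation "F \<equiv> ext_free R M"
abbreviation "N \<equiv> ext_relations R M"
abbreviation "E \<equiv> ext_power R M"
abbreviation "w \<equiv> wedge_list R M"
abbreviation "P \<equiv> ext_mult R M"
abbreviation "e \<equiv> basis_vec R"

lemma F_module: "Module.module R (F k)"
  unfolding ext_free_def by (rule free_module_module) (rule R.is_cring)

lemma e_closed: "set xs \<subseteq> carrier M \<Longrightarrow> int (length xs) = k \<Longrightarrow> e xs \<in> carrier (F k)"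
  unfolding ext_free_def by (rule basis_vec_carrier) (auto simp: R.is_cring)

lemma ext_gens_cases [consumes 1, case_names add smult alt]:
  assumes "g \<in> ext_gens R M k"
  obtains xs x y ys where "g = e (xs @ (x \<oplus>\<^bsub>M\<^esub> y) # ys) \<ominus>\<^bsub>F k\<^esub> (e (xs @ x # ys) \<oplus>\<^bsub>F k\<^esub> e (xs @ y # ys))"
      "set xs \<subseteq> carrier M" "x \<in> carrier M" "y \<in> carrier M" "set ys \<subseteq> carrier M" "int (length xs + 1 + length ys) = k"
  | xs r x ys where "g = e (xs @ (r \<odot>\<^bsub>M\<^esub> x) # ys) \<ominus>\<^bsub>F k\<^esub> r \<odot>\<^bsub>F k\<^esub> e (xs @ x # ys)"
      "set xs \<subseteq> carrier M" "r \<in> carrier R" "x \<in> carrier M" "set ys \<subseteq> carrier M" "int (length xs + 1 + length ys) = k"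
  | xs x ys where "g = e (xs @ x # x # ys)"
      "set xs \<subseteq> carrier M" "x \<in> carrier M" "set ys \<subseteq> carrier M" "int (length xs + 2 + length ys) = k"
  using assms unfolding ext_gens_def Let_def by blast

lemma ext_gensI:
  "set xs \<subseteq> carrier M \<Longrightarrow> x \<in> carrier M \<Longrightarrow> y \<in> carrier M \<Longrightarrow> set ys \<subseteq> carrier M \<Longrightarrow> int (length xs + 1 + length ys) = k \<Longrightarrow>
    e (xs @ (x \<oplus>\<^bsub>M\<^esub> y) # ys) \<ominus>\<^bsub>F k\<^esub> (e (xs @ x # ys) \<oplus>\<^bsub>F k\<^esub> e (xs @ y # ys)) \<in> ext_gens R M k"
  "set xs \<subseteq> carrier M \<Longrightarrow> r \<in> carrier R \<Longrightarrow> x \<in> carrier M \<Longrightarrow> set ys \<subseteq> carrier M \<Longrightarrow> int (length xs + 1 + length ys) = k \<Longrightarrow>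
    e (xs @ (r \<odot>\<^bsub>M\<^esub> x) # ys) \<ominus>\<^bsub>F k\<^esub> r \<odot>\<^bsub>F k\<^esub> e (xs @ x # ys) \<in> ext_gens R M k"
  "set xs \<subseteq> carrier M \<Longrightarrow> x \<in> carrier M \<Longrightarrow> set ys \<subseteq> carrier M \<Longrightarrow> int (length xs + 2 + length ys) = k \<Longrightarrow>
    e (xs @ x # x # ys) \<in> ext_gens R M k"
  unfolding ext_gens_def Let_def by blast+

lemma ext_gens_carrier: "ext_gens R M k \<subseteq> carrier (F k)"
proof
  fix g assume "g \<in> ext_gens R M k"
  interpret F: Module.module R "F k" by (rule F_module)
  from \<open>g \<in> ext_gens R M k\<close> show "g \<in> carrier (F k)"
  proof (cases rule: ext_gens_cases)
    case (add xs x y ys)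
    then show ?thesis unfolding add(1) by (intro F.minus_closed F.a_closed e_closed) simp_all
  next
    case (smult xs r x ys)
    then show ?thesis unfolding smult(1) by (intro F.minus_closed F.smult_closed e_closed) simp_all
  next
    case (alt xs x ys)
    then show ?thesis unfolding alt(1) by (intro e_closed) simp_all
  qed
qed

lemma N_submodule: "submodule (N k) R (F k)"
  unfolding ext_relations_gens by (rule gen_submodule_submodule[OF F_module ext_gens_carrier])

lemma gens_N: "ext_gens R M k \<subseteq> N k"
  unfolding ext_relations_gens by (rule gen_submodule_incl)

lemma N_carrier: "x \<in> N k \<Longrightarrow> x \<in> carrier (F k)"
  using submodule.axioms(1)[OF N_submodule] subgroup.subset by fastforce

lemmas E_quot = quot_module_module[OF F_module N_submodule, folded ext_power_def]

lemma E_module: "Module.module R (E k)"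
  by (rule E_quot(1))

lemma class_map: "module_map R (F k) (E k) (\<lambda>u. N k +>\<^bsub>F k\<^esub> u)"
  using E_quot(2-4)[where k = k] unfolding module_map_def by auto

lemmas class_add_map = module_map_add_map[OF class_map]

lemma w_class: "int (length xs) = k \<Longrightarrow> w xs = N k +>\<^bsub>F k\<^esub> e xs"
  by (auto simp: wedge_list_def)

lemma w_closed: "set xs \<subseteq> carrier M \<Longrightarrow> int (length xs) = k \<Longrightarrow> w xs \<in> carrier (E k)"
  using w_class E_quot(2) e_closed by simp

lemma w_add:
  assumes "set xs \<subseteq> carrier M" "x \<in> carrier M" "y \<in> carrier M" "set ys \<subseteq> carrier M" "int (length xs + 1 + length ys) = k"
  shows "w (xs @ (x \<oplus>\<^bsub>M\<^esub> y) # ys) = w (xs @ x # ys) \<oplus>\<^bsub>E k\<^esub> w (xs @ y # ys)"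
proof -
  interpret F: Module.module R "F k" by (rule F_module)
  interpret E: Module.module R "E k" by (rule E_module)
  have c: "e (xs @ (x \<oplus>\<^bsub>M\<^esub> y) # ys) \<in> carrier (F k)" "e (xs @ x # ys) \<in> carrier (F k)" "e (xs @ y # ys) \<in> carrier (F k)"
    using assms by (auto intro!: e_closed)
  have n: "int (length (xs @ z # ys)) = k" for z using assms(5) by simp
  have "N k +>\<^bsub>F k\<^esub> (e (xs @ (x \<oplus>\<^bsub>M\<^esub> y) # ys) \<ominus>\<^bsub>F k\<^esub> (e (xs @ x # ys) \<oplus>\<^bsub>F k\<^esub> e (xs @ y # ys))) = \<zero>\<^bsub>E k\<^esub>"
    using ext_gensI(1)[OF assms] gens_N E_quot(5) c by blast
  then show ?thesis
    using add_map_diff[OF F.abelian_group_axioms E.abelian_group_axioms class_add_map c(1), of "e (xs @ x # ys) \<oplus>\<^bsub>F k\<^esub> e (xs @ y # ys)"] c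
    by (simp add: w_class[OF n] E.diff_zero_imp_eq E_quot(2,3))
qed

lemma w_smult:
  assumes "set xs \<subseteq> carrier M" "r \<in> carrier R" "x \<in> carrier M" "set ys \<subseteq> carrier M" "int (length xs + 1 + length ys) = k"
  shows "w (xs @ (r \<odot>\<^bsub>M\<^esub> x) # ys) = r \<odot>\<^bsub>E k\<^esub> w (xs @ x # ys)"
proof -
  interpret F: Module.module R "F k" by (rule F_module)
  interpret E: Module.module R "E k" by (rule E_module)
  have c: "e (xs @ (r \<odot>\<^bsub>M\<^esub> x) # ys) \<in> carrier (F k)" "e (xs @ x # ys) \<in> carrier (F k)"
    using assms by (auto intro!: e_closed)
  have n: "int (length (xs @ z # ys)) = k" for z using assms(5) by simp
  have "N k +>\<^bsub>F k\<^esub> (e (xs @ (r \<odot>\<^bsub>M\<^esub> x) # ys) \<ominus>\<^bsub>F k\<^esub> r \<odot>\<^bsub>F k\<^esub> e (xs @ x # ys)) = \<zero>\<^bsub>E k\<^esub>"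
    using ext_gensI(2)[OF assms] gens_N E_quot(5) c assms(2) by blast
  then show ?thesis
    using add_map_diff[OF F.abelian_group_axioms E.abelian_group_axioms class_add_map c(1), of "r \<odot>\<^bsub>F k\<^esub> e (xs @ x # ys)"] c assms(2)
    by (simp add: w_class[OF n] E.diff_zero_imp_eq E_quot(2,4))
qed

lemma w_alt:
  assumes "set xs \<subseteq> carrier M" "x \<in> carrier M" "set ys \<subseteq> carrier M" "int (length xs + 2 + length ys) = k"
  shows "w (xs @ x # x # ys) = \<zero>\<^bsub>E k\<^esub>"
proof -
  have n: "int (length (xs @ x # x # ys)) = k" using assms(4) by simp
  show ?thesis
    using ext_gensI(3)[OF assms] gens_N[of k] E_quot(5)[where k = k] N_carrier unfolding w_class[OF n] by blast
qed

text \<open>Polarisation: the sum of \<open>x\<close> and \<open>y\<close> in both neighbouring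
  places gives zero, and so do the two terms with a repeated factor; the two mixed terms are what
  remains.\<close>

lemma w_anti:
  assumes "set xs \<subseteq> carrier M" "x \<in> carrier M" "y \<in> carrier M" "set ys \<subseteq> carrier M" "int (length xs + 2 + length ys) = k"
  shows "w (xs @ x # y # ys) = \<ominus>\<^bsub>E k\<^esub> w (xs @ y # x # ys)"
proof -
  interpret E: Module.module R "E k" by (rule E_module)
  let ?z = "x \<oplus>\<^bsub>M\<^esub> y"
  have c: "w (xs @ a # b # ys) \<in> carrier (E k)" if "a \<in> carrier M" "b \<in> carrier M" for a b
    by (rule w_closed) (use assms that in auto)
  have "w (xs @ a # (x \<oplus>\<^bsub>M\<^esub> y) # ys) = w (xs @ a # x # ys) \<oplus>\<^bsub>E k\<^esub> w (xs @ a # y # ys)"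
    if "a \<in> carrier M" for a
    using w_add[of "xs @ [a]" x y ys k] assms that by simp
  moreover have "w (xs @ (x \<oplus>\<^bsub>M\<^esub> y) # a # ys) = w (xs @ x # a # ys) \<oplus>\<^bsub>E k\<^esub> w (xs @ y # a # ys)"
    if "a \<in> carrier M" for a
    using w_add[of xs x y "a # ys" k] assms that by simp
  moreover have "w (xs @ ?z # ?z # ys) = \<zero>\<^bsub>E k\<^esub>" "w (xs @ x # x # ys) = \<zero>\<^bsub>E k\<^esub>" "w (xs @ y # y # ys) = \<zero>\<^bsub>E k\<^esub>"
    by (rule w_alt; use assms in simp)+
  ultimately have "w (xs @ x # y # ys) \<oplus>\<^bsub>E k\<^esub> w (xs @ y # x # ys) = \<zero>\<^bsub>E k\<^esub>"
    using assms c by (simp add: E.a_comm)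
  then show ?thesis using c assms by (metis E.minus_equality)
qed

lemma ext_induct [consumes 1, case_names zero wedge add]:
  assumes "K \<in> carrier (E k)"
    and zero: "Q \<zero>\<^bsub>E k\<^esub>"
    and wedge: "\<And>r xs. r \<in> carrier R \<Longrightarrow> set xs \<subseteq> carrier M \<Longrightarrow> int (length xs) = k \<Longrightarrow> Q (r \<odot>\<^bsub>E k\<^esub> w xs)"
    and add: "\<And>x y. x \<in> carrier (E k) \<Longrightarrow> y \<in> carrier (E k) \<Longrightarrow> Q x \<Longrightarrow> Q y \<Longrightarrow> Q (x \<oplus>\<^bsub>E k\<^esub> y)"
  shows "Q K"
proof -
  interpret F: Module.module R "F k" by (rule F_module)
  interpret E: Module.module R "E k" by (rule E_module)
  obtain u where u: "u \<in> carrier (F k)" "K = N k +>\<^bsub>F k\<^esub> u" using E_quot(6) assms(1) by blast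
  have "Q (N k +>\<^bsub>F k\<^esub> u)"
    using R.is_cring u(1)[unfolded ext_free_def]
  proof (induction rule: free_module_induct)
    case zero
    show ?case
      using add_map_zero[OF F.abelian_group_axioms E.abelian_group_axioms class_add_map] assms(2)
      by (simp add: ext_free_def)
  next
    case (basis r xs)
    then show ?case using E_quot(4)[of r "e xs" k] e_closed[of xs k] wedge[of r xs] w_class[of xs k]
      by (auto simp: ext_free_def)
  next
    case (add u v)
    then show ?case using assms(4)[OF E_quot(2) E_quot(2), of u v] E_quot(3)[of u k v]
      unfolding ext_free_def by metis
  qed
  with u(2) show ?thesis by simp
qed

text \<open>
  The lift is merely additive, with the coefficient as an argument of \<open>c\<close>: the differential and
  the maps over a change of rings are not linear over \<open>R\<close>.
\<close>

lemma ext_add_lift: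
  assumes A: "abelian_group A"
    and c: "\<And>xs. set xs \<subseteq> carrier M \<Longrightarrow> int (length xs) = k \<Longrightarrow> add_map R A (c xs)"
    and add: "\<And>xs x y ys r. set xs \<subseteq> carrier M \<Longrightarrow> x \<in> carrier M \<Longrightarrow> y \<in> carrier M \<Longrightarrow> set ys \<subseteq> carrier M \<Longrightarrow>
      int (length xs + 1 + length ys) = k \<Longrightarrow> r \<in> carrier R \<Longrightarrow>
      c (xs @ (x \<oplus>\<^bsub>M\<^esub> y) # ys) r = c (xs @ x # ys) r \<oplus>\<^bsub>A\<^esub> c (xs @ y # ys) r"
    and smult: "\<And>xs s x ys r. set xs \<subseteq> carrier M \<Longrightarrow> s \<in> carrier R \<Longrightarrow> x \<in> carrier M \<Longrightarrow> set ys \<subseteq> carrier M \<Longrightarrow>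
      int (length xs + 1 + length ys) = k \<Longrightarrow> r \<in> carrier R \<Longrightarrow>
      c (xs @ (s \<odot>\<^bsub>M\<^esub> x) # ys) r = c (xs @ x # ys) (r \<otimes>\<^bsub>R\<^esub> s)"
    and alt: "\<And>xs x ys r. set xs \<subseteq> carrier M \<Longrightarrow> x \<in> carrier M \<Longrightarrow> set ys \<subseteq> carrier M \<Longrightarrow>
      int (length xs + 2 + length ys) = k \<Longrightarrow> r \<in> carrier R \<Longrightarrow> c (xs @ x # x # ys) r = \<zero>\<^bsub>A\<^esub>"
  shows "\<exists>\<phi>. add_map (E k) A \<phi> \<and>
    (\<forall>r xs. r \<in> carrier R \<and> set xs \<subseteq> carrier M \<and> int (length xs) = k \<longrightarrow> \<phi> (r \<odot>\<^bsub>E k\<^esub> w xs) = c xs r)"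
proof -
  interpret A: abelian_group A by fact
  interpret F: Module.module R "F k" by (rule F_module)
  obtain \<psi> where \<psi>: "add_map (F k) A \<psi>"
    and \<psi>e: "\<And>r xs. r \<in> carrier R \<Longrightarrow> set xs \<subseteq> carrier M \<Longrightarrow> int (length xs) = k \<Longrightarrow> \<psi> (r \<odot>\<^bsub>F k\<^esub> e xs) = c xs r"
    using free_module_add_lift[OF R.is_cring A, of "{xs. set xs \<subseteq> carrier M \<and> int (length xs) = k}" c] c
    unfolding ext_free_def by auto
  note \<psi>_simps = add_map_add[OF \<psi>] add_map_diff[OF F.abelian_group_axioms A \<psi>] \<psi>e
  \<comment> \<open>\<open>quot_gen_add_lift\<close> asks for every multiple of a generator. The
    multiplier \<open>r\<close> becomes the argument of \<open>c\<close>, which is why the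
    hypotheses on \<open>c\<close> are required for all \<open>r\<close>.\<close>
  have "\<psi> (r \<odot>\<^bsub>F k\<^esub> g) = \<zero>\<^bsub>A\<^esub>" if r: "r \<in> carrier R" and g: "g \<in> ext_gens R M k" for r g
    using g
  proof (cases rule: ext_gens_cases)
    case (add xs x y ys)
    have n: "int (length (xs @ z # ys)) = k" for z using add(6) by simp
    have s: "set (xs @ z # ys) \<subseteq> carrier M" if "z \<in> carrier M" for z using add that by simp
    have "e (xs @ (x \<oplus>\<^bsub>M\<^esub> y) # ys) \<in> carrier (F k)" "e (xs @ x # ys) \<in> carrier (F k)" "e (xs @ y # ys) \<in> carrier (F k)"
      using add by (auto intro!: e_closed)
    moreover have "c (xs @ x # ys) r \<oplus>\<^bsub>A\<^esub> c (xs @ y # ys) r \<in> carrier A"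
      using add_map_closed[OF c[OF s n]] r add by simp
    ultimately show ?thesis
      using r add n s assms(3)[OF add(2-6) r]
      by (simp only: F.smult_diff F.smult_r_distr \<psi>_simps F.smult_closed F.a_closed M.a_closed) (simp add: a_minus_def A.r_neg)
  next
    case (smult xs s x ys)
    have n: "int (length (xs @ z # ys)) = k" for z using smult(6) by simp
    have s: "set (xs @ z # ys) \<subseteq> carrier M" if "z \<in> carrier M" for z using smult that by simp
    have "e (xs @ (s \<odot>\<^bsub>M\<^esub> x) # ys) \<in> carrier (F k)" "e (xs @ x # ys) \<in> carrier (F k)"
      using smult by (auto intro!: e_closed)
    moreover have "c (xs @ x # ys) (r \<otimes> s) \<in> carrier A"
      using add_map_closed[OF c[OF s n]] r smult by simp
    ultimately show ?thesis
      using r smult n s assms(4)[OF smult(2-6) r]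
      by (simp only: F.smult_diff F.smult_assoc1[symmetric] \<psi>_simps F.smult_closed F.a_closed smult_closed R.m_closed) (simp add: a_minus_def A.r_neg)
  next
    case (alt xs x ys)
    then show ?thesis using assms(5)[OF alt(2-5) r] \<psi>e[OF r, of "xs @ x # x # ys"] by simp
  qed
  with quot_gen_add_lift[OF F_module[of k] ext_gens_carrier[of k] A \<psi>]
  obtain \<phi> where \<phi>: "add_map (E k) A \<phi>" "\<And>u. u \<in> carrier (F k) \<Longrightarrow> \<phi> (N k +>\<^bsub>F k\<^esub> u) = \<psi> u"
    unfolding ext_power_def ext_relations_gens by metis
  have "\<phi> (r \<odot>\<^bsub>E k\<^esub> w xs) = c xs r" if "r \<in> carrier R" "set xs \<subseteq> carrier M" "int (length xs) = k" for r xs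
    using that \<phi>(2)[of "r \<odot>\<^bsub>F k\<^esub> e xs"] E_quot(4)[of r "e xs" k] e_closed[of xs k] \<psi>e w_class[of xs k] by simp
  with \<phi>(1) show ?thesis by blast
qed

section \<open>The product of the exterior algebra\<close>

definition mul :: "int \<Rightarrow> ('c list \<Rightarrow> 'a) \<Rightarrow> ('c list \<Rightarrow> 'a) \<Rightarrow> 'c list \<Rightarrow> 'a" where
  "mul k u v = (\<lambda>zs. u (take (nat k) zs) \<otimes> v (drop (nat k) zs))"

lemma F_coeff:
  assumes "u \<in> carrier (F k)"
  shows "u zs \<in> carrier R" "u zs \<noteq> \<zero> \<Longrightarrow> set zs \<subseteq> carrier M" "u zs \<noteq> \<zero> \<Longrightarrow> int (length zs) = k"
    "finite {zs. u zs \<noteq> \<zero>}"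
  using assms by (auto simp: ext_free_def free_module_def)

lemma F_simps:
  "(u \<oplus>\<^bsub>F k\<^esub> v) zs = u zs \<oplus> v zs" "(r \<odot>\<^bsub>F k\<^esub> u) zs = r \<otimes> u zs" "\<zero>\<^bsub>F k\<^esub> zs = \<zero>"
  by (simp_all add: ext_free_def free_module_def)

text \<open>\<open>mul\<close> is convolution along concatenation: a list splits in only one way
  after its first \<open>k\<close> entries, so each coefficient is a single product. A list with
  nonzero coefficient is a concatenation of lists from the two supports, which keeps the support
  finite.\<close>

lemma mul_closed:
  assumes u: "u \<in> carrier (F k)" and v: "v \<in> carrier (F l)"
  shows "mul k u v \<in> carrier (F (k + l))"
proof -
  note cu = F_coeff[OF u] and cv = F_coeff[OF v]
  have *: "set zs \<subseteq> carrier M \<and> int (length zs) = k + l \<and>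
      zs \<in> (\<lambda>(a, b). a @ b) ` ({zs. u zs \<noteq> \<zero>} \<times> {zs. v zs \<noteq> \<zero>})" if "mul k u v zs \<noteq> \<zero>" for zs
  proof -
    let ?a = "take (nat k) zs" and ?b = "drop (nat k) zs"
    have ab: "u ?a \<noteq> \<zero>" "v ?b \<noteq> \<zero>" using that cu(1) cv(1) by (auto simp: mul_def)
    have "zs = ?a @ ?b" by simp
    moreover have "set (?a @ ?b) \<subseteq> carrier M" "int (length (?a @ ?b)) = k + l"
      using ab cu(2,3)[of ?a] cv(2,3)[of ?b] by (simp_all only: set_append length_append) auto
    moreover have "?a @ ?b \<in> (\<lambda>(a, b). a @ b) ` ({zs. u zs \<noteq> \<zero>} \<times> {zs. v zs \<noteq> \<zero>})"
      by (rule image_eqI[of _ _ "(?a, ?b)"]) (use ab in auto)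
    ultimately show ?thesis by metis
  qed
  have "finite {zs. mul k u v zs \<noteq> \<zero>}"
    by (rule finite_subset[of _ "(\<lambda>(a, b). a @ b) ` ({zs. u zs \<noteq> \<zero>} \<times> {zs. v zs \<noteq> \<zero>})"])
       (use * cu(4) cv(4) in auto)
  moreover have "mul k u v zs \<in> carrier R" for zs using cu cv by (simp add: mul_def)
  ultimately show ?thesis using * unfolding ext_free_def free_module_def by auto
qed

lemma mul_add_l: "u \<in> carrier (F k) \<Longrightarrow> u' \<in> carrier (F k) \<Longrightarrow> v \<in> carrier (F l) \<Longrightarrow>
    mul k (u \<oplus>\<^bsub>F k\<^esub> u') v = mul k u v \<oplus>\<^bsub>F (k + l)\<^esub> mul k u' v"
  and mul_add_r: "u \<in> carrier (F k) \<Longrightarrow> v \<in> carrier (F l) \<Longrightarrow> v' \<in> carrier (F l) \<Longrightarrow>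
    mul k u (v \<oplus>\<^bsub>F l\<^esub> v') = mul k u v \<oplus>\<^bsub>F (k + l)\<^esub> mul k u v'"
  and mul_smult_l: "u \<in> carrier (F k) \<Longrightarrow> v \<in> carrier (F l) \<Longrightarrow> r \<in> carrier R \<Longrightarrow>
    mul k (r \<odot>\<^bsub>F k\<^esub> u) v = r \<odot>\<^bsub>F (k + l)\<^esub> mul k u v"
  and mul_smult_r: "u \<in> carrier (F k) \<Longrightarrow> v \<in> carrier (F l) \<Longrightarrow> r \<in> carrier R \<Longrightarrow>
    mul k u (r \<odot>\<^bsub>F l\<^esub> v) = r \<odot>\<^bsub>F (k + l)\<^esub> mul k u v"
  by (auto simp: mul_def F_simps fun_eq_iff F_coeff(1) R.l_distr R.r_distr R.m_assoc R.m_lcomm)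

lemma mul_e: "int (length xs) = k \<Longrightarrow> mul k (e xs) (e ys) = e (xs @ ys)"
proof
  fix zs assume k: "int (length xs) = k"
  have "take (nat k) zs = xs \<and> drop (nat k) zs = ys \<longleftrightarrow> zs = xs @ ys"
    using k by (metis append_eq_conv_conj append_take_drop_id nat_int)
  then show "mul k (e xs) (e ys) zs = e (xs @ ys) zs"
    by (auto simp: mul_def basis_vec_def)
qed

lemma mul_add_map_l: "v \<in> carrier (F l) \<Longrightarrow> add_map (F k) (F (k + l)) (\<lambda>u. mul k u v)"
  by (rule add_mapI) (auto simp: mul_closed mul_add_l)

lemma mul_add_map_r: "u \<in> carrier (F k) \<Longrightarrow> add_map (F l) (F (k + l)) (\<lambda>v. mul k u v)"
  by (rule add_mapI) (auto simp: mul_closed mul_add_r)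

text \<open>Relations come with arbitrary contexts \<open>xs\<close> and \<open>ys\<close>.
  Multiplying by a basis element on the right only lengthens the right context, so a generator goes
  to a generator.\<close>

lemma gens_mul_e:
  assumes g: "g \<in> ext_gens R M k" and zs: "set zs \<subseteq> carrier M" "int (length zs) = l"
  shows "mul k g (e zs) \<in> ext_gens R M (k + l)"
proof -
  interpret F: Module.module R "F k" by (rule F_module)
  interpret F': Module.module R "F (k + l)" by (rule F_module)
  have ez: "e zs \<in> carrier (F l)" by (rule e_closed[OF zs])
  note am = add_map_diff[OF F.abelian_group_axioms F'.abelian_group_axioms mul_add_map_l[OF ez]]
    mul_add_l[OF _ _ ez] mul_smult_l[OF _ ez]
  from g show ?thesis
  proof (cases rule: ext_gens_cases)
    case (add xs x y ys)
    have n: "int (length (xs @ z # ys)) = k" for z using add(6) by simp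
    have c: "e (xs @ z # ys) \<in> carrier (F k)" if "z \<in> carrier M" for z using add that by (intro e_closed n) simp_all
    show ?thesis
      unfolding add(1) using add c zs ext_gensI(1)[of xs x y "ys @ zs" "k + l"]
      by (simp add: am mul_e[OF n])
  next
    case (smult xs s x ys)
    have n: "int (length (xs @ z # ys)) = k" for z using smult(6) by simp
    have c: "e (xs @ z # ys) \<in> carrier (F k)" if "z \<in> carrier M" for z using smult that by (intro e_closed n) simp_all
    show ?thesis
      unfolding smult(1) using smult c zs ext_gensI(2)[of xs s x "ys @ zs" "k + l"]
      by (simp add: am mul_e[OF n])
  next
    case (alt xs x ys)
    have n: "int (length (xs @ x # x # ys)) = k" using alt(5) by simp
    show ?thesis
      unfolding alt(1) using alt zs ext_gensI(3)[of xs x "ys @ zs" "k + l"]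
      by (simp add: mul_e[OF n])
  qed
qed

text \<open>The mirror image of \<open>gens_mul_e\<close>: the left context is lengthened.\<close>

lemma e_mul_gens:
  assumes g: "g \<in> ext_gens R M l" and zs: "set zs \<subseteq> carrier M" "int (length zs) = k"
  shows "mul k (e zs) g \<in> ext_gens R M (k + l)"
proof -
  interpret F: Module.module R "F l" by (rule F_module)
  interpret F': Module.module R "F (k + l)" by (rule F_module)
  have ez: "e zs \<in> carrier (F k)" by (rule e_closed[OF zs])
  note am = add_map_diff[OF F.abelian_group_axioms F'.abelian_group_axioms mul_add_map_r[OF ez]]
    mul_add_r[OF ez] mul_smult_r[OF ez]
  from g show ?thesis
  proof (cases rule: ext_gens_cases)
    case (add xs x y ys)
    have c: "e (xs @ z # ys) \<in> carrier (F l)" if "z \<in> carrier M" for z using add that by (intro e_closed) simp_all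
    show ?thesis
      unfolding add(1) using add c zs ext_gensI(1)[of "zs @ xs" x y ys "k + l"]
      by (simp add: am mul_e[OF zs(2)])
  next
    case (smult xs s x ys)
    have c: "e (xs @ z # ys) \<in> carrier (F l)" if "z \<in> carrier M" for z using smult that by (intro e_closed) simp_all
    show ?thesis
      unfolding smult(1) using smult c zs ext_gensI(2)[of "zs @ xs" s x ys "k + l"]
      by (simp add: am mul_e[OF zs(2)])
  next
    case (alt xs x ys)
    show ?thesis
      unfolding alt(1) using alt zs ext_gensI(3)[of "zs @ xs" x ys "k + l"]
      by (simp add: mul_e[OF zs(2)])
  qed
qed

lemma F_induct [consumes 1, case_names zero basis add]:
  assumes "u \<in> carrier (F k)"
    and "Q \<zero>\<^bsub>F k\<^esub>"
    and "\<And>r xs. r \<in> carrier R \<Longrightarrow> set xs \<subseteq> carrier M \<Longrightarrow> int (length xs) = k \<Longrightarrow> Q (r \<odot>\<^bsub>F k\<^esub> e xs)"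
    and "\<And>u v. u \<in> carrier (F k) \<Longrightarrow> v \<in> carrier (F k) \<Longrightarrow> Q u \<Longrightarrow> Q v \<Longrightarrow> Q (u \<oplus>\<^bsub>F k\<^esub> v)"
  shows "Q u"
  by (rule free_module_induct[OF R.is_cring assms(1)[unfolded ext_free_def]])
     (use assms(2-4) in \<open>auto simp: ext_free_def\<close>)

lemma N_closed:
  "\<zero>\<^bsub>F k\<^esub> \<in> N k" "x \<in> N k \<Longrightarrow> y \<in> N k \<Longrightarrow> x \<oplus>\<^bsub>F k\<^esub> y \<in> N k"
  "r \<in> carrier R \<Longrightarrow> x \<in> N k \<Longrightarrow> r \<odot>\<^bsub>F k\<^esub> x \<in> N k"
  using submodule.axioms(1)[OF N_submodule[of k], THEN subgroup.one_closed]
    Module.module.submoduleE(4,5)[OF F_module N_submodule] by auto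

text \<open>One half of the fact that the relations form a two-sided ideal. The elements whose
  products with everything lie in \<open>N\<close> form a submodule; it contains the generators,
  since the second factor can be built from basis vectors, for which \<open>gens_mul_e\<close>
  applies.\<close>

lemma N_mul:
  assumes "u \<in> N k" "v \<in> carrier (F l)"
  shows "mul k u v \<in> N (k + l)"
proof -
  interpret F: Module.module R "F k" by (rule F_module)
  interpret F': Module.module R "F (k + l)" by (rule F_module)
  interpret Fl: Module.module R "F l" by (rule F_module)
  let ?H = "{u \<in> carrier (F k). \<forall>v\<in>carrier (F l). mul k u v \<in> N (k + l)}"
  have z: "mul k \<zero>\<^bsub>F k\<^esub> v = \<zero>\<^bsub>F (k + l)\<^esub>" "mul k \<zero>\<^bsub>F k\<^esub> v \<in> N (k + l)" if "v \<in> carrier (F l)" for v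
    using add_map_zero[OF F.abelian_group_axioms F'.abelian_group_axioms mul_add_map_l[OF that]] N_closed by auto
  \<comment> \<open>\<open>submoduleI\<close> asks for closure under negatives, which this reduces
    to closure under scalars.\<close>
  have "\<ominus>\<^bsub>F k\<^esub> u = (\<ominus> \<one>) \<odot>\<^bsub>F k\<^esub> u" if "u \<in> carrier (F k)" for u
    using that by (simp add: F.smult_l_minus)
  then have "submodule ?H R (F k)"
    by (intro F.submoduleI) (auto simp: z mul_add_l mul_smult_l N_closed)
  moreover have "mul k g v \<in> N (k + l)" if g: "g \<in> ext_gens R M k" and v: "v \<in> carrier (F l)" for g v
    using v
  proof (induction rule: F_induct)
    have gc: "g \<in> carrier (F k)" using g ext_gens_carrier by blast
    case zero
    show ?case
      using add_map_zero[OF Fl.abelian_group_axioms F'.abelian_group_axioms mul_add_map_r[OF gc]] N_closed by simp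
  next
    have gc: "g \<in> carrier (F k)" using g ext_gens_carrier by blast
    case (basis r xs)
    then show ?case
      using gens_mul_e[OF g basis(2,3)] gens_N e_closed by (auto simp: mul_smult_r[OF gc, of _ l] intro!: N_closed)
  next
    have gc: "g \<in> carrier (F k)" using g ext_gens_carrier by blast
    case (add u v)
    then show ?case by (simp add: mul_add_r[OF gc] N_closed)
  qed
  ultimately have "N k \<subseteq> ?H"
    unfolding ext_relations_gens[of _ _ k] using ext_gens_carrier by (intro gen_submodule_least) auto
  with assms show ?thesis by blast
qed

lemma mul_N:
  assumes "u \<in> carrier (F k)" "v \<in> N l"
  shows "mul k u v \<in> N (k + l)"
proof -
  interpret F: Module.module R "F k" by (rule F_module)
  interpret F': Module.module R "F (k + l)" by (rule F_module)
  interpret Fl: Module.module R "F l" by (rule F_module)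
  let ?H = "{v \<in> carrier (F l). \<forall>u\<in>carrier (F k). mul k u v \<in> N (k + l)}"
  have z: "mul k u \<zero>\<^bsub>F l\<^esub> = \<zero>\<^bsub>F (k + l)\<^esub>" if "u \<in> carrier (F k)" for u
    using add_map_zero[OF Fl.abelian_group_axioms F'.abelian_group_axioms mul_add_map_r[OF that]] by auto
  have "\<ominus>\<^bsub>F l\<^esub> u = (\<ominus> \<one>) \<odot>\<^bsub>F l\<^esub> u" if "u \<in> carrier (F l)" for u
    using that by (simp add: Fl.smult_l_minus)
  then have "submodule ?H R (F l)"
    by (intro Fl.submoduleI) (auto simp: z mul_add_r mul_smult_r N_closed)
  moreover have "mul k u g \<in> N (k + l)" if g: "g \<in> ext_gens R M l" and u: "u \<in> carrier (F k)" for g u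
    using u
  proof (induction rule: F_induct)
    have gc: "g \<in> carrier (F l)" using g ext_gens_carrier by blast
    case zero
    show ?case
      using add_map_zero[OF F.abelian_group_axioms F'.abelian_group_axioms mul_add_map_l[OF gc]] N_closed by simp
  next
    have gc: "g \<in> carrier (F l)" using g ext_gens_carrier by blast
    case (basis r xs)
    then show ?case
      using e_mul_gens[OF g basis(2,3)] gens_N e_closed by (auto simp: mul_smult_l[OF _ gc] intro!: N_closed)
  next
    have gc: "g \<in> carrier (F l)" using g ext_gens_carrier by blast
    case (add u v)
    then show ?case by (simp add: mul_add_l[OF _ _ gc] N_closed)
  qed
  ultimately have "N l \<subseteq> ?H"
    unfolding ext_relations_gens[of _ _ l] using ext_gens_carrier by (intro gen_submodule_least) auto
  with assms show ?thesis by blast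
qed

text \<open>Changing \<open>u\<close> by an element of \<open>N k\<close> or \<open>v\<close> by one
  of \<open>N l\<close> changes the product by an element of \<open>N (k + l)\<close>. So all
  members of the double union in \<open>ext_mult\<close> are one and the same coset.\<close>

lemma P_class:
  assumes u: "u \<in> carrier (F k)" and v: "v \<in> carrier (F l)"
  shows "P k l (N k +>\<^bsub>F k\<^esub> u) (N l +>\<^bsub>F l\<^esub> v) = N (k + l) +>\<^bsub>F (k + l)\<^esub> mul k u v"
proof -
  interpret F: Module.module R "F k" by (rule F_module)
  interpret F': Module.module R "F (k + l)" by (rule F_module)
  interpret Fl: Module.module R "F l" by (rule F_module)
  interpret E: Module.module R "E (k + l)" by (rule E_module)
  let ?\<pi> = "\<lambda>u. N (k + l) +>\<^bsub>F (k + l)\<^esub> u"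
  have eq: "?\<pi> (mul k u' v') = ?\<pi> (mul k u v)" if u': "u' \<in> N k +>\<^bsub>F k\<^esub> u" and v': "v' \<in> N l +>\<^bsub>F l\<^esub> v" for u' v'
  proof -
    obtain m n where m: "m \<in> N k" "u' = m \<oplus>\<^bsub>F k\<^esub> u" and n: "n \<in> N l" "v' = n \<oplus>\<^bsub>F l\<^esub> v"
      using u' v' unfolding a_r_coset_iff by blast
    have c: "m \<in> carrier (F k)" "n \<in> carrier (F l)" "v' \<in> carrier (F l)"
      using m n N_carrier v by auto
    have 0: "?\<pi> x = \<zero>\<^bsub>E (k + l)\<^esub>" if "x \<in> N (k + l)" for x
      using E_quot(5)[OF N_carrier[OF that]] that by simp
    have "?\<pi> (mul k u' v') = ?\<pi> (mul k m v') \<oplus>\<^bsub>E (k + l)\<^esub> ?\<pi> (mul k u v')"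
      unfolding m(2) using c u by (simp add: mul_add_l mul_closed E_quot(3))
    also have "\<dots> = ?\<pi> (mul k u v')"
      using 0[OF N_mul[OF m(1) c(3)]] E_quot(2)[OF mul_closed[OF u c(3)]] by simp
    also have "\<dots> = ?\<pi> (mul k u n) \<oplus>\<^bsub>E (k + l)\<^esub> ?\<pi> (mul k u v)"
      unfolding n(2) using c u v by (simp add: mul_add_r mul_closed E_quot(3))
    also have "\<dots> = ?\<pi> (mul k u v)"
      using 0[OF mul_N[OF u n(1)]] E_quot(2)[OF mul_closed[OF u v]] by simp
    finally show ?thesis .
  qed
  \<comment> \<open>The two cosets must be nonempty for a union of equal sets over them to be that
    set.\<close>
  have self: "x \<in> N m +>\<^bsub>F m\<^esub> x" if "x \<in> carrier (F m)" for x m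
    unfolding a_r_coset_iff using N_closed(1)[of m] that abelian_monoid.l_zero
    by (metis Module.module.axioms(2) F_module abelian_group.axioms(1))
  have "P k l (N k +>\<^bsub>F k\<^esub> u) (N l +>\<^bsub>F l\<^esub> v) =
      (\<Union>u'\<in>N k +>\<^bsub>F k\<^esub> u. \<Union>v'\<in>N l +>\<^bsub>F l\<^esub> v. ?\<pi> (mul k u' v'))"
    by (simp add: ext_mult_def mul_def)
  also have "\<dots> = (\<Union>u'\<in>N k +>\<^bsub>F k\<^esub> u. \<Union>v'\<in>N l +>\<^bsub>F l\<^esub> v. ?\<pi> (mul k u v))"
    using eq by simp
  also have "\<dots> = ?\<pi> (mul k u v)" using self[OF u] self[OF v] by blast
  finally show ?thesis .
qed

lemma P_wedge:
  assumes "set xs \<subseteq> carrier M" "int (length xs) = k" "set ys \<subseteq> carrier M" "int (length ys) = l"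
  shows "P k l (w xs) (w ys) = w (xs @ ys)"
  using P_class[OF e_closed[OF assms(1,2)] e_closed[OF assms(3,4)]] assms
  by (simp add: w_class[of _ k] w_class[of _ l] w_class[of _ "k + l"] mul_e)

text \<open>The degree of the product is a separate variable \<open>n\<close> with
  \<open>k + l = n\<close>, here and in the rules that follow: degrees such as
  \<open>1 + (l + 1)\<close> and \<open>l + 2\<close> are equal only by arithmetic, and the rules
  have to match either form.\<close>

lemma P_closed: "x \<in> carrier (E k) \<Longrightarrow> y \<in> carrier (E l) \<Longrightarrow> k + l = n \<Longrightarrow> P k l x y \<in> carrier (E n)"
  using E_quot(6)[of x k] E_quot(6)[of y l] by (auto simp: P_class mul_closed intro!: E_quot(2))

lemma P_add_l: "x \<in> carrier (E k) \<Longrightarrow> x' \<in> carrier (E k) \<Longrightarrow> y \<in> carrier (E l) \<Longrightarrow> k + l = n \<Longrightarrow>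
    P k l (x \<oplus>\<^bsub>E k\<^esub> x') y = P k l x y \<oplus>\<^bsub>E n\<^esub> P k l x' y"
  using E_quot(6)[of x k] E_quot(6)[of x' k] E_quot(6)[of y l] Module.module.axioms(2)[OF F_module[of k]]
  by (auto simp: P_class mul_closed E_quot(3) mul_add_l abelian_group.axioms(1) abelian_monoid.a_closed)

lemma P_add_r: "x \<in> carrier (E k) \<Longrightarrow> y \<in> carrier (E l) \<Longrightarrow> y' \<in> carrier (E l) \<Longrightarrow> k + l = n \<Longrightarrow>
    P k l x (y \<oplus>\<^bsub>E l\<^esub> y') = P k l x y \<oplus>\<^bsub>E n\<^esub> P k l x y'"
  using E_quot(6)[of x k] E_quot(6)[of y l] E_quot(6)[of y' l] Module.module.axioms(2)[OF F_module[of l]]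
  by (auto simp: P_class mul_closed E_quot(3) mul_add_r abelian_group.axioms(1) abelian_monoid.a_closed)

lemma P_smult_l: "x \<in> carrier (E k) \<Longrightarrow> y \<in> carrier (E l) \<Longrightarrow> r \<in> carrier R \<Longrightarrow> k + l = n \<Longrightarrow>
    P k l (r \<odot>\<^bsub>E k\<^esub> x) y = r \<odot>\<^bsub>E n\<^esub> P k l x y"
  using E_quot(6)[of x k] E_quot(6)[of y l] Module.module.smult_closed[OF F_module[of k]]
  by (auto simp: P_class mul_closed E_quot(4) mul_smult_l)

lemma P_smult_r: "x \<in> carrier (E k) \<Longrightarrow> y \<in> carrier (E l) \<Longrightarrow> r \<in> carrier R \<Longrightarrow> k + l = n \<Longrightarrow>
    P k l x (r \<odot>\<^bsub>E l\<^esub> y) = r \<odot>\<^bsub>E n\<^esub> P k l x y"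
  using E_quot(6)[of x k] E_quot(6)[of y l] Module.module.smult_closed[OF F_module[of l]]
  by (auto simp: P_class mul_closed E_quot(4) mul_smult_r)

lemma P_add_map_l: "y \<in> carrier (E l) \<Longrightarrow> k + l = n \<Longrightarrow> add_map (E k) (E n) (\<lambda>x. P k l x y)"
  by (rule add_mapI) (auto simp: P_closed P_add_l)

lemma P_add_map_r: "x \<in> carrier (E k) \<Longrightarrow> k + l = n \<Longrightarrow> add_map (E l) (E n) (P k l x)"
  by (rule add_mapI) (auto simp: P_closed P_add_r)

lemma E_abelian_group: "abelian_group (E k)"
  using E_module Module.module.axioms(2) by blast

lemmas P_zero_l = add_map_zero[OF E_abelian_group E_abelian_group P_add_map_l]
lemmas P_zero_r = add_map_zero[OF E_abelian_group E_abelian_group P_add_map_r]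
lemmas P_minus_l = add_map_minus[OF E_abelian_group E_abelian_group P_add_map_l]
lemmas P_minus_r = add_map_minus[OF E_abelian_group E_abelian_group P_add_map_r]

lemma mul_assoc:
  assumes "u \<in> carrier (F k)" "v \<in> carrier (F l)" "t \<in> carrier (F m)"
  shows "mul (k + l) (mul k u v) t = mul k u (mul l v t)"
proof
  fix zs
  show "mul (k + l) (mul k u v) t zs = mul k u (mul l v t) zs"
  proof (cases "k \<ge> 0 \<and> l \<ge> 0")
    case True
    then have "nat (k + l) = nat l + nat k" by (simp add: nat_add_distrib)
    then show ?thesis using assms[THEN F_coeff(1)]
      by (simp add: mul_def R.m_assoc take_drop)
  next
    case False
    \<comment> \<open>In a negative degree there are no lists, so one of the factors is zero and the
      truncation performed by \<open>nat\<close> does no harm.\<close>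
    then have "u xs = \<zero> \<or> v ys = \<zero>" for xs ys
      using F_coeff(3)[OF assms(1), of xs] F_coeff(3)[OF assms(2), of ys] False by (metis of_nat_0_le_iff)
    then have "mul k u v xs = \<zero>" "v ys \<otimes> t xs = \<zero> \<or> u zs = \<zero>" for xs ys zs
      using assms[THEN F_coeff(1)] unfolding mul_def by (metis R.l_null R.r_null)+
    then show ?thesis using assms[THEN F_coeff(1)]
      by (simp add: mul_def) (metis R.l_null R.r_null R.m_closed)
  qed
qed

lemma P_assoc: "x \<in> carrier (E k) \<Longrightarrow> y \<in> carrier (E l) \<Longrightarrow> z \<in> carrier (E m) \<Longrightarrow> k + l = n \<Longrightarrow> l + m = n' \<Longrightarrow>
    P n m (P k l x y) z = P k n' x (P l m y z)"
  using E_quot(6)[of x k] E_quot(6)[of y l] E_quot(6)[of z m]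
  by (auto simp: P_class mul_closed mul_assoc add.assoc)

section \<open>Signs and graded commutativity\<close>

lemma signed_signed: "x \<in> carrier (E k) \<Longrightarrow> signed (E k) a (signed (E k) b x) = signed (E k) (a + b) x"
  using E_abelian_group[of k] by (auto simp: signed_def abelian_group.minus_minus)

lemma signed_closed: "x \<in> carrier (E k) \<Longrightarrow> signed (E k) a x \<in> carrier (E k)"
  using E_abelian_group[of k] by (simp add: signed_def abelian_group.a_inv_closed)

lemma signed_add: "x \<in> carrier (E k) \<Longrightarrow> y \<in> carrier (E k) \<Longrightarrow>
    signed (E k) a (x \<oplus>\<^bsub>E k\<^esub> y) = signed (E k) a x \<oplus>\<^bsub>E k\<^esub> signed (E k) a y"
  using E_abelian_group[of k] by (simp add: signed_def abelian_group.minus_add)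

lemma signed_smult: "x \<in> carrier (E k) \<Longrightarrow> r \<in> carrier R \<Longrightarrow>
    signed (E k) a (r \<odot>\<^bsub>E k\<^esub> x) = r \<odot>\<^bsub>E k\<^esub> signed (E k) a x"
  using E_module[of k] by (simp add: signed_def Module.module.smult_r_minus)

lemma signed_zero: "signed (E k) a \<zero>\<^bsub>E k\<^esub> = \<zero>\<^bsub>E k\<^esub>"
proof -
  interpret E: Module.module R "E k" by (rule E_module)
  show ?thesis by (simp add: signed_def)
qed

text \<open>One transposition, hence one sign, for each element of \<open>ys\<close> that
  \<open>x\<close> passes. The passed element joins the prefix, so \<open>us\<close> has to stay
  arbitrary in the induction.\<close>

lemma w_move:
  assumes "set us \<subseteq> carrier M" "x \<in> carrier M" "set ys \<subseteq> carrier M" "set vs \<subseteq> carrier M"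
    "int (length us + 1 + length ys + length vs) = k"
  shows "w (us @ x # ys @ vs) = signed (E k) (int (length ys)) (w (us @ ys @ x # vs))"
  using assms
proof (induction ys arbitrary: us)
  case Nil
  then show ?case by (simp add: signed_def)
next
  case (Cons y ys)
  have c: "w (us @ y # x # ys @ vs) \<in> carrier (E k)" "w (us @ (y # ys) @ x # vs) \<in> carrier (E k)"
    by (rule w_closed; use Cons.prems in simp)+
  have "w (us @ x # (y # ys) @ vs) = \<ominus>\<^bsub>E k\<^esub> w (us @ y # x # ys @ vs)"
    using w_anti[of us x y "ys @ vs" k] Cons.prems by simp
  also have "\<dots> = signed (E k) 1 (w ((us @ [y]) @ x # ys @ vs))" by (simp add: signed_def)
  also have "w ((us @ [y]) @ x # ys @ vs) = signed (E k) (int (length ys)) (w ((us @ [y]) @ ys @ x # vs))"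
    by (rule Cons.IH) (use Cons.prems in simp_all)
  finally show ?case using c signed_signed[of _ k 1 "int (length ys)"] by simp
qed

text \<open>Induction on \<open>xs\<close>: while the tail is carried past \<open>ys\<close> the
  head waits at the end of the prefix, then \<open>w_move\<close> carries it across. Each element of
  \<open>xs\<close> contributes \<open>length ys\<close> signs.\<close>

lemma w_swap:
  assumes "set us \<subseteq> carrier M" "set xs \<subseteq> carrier M" "set ys \<subseteq> carrier M" "int (length us + length xs + length ys) = k"
  shows "w (us @ xs @ ys) = signed (E k) (int (length xs) * int (length ys)) (w (us @ ys @ xs))"
  using assms
proof (induction xs arbitrary: us)
  case Nil
  then show ?case by (simp add: signed_def)
next
  case (Cons x xs)
  have c: "w (us @ ys @ x # xs) \<in> carrier (E k)" by (rule w_closed; use Cons.prems in simp)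
  have "w ((us @ [x]) @ xs @ ys) = signed (E k) (int (length xs) * int (length ys)) (w ((us @ [x]) @ ys @ xs))"
    by (rule Cons.IH) (use Cons.prems in simp_all)
  moreover have "w (us @ x # ys @ xs) = signed (E k) (int (length ys)) (w (us @ ys @ x # xs))"
    by (rule w_move) (use Cons.prems in simp_all)
  ultimately show ?case using c by (simp add: signed_signed algebra_simps)
qed

text \<open>Both sides are additive in each argument and scalars can be pulled out of either factor,
  so two nested inductions reduce the sign rule to \<open>w_swap\<close>.\<close>

lemma P_commute:
  assumes x: "x \<in> carrier (E k)" and y: "y \<in> carrier (E l)" and n: "k + l = n"
  shows "P k l x y = signed (E n) (k * l) (P l k y x)"
  using x
proof (induction rule: ext_induct)
  case zero
  show ?case using n by (simp add: P_zero_l[OF y n] P_zero_r[OF y] signed_zero add.commute)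
next
  case (add x x')
  then show ?case using n y by (simp add: P_add_l P_add_r[of _ l _ k _ n] signed_add P_closed add.commute)
next
  case (wedge r xs)
  have x: "w xs \<in> carrier (E k)" by (rule w_closed[OF wedge(2,3)])
  from y have "P k l (w xs) y = signed (E n) (k * l) (P l k y (w xs))"
  proof (induction rule: ext_induct)
    case zero
    show ?case using n by (simp add: P_zero_r[OF x n] P_zero_l[OF x] signed_zero add.commute)
  next
    case (add y y')
    then show ?case using n x by (simp add: P_add_r P_add_l[of _ l _ _ k n] signed_add P_closed add.commute)
  next
    case (wedge s ys)
    have y: "w ys \<in> carrier (E l)" by (rule w_closed[OF wedge(2,3)])
    have "w (xs @ ys) = signed (E n) (k * l) (w (ys @ xs))"
      using w_swap[of "[]" xs ys n] \<open>set xs \<subseteq> carrier M\<close> \<open>int (length xs) = k\<close> wedge n by auto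
    moreover have "w (ys @ xs) \<in> carrier (E n)"
      by (rule w_closed) (use \<open>set xs \<subseteq> carrier M\<close> \<open>int (length xs) = k\<close> wedge n in auto)
    ultimately show ?case
      using wedge \<open>set xs \<subseteq> carrier M\<close> \<open>int (length xs) = k\<close> n x y
      by (simp add: P_smult_r P_smult_l[of _ l _ k _ n] P_wedge add.commute signed_smult)
  qed
  moreover have "P l k y (w xs) \<in> carrier (E n)" using P_closed[OF y x] n by (simp add: add.commute)
  ultimately show ?case using wedge x y n
    by (simp add: P_smult_l P_smult_r[of _ l _ k _ n] add.commute signed_smult)
qed

lemma P_anti: "x \<in> carrier (E 1) \<Longrightarrow> y \<in> carrier (E 1) \<Longrightarrow> P 1 1 x y = \<ominus>\<^bsub>E 2\<^esub> P 1 1 y x"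
  using P_commute[of x 1 y 1 2] by (simp add: signed_def)

end

section \<open>Derivations of the exterior algebra\<close>

context abelian_group
begin

lemma add_diff_add:
  assumes "a \<in> carrier G" "b \<in> carrier G" "c \<in> carrier G" "d \<in> carrier G"
  shows "(a \<oplus> b) \<ominus> (c \<oplus> d) = (a \<ominus> c) \<oplus> (b \<ominus> d)"
  using assms by (simp add: a_minus_def minus_add a_ac)

lemma add_diff_assoc:
  assumes "a \<in> carrier G" "b \<in> carrier G" "c \<in> carrier G"
  shows "(a \<oplus> b) \<ominus> c = a \<oplus> (b \<ominus> c)"
  using assms by (simp add: a_minus_def a_ac)

lemma diff_self: "a \<in> carrier G \<Longrightarrow> a \<ominus> a = \<zero>"
  by (simp add: a_minus_def r_neg)

lemma diff_zero: "a \<in> carrier G \<Longrightarrow> a \<ominus> \<zero> = a"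
  by (simp add: a_minus_def)

lemma diff_diff: "a \<in> carrier G \<Longrightarrow> b \<in> carrier G \<Longrightarrow> c \<in> carrier G \<Longrightarrow> a \<ominus> (\<ominus> b \<oplus> c) = b \<oplus> (a \<ominus> c)"
  by (simp add: a_minus_def minus_add a_ac)

end

text \<open>The data of a graded derivation in the two lowest degrees, with the product rule as far
  as it makes sense there. Both maps take values in exterior powers, so that \<open>d0 r\<close> and
  \<open>d1 x\<close> can be multiplied at once. Vanishing of the square is a separate question,
  answered by \<open>DD\<close>.\<close>

locale ext_derivation = ext_alg +
  fixes d0 :: "'a \<Rightarrow> ('c list \<Rightarrow> 'a) set" and d1 :: "'c \<Rightarrow> ('c list \<Rightarrow> 'a) set"
  assumes d0_add_map: "add_map R (E 1) d0"
    and d0_mult: "\<And>r s. r \<in> carrier R \<Longrightarrow> s \<in> carrier R \<Longrightarrow>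
      d0 (r \<otimes> s) = r \<odot>\<^bsub>E 1\<^esub> d0 s \<oplus>\<^bsub>E 1\<^esub> s \<odot>\<^bsub>E 1\<^esub> d0 r"
    and d1_add_map: "add_map M (E 2) d1"
    and d1_smult: "\<And>r x. r \<in> carrier R \<Longrightarrow> x \<in> carrier M \<Longrightarrow>
      d1 (r \<odot>\<^bsub>M\<^esub> x) = P 1 1 (d0 r) (w [x]) \<oplus>\<^bsub>E 2\<^esub> r \<odot>\<^bsub>E 2\<^esub> d1 x"
begin

lemmas d0_closed = add_map_closed[OF d0_add_map]
lemmas d0_add = add_map_add[OF d0_add_map]
lemmas d1_closed = add_map_closed[OF d1_add_map]
lemmas d1_add = add_map_add[OF d1_add_map]

lemma w1_closed: "x \<in> carrier M \<Longrightarrow> w [x] \<in> carrier (E 1)"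
  by (rule w_closed) simp_all

lemma w0_closed: "w [] \<in> carrier (E 0)"
  by (rule w_closed) simp_all

lemma P_unit_l: "x \<in> carrier (E k) \<Longrightarrow> P 0 k (w []) x = x"
proof (induction rule: ext_induct)
  case zero
  show ?case by (rule P_zero_r[OF w0_closed]) simp
next
  case (wedge r xs)
  then show ?case using P_wedge[of "[]" 0 xs k] w_closed[of xs k]
    by (simp add: P_smult_r[OF w0_closed, of _ k _ k])
next
  case (add x y)
  then show ?case by (simp add: P_add_r[OF w0_closed, of _ k _ k])
qed

lemma P_unit_r: "x \<in> carrier (E k) \<Longrightarrow> P k 0 x (w []) = x"
  using P_commute[of x k "w []" 0 k] w0_closed P_unit_l[of x k] by (simp add: signed_def)

text \<open>
  The value on \<open>x\<^sub>1 \<and> \<dots> \<and> x\<^sub>k\<close> forced by the Leibniz rule,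
  \<open>\<Sum>\<^sub>i (-1)\<^sup>i\<^sup>-\<^sup>1 x\<^sub>1 \<and> \<dots> \<and> d1 x\<^sub>i \<and> \<dots> \<and> x\<^sub>k\<close>.
\<close>

fun delta :: "'c list \<Rightarrow> ('c list \<Rightarrow> 'a) set" where
  "delta [] = \<zero>\<^bsub>E 1\<^esub>"
| "delta (x # xs) = P 2 (int (length xs)) (d1 x) (w xs) \<ominus>\<^bsub>E (int (length xs) + 2)\<^esub>
     P 1 (int (length xs) + 1) (w [x]) (delta xs)"

lemma delta_Cons:
  "int (length xs) = k \<Longrightarrow>
    delta (x # xs) = P 2 k (d1 x) (w xs) \<ominus>\<^bsub>E (k + 2)\<^esub> P 1 (k + 1) (w [x]) (delta xs)"
  by auto

declare delta.simps(2) [simp del]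

lemma delta_closed: "set xs \<subseteq> carrier M \<Longrightarrow> int (length xs) + 1 = n \<Longrightarrow> delta xs \<in> carrier (E n)"
proof (induction xs arbitrary: n)
  case Nil
  interpret E1: Module.module R "E 1" by (rule E_module)
  from Nil have "n = 1" by simp
  then show ?case by simp
next
  case (Cons x xs)
  interpret E: Module.module R "E n" by (rule E_module)
  define k where "k = int (length xs)"
  have n: "n = k + 2" using Cons.prems by (simp add: k_def)
  have "delta xs \<in> carrier (E (k + 1))" by (rule Cons.IH) (use Cons.prems k_def in auto)
  moreover have "w xs \<in> carrier (E k)" by (rule w_closed) (use Cons.prems k_def in auto)
  moreover have "d1 x \<in> carrier (E 2)" "w [x] \<in> carrier (E 1)" using Cons.prems by (auto intro: d1_closed w1_closed)
  ultimately show ?case unfolding delta_Cons[OF k_def[symmetric]] n[symmetric]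
    by (intro E.minus_closed P_closed) (auto simp: n)
qed

lemma delta_add:
  assumes "set xs \<subseteq> carrier M" "x \<in> carrier M" "y \<in> carrier M" "set ys \<subseteq> carrier M" "int (length xs + 1 + length ys) = k"
  shows "delta (xs @ (x \<oplus>\<^bsub>M\<^esub> y) # ys) = delta (xs @ x # ys) \<oplus>\<^bsub>E (k + 1)\<^esub> delta (xs @ y # ys)"
  using assms
proof (induction xs arbitrary: k)
  case Nil
  define l where "l = int (length ys)"
  have k: "k + 1 = l + 2" using Nil by (simp add: l_def)
  interpret E: Module.module R "E (l + 2)" by (rule E_module)
  have c: "delta ys \<in> carrier (E (l + 1))" "w ys \<in> carrier (E l)" "d1 x \<in> carrier (E 2)" "d1 y \<in> carrier (E 2)"
    "w [x] \<in> carrier (E 1)" "w [y] \<in> carrier (E 1)"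
    using Nil by (auto intro!: delta_closed w_closed d1_closed simp: l_def)
  have w: "w [x \<oplus>\<^bsub>M\<^esub> y] = w [x] \<oplus>\<^bsub>E 1\<^esub> w [y]" using w_add[of "[]" x y "[]" 1] Nil by simp
  show ?case
    using Nil c by (simp add: delta_Cons[OF l_def[symmetric]] k w d1_add P_add_l[of _ 2 _ _ l "l + 2"]
        P_add_l[of _ 1 _ _ "l + 1" "l + 2"] E.add_diff_add P_closed)
next
  case (Cons z xs)
  define l where "l = int (length xs + 1 + length ys)"
  have k: "k + 1 = l + 2" using Cons by (simp add: l_def)
  interpret E: Module.module R "E (l + 2)" by (rule E_module)
  have n: "int (length (xs @ u # ys)) = l" for u by (simp add: l_def)
  have IH: "delta (xs @ (x \<oplus>\<^bsub>M\<^esub> y) # ys) = delta (xs @ x # ys) \<oplus>\<^bsub>E (l + 1)\<^esub> delta (xs @ y # ys)"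
    by (rule Cons.IH) (use Cons.prems l_def in auto)
  have c: "delta (xs @ x # ys) \<in> carrier (E (l + 1))" "delta (xs @ y # ys) \<in> carrier (E (l + 1))"
    "w (xs @ x # ys) \<in> carrier (E l)" "w (xs @ y # ys) \<in> carrier (E l)" "d1 z \<in> carrier (E 2)" "w [z] \<in> carrier (E 1)"
    using Cons.prems by (auto intro!: delta_closed w_closed d1_closed simp: l_def)
  have w: "w (xs @ (x \<oplus>\<^bsub>M\<^esub> y) # ys) = w (xs @ x # ys) \<oplus>\<^bsub>E l\<^esub> w (xs @ y # ys)"
    by (rule w_add) (use Cons.prems l_def in auto)
  show ?case
    using c by (simp add: delta_Cons[OF n] k w IH P_add_r[of _ 2 _ l _ "l + 2"]
        P_add_r[of _ 1 _ "l + 1" _ "l + 2"] E.add_diff_add P_closed)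
qed

text \<open>\<open>delta\<close> is not linear in a slot: the defect is \<open>d0 s\<close> in front
  of the whole product, whichever slot carries the scalar. In the induction \<open>d0 s\<close> has
  to cross \<open>w [z]\<close>, which costs a sign, and the minus sign in the recursion of
  \<open>delta\<close> cancels it.\<close>

lemma delta_smult:
  assumes "set xs \<subseteq> carrier M" "s \<in> carrier R" "x \<in> carrier M" "set ys \<subseteq> carrier M" "int (length xs + 1 + length ys) = k"
  shows "delta (xs @ (s \<odot>\<^bsub>M\<^esub> x) # ys) =
    P 1 k (d0 s) (w (xs @ x # ys)) \<oplus>\<^bsub>E (k + 1)\<^esub> s \<odot>\<^bsub>E (k + 1)\<^esub> delta (xs @ x # ys)"
  using assms
proof (induction xs arbitrary: k)
  case Nil
  define l where "l = int (length ys)"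
  have k: "k + 1 = l + 2" "k = l + 1" using Nil by (simp_all add: l_def)
  interpret E: Module.module R "E (l + 2)" by (rule E_module)
  have c: "delta ys \<in> carrier (E (l + 1))" "w ys \<in> carrier (E l)" "d1 x \<in> carrier (E 2)" "d0 s \<in> carrier (E 1)"
    "w [x] \<in> carrier (E 1)"
    using Nil by (auto intro!: delta_closed w_closed d1_closed d0_closed simp: l_def)
  have c2: "P 1 1 (d0 s) (w [x]) \<in> carrier (E 2)" "s \<odot>\<^bsub>E 2\<^esub> d1 x \<in> carrier (E 2)"
    using c Nil Module.module.smult_closed[OF E_module] by (auto intro: P_closed)
  have w: "w [s \<odot>\<^bsub>M\<^esub> x] = s \<odot>\<^bsub>E 1\<^esub> w [x]" using w_smult[of "[]" s x "[]" 1] Nil by simp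
  have w2: "P 1 l (w [x]) (w ys) = w (x # ys)" using P_wedge[of "[x]" 1 ys l] Nil by (simp add: l_def)
  have "delta ((s \<odot>\<^bsub>M\<^esub> x) # ys) = P 2 l (P 1 1 (d0 s) (w [x]) \<oplus>\<^bsub>E 2\<^esub> s \<odot>\<^bsub>E 2\<^esub> d1 x) (w ys)
      \<ominus>\<^bsub>E (l + 2)\<^esub> P 1 (l + 1) (s \<odot>\<^bsub>E 1\<^esub> w [x]) (delta ys)"
    using Nil by (simp add: delta_Cons[OF l_def[symmetric]] w d1_smult)
  also have "P 2 l (P 1 1 (d0 s) (w [x]) \<oplus>\<^bsub>E 2\<^esub> s \<odot>\<^bsub>E 2\<^esub> d1 x) (w ys) =
      P 1 (l + 1) (d0 s) (w (x # ys)) \<oplus>\<^bsub>E (l + 2)\<^esub> s \<odot>\<^bsub>E (l + 2)\<^esub> P 2 l (d1 x) (w ys)"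
    using c c2 Nil(2) by (simp add: P_add_l[of _ 2 _ _ l "l + 2"] P_smult_l[of _ 2 _ l _ "l + 2"]
        P_assoc[of _ 1 _ 1 _ l 2 "l + 1"] w2)
  also have "P 1 (l + 1) (s \<odot>\<^bsub>E 1\<^esub> w [x]) (delta ys) = s \<odot>\<^bsub>E (l + 2)\<^esub> P 1 (l + 1) (w [x]) (delta ys)"
    using c Nil(2) by (simp add: P_smult_l[of _ 1 _ "l + 1" _ "l + 2"])
  finally show ?case
    unfolding k(1) unfolding k(2)
    using c Nil w2 P_closed[of "w [x]" 1 "w ys" l "l + 1"]
    by (simp add: delta_Cons[OF l_def[symmetric]] E.add_diff_assoc E.smult_diff P_closed)
next
  case (Cons z xs)
  define l where "l = int (length xs + 1 + length ys)"
  have k: "k + 1 = l + 2" "k = l + 1" using Cons by (simp_all add: l_def)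
  interpret E: Module.module R "E (l + 2)" by (rule E_module)
  have n: "int (length (xs @ u # ys)) = l" for u by (simp add: l_def)
  let ?w = "w (xs @ x # ys)" and ?d = "delta (xs @ x # ys)"
  have IH: "delta (xs @ (s \<odot>\<^bsub>M\<^esub> x) # ys) = P 1 l (d0 s) ?w \<oplus>\<^bsub>E (l + 1)\<^esub> s \<odot>\<^bsub>E (l + 1)\<^esub> ?d"
    by (rule Cons.IH) (use Cons.prems l_def in auto)
  have c: "?d \<in> carrier (E (l + 1))" "?w \<in> carrier (E l)" "d1 z \<in> carrier (E 2)" "w [z] \<in> carrier (E 1)" "d0 s \<in> carrier (E 1)"
    using Cons.prems by (auto intro!: delta_closed w_closed d1_closed d0_closed simp: l_def)
  have c2: "P 1 l (d0 s) ?w \<in> carrier (E (l + 1))" "s \<odot>\<^bsub>E (l + 1)\<^esub> ?d \<in> carrier (E (l + 1))"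
    "P 1 1 (w [z]) (d0 s) \<in> carrier (E 2)" "P 1 1 (d0 s) (w [z]) \<in> carrier (E 2)"
    "w (z # xs @ x # ys) \<in> carrier (E (l + 1))"
    using c Cons.prems Module.module.smult_closed[OF E_module] by (auto intro!: P_closed w_closed simp: l_def)
  have w: "w (xs @ (s \<odot>\<^bsub>M\<^esub> x) # ys) = s \<odot>\<^bsub>E l\<^esub> ?w"
    by (rule w_smult) (use Cons.prems l_def in auto)
  have w2: "P 1 l (w [z]) ?w = w (z # xs @ x # ys)" using P_wedge[of "[z]" 1 "xs @ x # ys" l] Cons.prems by (simp add: l_def)
  have "P 1 (l + 1) (w [z]) (P 1 l (d0 s) ?w) = P 2 l (P 1 1 (w [z]) (d0 s)) ?w"
    using c by (simp add: P_assoc[of _ 1 _ 1 _ l 2 "l + 1"])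
  also have "\<dots> = \<ominus>\<^bsub>E (l + 2)\<^esub> P 2 l (P 1 1 (d0 s) (w [z])) ?w"
    unfolding P_anti[OF c(4,5)] by (rule P_minus_l) (use c c2 in auto)
  also have "\<dots> = \<ominus>\<^bsub>E (l + 2)\<^esub> P 1 (l + 1) (d0 s) (w (z # xs @ x # ys))"
    using c by (simp add: P_assoc[of _ 1 _ 1 _ l 2 "l + 1"] w2)
  finally have sw: "P 1 (l + 1) (w [z]) (P 1 l (d0 s) ?w) = \<dots>" .
  have "delta (z # xs @ (s \<odot>\<^bsub>M\<^esub> x) # ys) = s \<odot>\<^bsub>E (l + 2)\<^esub> P 2 l (d1 z) ?w \<ominus>\<^bsub>E (l + 2)\<^esub>
      (\<ominus>\<^bsub>E (l + 2)\<^esub> P 1 (l + 1) (d0 s) (w (z # xs @ x # ys)) \<oplus>\<^bsub>E (l + 2)\<^esub> s \<odot>\<^bsub>E (l + 2)\<^esub> P 1 (l + 1) (w [z]) ?d)"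
    using c c2 Cons.prems(2) by (simp add: delta_Cons[OF n] w IH P_add_r[of _ 1 _ "l + 1" _ "l + 2"] P_smult_r[of _ 1 _ "l + 1" _ "l + 2"]
        P_smult_r[of _ 2 _ l _ "l + 2"] sw)
  also have "\<dots> = P 1 (l + 1) (d0 s) (w (z # xs @ x # ys)) \<oplus>\<^bsub>E (l + 2)\<^esub>
      (s \<odot>\<^bsub>E (l + 2)\<^esub> P 2 l (d1 z) ?w \<ominus>\<^bsub>E (l + 2)\<^esub> s \<odot>\<^bsub>E (l + 2)\<^esub> P 1 (l + 1) (w [z]) ?d)"
    using c c2 Cons.prems(2) by (intro E.diff_diff) (auto intro!: P_closed E.smult_closed)
  finally show ?case
    unfolding k(1) unfolding k(2)
    using c Cons.prems(2) by (simp add: delta_Cons[OF n] E.smult_diff P_closed)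
qed

text \<open>For a repeated factor at the head, \<open>d1 x\<close> arises from each copy with
  opposite signs; its degree is even, so the two terms are equal up to that sign and cancel. The
  term in which neither copy is differentiated contains the square of \<open>w [x]\<close>, which is
  zero.\<close>

lemma delta_alt:
  assumes "set xs \<subseteq> carrier M" "x \<in> carrier M" "set ys \<subseteq> carrier M" "int (length xs + 2 + length ys) = k"
  shows "delta (xs @ x # x # ys) = \<zero>\<^bsub>E (k + 1)\<^esub>"
  using assms
proof (induction xs arbitrary: k)
  case Nil
  define l where "l = int (length ys)"
  have k: "k + 1 = l + 3" using Nil by (simp add: l_def)
  have n: "int (length (x # ys)) = l + 1" by (simp add: l_def)
  interpret E: Module.module R "E (l + 3)" by (rule E_module)
  interpret E': Module.module R "E (l + 2)" by (rule E_module)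
  have c: "delta ys \<in> carrier (E (l + 1))" "w ys \<in> carrier (E l)" "d1 x \<in> carrier (E 2)" "w [x] \<in> carrier (E 1)"
    using Nil by (auto intro!: delta_closed w_closed d1_closed simp: l_def)
  have c2: "P 2 l (d1 x) (w ys) \<in> carrier (E (l + 2))" "P 1 (l + 1) (w [x]) (delta ys) \<in> carrier (E (l + 2))"
    "P 2 (l + 1) (d1 x) (w (x # ys)) \<in> carrier (E (l + 3))"
    using c Nil n by (auto intro!: P_closed w_closed)
  have w2: "P 1 l (w [x]) (w ys) = w (x # ys)" using P_wedge[of "[x]" 1 ys l] Nil by (simp add: l_def)
  have xx: "P 1 1 (w [x]) (w [x]) = \<zero>\<^bsub>E 2\<^esub>"
    using P_wedge[of "[x]" 1 "[x]" 1] w_alt[of "[]" x "[]" 2] Nil by simp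
  have "P 1 (l + 2) (w [x]) (P 1 (l + 1) (w [x]) (delta ys)) = P 2 (l + 1) (P 1 1 (w [x]) (w [x])) (delta ys)"
    using c by (simp add: P_assoc[of _ 1 _ 1 _ "l + 1" 2 "l + 2"])
  also have "\<dots> = \<zero>\<^bsub>E (l + 3)\<^esub>" unfolding xx by (rule P_zero_l[OF c(1)]) simp
  finally have 1: "P 1 (l + 2) (w [x]) (P 1 (l + 1) (w [x]) (delta ys)) = \<zero>\<^bsub>E (l + 3)\<^esub>" .
  have "P 1 (l + 2) (w [x]) (P 2 l (d1 x) (w ys)) = P 3 l (P 1 2 (w [x]) (d1 x)) (w ys)"
    using c by (simp add: P_assoc[of _ 1 _ 2 _ l 3 "l + 2"])
  \<comment> \<open>No sign appears, because \<open>d1 x\<close> has degree two.\<close>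
  also have "P 1 2 (w [x]) (d1 x) = P 2 1 (d1 x) (w [x])"
    using P_commute[OF c(4,3), of 3] by (simp add: signed_def)
  also have "P 3 l (P 2 1 (d1 x) (w [x])) (w ys) = P 2 (l + 1) (d1 x) (w (x # ys))"
    using c by (simp add: P_assoc[of _ 2 _ 1 _ l 3 "l + 1"] w2)
  finally have 2: "P 1 (l + 2) (w [x]) (P 2 l (d1 x) (w ys)) = P 2 (l + 1) (d1 x) (w (x # ys))" .
  have "P 1 (l + 2) (w [x]) (delta (x # ys)) = P 2 (l + 1) (d1 x) (w (x # ys))"
    unfolding delta_Cons[OF l_def[symmetric]]
      add_map_diff[OF E_abelian_group E_abelian_group P_add_map_r[OF c(4), of "l + 2" "l + 3"] c2(1,2), simplified] 1 2
    by (rule E.diff_zero[OF c2(3)])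
  moreover have "l + 1 + 2 = l + 3" "l + 1 + 1 = l + 2" by simp_all
  ultimately show ?case
    unfolding k append_Nil delta_Cons[OF n] using E.diff_self[OF c2(3)] by (simp only:)
next
  case (Cons z xs)
  define l where "l = int (length xs + 2 + length ys)"
  have k: "k + 1 = l + 2" using Cons by (simp add: l_def)
  interpret E: Module.module R "E (l + 2)" by (rule E_module)
  have n: "int (length (xs @ x # x # ys)) = l" by (simp add: l_def)
  have IH: "delta (xs @ x # x # ys) = \<zero>\<^bsub>E (l + 1)\<^esub>"
    by (rule Cons.IH) (use Cons.prems l_def in auto)
  have w: "w (xs @ x # x # ys) = \<zero>\<^bsub>E l\<^esub>"
    by (rule w_alt) (use Cons.prems l_def in auto)
  have c: "d1 z \<in> carrier (E 2)" "w [z] \<in> carrier (E 1)" using Cons.prems by (auto intro: d1_closed w1_closed)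
  show ?case
    using c by (simp add: delta_Cons[OF n] k IH w P_zero_r[of _ 2 l "l + 2"] P_zero_r[of _ 1 "l + 1" "l + 2"] E.diff_self)
qed


section \<open>The Leibniz rule for wedge products of lists\<close>

lemma signed_P_l:
  assumes "x \<in> carrier (E k)" "y \<in> carrier (E l)" "k + l = n"
  shows "P k l (signed (E k) a x) y = signed (E n) a (P k l x y)"
  using P_minus_l[OF assms(2,3,1)] by (simp add: signed_def)

lemma signed_P_r:
  assumes "x \<in> carrier (E k)" "y \<in> carrier (E l)" "k + l = n"
  shows "P k l x (signed (E l) a y) = signed (E n) a (P k l x y)"
  using P_minus_r[OF assms(1,3,2)] by (simp add: signed_def)

lemma P_diff_l:
  assumes "x \<in> carrier (E k)" "x' \<in> carrier (E k)" "y \<in> carrier (E l)" "k + l = n"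
  shows "P k l (x \<ominus>\<^bsub>E k\<^esub> x') y = P k l x y \<ominus>\<^bsub>E n\<^esub> P k l x' y"
  by (rule add_map_diff[OF E_abelian_group E_abelian_group P_add_map_l[OF assms(3,4)] assms(1,2)])

lemma diff_signed:
  assumes "a \<in> carrier (E n)" "b \<in> carrier (E n)" "c \<in> carrier (E n)"
  shows "a \<ominus>\<^bsub>E n\<^esub> (b \<oplus>\<^bsub>E n\<^esub> signed (E n) k c) = (a \<ominus>\<^bsub>E n\<^esub> b) \<oplus>\<^bsub>E n\<^esub> signed (E n) (k + 1) c"
proof -
  interpret E: Module.module R "E n" by (rule E_module)
  show ?thesis using assms by (simp add: signed_def a_minus_def E.minus_add E.a_ac)
qed

text \<open>Induction on the first list. The minus sign in the recursion meets the sign of degree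
  \<open>m\<close> from the induction hypothesis and makes it the sign of degree
  \<open>m + 1\<close>; the other terms are regrouped by associativity.\<close>

lemma delta_append:
  assumes "set xs \<subseteq> carrier M" "int (length xs) = k" "set ys \<subseteq> carrier M" "int (length ys) = l"
  shows "delta (xs @ ys) = P (k + 1) l (delta xs) (w ys) \<oplus>\<^bsub>E (k + l + 1)\<^esub>
    signed (E (k + l + 1)) k (P k (l + 1) (w xs) (delta ys))"
  using assms(1,2)
proof (induction xs arbitrary: k)
  case Nil
  interpret E: Module.module R "E (l + 1)" by (rule E_module)
  have c: "delta ys \<in> carrier (E (l + 1))" "w ys \<in> carrier (E l)"
    using assms by (auto intro: delta_closed w_closed)
  have "P 1 l \<zero>\<^bsub>E 1\<^esub> (w ys) = \<zero>\<^bsub>E (l + 1)\<^esub>" by (rule P_zero_l[OF c(2)]) simp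
  moreover from Nil have "k = 0" by simp
  ultimately show ?case using c by (simp add: P_unit_l signed_def)
next
  case (Cons z xs)
  define m where "m = int (length xs)"
  have k: "k = m + 1" using Cons by (simp add: m_def)
  define n where "n = m + l + 2"
  interpret E: Module.module R "E n" by (rule E_module)
  have c: "delta xs \<in> carrier (E (m + 1))" "w xs \<in> carrier (E m)" "delta ys \<in> carrier (E (l + 1))" "w ys \<in> carrier (E l)"
    "d1 z \<in> carrier (E 2)" "w [z] \<in> carrier (E 1)"
    using assms Cons.prems by (auto intro!: delta_closed w_closed d1_closed simp: m_def)
  have c2: "P (m + 1) l (delta xs) (w ys) \<in> carrier (E (m + l + 1))"
     "P m (l + 1) (w xs) (delta ys) \<in> carrier (E (m + l + 1))"
     "P 2 m (d1 z) (w xs) \<in> carrier (E (m + 2))" "P 1 (m + 1) (w [z]) (delta xs) \<in> carrier (E (m + 2))"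
     "P 1 (m + l + 1) (w [z]) (P (m + 1) l (delta xs) (w ys)) \<in> carrier (E n)"
     "P 1 (m + l + 1) (w [z]) (P m (l + 1) (w xs) (delta ys)) \<in> carrier (E n)"
     "P 2 (m + l) (d1 z) (w (xs @ ys)) \<in> carrier (E n)"
    using c assms Cons.prems by (auto intro!: P_closed w_closed simp: m_def n_def)
  have pw: "P m l (w xs) (w ys) = w (xs @ ys)" "P 1 m (w [z]) (w xs) = w (z # xs)"
    using P_wedge[of xs m ys l] P_wedge[of "[z]" 1 xs m] assms Cons.prems by (simp_all add: m_def)
  have len: "int (length (xs @ ys)) = m + l" using assms by (simp add: m_def)
  have IH: "delta (xs @ ys) = P (m + 1) l (delta xs) (w ys) \<oplus>\<^bsub>E (m + l + 1)\<^esub>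
    signed (E (m + l + 1)) m (P m (l + 1) (w xs) (delta ys))"
    by (rule Cons.IH) (use Cons.prems m_def in auto)
  have "P 1 (m + l + 1) (w [z]) (delta (xs @ ys)) =
      P 1 (m + l + 1) (w [z]) (P (m + 1) l (delta xs) (w ys)) \<oplus>\<^bsub>E n\<^esub>
      signed (E n) m (P 1 (m + l + 1) (w [z]) (P m (l + 1) (w xs) (delta ys)))"
    using c c2 by (simp add: IH P_add_r[of _ 1 _ "m + l + 1" _ n] signed_closed n_def signed_P_r[of _ 1 _ "m + l + 1" "m + l + 2"])
  then have "delta (z # xs @ ys) = (P 2 (m + l) (d1 z) (w (xs @ ys)) \<ominus>\<^bsub>E n\<^esub> P 1 (m + l + 1) (w [z]) (P (m + 1) l (delta xs) (w ys)))
      \<oplus>\<^bsub>E n\<^esub> signed (E n) (m + 1) (P 1 (m + l + 1) (w [z]) (P m (l + 1) (w xs) (delta ys)))"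
    using c2 diff_signed[of _ n] by (simp add: delta_Cons[OF len] n_def)
  also have "P 2 (m + l) (d1 z) (w (xs @ ys)) = P (m + 2) l (P 2 m (d1 z) (w xs)) (w ys)"
    unfolding pw(1)[symmetric] by (rule P_assoc[symmetric]) (use c in auto)
  also have "P 1 (m + l + 1) (w [z]) (P (m + 1) l (delta xs) (w ys)) = P (m + 2) l (P 1 (m + 1) (w [z]) (delta xs)) (w ys)"
    using c by (simp add: P_assoc[of _ 1 _ "m + 1" _ l "m + 2" "m + l + 1"])
  also have "P 1 (m + l + 1) (w [z]) (P m (l + 1) (w xs) (delta ys)) = P (m + 1) (l + 1) (w (z # xs)) (delta ys)"
    unfolding pw(2)[symmetric] by (rule P_assoc[symmetric]) (use c in auto)
  also have "P (m + 2) l (P 2 m (d1 z) (w xs)) (w ys) \<ominus>\<^bsub>E n\<^esub> P (m + 2) l (P 1 (m + 1) (w [z]) (delta xs)) (w ys) =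
      P (m + 2) l (delta (z # xs)) (w ys)"
    using c c2 by (simp add: delta_Cons[OF m_def[symmetric]] P_diff_l[of _ "m + 2" _ _ l n] n_def)
  finally show ?case unfolding k by (simp add: n_def add.assoc add.commute[of 1 l] add.left_commute[of 1 l])
qed

text \<open>The prescribed value is the product rule for a coefficient times a wedge. The
  restriction to the carrier matters because \<open>form_dif\<close> is described among functions
  that are extensional there, and the two are to be equal as functions.\<close>

definition D :: "int \<Rightarrow> ('c list \<Rightarrow> 'a) set \<Rightarrow> ('c list \<Rightarrow> 'a) set" where
  "D k = restrict (SOME \<phi>. add_map (E k) (E (k + 1)) \<phi> \<and>
    (\<forall>r xs. r \<in> carrier R \<and> set xs \<subseteq> carrier M \<and> int (length xs) = k \<longrightarrow>
      \<phi> (r \<odot>\<^bsub>E k\<^esub> w xs) = P 1 k (d0 r) (w xs) \<oplus>\<^bsub>E (k + 1)\<^esub> r \<odot>\<^bsub>E (k + 1)\<^esub> delta xs)) (carrier (E k))"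

text \<open>The delicate condition is that a scalar \<open>s\<close> may sit in a slot or in the
  coefficient. The term with \<open>d0 s\<close> that \<open>delta_smult\<close> produces,
  multiplied by \<open>r\<close>, is the half of \<open>d0\<close> of the product of
  \<open>r\<close> and \<open>s\<close> that the other side has in addition.\<close>

lemma D_ex: "\<exists>\<phi>. add_map (E k) (E (k + 1)) \<phi> \<and>
    (\<forall>r xs. r \<in> carrier R \<and> set xs \<subseteq> carrier M \<and> int (length xs) = k \<longrightarrow>
      \<phi> (r \<odot>\<^bsub>E k\<^esub> w xs) = P 1 k (d0 r) (w xs) \<oplus>\<^bsub>E (k + 1)\<^esub> r \<odot>\<^bsub>E (k + 1)\<^esub> delta xs)"
proof (rule ext_add_lift[OF E_abelian_group])
  interpret E: Module.module R "E (k + 1)" by (rule E_module)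
  have c: "w xs \<in> carrier (E k)" "delta xs \<in> carrier (E (k + 1))"
    if "set xs \<subseteq> carrier M" "int (length xs) = k" for xs
    using that by (auto intro: w_closed delta_closed)
  {
    fix xs assume xs: "set xs \<subseteq> carrier M" "int (length xs) = k"
    show "add_map R (E (k + 1)) (\<lambda>r. P 1 k (d0 r) (w xs) \<oplus>\<^bsub>E (k + 1)\<^esub> r \<odot>\<^bsub>E (k + 1)\<^esub> delta xs)"
      by (rule add_mapI) (use c[OF xs] in \<open>auto simp: d0_closed d0_add P_closed P_add_l[of _ 1 _ _ k "k + 1"] E.smult_l_distr E.a_ac\<close>)
  next
    fix xs x y ys r assume a: "set xs \<subseteq> carrier M" "x \<in> carrier M" "y \<in> carrier M" "set ys \<subseteq> carrier M"
      "int (length xs + 1 + length ys) = k" "r \<in> carrier R"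
    have c': "w (xs @ z # ys) \<in> carrier (E k)" "delta (xs @ z # ys) \<in> carrier (E (k + 1))" if "z \<in> carrier M" for z
      by (rule c; use a that in simp)+
    show "P 1 k (d0 r) (w (xs @ (x \<oplus>\<^bsub>M\<^esub> y) # ys)) \<oplus>\<^bsub>E (k + 1)\<^esub> r \<odot>\<^bsub>E (k + 1)\<^esub> delta (xs @ (x \<oplus>\<^bsub>M\<^esub> y) # ys) =
      P 1 k (d0 r) (w (xs @ x # ys)) \<oplus>\<^bsub>E (k + 1)\<^esub> r \<odot>\<^bsub>E (k + 1)\<^esub> delta (xs @ x # ys) \<oplus>\<^bsub>E (k + 1)\<^esub>
      (P 1 k (d0 r) (w (xs @ y # ys)) \<oplus>\<^bsub>E (k + 1)\<^esub> r \<odot>\<^bsub>E (k + 1)\<^esub> delta (xs @ y # ys))"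
      unfolding w_add[OF a(1-5)] delta_add[OF a(1-5)]
      using c' a d0_closed by (simp add: P_add_r[of _ 1 _ k _ "k + 1"] P_closed E.smult_r_distr E.a_ac)
  next
    fix xs s x ys r assume a: "set xs \<subseteq> carrier M" "s \<in> carrier R" "x \<in> carrier M" "set ys \<subseteq> carrier M"
      "int (length xs + 1 + length ys) = k" "r \<in> carrier R"
    have c': "w (xs @ x # ys) \<in> carrier (E k)" "delta (xs @ x # ys) \<in> carrier (E (k + 1))"
      by (rule c; use a in simp)+
    have c1: "r \<odot>\<^bsub>E 1\<^esub> d0 s \<in> carrier (E 1)" "s \<odot>\<^bsub>E 1\<^esub> d0 r \<in> carrier (E 1)"
      using a d0_closed Module.module.smult_closed[OF E_module] by auto
    show "P 1 k (d0 r) (w (xs @ (s \<odot>\<^bsub>M\<^esub> x) # ys)) \<oplus>\<^bsub>E (k + 1)\<^esub> r \<odot>\<^bsub>E (k + 1)\<^esub> delta (xs @ (s \<odot>\<^bsub>M\<^esub> x) # ys) =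
      P 1 k (d0 (r \<otimes> s)) (w (xs @ x # ys)) \<oplus>\<^bsub>E (k + 1)\<^esub> (r \<otimes> s) \<odot>\<^bsub>E (k + 1)\<^esub> delta (xs @ x # ys)"
      unfolding w_smult[OF a(1-5)] delta_smult[OF a(1-5)]
      using c' a c1 d0_closed by (simp add: P_smult_r[of _ 1 _ k _ "k + 1"] P_smult_l[of _ 1 _ k _ "k + 1"] P_add_l[of _ 1 _ _ k "k + 1"]
          P_closed E.smult_r_distr E.smult_assoc1 d0_mult E.a_ac)
  next
    fix xs x ys r assume a: "set xs \<subseteq> carrier M" "x \<in> carrier M" "set ys \<subseteq> carrier M"
      "int (length xs + 2 + length ys) = k" "r \<in> carrier R"
    show "P 1 k (d0 r) (w (xs @ x # x # ys)) \<oplus>\<^bsub>E (k + 1)\<^esub> r \<odot>\<^bsub>E (k + 1)\<^esub> delta (xs @ x # x # ys) = \<zero>\<^bsub>E (k + 1)\<^esub>"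
      unfolding w_alt[OF a(1-4)] delta_alt[OF a(1-4)]
      using a P_zero_r[OF d0_closed[OF a(5)], of k "k + 1"] by simp
  }
qed

lemma D_spec:
  "add_map (E k) (E (k + 1)) (D k)"
  "r \<in> carrier R \<Longrightarrow> set xs \<subseteq> carrier M \<Longrightarrow> int (length xs) = k \<Longrightarrow>
    D k (r \<odot>\<^bsub>E k\<^esub> w xs) = P 1 k (d0 r) (w xs) \<oplus>\<^bsub>E (k + 1)\<^esub> r \<odot>\<^bsub>E (k + 1)\<^esub> delta xs"
proof -
  note * = someI_ex[OF D_ex[of k]]
  interpret E: Module.module R "E k" by (rule E_module)
  show "add_map (E k) (E (k + 1)) (D k)"
    by (rule add_mapI) (use *[THEN conjunct1] in \<open>auto simp: D_def add_map_def Pi_iff\<close>)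
  show "D k (r \<odot>\<^bsub>E k\<^esub> w xs) = P 1 k (d0 r) (w xs) \<oplus>\<^bsub>E (k + 1)\<^esub> r \<odot>\<^bsub>E (k + 1)\<^esub> delta xs"
    if "r \<in> carrier R" "set xs \<subseteq> carrier M" "int (length xs) = k"
    using *[THEN conjunct2] w_closed[OF that(2,3)] that by (simp add: D_def)
qed

lemma D_extensional: "D k \<in> extensional (carrier (E k))"
  by (simp add: D_def)

lemmas D_closed = add_map_closed[OF D_spec(1)]
lemmas D_add = add_map_add[OF D_spec(1)]
lemmas D_zero = add_map_zero[OF E_abelian_group E_abelian_group D_spec(1)]

text \<open>The product rule for one times one equates \<open>d0\<close> of one with its
  double.\<close>

lemma d0_one: "d0 \<one> = \<zero>\<^bsub>E 1\<^esub>"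
proof -
  interpret E: Module.module R "E 1" by (rule E_module)
  have "d0 \<one> \<oplus>\<^bsub>E 1\<^esub> d0 \<one> = d0 \<one>" using d0_mult[of \<one> \<one>] d0_closed by simp
  then show ?thesis using E.add.r_cancel_one[OF d0_closed d0_closed] by simp
qed

lemma D_wedge: "set xs \<subseteq> carrier M \<Longrightarrow> int (length xs) = k \<Longrightarrow> D k (w xs) = delta xs"
proof -
  assume xs: "set xs \<subseteq> carrier M" "int (length xs) = k"
  interpret E: Module.module R "E k" by (rule E_module)
  interpret E1: Module.module R "E (k + 1)" by (rule E_module)
  have c: "w xs \<in> carrier (E k)" "delta xs \<in> carrier (E (k + 1))" using xs by (auto intro: w_closed delta_closed)
  show ?thesis
    using D_spec(2)[OF R.one_closed xs] c P_zero_l[OF c(1), of 1 "k + 1"] by (simp add: d0_one)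
qed

text \<open>This measures how far \<open>D\<close> is from being linear, and it is what carries the
  Leibniz rule from wedges to their multiples.\<close>

lemma D_smult:
  assumes "x \<in> carrier (E k)" "r \<in> carrier R"
  shows "D k (r \<odot>\<^bsub>E k\<^esub> x) = P 1 k (d0 r) x \<oplus>\<^bsub>E (k + 1)\<^esub> r \<odot>\<^bsub>E (k + 1)\<^esub> D k x"
  using assms(1)
proof (induction rule: ext_induct)
  interpret E: Module.module R "E k" by (rule E_module)
  interpret E1: Module.module R "E (k + 1)" by (rule E_module)
  {
    case zero
    show ?case using assms(2) P_zero_r[OF d0_closed[OF assms(2)], of k "k + 1"] by (simp add: D_zero)
  next
    case (wedge s xs)
    have c: "w xs \<in> carrier (E k)" "delta xs \<in> carrier (E (k + 1))" using wedge by (auto intro: w_closed delta_closed)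
    have c1: "r \<odot>\<^bsub>E 1\<^esub> d0 s \<in> carrier (E 1)" "s \<odot>\<^bsub>E 1\<^esub> d0 r \<in> carrier (E 1)"
      using wedge assms d0_closed Module.module.smult_closed[OF E_module] by auto
    have "D k (r \<odot>\<^bsub>E k\<^esub> (s \<odot>\<^bsub>E k\<^esub> w xs)) = D k ((r \<otimes> s) \<odot>\<^bsub>E k\<^esub> w xs)"
      using assms wedge c by (simp add: E.smult_assoc1)
    then show ?case
      using assms wedge c c1 by (simp add: D_spec(2) d0_mult P_add_l[of _ 1 _ _ k "k + 1"] P_smult_l[of _ 1 _ k _ "k + 1"]
          P_smult_r[of _ 1 _ k _ "k + 1"] d0_closed P_closed E1.smult_r_distr E1.smult_assoc1 E1.a_ac)
  next
    case (add x y)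
    then show ?case using assms(2) d0_closed
      by (simp add: E.smult_r_distr D_add P_add_r[of _ 1 _ k _ "k + 1"] D_closed E1.smult_r_distr P_closed E1.a_ac)
  }
qed

section \<open>The Leibniz rule for arbitrary elements\<close>

definition leibniz :: "int \<Rightarrow> int \<Rightarrow> ('c list \<Rightarrow> 'a) set \<Rightarrow> ('c list \<Rightarrow> 'a) set \<Rightarrow> bool" where
  "leibniz k l x y \<longleftrightarrow> D (k + l) (P k l x y) =
    P (k + 1) l (D k x) y \<oplus>\<^bsub>E (k + l + 1)\<^esub> signed (E (k + l + 1)) k (P k (l + 1) x (D l y))"

text \<open>By \<open>D_smult\<close> and associativity, the factor \<open>r\<close> adds the same
  term to both sides, namely \<open>d0 r\<close> times the whole product.\<close>

lemma leibniz_smult_l: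
  assumes x: "x \<in> carrier (E k)" and y: "y \<in> carrier (E l)" and r: "r \<in> carrier R" and "leibniz k l x y"
  shows "leibniz k l (r \<odot>\<^bsub>E k\<^esub> x) y"
proof -
  let ?n = "k + l + 1"
  interpret E: Module.module R "E k" by (rule E_module)
  interpret E1: Module.module R "E (k + 1)" by (rule E_module)
  interpret En: Module.module R "E ?n" by (rule E_module)
  note c = x y D_closed[OF x] D_closed[OF y] d0_closed[OF r]
  have c2: "P 1 k (d0 r) x \<in> carrier (E (k + 1))" "P k l x y \<in> carrier (E (k + l))"
    "P 1 (k + l) (d0 r) (P k l x y) \<in> carrier (E ?n)"
    "P (k + 1) l (D k x) y \<in> carrier (E ?n)" "P k (l + 1) x (D l y) \<in> carrier (E ?n)"
    using c by (auto intro!: P_closed)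
  have 1: "P (k + 1) l (P 1 k (d0 r) x) y = P 1 (k + l) (d0 r) (P k l x y)"
    by (rule P_assoc) (use c in auto)
  have "P (k + 1) l (D k (r \<odot>\<^bsub>E k\<^esub> x)) y = P 1 (k + l) (d0 r) (P k l x y) \<oplus>\<^bsub>E ?n\<^esub> r \<odot>\<^bsub>E ?n\<^esub> P (k + 1) l (D k x) y"
    using c c2 r by (simp add: D_smult P_add_l[of _ "k + 1" _ _ l ?n] P_smult_l[of _ "k + 1" _ l _ ?n] 1)
  moreover have "D (k + l) (P k l (r \<odot>\<^bsub>E k\<^esub> x) y) = P 1 (k + l) (d0 r) (P k l x y) \<oplus>\<^bsub>E ?n\<^esub> r \<odot>\<^bsub>E ?n\<^esub> D (k + l) (P k l x y)"
    using c c2 r by (simp add: P_smult_l[of _ k _ l _ "k + l"] D_smult)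
  moreover have "P k (l + 1) (r \<odot>\<^bsub>E k\<^esub> x) (D l y) = r \<odot>\<^bsub>E ?n\<^esub> P k (l + 1) x (D l y)"
    using c r by (simp add: P_smult_l[of _ k _ "l + 1" _ ?n])
  ultimately show ?thesis
    using assms(4) c2 r unfolding leibniz_def
    by (simp add: signed_smult signed_closed En.smult_r_distr En.a_ac)
qed

text \<open>Here the extra \<open>d0 r\<close> stands behind \<open>x\<close>. Bringing it to the
  front costs the sign of degree \<open>k\<close>, and the same sign in the Leibniz rule cancels
  it.\<close>

lemma leibniz_smult_r:
  assumes x: "x \<in> carrier (E k)" and y: "y \<in> carrier (E l)" and r: "r \<in> carrier R" and "leibniz k l x y"
  shows "leibniz k l x (r \<odot>\<^bsub>E l\<^esub> y)"
proof -
  let ?n = "k + l + 1"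
  interpret E: Module.module R "E l" by (rule E_module)
  interpret E1: Module.module R "E (l + 1)" by (rule E_module)
  interpret En: Module.module R "E ?n" by (rule E_module)
  note c = x y D_closed[OF x] D_closed[OF y] d0_closed[OF r]
  have c2: "P 1 l (d0 r) y \<in> carrier (E (l + 1))" "P k l x y \<in> carrier (E (k + l))"
    "P 1 (k + l) (d0 r) (P k l x y) \<in> carrier (E ?n)" "P 1 k (d0 r) x \<in> carrier (E (k + 1))"
    "P (k + 1) l (D k x) y \<in> carrier (E ?n)" "P k (l + 1) x (D l y) \<in> carrier (E ?n)"
    using c by (auto intro!: P_closed)
  have "P k (l + 1) x (P 1 l (d0 r) y) = P (k + 1) l (P k 1 x (d0 r)) y"
    by (rule P_assoc[symmetric]) (use c in auto)
  also have "P k 1 x (d0 r) = signed (E (k + 1)) k (P 1 k (d0 r) x)"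
    using P_commute[OF x c(5), of "k + 1"] by simp
  also have "P (k + 1) l \<dots> y = signed (E ?n) k (P (k + 1) l (P 1 k (d0 r) x) y)"
    by (rule signed_P_l) (use c c2 in auto)
  also have "P (k + 1) l (P 1 k (d0 r) x) y = P 1 (k + l) (d0 r) (P k l x y)"
    by (rule P_assoc) (use c in auto)
  finally have 1: "P k (l + 1) x (P 1 l (d0 r) y) = signed (E ?n) k (P 1 (k + l) (d0 r) (P k l x y))" .
  have "P k (l + 1) x (D l (r \<odot>\<^bsub>E l\<^esub> y)) = signed (E ?n) k (P 1 (k + l) (d0 r) (P k l x y)) \<oplus>\<^bsub>E ?n\<^esub> r \<odot>\<^bsub>E ?n\<^esub> P k (l + 1) x (D l y)"
    using c c2 r by (simp add: D_smult P_add_r[of _ k _ "l + 1" _ ?n] P_smult_r[of _ k _ "l + 1" _ ?n] 1)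
  then have "signed (E ?n) k (P k (l + 1) x (D l (r \<odot>\<^bsub>E l\<^esub> y))) =
      P 1 (k + l) (d0 r) (P k l x y) \<oplus>\<^bsub>E ?n\<^esub> r \<odot>\<^bsub>E ?n\<^esub> signed (E ?n) k (P k (l + 1) x (D l y))"
    using c2 r by (simp add: signed_add signed_closed signed_signed signed_smult) (simp add: signed_def)
  moreover have "D (k + l) (P k l x (r \<odot>\<^bsub>E l\<^esub> y)) = P 1 (k + l) (d0 r) (P k l x y) \<oplus>\<^bsub>E ?n\<^esub> r \<odot>\<^bsub>E ?n\<^esub> D (k + l) (P k l x y)"
    using c c2 r by (simp add: P_smult_r[of _ k _ l _ "k + l"] D_smult)
  moreover have "P (k + 1) l (D k x) (r \<odot>\<^bsub>E l\<^esub> y) = r \<odot>\<^bsub>E ?n\<^esub> P (k + 1) l (D k x) y"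
    using c r by (simp add: P_smult_r[of _ "k + 1" _ l _ ?n])
  ultimately show ?thesis
    using assms(4) c2 r unfolding leibniz_def
    by (simp add: signed_closed En.smult_r_distr En.a_ac)
qed

lemma leibniz_wedge:
  assumes "set xs \<subseteq> carrier M" "int (length xs) = k" "set ys \<subseteq> carrier M" "int (length ys) = l"
  shows "leibniz k l (w xs) (w ys)"
  unfolding leibniz_def P_wedge[OF assms] D_wedge[OF assms(1,2)] D_wedge[OF assms(3,4)]
  using D_wedge[of "xs @ ys" "k + l"] delta_append[OF assms] assms by simp

lemma leibniz_holds:
  assumes x: "x \<in> carrier (E k)" and y: "y \<in> carrier (E l)"
  shows "leibniz k l x y"
  using x
proof (induction rule: ext_induct)
  let ?n = "k + l + 1"
  interpret En: Module.module R "E ?n" by (rule E_module)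
  have n: "k + 1 + l = ?n" "k + (l + 1) = ?n" by simp_all
  {
    case zero
    show ?case
      unfolding leibniz_def D_zero P_zero_l[OF y refl] P_zero_l[OF y n(1)] P_zero_l[OF D_closed[OF y] n(2)]
      by (simp add: signed_zero n)
  next
    case (add x x')
    note c = add D_closed[OF add(1)] D_closed[OF add(2)] y D_closed[OF y]
    show ?case using c unfolding leibniz_def
      by (simp add: P_add_l[of _ _ _ _ l "k + l"] P_add_l[of _ _ _ _ _ ?n] D_add P_closed signed_add signed_closed En.a_ac)
  next
    case (wedge r xs)
    have "leibniz k l (w xs) y"
      using y
    proof (induction rule: ext_induct)
      have x: "w xs \<in> carrier (E k)" by (rule w_closed[OF wedge(2,3)])
      {
        case zero
        show ?case
          unfolding leibniz_def D_zero P_zero_r[OF x refl] P_zero_r[OF x n(2)] P_zero_r[OF D_closed[OF x] n(1)]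
          by (simp add: signed_zero n)
      next
        case (add y y')
        note c = add D_closed[OF add(1)] D_closed[OF add(2)] x D_closed[OF x]
        show ?case using c unfolding leibniz_def
          by (simp add: P_add_r[of _ k _ l _ "k + l"] P_add_r[of _ _ _ _ _ ?n] D_add P_closed signed_add signed_closed En.a_ac)
      next
        case (wedge s ys)
        then show ?case
          by (intro leibniz_smult_r leibniz_wedge w_closed x \<open>set xs \<subseteq> carrier M\<close> \<open>int (length xs) = k\<close>)
      }
    qed
    then show ?case by (intro leibniz_smult_l w_closed wedge y)
  }
qed

lemma D_product:
  "x \<in> carrier (E k) \<Longrightarrow> y \<in> carrier (E l) \<Longrightarrow> D (k + l) (P k l x y) =
    P (k + 1) l (D k x) y \<oplus>\<^bsub>E (k + l + 1)\<^esub> signed (E (k + l + 1)) k (P k (l + 1) x (D l y))"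
  using leibniz_holds by (simp add: leibniz_def)

section \<open>Low degrees and the square of the differential\<close>

lemma D_degree_0: "r \<in> carrier R \<Longrightarrow> D 0 (r \<odot>\<^bsub>E 0\<^esub> w []) = d0 r"
proof -
  assume r: "r \<in> carrier R"
  interpret E: Module.module R "E 1" by (rule E_module)
  show ?thesis using D_spec(2)[of r "[]" 0] r d0_closed by (simp add: P_unit_r)
qed

lemma D_degree_1: "x \<in> carrier M \<Longrightarrow> D 1 (w [x]) = d1 x"
proof -
  assume x: "x \<in> carrier M"
  interpret E: Module.module R "E 2" by (rule E_module)
  show ?thesis using D_wedge[of "[x]" 1] x d1_closed P_zero_r[OF w1_closed[OF x], of 1 2]
    by (simp add: P_unit_r delta_Cons[of "[]" 0] E.diff_zero)
qed

text \<open>Two of the four terms contain a second differential of \<open>x\<close> or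
  \<open>y\<close> and vanish by assumption. The product of \<open>D k x\<close> and
  \<open>D l y\<close> occurs in the other two, once with the sign of degree \<open>k + 1\<close>
  and once with that of degree \<open>k\<close>.\<close>

lemma DD_product:
  assumes x: "x \<in> carrier (E k)" and y: "y \<in> carrier (E l)"
    and x0: "D (k + 1) (D k x) = \<zero>\<^bsub>E (k + 2)\<^esub>" and y0: "D (l + 1) (D l y) = \<zero>\<^bsub>E (l + 2)\<^esub>"
  shows "D (k + l + 1) (D (k + l) (P k l x y)) = \<zero>\<^bsub>E (k + l + 2)\<^esub>"
proof -
  let ?n = "k + l + 1" and ?m = "k + l + 2"
  interpret En: Module.module R "E ?n" by (rule E_module)
  interpret Em: Module.module R "E ?m" by (rule E_module)
  note c = x y D_closed[OF x] D_closed[OF y]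
  have c2: "P (k + 1) l (D k x) y \<in> carrier (E ?n)" "P k (l + 1) x (D l y) \<in> carrier (E ?n)"
    "P (k + 1) (l + 1) (D k x) (D l y) \<in> carrier (E ?m)"
    using c by (auto intro!: P_closed)
  let ?A = "P (k + 1) (l + 1) (D k x) (D l y)"
  have ar: "k + 1 + l = ?n" "k + (l + 1) = ?n" "k + 1 + 1 = k + 2" "l + 1 + 1 = l + 2" "?n + 1 = ?m" by simp_all
  have "P (k + 2) l \<zero>\<^bsub>E (k + 2)\<^esub> y = \<zero>\<^bsub>E ?m\<^esub>" by (rule P_zero_l[OF y]) simp
  then have 1: "D ?n (P (k + 1) l (D k x) y) = signed (E ?m) (k + 1) ?A"
    using D_product[OF c(3,2)] c2 by (simp add: ar x0 signed_closed)
  have "P k (l + 2) x \<zero>\<^bsub>E (l + 2)\<^esub> = \<zero>\<^bsub>E ?m\<^esub>" by (rule P_zero_r[OF x]) simp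
  then have 2: "D ?n (P k (l + 1) x (D l y)) = ?A"
    using D_product[OF c(1,4)] c2 by (simp add: ar y0 signed_zero)
  have s: "D ?n (signed (E ?n) k z) = signed (E ?m) k (D ?n z)" if "z \<in> carrier (E ?n)" for z
    using add_map_minus[OF E_abelian_group E_abelian_group D_spec(1) that] by (simp add: signed_def ar)
  have "D ?n (D (k + l) (P k l x y)) = signed (E ?m) (k + 1) ?A \<oplus>\<^bsub>E ?m\<^esub> signed (E ?m) k ?A"
    using c2 by (simp add: D_product[OF x y] D_add signed_closed 1 2 s ar)
  also have "\<dots> = \<zero>\<^bsub>E ?m\<^esub>" using c2 by (auto simp: signed_def Em.l_neg Em.r_neg)
  finally show ?thesis .
qed

text \<open>By \<open>DD_product\<close> the elements killed by the square of the differential are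
  closed under products. A multiple of a wedge is a product of a scalar and elements of degree one,
  so the square only has to vanish on these, which is what the assumptions on \<open>d0\<close> and
  \<open>d1\<close> say.\<close>

lemma DD:
  assumes d0: "\<And>r. r \<in> carrier R \<Longrightarrow> D 1 (d0 r) = \<zero>\<^bsub>E 2\<^esub>"
    and d1: "\<And>x. x \<in> carrier M \<Longrightarrow> D 2 (d1 x) = \<zero>\<^bsub>E 3\<^esub>"
    and "x \<in> carrier (E k)"
  shows "D (k + 1) (D k x) = \<zero>\<^bsub>E (k + 2)\<^esub>"
  using assms(3)
proof (induction rule: ext_induct)
  case zero
  have "k + 1 + 1 = k + 2" by simp
  then show ?case unfolding D_zero by (simp only:)
next
  case (add x y)
  interpret E2: Module.module R "E (k + 2)" by (rule E_module)
  have "k + 1 + 1 = k + 2" by simp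
  with D_add[OF D_closed[OF add(1)] D_closed[OF add(2)]] show ?case
    using add E2.l_zero[OF E2.zero_closed] by (simp only: D_add)
next
  case (wedge r xs)
  interpret E0: Module.module R "E 0" by (rule E_module)
  have w0: "D (int (length xs) + 1) (D (int (length xs)) (w xs)) = \<zero>\<^bsub>E (int (length xs) + 2)\<^esub>"
    if "set xs \<subseteq> carrier M" for xs
    using that
  proof (induction xs)
    case Nil
    have "D 0 (w []) = \<zero>\<^bsub>E 1\<^esub>" using D_wedge[of "[]" 0] by simp
    then show ?case using D_zero[of 1] by simp
  next
    case (Cons x xs)
    have "P 1 (int (length xs)) (w [x]) (w xs) = w (x # xs)"
      using P_wedge[of "[x]" 1 xs] Cons.prems by simp
    moreover have "D (1 + int (length xs) + 1) (D (1 + int (length xs)) (P 1 (int (length xs)) (w [x]) (w xs))) =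
        \<zero>\<^bsub>E (1 + int (length xs) + 2)\<^esub>"
      by (rule DD_product) (use Cons w1_closed w_closed D_degree_1 d1 in auto)
    ultimately show ?case by simp
  qed
  have c: "r \<odot>\<^bsub>E 0\<^esub> w [] \<in> carrier (E 0)" "w xs \<in> carrier (E k)"
    using w0_closed wedge by (auto intro: w_closed)
  \<comment> \<open>The coefficient becomes one more factor, a form of degree zero, so that
    \<open>DD_product\<close> covers it as well.\<close>
  have "r \<odot>\<^bsub>E k\<^esub> w xs = P 0 k (r \<odot>\<^bsub>E 0\<^esub> w []) (w xs)"
    using c wedge P_smult_l[OF w0_closed c(2), of r k] by (simp add: P_unit_l)
  moreover have "D (0 + k + 1) (D (0 + k) (P 0 k (r \<odot>\<^bsub>E 0\<^esub> w []) (w xs))) = \<zero>\<^bsub>E (0 + k + 2)\<^esub>"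
    by (rule DD_product[OF c]) (use wedge w0[of xs] d0 D_degree_0 in auto)
  ultimately show ?case by simp
qed

end

section \<open>Differential forms of a smooth ring\<close>

text \<open>The last row and column are split off; their entries cancel in pairs and the corner is a
  diagonal entry. The diagonal needs its own hypothesis, because in an abelian group an element
  whose double is zero may be nonzero.\<close>

lemma (in abelian_group) finsum_alternating:
  fixes n :: nat
  assumes "\<And>i j. i < n \<Longrightarrow> j < n \<Longrightarrow> f i j \<in> carrier G"
    and "\<And>i. i < n \<Longrightarrow> f i i = \<zero>" and "\<And>i j. i < n \<Longrightarrow> j < n \<Longrightarrow> f i j \<oplus> f j i = \<zero>"
  shows "(\<Oplus>i\<in>{..<n}. \<Oplus>j\<in>{..<n}. f i j) = \<zero>"
  using assms
proof (induction n)
  case (Suc n)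
  have cl: "f i j \<in> carrier G" if "i < Suc n" "j < Suc n" for i j using Suc.prems that by blast
  have row: "(\<Oplus>j\<in>{..<Suc n}. f i j) = f i n \<oplus> (\<Oplus>j\<in>{..<n}. f i j)" if "i < Suc n" for i
    unfolding lessThan_Suc by (rule finsum_insert) (use cl that in auto)
  have rows: "(\<Oplus>i\<in>{..<n}. \<Oplus>j\<in>{..<Suc n}. f i j) = (\<Oplus>i\<in>{..<n}. f i n \<oplus> (\<Oplus>j\<in>{..<n}. f i j))"
    by (rule finsum_cong') (use row cl in \<open>auto intro!: finsum_closed\<close>)
  also have "\<dots> = (\<Oplus>i\<in>{..<n}. f i n) \<oplus> (\<Oplus>i\<in>{..<n}. \<Oplus>j\<in>{..<n}. f i j)"
    by (rule finsum_addf) (use cl in \<open>auto intro!: finsum_closed\<close>)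
  also have "(\<Oplus>i\<in>{..<n}. \<Oplus>j\<in>{..<n}. f i j) = \<zero>" by (rule Suc.IH) (use Suc.prems in auto)
  finally have 1: "(\<Oplus>i\<in>{..<n}. \<Oplus>j\<in>{..<Suc n}. f i j) = (\<Oplus>i\<in>{..<n}. f i n)"
    using cl by (simp add: finsum_closed Pi_def)
  have "(\<Oplus>i\<in>{..<Suc n}. \<Oplus>j\<in>{..<Suc n}. f i j) =
      (\<Oplus>j\<in>{..<Suc n}. f n j) \<oplus> (\<Oplus>i\<in>{..<n}. \<Oplus>j\<in>{..<Suc n}. f i j)"
    unfolding lessThan_Suc[of n]
    by (subst finsum_insert) (use cl in \<open>auto intro!: finsum_closed simp: lessThan_Suc[symmetric]\<close>)
  also have "\<dots> = (\<Oplus>j\<in>{..<n}. f n j) \<oplus> (\<Oplus>i\<in>{..<n}. f i n)"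
    using 1 row[of n] Suc.prems(2)[of n] cl by (simp add: finsum_closed Pi_def)
  also have "\<dots> = (\<Oplus>i\<in>{..<n}. f n i \<oplus> f i n)"
    by (rule finsum_addf[symmetric]) (use cl in auto)
  also have "\<dots> = (\<Oplus>i\<in>{..<n}. \<zero>)"
    by (rule finsum_cong') (use Suc.prems(3) in auto)
  finally show ?case by simp
qed simp

locale smooth_ring =
  fixes C :: "'a cinf_ring"
  assumes C: "cinf_ring C"

sublocale smooth_ring \<subseteq> ext_alg "alg C" "kaehler C"
  by (intro ext_alg.intro kaehler_module C)

section \<open>The universal derivation and additive maps out of the Kaehler differentials\<close>

context smooth_ring
begin

lemma R_carrier [simp]: "carrier (alg C) = carrier C"
  by (rule alg_carrier) (rule C)

lemmas C_closed [simp] = R.zero_closed[unfolded R_carrier] R.one_closed[unfolded R_carrier] R.m_closed[unfolded R_carrier]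

abbreviation "d \<equiv> kaehler_d C"

lemma derivation:
  "as \<noteq> [] \<Longrightarrow> set as \<subseteq> carrier C \<Longrightarrow> h \<in> smooth_fun (length as) \<Longrightarrow>
    d (cop C h as) = (\<Oplus>\<^bsub>kaehler C\<^esub>i\<in>{..<length as}. cop C (pderivative i h) as \<odot>\<^bsub>kaehler C\<^esub> d (as ! i))"
  using kaehler_d_derivation[OF C] unfolding cinf_derivation_def by blast

lemma d_closed: "a \<in> carrier C \<Longrightarrow> d a \<in> carrier (kaehler C)"
  using kaehler_d_derivation[OF C] unfolding cinf_derivation_def by blast

lemma d_binary:
  assumes "a \<in> carrier C" "b \<in> carrier C" "h \<in> smooth_fun 2"
  shows "d (cop C h [a, b]) = cop C (pderivative 0 h) [a, b] \<odot>\<^bsub>kaehler C\<^esub> d a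
    \<oplus>\<^bsub>kaehler C\<^esub> cop C (pderivative 1 h) [a, b] \<odot>\<^bsub>kaehler C\<^esub> d b"
proof -
  have "cop C (pderivative i h) [a, b] \<in> carrier C" if "i < 2" for i
    by (rule cop_closed[OF C]) (use assms that smooth_fun_pderivative_closed in \<open>auto simp: numeral_2_eq_2\<close>)
  from this[of 0] this[of 1] show ?thesis
    using derivation[of "[a, b]" h] assms d_closed
    by (simp add: lessThan_Suc numeral_2_eq_2 M.finsum_insert M.a_comm)
qed

lemma d_add: "a \<in> carrier C \<Longrightarrow> b \<in> carrier C \<Longrightarrow> d (a \<oplus>\<^bsub>alg C\<^esub> b) = d a \<oplus>\<^bsub>kaehler C\<^esub> d b"
proof -
  assume ab: "a \<in> carrier C" "b \<in> carrier C"
  have p: "pderivative 0 (\<lambda>x. x 0 + x 1) = (\<lambda>_. 1)" "pderivative 1 (\<lambda>x. x 0 + x 1) = (\<lambda>_. 1)"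
    by (auto simp: pderivative_def fun_eq_iff intro!: DERIV_imp_deriv derivative_eq_intros)
  have "(\<lambda>x. x 0 + x 1) \<in> smooth_fun 2" using smooth_bilinear[of 0 2 1 0 1 1 0] by simp
  moreover have "cop C (\<lambda>_. 1) [a, b] = \<one>\<^bsub>alg C\<^esub>"
    using cconst_cop[OF C, of "[a, b]" 1] ab by (simp add: alg_def)
  ultimately have "d (cop C (\<lambda>x. x 0 + x 1) [a, b]) = d a \<oplus>\<^bsub>kaehler C\<^esub> d b"
    using d_binary[OF ab, of "\<lambda>x. x 0 + x 1"] ab d_closed unfolding p by simp
  then show ?thesis by (simp add: alg_def)
qed

lemma d_mult: "a \<in> carrier C \<Longrightarrow> b \<in> carrier C \<Longrightarrow>
  d (a \<otimes>\<^bsub>alg C\<^esub> b) = a \<odot>\<^bsub>kaehler C\<^esub> d b \<oplus>\<^bsub>kaehler C\<^esub> b \<odot>\<^bsub>kaehler C\<^esub> d a"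
proof -
  assume ab: "a \<in> carrier C" "b \<in> carrier C"
  have p: "pderivative 0 (\<lambda>x. x 0 * x 1) = (\<lambda>x. x 1)" "pderivative 1 (\<lambda>x. x 0 * x 1) = (\<lambda>x. x 0)"
    by (auto simp: pderivative_def fun_eq_iff intro!: DERIV_imp_deriv derivative_eq_intros)
  have "(\<lambda>x. x 0 * x 1) \<in> smooth_fun 2" using smooth_bilinear[of 0 2 1 0 0 0 1] by simp
  moreover have "cop C (\<lambda>x. x 0) [a, b] = a" "cop C (\<lambda>x. x 1) [a, b] = b"
    using cop_coord[OF C, of "[a, b]" 0] cop_coord[OF C, of "[a, b]" 1] ab by simp_all
  ultimately show ?thesis
    using d_binary[OF ab, of "\<lambda>x. x 0 * x 1"] ab d_closed unfolding p
    by (simp add: alg_def M.a_comm)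
qed

lemma cconst_closed: "cconst C r \<in> carrier C"
  unfolding cconst_def by (rule cop_closed[OF C]) (auto intro: smooth_const)

lemma one_cconst: "\<one>\<^bsub>alg C\<^esub> = cconst C 1"
  by (simp add: alg_def)

lemma d_cconst: "d (cconst C r) = \<zero>\<^bsub>kaehler C\<^esub>"
proof -
  \<comment> \<open>The derivation law speaks of operations with at least one argument, so the
    constant is read as an operation in two variables and evaluated at the constant zero.\<close>
  let ?a = "cconst C 0"
  have a: "?a \<in> carrier C" by (rule cconst_closed)
  have p: "pderivative i (\<lambda>_. r) = (\<lambda>_. 0)" for i by (auto simp: pderivative_def)
  have z: "cop C (\<lambda>_. 0) [?a, ?a] = \<zero>\<^bsub>alg C\<^esub>" "cop C (\<lambda>_. r) [?a, ?a] = cconst C r"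
    by (subst cconst_cop[OF C, of "[?a, ?a]", symmetric]; use a in \<open>simp add: alg_def\<close>)+
  show ?thesis
    using d_binary[OF a a smooth_const, of r] d_closed[OF a] by (simp add: p z)
qed

lemma kaehler_quot:
  "u \<in> carrier (free_module (alg C) (carrier C)) \<Longrightarrow> kaehler_relations C +>\<^bsub>free_module (alg C) (carrier C)\<^esub> u \<in> carrier (kaehler C)"
  "u \<in> carrier (free_module (alg C) (carrier C)) \<Longrightarrow> v \<in> carrier (free_module (alg C) (carrier C)) \<Longrightarrow>
   (kaehler_relations C +>\<^bsub>free_module (alg C) (carrier C)\<^esub> u) \<oplus>\<^bsub>kaehler C\<^esub> (kaehler_relations C +>\<^bsub>free_module (alg C) (carrier C)\<^esub> v)
     = kaehler_relations C +>\<^bsub>free_module (alg C) (carrier C)\<^esub> (u \<oplus>\<^bsub>free_module (alg C) (carrier C)\<^esub> v)"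
  "r \<in> carrier C \<Longrightarrow> u \<in> carrier (free_module (alg C) (carrier C)) \<Longrightarrow>
   r \<odot>\<^bsub>kaehler C\<^esub> (kaehler_relations C +>\<^bsub>free_module (alg C) (carrier C)\<^esub> u)
     = kaehler_relations C +>\<^bsub>free_module (alg C) (carrier C)\<^esub> (r \<odot>\<^bsub>free_module (alg C) (carrier C)\<^esub> u)"
  "K \<in> carrier (kaehler C) \<Longrightarrow> \<exists>u\<in>carrier (free_module (alg C) (carrier C)). K = kaehler_relations C +>\<^bsub>free_module (alg C) (carrier C)\<^esub> u"
  using quot_module_module[OF free_module_module[OF alg_cring[OF C]] kaehler_relations_submodule[OF C], folded kaehler_def]
  by auto

lemma kaehler_induct [consumes 1, case_names zero basis add]:
  assumes "K \<in> carrier (kaehler C)"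
    and zero: "Q \<zero>\<^bsub>kaehler C\<^esub>"
    and basis: "\<And>r a. r \<in> carrier C \<Longrightarrow> a \<in> carrier C \<Longrightarrow> Q (r \<odot>\<^bsub>kaehler C\<^esub> d a)"
    and add: "\<And>x y. x \<in> carrier (kaehler C) \<Longrightarrow> y \<in> carrier (kaehler C) \<Longrightarrow> Q x \<Longrightarrow> Q y \<Longrightarrow> Q (x \<oplus>\<^bsub>kaehler C\<^esub> y)"
  shows "Q K"
proof -
  let ?F = "free_module (alg C) (carrier C)"
  interpret F: Module.module "alg C" ?F by (rule free_module_module[OF alg_cring[OF C]])
  obtain u where u: "u \<in> carrier ?F" "K = kaehler_relations C +>\<^bsub>?F\<^esub> u" using kaehler_quot(4) assms(1) by blast
  have "Q (kaehler_relations C +>\<^bsub>?F\<^esub> u)"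
    using alg_cring[OF C] u(1)
  proof (induction rule: free_module_induct)
    case zero
    show ?case
      using add_map_zero[OF F.abelian_group_axioms M.abelian_group_axioms module_map_add_map[OF kaehler_proj[OF C]]] assms(2)
      by simp
  next
    case (basis r a)
    then show ?case using kaehler_quot(3)[of r "basis_vec (alg C) a"] basis_vec_carrier[OF alg_cring[OF C], of a "carrier C"] assms(3)[of r a]
      by (simp add: kaehler_d_def)
  next
    case (add u v)
    then show ?case using assms(4)[OF kaehler_quot(1) kaehler_quot(1), of u v] kaehler_quot(2)[of u v] by metis
  qed
  with u(2) show ?thesis by simp
qed

text \<open>A substitute for \<open>kaehler_universal\<close>, which produces linear maps only. The
  coefficient \<open>r\<close> is handed to \<open>c\<close>, and the defining relation is tested
  with every multiplier, as \<open>quot_gen_add_lift\<close> requires.\<close>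

lemma kaehler_add_lift:
  assumes A: "abelian_group A"
    and c: "\<And>a. a \<in> carrier C \<Longrightarrow> add_map (alg C) A (c a)"
    and rel: "\<And>h as r. as \<noteq> [] \<Longrightarrow> set as \<subseteq> carrier C \<Longrightarrow> h \<in> smooth_fun (length as) \<Longrightarrow> r \<in> carrier C \<Longrightarrow>
      c (cop C h as) r = (\<Oplus>\<^bsub>A\<^esub>i\<in>{..<length as}. c (as ! i) (r \<otimes>\<^bsub>alg C\<^esub> cop C (pderivative i h) as))"
  shows "\<exists>\<phi>. add_map (kaehler C) A \<phi> \<and> (\<forall>r\<in>carrier C. \<forall>a\<in>carrier C. \<phi> (r \<odot>\<^bsub>kaehler C\<^esub> d a) = c a r)"
proof -
  let ?F = "free_module (alg C) (carrier C)" and ?e = "basis_vec (alg C)"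
  interpret A: abelian_group A by fact
  interpret F: Module.module "alg C" ?F by (rule free_module_module[OF alg_cring[OF C]])
  obtain \<psi> where \<psi>: "add_map ?F A \<psi>"
    and \<psi>e: "\<And>r a. r \<in> carrier C \<Longrightarrow> a \<in> carrier C \<Longrightarrow> \<psi> (r \<odot>\<^bsub>?F\<^esub> ?e a) = c a r"
    using free_module_add_lift[where S = "carrier C" and c = c, OF alg_cring[OF C] A] c by auto
  define S where "S = {?e (cop C h as) \<ominus>\<^bsub>?F\<^esub>
           (\<Oplus>\<^bsub>?F\<^esub>i\<in>{..<length as}. cop C (pderivative i h) as \<odot>\<^bsub>?F\<^esub> ?e (as ! i)) | h as.
         as \<noteq> [] \<and> set as \<subseteq> carrier C \<and> h \<in> smooth_fun (length as)}"
  have rels: "kaehler_relations C = gen_submodule (alg C) ?F S"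
    by (simp add: kaehler_relations_def Let_def S_def)
  have S: "S \<subseteq> carrier ?F" using rel_carrier[OF C] unfolding S_def by blast
  have "\<psi> (r \<odot>\<^bsub>?F\<^esub> g) = \<zero>\<^bsub>A\<^esub>" if r: "r \<in> carrier (alg C)" and g: "g \<in> S" for r g
  proof -
    obtain h as where g: "g = ?e (cop C h as) \<ominus>\<^bsub>?F\<^esub> (\<Oplus>\<^bsub>?F\<^esub>i\<in>{..<length as}. cop C (pderivative i h) as \<odot>\<^bsub>?F\<^esub> ?e (as ! i))"
      and a: "as \<noteq> []" "set as \<subseteq> carrier C" "h \<in> smooth_fun (length as)"
      using g unfolding S_def by blast
    note f = rel_facts[OF C a(2,3)]
    let ?t = "\<lambda>i. cop C (pderivative i h) as \<odot>\<^bsub>?F\<^esub> ?e (as ! i)"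
    have sum: "(\<Oplus>\<^bsub>?F\<^esub>i\<in>{..<length as}. ?t i) \<in> carrier ?F" by (rule F.finsum_closed[OF f(6)])
    have "\<psi> (r \<odot>\<^bsub>?F\<^esub> g) = \<psi> (r \<odot>\<^bsub>?F\<^esub> ?e (cop C h as)) \<ominus>\<^bsub>A\<^esub> \<psi> (r \<odot>\<^bsub>?F\<^esub> (\<Oplus>\<^bsub>?F\<^esub>i\<in>{..<length as}. ?t i))"
      unfolding g using r f(5) sum
      by (simp add: F.smult_diff add_map_diff[OF F.abelian_group_axioms A \<psi>])
    also have "r \<odot>\<^bsub>?F\<^esub> (\<Oplus>\<^bsub>?F\<^esub>i\<in>{..<length as}. ?t i) = (\<Oplus>\<^bsub>?F\<^esub>i\<in>{..<length as}. r \<odot>\<^bsub>?F\<^esub> ?t i)"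
      by (rule F.finsum_smult_ldistr) (use r f(6) in auto)
    also have "\<psi> \<dots> = (\<Oplus>\<^bsub>A\<^esub>i\<in>{..<length as}. \<psi> (r \<odot>\<^bsub>?F\<^esub> ?t i))"
      by (rule add_map_finsum[OF F.abelian_group_axioms A \<psi>]) (use r f(6) in auto)
    also have "\<dots> = (\<Oplus>\<^bsub>A\<^esub>i\<in>{..<length as}. c (as ! i) (r \<otimes>\<^bsub>alg C\<^esub> cop C (pderivative i h) as))"
    proof (rule A.finsum_cong')
      fix i assume "i \<in> {..<length as}"
      then have i: "i < length as" by simp
      have "r \<odot>\<^bsub>?F\<^esub> ?t i = (r \<otimes>\<^bsub>alg C\<^esub> cop C (pderivative i h) as) \<odot>\<^bsub>?F\<^esub> ?e (as ! i)"
        using r f(2)[OF i] f(4)[OF i] by (simp add: F.smult_assoc1)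
      moreover have "r \<otimes>\<^bsub>alg C\<^esub> cop C (pderivative i h) as \<in> carrier C" using r f(2)[OF i] R.m_closed by simp
      ultimately show "\<psi> (r \<odot>\<^bsub>?F\<^esub> ?t i) = c (as ! i) (r \<otimes>\<^bsub>alg C\<^esub> cop C (pderivative i h) as)"
        using f(3)[OF i] \<psi>e by simp
    next
      have "c (as ! i) (r \<otimes>\<^bsub>alg C\<^esub> cop C (pderivative i h) as) \<in> carrier A" if i: "i < length as" for i
        by (rule add_map_closed[OF c[OF f(3)[OF i]]]) (use r f(2)[OF i] R.m_closed in simp)
      then show "(\<lambda>i. c (as ! i) (r \<otimes>\<^bsub>alg C\<^esub> cop C (pderivative i h) as)) \<in> {..<length as} \<rightarrow> carrier A" by auto
    qed simp
    also have "\<dots> = c (cop C h as) r" using rel[OF a] r by simp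
    also have "\<psi> (r \<odot>\<^bsub>?F\<^esub> ?e (cop C h as)) = c (cop C h as) r" using r f(1) \<psi>e by simp
    finally show ?thesis using add_map_closed[OF c[OF f(1)] r] by (simp add: A.diff_self)
  qed
  with quot_gen_add_lift[OF F.module_axioms S A \<psi>]
  obtain \<phi> where \<phi>: "add_map (kaehler C) A \<phi>" "\<And>u. u \<in> carrier ?F \<Longrightarrow> \<phi> (kaehler_relations C +>\<^bsub>?F\<^esub> u) = \<psi> u"
    unfolding kaehler_def rels by metis
  have "\<phi> (r \<odot>\<^bsub>kaehler C\<^esub> d a) = c a r" if "r \<in> carrier C" "a \<in> carrier C" for r a
    using that \<phi>(2)[of "r \<odot>\<^bsub>?F\<^esub> ?e a"] kaehler_quot(3)[of r "?e a"] basis_vec_carrier[OF alg_cring[OF C], of a "carrier C"] \<psi>e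
    by (simp add: kaehler_d_def)
  with \<phi>(1) show ?thesis by blast
qed

text \<open>The differential of \<open>r\<close> as a form. The first exterior power is a quotient
  in its own right and not the module \<open>kaehler C\<close>, so the class \<open>d r\<close> has
  to be carried there by \<open>w\<close>.\<close>

definition d0 :: "'a \<Rightarrow> (('a \<Rightarrow> 'a) set list \<Rightarrow> 'a) set" where
  "d0 r = w [d r]"

lemma w1_add: "x \<in> carrier (kaehler C) \<Longrightarrow> y \<in> carrier (kaehler C) \<Longrightarrow> w [x \<oplus>\<^bsub>kaehler C\<^esub> y] = w [x] \<oplus>\<^bsub>E 1\<^esub> w [y]"
  using w_add[of "[]" x y "[]" 1] by simp

lemma w1_smult: "x \<in> carrier (kaehler C) \<Longrightarrow> r \<in> carrier C \<Longrightarrow> w [r \<odot>\<^bsub>kaehler C\<^esub> x] = r \<odot>\<^bsub>E 1\<^esub> w [x]"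
  using w_smult[of "[]" r x "[]" 1] by simp

lemma w1_add_map: "add_map (kaehler C) (E 1) (\<lambda>x. w [x])"
  by (rule add_mapI) (auto simp: w1_add intro: w_closed)

lemma d0_closed: "a \<in> carrier C \<Longrightarrow> d0 a \<in> carrier (E 1)"
  unfolding d0_def by (rule w_closed) (auto intro: d_closed)

lemma d0_add: "a \<in> carrier C \<Longrightarrow> b \<in> carrier C \<Longrightarrow> d0 (a \<oplus>\<^bsub>alg C\<^esub> b) = d0 a \<oplus>\<^bsub>E 1\<^esub> d0 b"
  by (simp add: d0_def d_add w1_add d_closed)

lemma d0_mult: "a \<in> carrier C \<Longrightarrow> b \<in> carrier C \<Longrightarrow>
    d0 (a \<otimes>\<^bsub>alg C\<^esub> b) = a \<odot>\<^bsub>E 1\<^esub> d0 b \<oplus>\<^bsub>E 1\<^esub> b \<odot>\<^bsub>E 1\<^esub> d0 a"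
  by (simp add: d0_def d_mult w1_add w1_smult d_closed)

lemma d0_cop:
  assumes "as \<noteq> []" "set as \<subseteq> carrier C" "h \<in> smooth_fun (length as)"
  shows "d0 (cop C h as) = (\<Oplus>\<^bsub>E 1\<^esub>i\<in>{..<length as}. cop C (pderivative i h) as \<odot>\<^bsub>E 1\<^esub> d0 (as ! i))"
proof -
  interpret E: Module.module "alg C" "E 1" by (rule E_module)
  note f = rel_facts[OF C assms(2,3)]
  have "d0 (cop C h as) = (\<Oplus>\<^bsub>E 1\<^esub>i\<in>{..<length as}. w [cop C (pderivative i h) as \<odot>\<^bsub>kaehler C\<^esub> d (as ! i)])"
    unfolding d0_def derivation[OF assms]
    by (rule add_map_finsum[OF M.abelian_group_axioms E.abelian_group_axioms w1_add_map])
       (use f d_closed in auto)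
  also have "\<dots> = (\<Oplus>\<^bsub>E 1\<^esub>i\<in>{..<length as}. cop C (pderivative i h) as \<odot>\<^bsub>E 1\<^esub> d0 (as ! i))"
    by (rule E.finsum_cong') (use f d_closed d0_closed in \<open>auto simp: w1_smult d0_def\<close>)
  finally show ?thesis .
qed

text \<open>The second derivatives are symmetric and the wedge products antisymmetric.\<close>

lemma second_derivatives_cancel:
  assumes "as \<noteq> []" "set as \<subseteq> carrier C" "h \<in> smooth_fun (length as)"
  shows "(\<Oplus>\<^bsub>E 2\<^esub>i\<in>{..<length as}. P 1 1 (d0 (cop C (pderivative i h) as)) (d0 (as ! i))) = \<zero>\<^bsub>E 2\<^esub>"
proof -
  interpret E: Module.module "alg C" "E 2" by (rule E_module)
  interpret E1: Module.module "alg C" "E 1" by (rule E_module)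
  let ?n = "length as"
  have dd: "d0 (as ! i) \<in> carrier (E 1)" if "i < ?n" for i using that assms(2) by (intro d0_closed) auto
  have cc: "cop C (pderivative j (pderivative i h)) as \<in> carrier C" if "i < ?n" "j < ?n" for i j
    using that assms by (intro cop_closed[OF C] smooth_fun_pderivative_closed)
  let ?f = "\<lambda>i j. cop C (pderivative j (pderivative i h)) as \<odot>\<^bsub>E 2\<^esub> P 1 1 (d0 (as ! j)) (d0 (as ! i))"
  have pp: "P 1 1 (d0 (as ! j)) (d0 (as ! i)) \<in> carrier (E 2)" if "i < ?n" "j < ?n" for i j
    using that dd by (intro P_closed) auto
  \<comment> \<open>Expanding the differential of each first derivative turns the sum into a double
    sum over the second derivatives.\<close>
  have row: "P 1 1 (d0 (cop C (pderivative i h) as)) (d0 (as ! i)) = (\<Oplus>\<^bsub>E 2\<^esub>j\<in>{..<?n}. ?f i j)" if i: "i < ?n" for i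
  proof -
    have s: "pderivative i h \<in> smooth_fun ?n" by (rule smooth_fun_pderivative_closed[OF assms(3) i])
    have "P 1 1 (d0 (cop C (pderivative i h) as)) (d0 (as ! i)) =
        (\<Oplus>\<^bsub>E 2\<^esub>j\<in>{..<?n}. P 1 1 (cop C (pderivative j (pderivative i h)) as \<odot>\<^bsub>E 1\<^esub> d0 (as ! j)) (d0 (as ! i)))"
      unfolding d0_cop[OF assms(1,2) s]
      by (rule add_map_finsum[OF E_abelian_group E_abelian_group P_add_map_l[OF dd[OF i]]])
         (use dd cc i in auto)
    also have "\<dots> = (\<Oplus>\<^bsub>E 2\<^esub>j\<in>{..<?n}. ?f i j)"
      by (rule E.finsum_cong') (use dd cc i pp in \<open>auto simp: P_smult_l[of _ 1 _ 1 _ 2]\<close>)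
    finally show ?thesis .
  qed
  have "(\<Oplus>\<^bsub>E 2\<^esub>i\<in>{..<?n}. P 1 1 (d0 (cop C (pderivative i h) as)) (d0 (as ! i))) =
      (\<Oplus>\<^bsub>E 2\<^esub>i\<in>{..<?n}. \<Oplus>\<^bsub>E 2\<^esub>j\<in>{..<?n}. ?f i j)"
    by (rule E.finsum_cong') (use row cc pp in \<open>auto intro!: E.finsum_closed\<close>)
  also have "\<dots> = \<zero>\<^bsub>E 2\<^esub>"
  proof (rule E.finsum_alternating)
    show "?f i j \<in> carrier (E 2)" if "i < ?n" "j < ?n" for i j using that cc pp by simp
    have *: "P 1 1 (d0 a) (d0 a) = \<zero>\<^bsub>E 2\<^esub>" if "a \<in> carrier C" for a
      unfolding d0_def using P_wedge[of "[d a]" 1 "[d a]" 1] w_alt[of "[]" "d a" "[]" 2] d_closed[OF that] by simp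
    show "?f i i = \<zero>\<^bsub>E 2\<^esub>" if "i < ?n" for i
    proof -
      have "as ! i \<in> carrier C" using assms(2) nth_mem[OF that] by blast
      then show ?thesis using * cc[OF that that] by simp
    qed
    show "?f i j \<oplus>\<^bsub>E 2\<^esub> ?f j i = \<zero>\<^bsub>E 2\<^esub>" if "i < ?n" "j < ?n" for i j
      unfolding P_anti[OF dd[OF that(1)] dd[OF that(2)]] pderivative_commute[OF assms(3) that]
      using cc[OF that(2,1)] cc[OF that] pp[OF that] by (simp add: E.smult_r_minus E.r_neg pderivative_commute[OF assms(3) that])
  qed
  finally show ?thesis .
qed

text \<open>On a relation with multiplier \<open>r\<close> the product rule for \<open>d0\<close>
  splits the sum in two. The part with differentials of partial derivatives is \<open>r\<close>
  times the sum in \<open>second_derivatives_cancel\<close>; the other part is \<open>d0 r\<close>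
  multiplied by the expansion \<open>d0_cop\<close>.\<close>

lemma d1_ex: "\<exists>\<phi>. add_map (kaehler C) (E 2) \<phi> \<and>
    (\<forall>r\<in>carrier C. \<forall>a\<in>carrier C. \<phi> (r \<odot>\<^bsub>kaehler C\<^esub> d a) = P 1 1 (d0 r) (d0 a))"
proof (rule kaehler_add_lift[OF E_abelian_group])
  interpret E: Module.module "alg C" "E 2" by (rule E_module)
  interpret E1: Module.module "alg C" "E 1" by (rule E_module)
  show "add_map (alg C) (E 2) (\<lambda>r. P 1 1 (d0 r) (d0 a))" if "a \<in> carrier C" for a
    by (rule add_mapI) (use that in \<open>auto simp: d0_closed d0_add P_add_l[of _ 1 _ _ 1 2] intro!: P_closed\<close>)
  fix h as r assume a: "as \<noteq> []" "set as \<subseteq> carrier C" "h \<in> smooth_fun (length as)" and r: "r \<in> carrier C"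
  let ?n = "length as" and ?p = "\<lambda>i. cop C (pderivative i h) as"
  note f = rel_facts[OF C a(2,3)]
  have cc: "?p i \<in> carrier C" "d0 (?p i) \<in> carrier (E 1)" "d0 (as ! i) \<in> carrier (E 1)" "d0 r \<in> carrier (E 1)"
    "P 1 1 (d0 (?p i)) (d0 (as ! i)) \<in> carrier (E 2)" "P 1 1 (d0 r) (d0 (as ! i)) \<in> carrier (E 2)" if "i < ?n" for i
    using f(2,3)[of i] that r by (auto intro!: d0_closed P_closed)
  have "(\<Oplus>\<^bsub>E 2\<^esub>i\<in>{..<?n}. P 1 1 (d0 (r \<otimes>\<^bsub>alg C\<^esub> ?p i)) (d0 (as ! i))) =
      (\<Oplus>\<^bsub>E 2\<^esub>i\<in>{..<?n}. r \<odot>\<^bsub>E 2\<^esub> P 1 1 (d0 (?p i)) (d0 (as ! i)) \<oplus>\<^bsub>E 2\<^esub> ?p i \<odot>\<^bsub>E 2\<^esub> P 1 1 (d0 r) (d0 (as ! i)))"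
    by (rule E.finsum_cong')
      (use cc r in \<open>auto simp: d0_mult P_add_l[of _ 1 _ _ 1 2] P_smult_l[of _ 1 _ 1 _ 2]\<close>)
  also have "\<dots> = (\<Oplus>\<^bsub>E 2\<^esub>i\<in>{..<?n}. r \<odot>\<^bsub>E 2\<^esub> P 1 1 (d0 (?p i)) (d0 (as ! i))) \<oplus>\<^bsub>E 2\<^esub>
      (\<Oplus>\<^bsub>E 2\<^esub>i\<in>{..<?n}. ?p i \<odot>\<^bsub>E 2\<^esub> P 1 1 (d0 r) (d0 (as ! i)))"
    by (rule E.finsum_addf) (use cc r in auto)
  also have "(\<Oplus>\<^bsub>E 2\<^esub>i\<in>{..<?n}. r \<odot>\<^bsub>E 2\<^esub> P 1 1 (d0 (?p i)) (d0 (as ! i))) =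
      r \<odot>\<^bsub>E 2\<^esub> (\<Oplus>\<^bsub>E 2\<^esub>i\<in>{..<?n}. P 1 1 (d0 (?p i)) (d0 (as ! i)))"
    by (rule E.finsum_smult_ldistr[symmetric]) (use cc r in auto)
  also have "\<dots> = \<zero>\<^bsub>E 2\<^esub>" unfolding second_derivatives_cancel[OF a] using r by simp
  also have "\<zero>\<^bsub>E 2\<^esub> \<oplus>\<^bsub>E 2\<^esub> (\<Oplus>\<^bsub>E 2\<^esub>i\<in>{..<?n}. ?p i \<odot>\<^bsub>E 2\<^esub> P 1 1 (d0 r) (d0 (as ! i))) =
      (\<Oplus>\<^bsub>E 2\<^esub>i\<in>{..<?n}. ?p i \<odot>\<^bsub>E 2\<^esub> P 1 1 (d0 r) (d0 (as ! i)))"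
    using cc by (intro E.l_zero E.finsum_closed) auto
  also have "\<dots> = (\<Oplus>\<^bsub>E 2\<^esub>i\<in>{..<?n}. P 1 1 (d0 r) (?p i \<odot>\<^bsub>E 1\<^esub> d0 (as ! i)))"
    by (rule E.finsum_cong') (use cc r in \<open>auto simp: P_smult_r[of _ 1 _ 1 _ 2] intro!: P_closed\<close>)
  also have "\<dots> = P 1 1 (d0 r) (d0 (cop C h as))"
    unfolding d0_cop[OF a]
    by (rule add_map_finsum[OF E_abelian_group E_abelian_group P_add_map_r[OF d0_closed[OF r]], symmetric]) (use cc in auto)
  finally show "P 1 1 (d0 r) (d0 (cop C h as)) = (\<Oplus>\<^bsub>E 2\<^esub>i\<in>{..<?n}. P 1 1 (d0 (r \<otimes>\<^bsub>alg C\<^esub> ?p i)) (d0 (as ! i)))"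
    by simp
qed

definition d1 :: "('a \<Rightarrow> 'a) set \<Rightarrow> (('a \<Rightarrow> 'a) set list \<Rightarrow> 'a) set" where
  "d1 = (SOME \<phi>. add_map (kaehler C) (E 2) \<phi> \<and>
    (\<forall>r\<in>carrier C. \<forall>a\<in>carrier C. \<phi> (r \<odot>\<^bsub>kaehler C\<^esub> d a) = P 1 1 (d0 r) (d0 a)))"

lemma d1_add_map: "add_map (kaehler C) (E 2) d1"
  and d1_basis: "r \<in> carrier C \<Longrightarrow> a \<in> carrier C \<Longrightarrow> d1 (r \<odot>\<^bsub>kaehler C\<^esub> d a) = P 1 1 (d0 r) (d0 a)"
  using someI_ex[OF d1_ex] unfolding d1_def by blast+

text \<open>This is the law that \<open>ext_derivation\<close> demands of \<open>d1\<close>. Both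
  sides are additive in \<open>x\<close>, and on a multiple of \<open>d a\<close> the law is the
  product rule for \<open>d0\<close>.\<close>

lemma d1_smult:
  assumes r: "r \<in> carrier C" and x: "x \<in> carrier (kaehler C)"
  shows "d1 (r \<odot>\<^bsub>kaehler C\<^esub> x) = P 1 1 (d0 r) (w [x]) \<oplus>\<^bsub>E 2\<^esub> r \<odot>\<^bsub>E 2\<^esub> d1 x"
  using x
proof (induction rule: kaehler_induct)
  interpret E: Module.module "alg C" "E 2" by (rule E_module)
  interpret E1: Module.module "alg C" "E 1" by (rule E_module)
  {
    case zero
    have "w [\<zero>\<^bsub>kaehler C\<^esub>] = \<zero>\<^bsub>E 1\<^esub>"
      by (rule add_map_zero[OF M.abelian_group_axioms E1.abelian_group_axioms w1_add_map])
    moreover have "d1 \<zero>\<^bsub>kaehler C\<^esub> = \<zero>\<^bsub>E 2\<^esub>"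
      by (rule add_map_zero[OF M.abelian_group_axioms E.abelian_group_axioms d1_add_map])
    moreover have "P 1 1 (d0 r) \<zero>\<^bsub>E 1\<^esub> = \<zero>\<^bsub>E 2\<^esub>" by (rule P_zero_r[OF d0_closed[OF r]]) simp
    moreover have "r \<odot>\<^bsub>kaehler C\<^esub> \<zero>\<^bsub>kaehler C\<^esub> = \<zero>\<^bsub>kaehler C\<^esub>" "r \<odot>\<^bsub>E 2\<^esub> \<zero>\<^bsub>E 2\<^esub> = \<zero>\<^bsub>E 2\<^esub>"
      using r by simp_all
    ultimately show ?case by (simp only: E.l_zero E.zero_closed)
  next
    case (basis s a)
    have "r \<odot>\<^bsub>kaehler C\<^esub> (s \<odot>\<^bsub>kaehler C\<^esub> d a) = (r \<otimes>\<^bsub>alg C\<^esub> s) \<odot>\<^bsub>kaehler C\<^esub> d a"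
      using basis r d_closed by (simp add: smult_assoc1)
    moreover have "r \<otimes>\<^bsub>alg C\<^esub> s \<in> carrier C" using r basis R.m_closed[of r s] by simp
    ultimately have "d1 (r \<odot>\<^bsub>kaehler C\<^esub> (s \<odot>\<^bsub>kaehler C\<^esub> d a)) = P 1 1 (d0 (r \<otimes>\<^bsub>alg C\<^esub> s)) (d0 a)"
      using basis by (simp add: d1_basis)
    then show ?case
      using basis r d0_closed d_closed P_closed[of "d0 s" 1 "d0 a" 1 2] P_closed[of "d0 r" 1 "d0 a" 1 2]
      by (simp add: d1_basis w1_smult d0_mult P_add_l[of _ 1 _ _ 1 2]
          P_smult_l[of _ 1 _ 1 _ 2] P_smult_r[of _ 1 _ 1 _ 2] d0_def[symmetric] E.a_comm)
  next
    case (add x y)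
    have "w [x] \<in> carrier (E 1)" "w [y] \<in> carrier (E 1)" using add by (auto intro: w_closed)
    then show ?case
      using add r d0_closed[OF r] P_closed[of "d0 r" 1 "w [x]" 1 2] P_closed[of "d0 r" 1 "w [y]" 1 2]
      by (simp add: smult_r_distr add_map_add[OF d1_add_map] add_map_closed[OF d1_add_map] w1_add
          P_add_r[of _ 1 _ 1 _ 2] E.smult_r_distr E.a_ac)
  }
qed

end

sublocale smooth_ring \<subseteq> ext_derivation "alg C" "kaehler C" d0 d1
proof (intro ext_derivation.intro ext_derivation_axioms.intro)
  show "ext_alg (alg C) (kaehler C)" by unfold_locales
  show "add_map (alg C) (E 1) d0" by (rule add_mapI) (simp_all add: d0_closed d0_add)
  show "add_map (kaehler C) (E 2) d1" by (rule d1_add_map)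
  show "d0 (r \<otimes>\<^bsub>alg C\<^esub> s) = r \<odot>\<^bsub>E 1\<^esub> d0 s \<oplus>\<^bsub>E 1\<^esub> s \<odot>\<^bsub>E 1\<^esub> d0 r"
    if "r \<in> carrier (alg C)" "s \<in> carrier (alg C)" for r s
    by (rule d0_mult) (use that in simp_all)
  show "d1 (r \<odot>\<^bsub>kaehler C\<^esub> x) = P 1 1 (d0 r) (w [x]) \<oplus>\<^bsub>E 2\<^esub> r \<odot>\<^bsub>E 2\<^esub> d1 x"
    if "r \<in> carrier (alg C)" "x \<in> carrier (kaehler C)" for r x
    by (rule d1_smult) (use that in simp_all)
qed

section \<open>The algebra of forms as a CDGA and the uniqueness of its differential\<close>

context smooth_ring
begin

lemma d0_cconst: "d0 (cconst C r) = \<zero>\<^bsub>E 1\<^esub>"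
  unfolding d0_def d_cconst by (rule add_map_zero[OF M.abelian_group_axioms E_abelian_group w1_add_map])

lemma D_d0: "a \<in> carrier C \<Longrightarrow> D 1 (d0 a) = \<zero>\<^bsub>E 2\<^esub>"
  \<comment> \<open>With \<open>d a\<close> written as one times \<open>d a\<close>,
    \<open>d1_basis\<close> gives \<open>d0\<close> of one times \<open>d0 a\<close>, and
    \<open>d0\<close> of one is zero.\<close>
  using D_degree_1[of "d a"] d1_basis[of "\<one>\<^bsub>alg C\<^esub>" a] d_closed[of a] R.one_closed P_zero_l[OF d0_closed, of a 1 2]
  by (simp add: d0_one) (simp add: d0_def)

text \<open>On a multiple \<open>r d a\<close> the value of \<open>d1\<close> is the product of
  \<open>d0 r\<close> and \<open>d0 a\<close>, and \<open>D\<close> kills both factors by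
  \<open>D_d0\<close>.\<close>

lemma D_d1: "x \<in> carrier (kaehler C) \<Longrightarrow> D 2 (d1 x) = \<zero>\<^bsub>E 3\<^esub>"
proof (induction rule: kaehler_induct)
  case zero
  show ?case using D_zero[of 2] add_map_zero[OF M.abelian_group_axioms E_abelian_group d1_add_map] by simp
next
  case (basis r a)
  note c = d0_closed[OF basis(1)] d0_closed[OF basis(2)]
  interpret E: Module.module "alg C" "E 3" by (rule E_module)
  show ?case using D_product[OF c] P_zero_l[OF c(2), of 2 3] P_zero_r[OF c(1), of 2 3] basis
    by (simp add: d1_basis D_d0 signed_zero)
next
  case (add x y)
  interpret E: Module.module "alg C" "E 3" by (rule E_module)
  show ?case using D_add[of "d1 x" 2 "d1 y"] add by (simp add: add_map_add[OF d1_add_map] add_map_closed[OF d1_add_map])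
qed

lemma form_deg_E: "form_deg C = E" and form_prd_P: "form_prd C = P"
  by (simp_all add: form_deg_def form_prd_def)

lemma forms_graded_algebra: "graded_algebra C (form_deg C) (form_prd C)"
  unfolding graded_algebra_def form_deg_E form_prd_P
  by (intro conjI allI ballI E_module P_closed P_commute P_add_l P_add_r P_smult_l P_smult_r P_assoc) simp_all

lemma D_graded_derivation: "graded_derivation C (form_deg C) (form_prd C) D"
  unfolding graded_derivation_def form_deg_E form_prd_P
proof (intro conjI allI ballI)
  fix k :: int and r x assume x: "x \<in> carrier (E k)"
  interpret E: Module.module "alg C" "E (k + 1)" by (rule E_module)
  show "D k (cconst C r \<odot>\<^bsub>E k\<^esub> x) = cconst C r \<odot>\<^bsub>E (k + 1)\<^esub> D k x"
    using x D_closed[OF x] P_zero_l[OF x, of 1 "k + 1"] by (simp add: D_smult cconst_closed d0_cconst)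
qed (simp_all add: D_closed D_add D_product Pi_iff)

lemma D_square_zero: "square_zero (form_deg C) D"
  unfolding square_zero_def form_deg_E by (intro allI ballI DD D_d0 D_d1) simp_all

lemma simple_form_E: "int (length as) = k \<Longrightarrow> simple_form C a as = a \<odot>\<^bsub>E k\<^esub> w (map d as)"
  by (auto simp: simple_form_def form_deg_E)

lemma map_d: "set as \<subseteq> carrier C \<Longrightarrow> set (map d as) \<subseteq> carrier (kaehler C)"
  using d_closed by auto

lemma simple_form_closed: "a \<in> carrier C \<Longrightarrow> set as \<subseteq> carrier C \<Longrightarrow> int (length as) = k \<Longrightarrow> simple_form C a as \<in> carrier (E k)"
  unfolding simple_form_E using Module.module.smult_closed[OF E_module] w_closed[OF map_d] by simp

lemma D_degree_0_form: "a \<in> carrier C \<Longrightarrow> D 0 (simple_form C a []) = simple_form C (cconst C 1) [a]"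
  using simple_form_E[of "[]" 0 a] simple_form_E[of "[a]" 1 "cconst C 1"] D_degree_0[of a]
    Module.module.smult_one[OF E_module d0_closed] by (simp add: one_cconst[symmetric]) (simp add: d0_def)

text \<open>The slots of a wedge are treated from left to right. The list \<open>as\<close> collects
  those already reduced to a differential \<open>d a\<close>, and the coefficient of the current
  slot moves into \<open>r\<close>; sums in a slot are split by \<open>w_add\<close>. Since
  \<open>r\<close> and \<open>as\<close> change on the way, both are arbitrary in the
  induction.\<close>

lemma forms_induct [consumes 1, case_names zero simple add]:
  assumes "K \<in> carrier (E k)"
    and zero: "Q \<zero>\<^bsub>E k\<^esub>"
    and simple: "\<And>a as. a \<in> carrier C \<Longrightarrow> set as \<subseteq> carrier C \<Longrightarrow> int (length as) = k \<Longrightarrow> Q (simple_form C a as)"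
    and add: "\<And>x y. x \<in> carrier (E k) \<Longrightarrow> y \<in> carrier (E k) \<Longrightarrow> Q x \<Longrightarrow> Q y \<Longrightarrow> Q (x \<oplus>\<^bsub>E k\<^esub> y)"
  shows "Q K"
  using assms(1)
proof (induction rule: ext_induct)
  interpret E: Module.module "alg C" "E k" by (rule E_module)
  case (wedge r xs)
  have "Q (r \<odot>\<^bsub>E k\<^esub> w (map d as @ xs))"
    if "r \<in> carrier C" "set as \<subseteq> carrier C" "set xs \<subseteq> carrier (kaehler C)" "int (length as + length xs) = k" for r as xs
    using that
  proof (induction xs arbitrary: r as)
    case Nil
    then show ?case using simple[of r as] simple_form_E[of as k r] by simp
  next
    case (Cons x xs)
    have k: "int (length (map d as) + 1 + length xs) = k" and xs: "set xs \<subseteq> carrier (kaehler C)" using Cons.prems by auto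
    have wc: "w (map d as @ x # xs) \<in> carrier (E k)" if "x \<in> carrier (kaehler C)" for x
      by (rule w_closed) (use that Cons.prems d_closed in auto)
    from Cons.prems(3) have "x \<in> carrier (kaehler C)" by simp
    then show ?case
    proof (induction rule: kaehler_induct)
      case zero
      \<comment> \<open>Zero is written as a zero multiple, so that \<open>w_smult\<close> makes the
        wedge vanish.\<close>
      have "w (map d as @ (\<zero>\<^bsub>alg C\<^esub> \<odot>\<^bsub>kaehler C\<^esub> \<zero>\<^bsub>kaehler C\<^esub>) # xs) = \<zero>\<^bsub>alg C\<^esub> \<odot>\<^bsub>E k\<^esub> w (map d as @ \<zero>\<^bsub>kaehler C\<^esub> # xs)"
        by (rule w_smult) (use map_d[OF Cons.prems(2)] xs k in auto)
      then show ?case using assms(2) wc[OF M.zero_closed] Cons.prems(1) by simp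
    next
      case (basis s a)
      have "w (map d as @ (s \<odot>\<^bsub>kaehler C\<^esub> d a) # xs) = s \<odot>\<^bsub>E k\<^esub> w (map d as @ d a # xs)"
        by (rule w_smult) (use map_d[OF Cons.prems(2)] xs k basis d_closed in auto)
      moreover have "Q ((r \<otimes>\<^bsub>alg C\<^esub> s) \<odot>\<^bsub>E k\<^esub> w (map d (as @ [a]) @ xs))"
        by (rule Cons.IH) (use Cons.prems basis R.m_closed[of r s] in auto)
      ultimately show ?case using Cons.prems basis wc[OF d_closed[OF basis(2)]] by (simp add: E.smult_assoc1)
    next
      case (add x y)
      have "w (map d as @ (x \<oplus>\<^bsub>kaehler C\<^esub> y) # xs) = w (map d as @ x # xs) \<oplus>\<^bsub>E k\<^esub> w (map d as @ y # xs)"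
        by (rule w_add) (use map_d[OF Cons.prems(2)] xs k add in auto)
      then show ?case using assms(4)[OF _ _ add(3,4)] Cons.prems wc add by (simp add: E.smult_r_distr)
    qed
  qed
  from this[of r "[]" xs] wedge show ?case by simp
qed (use assms in auto)

lemma P_simple:
  assumes "a \<in> carrier C" "set as \<subseteq> carrier C" "int (length as) = k" "b \<in> carrier C" "set bs \<subseteq> carrier C" "int (length bs) = l"
  shows "P k l (simple_form C a as) (simple_form C b bs) = simple_form C (a \<otimes>\<^bsub>alg C\<^esub> b) (as @ bs)"
proof -
  interpret E: Module.module "alg C" "E (k + l)" by (rule E_module)
  interpret El: Module.module "alg C" "E l" by (rule E_module)
  have wc: "w (map d as) \<in> carrier (E k)" "w (map d bs) \<in> carrier (E l)" "w (map d as @ map d bs) \<in> carrier (E (k + l))"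
    by (rule w_closed; use assms map_d[of as] map_d[of bs] in simp)+
  show ?thesis
    using assms wc P_wedge[of "map d as" k "map d bs" l] map_d
    by (simp add: simple_form_E[of as k] simple_form_E[of bs l] simple_form_E[of "as @ bs" "k + l"]
        P_smult_l[of _ k _ l _ "k + l"] P_smult_r[of _ k _ l _ "k + l"] E.smult_assoc1)
qed

text \<open>A differential of a 0-form is killed by \<open>D'\<close> because the square of
  \<open>D'\<close> is zero; the Leibniz rule then kills products of such differentials, and only
  the coefficient gets differentiated. As \<open>D'\<close> is arbitrary, the lemma serves both to
  compute \<open>D\<close> and to compare it with any competitor.\<close>

lemma derivation_simple:
  assumes gd: "graded_derivation C (form_deg C) (form_prd C) D'" and sz: "square_zero (form_deg C) D'"
    and D0: "\<And>a. a \<in> carrier C \<Longrightarrow> D' 0 (simple_form C a []) = simple_form C (cconst C 1) [a]"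
    and a: "a \<in> carrier C" "set as \<subseteq> carrier C" "int (length as) = k"
  shows "D' k (simple_form C a as) = simple_form C (cconst C 1) (a # as)"
proof -
  let ?s = "simple_form C (cconst C 1)"
  note one = cconst_closed[of 1]
  have cl: "D' k x \<in> carrier (E (k + 1))" if "x \<in> carrier (E k)" for k x
    using gd that unfolding graded_derivation_def form_deg_E by blast
  have prod: "D' (k + l) (P k l x y) =
          P (k + 1) l (D' k x) y \<oplus>\<^bsub>E (k + l + 1)\<^esub> signed (E (k + l + 1)) k (P k (l + 1) x (D' l y))"
    if "x \<in> carrier (E k)" "y \<in> carrier (E l)" for k l x y
    using gd that unfolding graded_derivation_def form_deg_E form_prd_P by blast
  have z: "D' 1 (?s [a]) = \<zero>\<^bsub>E 2\<^esub>" if "a \<in> carrier C" for a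
    using sz D0[OF that] simple_form_closed[of a "[]" 0] that unfolding square_zero_def form_deg_E by fastforce
  have z0: "D' (int (length as)) (?s as) = \<zero>\<^bsub>E (int (length as) + 1)\<^esub>" if "set as \<subseteq> carrier C" for as
    using that
  proof (induction as)
    case Nil
    \<comment> \<open>The empty product is the 0-form one, whose differential is the differential of
      a constant.\<close>
    have "?s [cconst C 1] = \<zero>\<^bsub>E 1\<^esub>"
      using simple_form_E[of "[cconst C 1]" 1 "cconst C 1"] Module.module.smult_one[OF E_module d0_closed[OF one]]
        d0_cconst[of 1] by (simp add: one_cconst[symmetric]) (simp add: d0_def one_cconst)
    then show ?case using D0[OF one] by simp
  next
    case (Cons a as)
    define l where "l = int (length as)"
    interpret E: Module.module "alg C" "E (l + 2)" by (rule E_module)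
    have c: "?s [a] \<in> carrier (E 1)" "?s as \<in> carrier (E l)"
      using Cons.prems one l_def by (auto intro!: simple_form_closed)
    have 1: "?s (a # as) = P 1 l (?s [a]) (?s as)"
      using P_simple[OF one, of "[a]" 1 "cconst C 1" as l] one Cons.prems R.l_one by (simp add: l_def one_cconst[symmetric])
    have 2: "P 2 l \<zero>\<^bsub>E 2\<^esub> (?s as) = \<zero>\<^bsub>E (l + 2)\<^esub>" by (rule P_zero_l[OF c(2)]) simp
    have 3: "P 1 (l + 1) (?s [a]) \<zero>\<^bsub>E (l + 1)\<^esub> = \<zero>\<^bsub>E (l + 2)\<^esub>" by (rule P_zero_r[OF c(1)]) simp
    have 4: "1 + l + 1 = l + 2" "1 + 1 = (2::int)" "int (length (a # as)) = 1 + l" by (simp_all add: l_def)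
    have 5: "D' 1 (?s [a]) = \<zero>\<^bsub>E 2\<^esub>" "D' l (?s as) = \<zero>\<^bsub>E (l + 1)\<^esub>"
      using z[of a] Cons by (simp_all add: l_def)
    have "D' (1 + l) (P 1 l (?s [a]) (?s as)) =
        P 2 l (D' 1 (?s [a])) (?s as) \<oplus>\<^bsub>E (l + 2)\<^esub> signed (E (l + 2)) 1 (P 1 (l + 1) (?s [a]) (D' l (?s as)))"
      using prod[OF c] unfolding 4 .
    also have "\<dots> = \<zero>\<^bsub>E (l + 2)\<^esub>" unfolding 5 2 3 signed_zero by simp
    finally show ?case unfolding 4 1 .
  qed
  have c: "simple_form C a [] \<in> carrier (E 0)" "?s as \<in> carrier (E k)" "?s [a] \<in> carrier (E 1)" "?s (a # as) \<in> carrier (E (k + 1))"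
    using a one by (auto intro!: simple_form_closed)
  interpret E: Module.module "alg C" "E (k + 1)" by (rule E_module)
  have "simple_form C a as = P 0 k (simple_form C a []) (?s as)"
    using P_simple[OF a(1), of "[]" 0 "cconst C 1" as k] one a R.r_one by (simp add: one_cconst[symmetric])
  moreover have "P 0 (k + 1) (simple_form C a []) \<zero>\<^bsub>E (k + 1)\<^esub> = \<zero>\<^bsub>E (k + 1)\<^esub>" by (rule P_zero_r[OF c(1)]) simp
  moreover have "P 1 k (?s [a]) (?s as) = ?s (a # as)"
    using P_simple[OF one, of "[a]" 1 "cconst C 1" as k] one a R.l_one by (simp add: one_cconst[symmetric])
  ultimately show ?thesis
    using prod[OF c(1,2)] D0[OF a(1)] z0[OF a(2)] a(3) c(4) by (simp add: signed_zero)
qed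

text \<open>A competitor agrees with \<open>D\<close> on simple forms by
  \<open>derivation_simple\<close>, hence on all forms by additivity; extensionality settles the
  values outside the carriers.\<close>

lemma form_dif_D: "form_dif C = D"
  unfolding form_dif_def
proof (rule the_equality)
  show "(\<forall>k. D k \<in> carrier (form_deg C k) \<rightarrow>\<^sub>E carrier (form_deg C (k + 1))) \<and>
     graded_derivation C (form_deg C) (form_prd C) D \<and> square_zero (form_deg C) D \<and>
     (\<forall>a\<in>carrier C. D 0 (simple_form C a []) = simple_form C (cconst C 1) [a])"
    using D_graded_derivation D_square_zero D_degree_0_form D_closed D_extensional
    by (simp add: PiE_iff form_deg_E)
next
  fix D' assume "(\<forall>k. D' k \<in> carrier (form_deg C k) \<rightarrow>\<^sub>E carrier (form_deg C (k + 1))) \<and>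
     graded_derivation C (form_deg C) (form_prd C) D' \<and> square_zero (form_deg C) D' \<and>
     (\<forall>a\<in>carrier C. D' 0 (simple_form C a []) = simple_form C (cconst C 1) [a])"
  then have D'_ext: "\<And>k. D' k \<in> extensional (carrier (E k))" and gd: "graded_derivation C (form_deg C) (form_prd C) D'"
    and sz: "square_zero (form_deg C) D'" and D0: "\<And>a. a \<in> carrier C \<Longrightarrow> D' 0 (simple_form C a []) = simple_form C (cconst C 1) [a]"
    by (simp_all add: PiE_iff form_deg_E)
  have am: "add_map (E k) (E (k + 1)) (D' k)" for k
    using gd unfolding graded_derivation_def form_deg_E add_map_def by blast
  have "D' k x = D k x" if "x \<in> carrier (E k)" for k x
    using that
  proof (induction rule: forms_induct)
    case zero
    show ?case using add_map_zero[OF E_abelian_group E_abelian_group am] D_zero by metis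
  next
    case (simple a as)
    then show ?case
      using derivation_simple[OF gd sz D0 simple]
        derivation_simple[OF D_graded_derivation D_square_zero D_degree_0_form simple] by simp
  next
    case (add x y)
    then show ?case by (simp add: D_add add_map_add[OF am])
  qed
  then show "D' = D"
    by (intro ext extensionalityI[OF D'_ext D_extensional]) blast
qed

lemma D_simple: "a \<in> carrier C \<Longrightarrow> set as \<subseteq> carrier C \<Longrightarrow> int (length as) = k \<Longrightarrow>
    D k (simple_form C a as) = simple_form C (cconst C 1) (a # as)"
  by (rule derivation_simple[OF D_graded_derivation D_square_zero D_degree_0_form])

lemma forms_cdga: "is_cdga C (forms C)"
  using forms_graded_algebra D_graded_derivation D_square_zero
  by (simp add: is_cdga_def forms_def form_dif_D)

end

section \<open>Functoriality of differential forms\<close>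

locale smooth_hom = smooth_ring C + T: smooth_ring C'
  for C :: "'a cinf_ring" and C' :: "'b cinf_ring" +
  fixes g :: "'a \<Rightarrow> 'b"
  assumes hom: "cinf_hom C C' g"
begin

lemma g_closed [simp]: "a \<in> carrier C \<Longrightarrow> g a \<in> carrier C'"
  using hom by (auto simp: cinf_hom_def)

lemma g_cop: "set as \<subseteq> carrier C \<Longrightarrow> h \<in> smooth_fun (length as) \<Longrightarrow> g (cop C h as) = cop C' h (map g as)"
  using hom by (auto simp: cinf_hom_def)

lemma g_set: "set as \<subseteq> carrier C \<Longrightarrow> set (map g as) \<subseteq> carrier C'"
  by auto

lemma g_add: "a \<in> carrier C \<Longrightarrow> b \<in> carrier C \<Longrightarrow> g (a \<oplus>\<^bsub>alg C\<^esub> b) = g a \<oplus>\<^bsub>alg C'\<^esub> g b"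
  using g_cop[of "[a, b]" "\<lambda>x. x 0 + x 1"] smooth_bilinear[of 0 2 1 0 1 1 0]
  by (simp add: alg_def numeral_2_eq_2)

lemma g_mult: "a \<in> carrier C \<Longrightarrow> b \<in> carrier C \<Longrightarrow> g (a \<otimes>\<^bsub>alg C\<^esub> b) = g a \<otimes>\<^bsub>alg C'\<^esub> g b"
  using g_cop[of "[a, b]" "\<lambda>x. x 0 * x 1"] smooth_bilinear[of 0 2 1 0 0 0 1]
  by (simp add: alg_def numeral_2_eq_2)

lemma g_cconst: "g (cconst C r) = cconst C' r"
  using g_cop[of "[]" "\<lambda>_. r"] smooth_const by (simp add: cconst_def)

text \<open>\<open>g\<close> commutes with the operation of \<open>h\<close> and with those of its
  partial derivatives, so the relation for \<open>h\<close> and \<open>as\<close> is carried to the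
  relation for \<open>h\<close> and \<open>map g as\<close>.\<close>

lemma kaehler_map_ex: "\<exists>\<phi>. add_map (kaehler C) (kaehler C') \<phi> \<and>
    (\<forall>r\<in>carrier C. \<forall>a\<in>carrier C. \<phi> (r \<odot>\<^bsub>kaehler C\<^esub> kaehler_d C a) = g r \<odot>\<^bsub>kaehler C'\<^esub> kaehler_d C' (g a))"
proof (rule kaehler_add_lift[OF T.M.abelian_group_axioms])
  show "add_map (alg C) (kaehler C') (\<lambda>r. g r \<odot>\<^bsub>kaehler C'\<^esub> kaehler_d C' (g a))" if "a \<in> carrier C" for a
    by (rule add_mapI) (use that in \<open>simp_all add: T.d_closed g_add T.smult_l_distr\<close>)
  fix h as r assume a: "as \<noteq> []" "set as \<subseteq> carrier C" "h \<in> smooth_fun (length as)" and r: "r \<in> carrier C"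
  have p: "cop C (pderivative i h) as \<in> carrier C" "as ! i \<in> carrier C"
    "g (cop C (pderivative i h) as) = cop C' (pderivative i h) (map g as)" if "i < length as" for i
    using rel_facts(2,3)[OF C a(2,3) that] g_cop[OF a(2) smooth_fun_pderivative_closed[OF a(3) that]] by auto
  have q: "cop C' (pderivative i h) (map g as) \<in> carrier C'" if "i < length as" for i
    using p[OF that] g_closed by metis
  have "g r \<odot>\<^bsub>kaehler C'\<^esub> kaehler_d C' (g (cop C h as)) =
      g r \<odot>\<^bsub>kaehler C'\<^esub> (\<Oplus>\<^bsub>kaehler C'\<^esub>i\<in>{..<length as}. cop C' (pderivative i h) (map g as) \<odot>\<^bsub>kaehler C'\<^esub> kaehler_d C' (map g as ! i))"
    using T.derivation[of "map g as" h] a g_set[OF a(2)] by (simp add: g_cop)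
  also have "\<dots> = (\<Oplus>\<^bsub>kaehler C'\<^esub>i\<in>{..<length as}. g r \<odot>\<^bsub>kaehler C'\<^esub>
      (cop C' (pderivative i h) (map g as) \<odot>\<^bsub>kaehler C'\<^esub> kaehler_d C' (map g as ! i)))"
    by (rule T.finsum_smult_ldistr) (use r p q T.d_closed in auto)
  also have "\<dots> = (\<Oplus>\<^bsub>kaehler C'\<^esub>i\<in>{..<length as}.
      g (r \<otimes>\<^bsub>alg C\<^esub> cop C (pderivative i h) as) \<odot>\<^bsub>kaehler C'\<^esub> kaehler_d C' (g (as ! i)))"
    by (rule T.M.finsum_cong') (use r p q T.d_closed in \<open>auto simp: g_mult T.smult_assoc1\<close>)
  finally show "g r \<odot>\<^bsub>kaehler C'\<^esub> kaehler_d C' (g (cop C h as)) = \<dots>" .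
qed

definition kmap :: "('a \<Rightarrow> 'a) set \<Rightarrow> ('b \<Rightarrow> 'b) set" where
  "kmap = (SOME \<phi>. add_map (kaehler C) (kaehler C') \<phi> \<and>
    (\<forall>r\<in>carrier C. \<forall>a\<in>carrier C. \<phi> (r \<odot>\<^bsub>kaehler C\<^esub> kaehler_d C a) = g r \<odot>\<^bsub>kaehler C'\<^esub> kaehler_d C' (g a)))"

lemma kmap_add_map: "add_map (kaehler C) (kaehler C') kmap"
  and kmap_basis: "r \<in> carrier C \<Longrightarrow> a \<in> carrier C \<Longrightarrow>
    kmap (r \<odot>\<^bsub>kaehler C\<^esub> kaehler_d C a) = g r \<odot>\<^bsub>kaehler C'\<^esub> kaehler_d C' (g a)"
  using someI_ex[OF kaehler_map_ex] unfolding kmap_def by blast+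

lemmas kmap_closed = add_map_closed[OF kmap_add_map]

lemma kmap_smult:
  assumes "x \<in> carrier (kaehler C)" "r \<in> carrier C"
  shows "kmap (r \<odot>\<^bsub>kaehler C\<^esub> x) = g r \<odot>\<^bsub>kaehler C'\<^esub> kmap x"
  using assms(1)
proof (induction rule: kaehler_induct)
  case zero
  have "kmap \<zero>\<^bsub>kaehler C\<^esub> = \<zero>\<^bsub>kaehler C'\<^esub>"
    by (rule add_map_zero[OF M.abelian_group_axioms T.M.abelian_group_axioms kmap_add_map])
  then show ?case using assms(2) by simp
next
  case (basis s a)
  have "r \<odot>\<^bsub>kaehler C\<^esub> (s \<odot>\<^bsub>kaehler C\<^esub> d a) = (r \<otimes>\<^bsub>alg C\<^esub> s) \<odot>\<^bsub>kaehler C\<^esub> d a"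
    using basis assms d_closed by (simp add: smult_assoc1)
  then show ?case using basis assms(2) T.d_closed by (simp add: kmap_basis g_mult T.smult_assoc1)
next
  case (add x y)
  then show ?case using assms(2)
    by (simp add: smult_r_distr add_map_add[OF kmap_add_map] kmap_closed T.smult_r_distr)
qed

lemma kmap_d: "a \<in> carrier C \<Longrightarrow> kmap (kaehler_d C a) = kaehler_d C' (g a)"
  using kmap_basis[of "\<one>\<^bsub>alg C\<^esub>" a] d_closed[of a] T.d_closed[of "g a"] g_cconst[of 1]
  by (simp add: one_cconst[symmetric] T.one_cconst[symmetric])

text \<open>The target is a module over the other ring, so only an additive lift is available;
  compatibility with scalars in a slot comes down to \<open>g\<close> being multiplicative.\<close>

lemma ext_map_ex: "\<exists>\<phi>. add_map (E k) (T.E k) \<phi> \<and>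
    (\<forall>r xs. r \<in> carrier (alg C) \<and> set xs \<subseteq> carrier (kaehler C) \<and> int (length xs) = k \<longrightarrow>
      \<phi> (r \<odot>\<^bsub>E k\<^esub> w xs) = g r \<odot>\<^bsub>T.E k\<^esub> T.w (map kmap xs))"
proof (rule ext_add_lift[OF T.E_abelian_group])
  interpret Ek: Module.module "alg C'" "T.E k" by (rule T.E_module)
  have s: "set (map kmap xs) \<subseteq> carrier (kaehler C')" if "set xs \<subseteq> carrier (kaehler C)" for xs
    using that kmap_closed by auto
  {
    fix xs assume xs: "set xs \<subseteq> carrier (kaehler C)" "int (length xs) = k"
    then have "T.w (map kmap xs) \<in> carrier (T.E k)" using T.w_closed[OF s] by simp
    then show "add_map (alg C) (T.E k) (\<lambda>r. g r \<odot>\<^bsub>T.E k\<^esub> T.w (map kmap xs))"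
      by (intro add_mapI) (simp_all add: g_add Ek.smult_l_distr)
  next
    fix xs x y ys r assume a: "set xs \<subseteq> carrier (kaehler C)" "x \<in> carrier (kaehler C)" "y \<in> carrier (kaehler C)"
      "set ys \<subseteq> carrier (kaehler C)" "int (length xs + 1 + length ys) = k" "r \<in> carrier (alg C)"
    have c: "T.w (map kmap xs @ kmap x # map kmap ys) \<in> carrier (T.E k)" "T.w (map kmap xs @ kmap y # map kmap ys) \<in> carrier (T.E k)"
      by (rule T.w_closed; use a s[OF a(1)] s[OF a(4)] kmap_closed in simp)+
    show "g r \<odot>\<^bsub>T.E k\<^esub> T.w (map kmap (xs @ (x \<oplus>\<^bsub>kaehler C\<^esub> y) # ys)) =
       g r \<odot>\<^bsub>T.E k\<^esub> T.w (map kmap (xs @ x # ys)) \<oplus>\<^bsub>T.E k\<^esub> g r \<odot>\<^bsub>T.E k\<^esub> T.w (map kmap (xs @ y # ys))"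
      using T.w_add[OF s[OF a(1)] kmap_closed[OF a(2)] kmap_closed[OF a(3)] s[OF a(4)], of k] a c
      by (simp add: add_map_add[OF kmap_add_map] Ek.smult_r_distr)
  next
    fix xs t x ys r assume a: "set xs \<subseteq> carrier (kaehler C)" "t \<in> carrier (alg C)" "x \<in> carrier (kaehler C)"
      "set ys \<subseteq> carrier (kaehler C)" "int (length xs + 1 + length ys) = k" "r \<in> carrier (alg C)"
    have c: "T.w (map kmap xs @ kmap x # map kmap ys) \<in> carrier (T.E k)"
      by (rule T.w_closed; use a s[OF a(1)] s[OF a(4)] kmap_closed in simp)+
    show "g r \<odot>\<^bsub>T.E k\<^esub> T.w (map kmap (xs @ (t \<odot>\<^bsub>kaehler C\<^esub> x) # ys)) =
       g (r \<otimes>\<^bsub>alg C\<^esub> t) \<odot>\<^bsub>T.E k\<^esub> T.w (map kmap (xs @ x # ys))"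
      using T.w_smult[OF s[OF a(1)] _ kmap_closed[OF a(3)] s[OF a(4)], of "g t" k] a c
      by (simp add: kmap_smult Ek.smult_assoc1 g_mult)
  next
    fix xs x ys r assume a: "set xs \<subseteq> carrier (kaehler C)" "x \<in> carrier (kaehler C)"
      "set ys \<subseteq> carrier (kaehler C)" "int (length xs + 2 + length ys) = k" "r \<in> carrier (alg C)"
    show "g r \<odot>\<^bsub>T.E k\<^esub> T.w (map kmap (xs @ x # x # ys)) = \<zero>\<^bsub>T.E k\<^esub>"
      using T.w_alt[OF s[OF a(1)] kmap_closed[OF a(2)] s[OF a(3)], of k] a by simp
  }
qed

lemma forms_map_ex: "\<exists>\<phi>. \<phi> \<in> extensional (carrier (E k)) \<and> add_map (E k) (T.E k) \<phi> \<and>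
    (\<forall>a as. a \<in> carrier C \<and> set as \<subseteq> carrier C \<and> int (length as) = k \<longrightarrow>
      \<phi> (simple_form C a as) = simple_form C' (g a) (map g as))"
proof -
  interpret Ek: Module.module "alg C" "E k" by (rule E_module)
  obtain \<phi> where \<phi>: "add_map (E k) (T.E k) \<phi>" "\<And>r xs. r \<in> carrier (alg C) \<Longrightarrow> set xs \<subseteq> carrier (kaehler C) \<Longrightarrow> int (length xs) = k \<Longrightarrow>
      \<phi> (r \<odot>\<^bsub>E k\<^esub> w xs) = g r \<odot>\<^bsub>T.E k\<^esub> T.w (map kmap xs)"
    using ext_map_ex[of k] by blast
  have "restrict \<phi> (carrier (E k)) (simple_form C a as) = simple_form C' (g a) (map g as)"
    if a: "a \<in> carrier C" "set as \<subseteq> carrier C" "int (length as) = k" for a as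
  proof -
    have "map kmap (map d as) = map (kaehler_d C') (map g as)" using a(2) kmap_d by auto
    then show ?thesis
      using simple_form_closed[OF a] \<phi>(2)[of a "map d as"] a map_d[OF a(2)] simple_form_E[OF a(3)] T.simple_form_E[of "map g as" k]
      by (simp del: map_map)
  qed
  moreover have "add_map (E k) (T.E k) (restrict \<phi> (carrier (E k)))"
    using \<phi>(1) by (intro add_mapI) (simp_all add: add_map_closed add_map_add)
  ultimately show ?thesis by (intro exI[of _ "restrict \<phi> (carrier (E k))"]) simp
qed

text \<open>The maps compared are arbitrary additive ones, so that compositions and the identity can
  be compared with \<open>forms_map\<close> too.\<close>

lemma forms_map_unique:
  assumes "add_map (E k) (T.E k) \<phi>" "add_map (E k) (T.E k) \<psi>"
    and "\<And>a as. a \<in> carrier C \<Longrightarrow> set as \<subseteq> carrier C \<Longrightarrow> int (length as) = k \<Longrightarrow>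
      \<phi> (simple_form C a as) = \<psi> (simple_form C a as)"
    and "x \<in> carrier (E k)"
  shows "\<phi> x = \<psi> x"
  using assms(4)
proof (induction rule: forms_induct)
  case zero
  then show ?case using add_map_zero[OF E_abelian_group T.E_abelian_group] assms(1,2) by metis
qed (simp_all add: assms(3) add_map_add[OF assms(1)] add_map_add[OF assms(2)])

lemma forms_map_spec:
  "forms_map C C' g k \<in> extensional (carrier (E k)) \<and> add_map (E k) (T.E k) (forms_map C C' g k) \<and>
    (\<forall>a as. a \<in> carrier C \<and> set as \<subseteq> carrier C \<and> int (length as) = k \<longrightarrow>
      forms_map C C' g k (simple_form C a as) = simple_form C' (g a) (map g as))"
proof -
  let ?Q = "\<lambda>\<phi>. \<phi> \<in> extensional (carrier (E k)) \<and> add_map (E k) (T.E k) \<phi> \<and>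
    (\<forall>a as. a \<in> carrier C \<and> set as \<subseteq> carrier C \<and> int (length as) = k \<longrightarrow>
      \<phi> (simple_form C a as) = simple_form C' (g a) (map g as))"
  have PiE: "\<phi> \<in> carrier (E k) \<rightarrow>\<^sub>E carrier (T.E k) \<longleftrightarrow> \<phi> \<in> extensional (carrier (E k)) \<and> \<phi> \<in> carrier (E k) \<rightarrow> carrier (T.E k)" for \<phi>
    unfolding PiE_def by blast
  define t where "t = (THE \<phi>. ?Q \<phi>)"
  have eq: "forms_map C C' g k = t"
    unfolding t_def forms_map_def form_deg_E T.form_deg_E PiE add_map_def conj_assoc ..
  have "?Q t"
    unfolding t_def
  proof (rule theI'[of ?Q])
    from forms_map_ex[of k] obtain \<phi> where \<phi>: "?Q \<phi>" ..
    show "\<exists>!\<phi>. ?Q \<phi>"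
    proof (rule ex1I[of _ \<phi>])
      fix \<psi> assume \<psi>: "?Q \<psi>"
      show "\<psi> = \<phi>"
        by (rule extensionalityI[of _ "carrier (E k)"])
           (use \<phi> \<psi> in \<open>simp_all add: forms_map_unique[of k \<psi> \<phi>]\<close>)
    qed (rule \<phi>)
  qed
  then show ?thesis unfolding eq .
qed

lemma forms_map_add_map: "add_map (E k) (T.E k) (forms_map C C' g k)"
  using forms_map_spec[of k] by (elim conjE)

lemma forms_map_simple: "a \<in> carrier C \<Longrightarrow> set as \<subseteq> carrier C \<Longrightarrow> int (length as) = k \<Longrightarrow>
    forms_map C C' g k (simple_form C a as) = simple_form C' (g a) (map g as)"
  using forms_map_spec[of k] by simp

lemmas forms_map_closed = add_map_closed[OF forms_map_add_map]
lemmas forms_map_add = add_map_add[OF forms_map_add_map]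
lemmas forms_map_zero = add_map_zero[OF E_abelian_group T.E_abelian_group forms_map_add_map]

lemma forms_map_smult:
  assumes "x \<in> carrier (E k)" "r \<in> carrier C"
  shows "forms_map C C' g k (r \<odot>\<^bsub>E k\<^esub> x) = g r \<odot>\<^bsub>T.E k\<^esub> forms_map C C' g k x"
  using assms(1)
proof (induction rule: forms_induct)
  interpret Ek: Module.module "alg C" "E k" by (rule E_module)
  interpret Tk: Module.module "alg C'" "T.E k" by (rule T.E_module)
  {
    case zero
    then show ?case using assms(2) by (simp add: forms_map_zero)
  next
    case (simple a as)
    have "r \<odot>\<^bsub>E k\<^esub> simple_form C a as = simple_form C (r \<otimes>\<^bsub>alg C\<^esub> a) as"
      using simple assms(2) w_closed[OF map_d, of as k] by (simp add: simple_form_E[of as k] Ek.smult_assoc1)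
    moreover have "g r \<odot>\<^bsub>T.E k\<^esub> simple_form C' (g a) (map g as) = simple_form C' (g r \<otimes>\<^bsub>alg C'\<^esub> g a) (map g as)"
      using simple assms(2) T.w_closed[OF T.map_d[OF g_set], of as k] by (simp add: T.simple_form_E[of "map g as" k] Tk.smult_assoc1)
    ultimately show ?case using simple assms(2) by (simp add: forms_map_simple g_mult)
  next
    case (add x y)
    then show ?case using assms(2) by (simp add: Ek.smult_r_distr forms_map_add forms_map_closed Tk.smult_r_distr)
  }
qed

lemma forms_map_mult:
  assumes x: "x \<in> carrier (E k)" and y: "y \<in> carrier (E l)"
  shows "forms_map C C' g (k + l) (P k l x y) = T.P k l (forms_map C C' g k x) (forms_map C C' g l y)"
  using x
proof (induction rule: forms_induct)
  case zero
  show ?case using P_zero_l[OF y refl, of k] T.P_zero_l[OF forms_map_closed[OF y] refl, of k] by (simp add: forms_map_zero)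
next
  case (add x x')
  then show ?case using y by (simp add: P_add_l[of _ k _ _ l "k + l"] T.P_add_l[of _ k _ _ l "k + l"] forms_map_add forms_map_closed P_closed)
next
  case (simple a as)
  have x: "simple_form C a as \<in> carrier (E k)" by (rule simple_form_closed[OF simple])
  from y show ?case
  proof (induction rule: forms_induct)
    case zero
    show ?case using P_zero_r[OF x refl, of l] T.P_zero_r[OF forms_map_closed[OF x] refl, of l] by (simp add: forms_map_zero)
  next
    case (add y y')
    then show ?case using x by (simp add: P_add_r[of _ k _ l _ "k + l"] T.P_add_r[of _ k _ l _ "k + l"] forms_map_add forms_map_closed P_closed)
  next
    case (simple b bs)
    note a = \<open>a \<in> carrier C\<close> \<open>set as \<subseteq> carrier C\<close> \<open>int (length as) = k\<close>
    show ?case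
      using P_simple[OF a simple] T.P_simple[OF g_closed[OF a(1)] g_set[OF a(2)] _ g_closed[OF simple(1)] g_set[OF simple(2)], of k l]
        forms_map_simple[OF a] forms_map_simple[OF simple] a simple forms_map_simple[of "a \<otimes>\<^bsub>alg C\<^esub> b" "as @ bs" "k + l"]
      by (simp add: g_mult)
  qed
qed

text \<open>On a simple form the differential moves the coefficient into the list and leaves one in
  its place; \<open>g\<close> respects this because it preserves constants.\<close>

lemma forms_map_dif:
  assumes "x \<in> carrier (E k)"
  shows "forms_map C C' g (k + 1) (form_dif C k x) = form_dif C' k (forms_map C C' g k x)"
  using assms unfolding form_dif_D T.form_dif_D
proof (induction rule: forms_induct)
  case zero
  then show ?case by (simp add: D_zero T.D_zero forms_map_zero)
next
  case (simple a as)
  then show ?case using forms_map_simple[OF cconst_closed, of "a # as" "k + 1" 1] T.D_simple[OF g_closed g_set, of a as k]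
    by (simp add: D_simple forms_map_simple g_cconst)
next
  case (add x y)
  then show ?case by (simp add: D_add T.D_add forms_map_add forms_map_closed D_closed)
qed

lemma forms_cdga_hom: "cdga_hom C (forms C) (forms C') g (forms_map C C' g)"
  unfolding cdga_hom_def forms_def
  by (simp add: form_deg_E T.form_deg_E form_prd_P T.form_prd_P forms_map_closed forms_map_add
      forms_map_smult forms_map_mult forms_map_dif Pi_iff)

end

lemma smooth_homI: "cinf_ring C \<Longrightarrow> cinf_ring C' \<Longrightarrow> cinf_hom C C' g \<Longrightarrow> smooth_hom C C' g"
  by (intro smooth_hom.intro smooth_ring.intro smooth_hom_axioms.intro)

text \<open>The composite is a third homomorphism \<open>m\<close> that agrees with \<open>h\<close>
  after \<open>g\<close> on the carrier only: restriction maps compose on sections, and nothing is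
  known about them elsewhere.\<close>

lemma forms_map_comp:
  assumes C: "cinf_ring C" "cinf_ring C'" "cinf_ring C''"
    and "cinf_hom C C' g" "cinf_hom C' C'' h" "cinf_hom C C'' m" and m: "\<And>a. a \<in> carrier C \<Longrightarrow> m a = h (g a)"
    and x: "x \<in> carrier (form_deg C k)"
  shows "forms_map C' C'' h k (forms_map C C' g k x) = forms_map C C'' m k x"
proof -
  interpret g: smooth_hom C C' g by (intro smooth_homI assms)
  interpret h: smooth_hom C' C'' h by (intro smooth_homI assms)
  interpret m: smooth_hom C C'' m by (intro smooth_homI assms)
  show ?thesis
  proof (rule m.forms_map_unique[OF add_map_comp[OF g.forms_map_add_map h.forms_map_add_map] m.forms_map_add_map])
    show "x \<in> carrier (g.E k)" using x by (simp add: g.form_deg_E)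
    fix a as assume a: "a \<in> carrier C" "set as \<subseteq> carrier C" "int (length as) = k"
    have "map m as = map h (map g as)" using a(2) m by auto
    then show "forms_map C' C'' h k (forms_map C C' g k (simple_form C a as)) = forms_map C C'' m k (simple_form C a as)"
      using a m h.forms_map_simple[OF g.g_closed g.g_set, of a as k]
      by (simp add: g.forms_map_simple m.forms_map_simple del: map_map)
  qed
qed

lemma forms_map_id:
  assumes C: "cinf_ring C" "cinf_hom C C g" and g: "\<And>a. a \<in> carrier C \<Longrightarrow> g a = a"
    and x: "x \<in> carrier (form_deg C k)"
  shows "forms_map C C g k x = x"
proof -
  interpret g: smooth_hom C C g by (intro smooth_homI assms)
  show ?thesis
  proof (rule g.forms_map_unique[OF g.forms_map_add_map])
    show "x \<in> carrier (g.E k)" using x by (simp add: g.form_deg_E)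
    show "add_map (g.E k) (g.E k) (\<lambda>x. x)" by (simp add: add_map_def)
    fix a as assume a: "a \<in> carrier C" "set as \<subseteq> carrier C" "int (length as) = k"
    then have "map g as = as" using g by (auto intro: map_idI)
    with a g show "forms_map C C g k (simple_form C a as) = simple_form C a as"
      by (simp add: g.forms_map_simple)
  qed
qed

section \<open>Sheafification\<close>

lemma graded_algebraD:
  assumes "graded_algebra C E P"
  shows "Module.module (alg C) (E k)"
    "x \<in> carrier (E k) \<Longrightarrow> y \<in> carrier (E l) \<Longrightarrow> P k l x y \<in> carrier (E (k + l))"
    "x \<in> carrier (E k) \<Longrightarrow> y \<in> carrier (E l) \<Longrightarrow> P k l x y = signed (E (k + l)) (k * l) (P l k y x)"
    "x \<in> carrier (E k) \<Longrightarrow> x' \<in> carrier (E k) \<Longrightarrow> y \<in> carrier (E l) \<Longrightarrow>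
      P k l (x \<oplus>\<^bsub>E k\<^esub> x') y = P k l x y \<oplus>\<^bsub>E (k + l)\<^esub> P k l x' y"
    "x \<in> carrier (E k) \<Longrightarrow> y \<in> carrier (E l) \<Longrightarrow> y' \<in> carrier (E l) \<Longrightarrow>
      P k l x (y \<oplus>\<^bsub>E l\<^esub> y') = P k l x y \<oplus>\<^bsub>E (k + l)\<^esub> P k l x y'"
    "a \<in> carrier C \<Longrightarrow> x \<in> carrier (E k) \<Longrightarrow> y \<in> carrier (E l) \<Longrightarrow>
      P k l (a \<odot>\<^bsub>E k\<^esub> x) y = a \<odot>\<^bsub>E (k + l)\<^esub> P k l x y"
    "a \<in> carrier C \<Longrightarrow> x \<in> carrier (E k) \<Longrightarrow> y \<in> carrier (E l) \<Longrightarrow>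
      P k l x (a \<odot>\<^bsub>E l\<^esub> y) = a \<odot>\<^bsub>E (k + l)\<^esub> P k l x y"
    "x \<in> carrier (E k) \<Longrightarrow> y \<in> carrier (E l) \<Longrightarrow> z \<in> carrier (E m) \<Longrightarrow>
      P (k + l) m (P k l x y) z = P k (l + m) x (P l m y z)"
proof -
  note g = assms[unfolded graded_algebra_def]
  note 1 = g[THEN conjunct1] and g = g[THEN conjunct2]
  note 2 = g[THEN conjunct1] and g = g[THEN conjunct2]
  note 3 = g[THEN conjunct1] and g = g[THEN conjunct2]
  note 4 = g[THEN conjunct1] and g = g[THEN conjunct2]
  note 5 = g[THEN conjunct1] and 6 = g[THEN conjunct2]
  show "Module.module (alg C) (E k)" by (rule 1[rule_format])
  show "x \<in> carrier (E k) \<Longrightarrow> y \<in> carrier (E l) \<Longrightarrow> P k l x y \<in> carrier (E (k + l))"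
    "x \<in> carrier (E k) \<Longrightarrow> y \<in> carrier (E l) \<Longrightarrow> P k l x y = signed (E (k + l)) (k * l) (P l k y x)"
    by (rule 2[rule_format, THEN conjunct1] 2[rule_format, THEN conjunct2]; assumption)+
  show "x \<in> carrier (E k) \<Longrightarrow> x' \<in> carrier (E k) \<Longrightarrow> y \<in> carrier (E l) \<Longrightarrow>
      P k l (x \<oplus>\<^bsub>E k\<^esub> x') y = P k l x y \<oplus>\<^bsub>E (k + l)\<^esub> P k l x' y" by (rule 3[rule_format])
  show "x \<in> carrier (E k) \<Longrightarrow> y \<in> carrier (E l) \<Longrightarrow> y' \<in> carrier (E l) \<Longrightarrow>
      P k l x (y \<oplus>\<^bsub>E l\<^esub> y') = P k l x y \<oplus>\<^bsub>E (k + l)\<^esub> P k l x y'" by (rule 4[rule_format])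
  show "a \<in> carrier C \<Longrightarrow> x \<in> carrier (E k) \<Longrightarrow> y \<in> carrier (E l) \<Longrightarrow>
      P k l (a \<odot>\<^bsub>E k\<^esub> x) y = a \<odot>\<^bsub>E (k + l)\<^esub> P k l x y" by (rule 5[rule_format, THEN conjunct1])
  show "a \<in> carrier C \<Longrightarrow> x \<in> carrier (E k) \<Longrightarrow> y \<in> carrier (E l) \<Longrightarrow>
      P k l x (a \<odot>\<^bsub>E l\<^esub> y) = a \<odot>\<^bsub>E (k + l)\<^esub> P k l x y" by (rule 5[rule_format, THEN conjunct2])
  show "x \<in> carrier (E k) \<Longrightarrow> y \<in> carrier (E l) \<Longrightarrow> z \<in> carrier (E m) \<Longrightarrow>
      P (k + l) m (P k l x y) z = P k (l + m) x (P l m y z)" by (rule 6[rule_format])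
qed

lemma graded_derivationD:
  assumes "graded_derivation C E P D"
  shows "x \<in> carrier (E k) \<Longrightarrow> D k x \<in> carrier (E (k + 1))"
    "x \<in> carrier (E k) \<Longrightarrow> y \<in> carrier (E k) \<Longrightarrow> D k (x \<oplus>\<^bsub>E k\<^esub> y) = D k x \<oplus>\<^bsub>E (k + 1)\<^esub> D k y"
    "x \<in> carrier (E k) \<Longrightarrow> D k (cconst C r \<odot>\<^bsub>E k\<^esub> x) = cconst C r \<odot>\<^bsub>E (k + 1)\<^esub> D k x"
    "x \<in> carrier (E k) \<Longrightarrow> y \<in> carrier (E l) \<Longrightarrow> D (k + l) (P k l x y) =
          P (k + 1) l (D k x) y \<oplus>\<^bsub>E (k + l + 1)\<^esub> signed (E (k + l + 1)) k (P k (l + 1) x (D l y))"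
proof -
  note g = assms[unfolded graded_derivation_def]
  note 1 = g[THEN conjunct1] and g = g[THEN conjunct2]
  note 2 = g[THEN conjunct1] and g = g[THEN conjunct2]
  note 3 = g[THEN conjunct1] and 4 = g[THEN conjunct2]
  show "x \<in> carrier (E k) \<Longrightarrow> D k x \<in> carrier (E (k + 1))" by (rule funcset_mem[OF 1[rule_format]])
  show "x \<in> carrier (E k) \<Longrightarrow> y \<in> carrier (E k) \<Longrightarrow> D k (x \<oplus>\<^bsub>E k\<^esub> y) = D k x \<oplus>\<^bsub>E (k + 1)\<^esub> D k y"
    by (rule 2[rule_format])
  show "x \<in> carrier (E k) \<Longrightarrow> D k (cconst C r \<odot>\<^bsub>E k\<^esub> x) = cconst C r \<odot>\<^bsub>E (k + 1)\<^esub> D k x"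
    by (rule 3[rule_format])
  show "x \<in> carrier (E k) \<Longrightarrow> y \<in> carrier (E l) \<Longrightarrow> D (k + l) (P k l x y) =
          P (k + 1) l (D k x) y \<oplus>\<^bsub>E (k + l + 1)\<^esub> signed (E (k + l + 1)) k (P k (l + 1) x (D l y))"
    by (rule 4[rule_format])
qed

lemma cdga_homD:
  assumes "cdga_hom C E E' \<phi> F"
  shows "x \<in> carrier (deg E k) \<Longrightarrow> F k x \<in> carrier (deg E' k)"
    "x \<in> carrier (deg E k) \<Longrightarrow> y \<in> carrier (deg E k) \<Longrightarrow> F k (x \<oplus>\<^bsub>deg E k\<^esub> y) = F k x \<oplus>\<^bsub>deg E' k\<^esub> F k y"
    "a \<in> carrier C \<Longrightarrow> x \<in> carrier (deg E k) \<Longrightarrow> F k (a \<odot>\<^bsub>deg E k\<^esub> x) = \<phi> a \<odot>\<^bsub>deg E' k\<^esub> F k x"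
    "x \<in> carrier (deg E k) \<Longrightarrow> y \<in> carrier (deg E l) \<Longrightarrow> F (k + l) (prd E k l x y) = prd E' k l (F k x) (F l y)"
    "x \<in> carrier (deg E k) \<Longrightarrow> F (k + 1) (dif E k x) = dif E' k (F k x)"
  using assms unfolding cdga_hom_def by (simp_all add: Pi_iff)

text \<open>Sheafification is carried out for an arbitrary presheaf of CDGAs; forms return only when
  the locale is interpreted. Functoriality of the restrictions of \<open>A\<close> is what makes
  scalar multiplication on germs well defined.\<close>

locale presheaf_of_cdgas =
  fixes X :: "'p topology" and A :: "('p, 'a) cinf_presheaf" and P :: "('p, 'a, 'w) cdga_presheaf"
  assumes A_ring: "\<And>U. openin X U \<Longrightarrow> cinf_ring (rng A U)"
    and A_hom: "\<And>U V. openin X U \<Longrightarrow> openin X V \<Longrightarrow> V \<subseteq> U \<Longrightarrow> cinf_hom (rng A U) (rng A V) (rst A U V)"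
    and A_presheaf: "set_presheaf X (\<lambda>U. carrier (rng A U)) (rst A)"
    and P_presheaf: "is_cdga_presheaf X A P"
begin

abbreviation "M U k \<equiv> deg (sec P U) k"
abbreviation "r \<equiv> res P"

lemma A_rst_closed: "openin X U \<Longrightarrow> openin X V \<Longrightarrow> V \<subseteq> U \<Longrightarrow> a \<in> carrier (rng A U) \<Longrightarrow> rst A U V a \<in> carrier (rng A V)"
  using A_presheaf by (simp add: set_presheaf_def Pi_iff)

lemma A_rst_comp: "openin X U \<Longrightarrow> openin X V \<Longrightarrow> openin X W \<Longrightarrow> V \<subseteq> U \<Longrightarrow> W \<subseteq> V \<Longrightarrow> a \<in> carrier (rng A U) \<Longrightarrow>
    rst A V W (rst A U V a) = rst A U W a"
  using A_presheaf by (simp add: set_presheaf_def Pi_iff)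

lemma cdga: "openin X U \<Longrightarrow> is_cdga (rng A U) (sec P U)"
  using P_presheaf by (simp add: is_cdga_presheaf_def)

lemma graded_algebra: "openin X U \<Longrightarrow> graded_algebra (rng A U) (deg (sec P U)) (prd (sec P U))"
  and graded_derivation: "openin X U \<Longrightarrow> graded_derivation (rng A U) (deg (sec P U)) (prd (sec P U)) (dif (sec P U))"
  and square_zero: "openin X U \<Longrightarrow> square_zero (deg (sec P U)) (dif (sec P U))"
  using cdga[of U] by (simp_all add: is_cdga_def)

lemma M_module: "openin X U \<Longrightarrow> Module.module (alg (rng A U)) (M U k)"
  by (rule graded_algebraD(1)[OF graded_algebra])

lemma M_group: "openin X U \<Longrightarrow> abelian_group (M U k)"
  using M_module Module.module.axioms(2) by blast

lemma A_carrier: "openin X U \<Longrightarrow> carrier (alg (rng A U)) = carrier (rng A U)"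
  by (rule alg_carrier[OF A_ring])

lemma r_hom: "openin X U \<Longrightarrow> openin X V \<Longrightarrow> V \<subseteq> U \<Longrightarrow> cdga_hom (rng A U) (sec P U) (sec P V) (rst A U V) (r U V)"
  using P_presheaf by (simp add: is_cdga_presheaf_def)

lemma r_id: "openin X U \<Longrightarrow> s \<in> carrier (M U k) \<Longrightarrow> r U U k s = s"
  using P_presheaf by (simp add: is_cdga_presheaf_def set_presheaf_def)

lemma r_comp: "openin X U \<Longrightarrow> openin X V \<Longrightarrow> openin X W \<Longrightarrow> V \<subseteq> U \<Longrightarrow> W \<subseteq> V \<Longrightarrow> s \<in> carrier (M U k) \<Longrightarrow>
    r V W k (r U V k s) = r U W k s"
  using P_presheaf by (simp add: is_cdga_presheaf_def set_presheaf_def)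

lemma r_closed: "openin X U \<Longrightarrow> openin X V \<Longrightarrow> V \<subseteq> U \<Longrightarrow> s \<in> carrier (M U k) \<Longrightarrow> r U V k s \<in> carrier (M V k)"
  using cdga_homD[OF r_hom[of U V]] by simp

lemma r_add: "openin X U \<Longrightarrow> openin X V \<Longrightarrow> V \<subseteq> U \<Longrightarrow> s \<in> carrier (M U k) \<Longrightarrow> t \<in> carrier (M U k) \<Longrightarrow>
    r U V k (s \<oplus>\<^bsub>M U k\<^esub> t) = r U V k s \<oplus>\<^bsub>M V k\<^esub> r U V k t"
  using cdga_homD[OF r_hom[of U V]] by simp

lemma r_smult: "openin X U \<Longrightarrow> openin X V \<Longrightarrow> V \<subseteq> U \<Longrightarrow> s \<in> carrier (M U k) \<Longrightarrow> a \<in> carrier (rng A U) \<Longrightarrow>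
    r U V k (a \<odot>\<^bsub>M U k\<^esub> s) = rst A U V a \<odot>\<^bsub>M V k\<^esub> r U V k s"
  using cdga_homD[OF r_hom[of U V]] by simp

lemma r_prd: "openin X U \<Longrightarrow> openin X V \<Longrightarrow> V \<subseteq> U \<Longrightarrow> s \<in> carrier (M U k) \<Longrightarrow> t \<in> carrier (M U l) \<Longrightarrow>
    r U V (k + l) (prd (sec P U) k l s t) = prd (sec P V) k l (r U V k s) (r U V l t)"
  using cdga_homD[OF r_hom[of U V]] by simp

lemma r_dif: "openin X U \<Longrightarrow> openin X V \<Longrightarrow> V \<subseteq> U \<Longrightarrow> s \<in> carrier (M U k) \<Longrightarrow>
    r U V (k + 1) (dif (sec P U) k s) = dif (sec P V) k (r U V k s)"
  using cdga_homD[OF r_hom[of U V]] by simp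

lemma r_zero: "openin X U \<Longrightarrow> openin X V \<Longrightarrow> V \<subseteq> U \<Longrightarrow> r U V k \<zero>\<^bsub>M U k\<^esub> = \<zero>\<^bsub>M V k\<^esub>"
  by (rule add_map_zero[OF M_group M_group]) (auto intro: add_mapI r_closed r_add)

lemma M_closed:
  assumes "openin X U"
  shows "s \<in> carrier (M U k) \<Longrightarrow> t \<in> carrier (M U k) \<Longrightarrow> s \<oplus>\<^bsub>M U k\<^esub> t \<in> carrier (M U k)"
    and "\<zero>\<^bsub>M U k\<^esub> \<in> carrier (M U k)"
    and "a \<in> carrier (rng A U) \<Longrightarrow> s \<in> carrier (M U k) \<Longrightarrow> a \<odot>\<^bsub>M U k\<^esub> s \<in> carrier (M U k)"
    and "s \<in> carrier (M U k) \<Longrightarrow> t \<in> carrier (M U l) \<Longrightarrow> prd (sec P U) k l s t \<in> carrier (M U (k + l))"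
    and "s \<in> carrier (M U k) \<Longrightarrow> dif (sec P U) k s \<in> carrier (M U (k + 1))"
proof -
  interpret M: Module.module "alg (rng A U)" "M U k" by (rule M_module[OF assms])
  show "s \<in> carrier (M U k) \<Longrightarrow> t \<in> carrier (M U k) \<Longrightarrow> s \<oplus>\<^bsub>M U k\<^esub> t \<in> carrier (M U k)"
    "\<zero>\<^bsub>M U k\<^esub> \<in> carrier (M U k)" by auto
  show "a \<in> carrier (rng A U) \<Longrightarrow> s \<in> carrier (M U k) \<Longrightarrow> a \<odot>\<^bsub>M U k\<^esub> s \<in> carrier (M U k)"
    by (rule M.smult_closed) (simp_all add: A_carrier assms)
  show "s \<in> carrier (M U k) \<Longrightarrow> t \<in> carrier (M U l) \<Longrightarrow> prd (sec P U) k l s t \<in> carrier (M U (k + l))"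
    by (rule graded_algebraD(2)[OF graded_algebra[OF assms]])
  show "s \<in> carrier (M U k) \<Longrightarrow> dif (sec P U) k s \<in> carrier (M U (k + 1))"
    by (rule graded_derivationD(1)[OF graded_derivation[OF assms]])
qed

section \<open>Germs and operations on representatives\<close>

lemma germ_refl: "openin X V \<Longrightarrow> p \<in> V \<Longrightarrow> \<sigma> \<in> carrier (M V k) \<Longrightarrow> (V, \<sigma>) \<in> germ X P k p V \<sigma>"
  unfolding germ_def by auto

lemma germ_memD:
  assumes "(W, \<tau>) \<in> germ X P k p V \<sigma>"
  shows "openin X W" "p \<in> W" "\<tau> \<in> carrier (M W k)"
    "\<exists>Z. openin X Z \<and> p \<in> Z \<and> Z \<subseteq> V \<inter> W \<and> r V Z k \<sigma> = r W Z k \<tau>"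
  using assms unfolding germ_def by auto

text \<open>The two inclusions have the same proof: a member of one germ agrees with its section on
  some \<open>Z'\<close>, and on the overlap of \<open>Z\<close> and \<open>Z'\<close> all three
  sections coincide.\<close>

lemma germ_eqI:
  assumes "openin X V" "\<sigma> \<in> carrier (M V k)" "openin X W" "\<tau> \<in> carrier (M W k)"
    and Z: "openin X Z" "p \<in> Z" "Z \<subseteq> V" "Z \<subseteq> W" "r V Z k \<sigma> = r W Z k \<tau>"
  shows "germ X P k p V \<sigma> = germ X P k p W \<tau>"
proof -
  have *: "germ X P k p V \<sigma> \<subseteq> germ X P k p W \<tau>"
    if "openin X V" "\<sigma> \<in> carrier (M V k)" "openin X W" "\<tau> \<in> carrier (M W k)" "Z \<subseteq> V" "Z \<subseteq> W" "r V Z k \<sigma> = r W Z k \<tau>"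
    for V \<sigma> W \<tau>
  proof
    fix x assume x: "x \<in> germ X P k p V \<sigma>"
    obtain W' \<tau>' where [simp]: "x = (W', \<tau>')" by (cases x)
    note W' = germ_memD[OF x[simplified]]
    obtain Z' where Z': "openin X Z'" "p \<in> Z'" "Z' \<subseteq> V \<inter> W'" "r V Z' k \<sigma> = r W' Z' k \<tau>'" using W'(4) by blast
    have o: "openin X (Z \<inter> Z')" using Z Z' by blast
    have "r W (Z \<inter> Z') k \<tau> = r Z (Z \<inter> Z') k (r W Z k \<tau>)" using that Z Z' o by (intro r_comp[symmetric]) auto
    also have "\<dots> = r V (Z \<inter> Z') k \<sigma>" using that Z Z' o by (subst that(7)[symmetric], intro r_comp) auto
    also have "\<dots> = r Z' (Z \<inter> Z') k (r V Z' k \<sigma>)" using that Z Z' o by (intro r_comp[symmetric]) auto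
    also have "\<dots> = r W' (Z \<inter> Z') k \<tau>'" using W' Z Z' o by (subst Z'(4), intro r_comp) auto
    finally show "x \<in> germ X P k p W \<tau>"
      unfolding germ_def using W' Z Z' o that by auto
  qed
  show ?thesis by (intro equalityI *) (use assms in auto)
qed

lemma germ_res:
  assumes "openin X V" "\<sigma> \<in> carrier (M V k)" "openin X W" "W \<subseteq> V" "p \<in> W"
  shows "germ X P k p W (r V W k \<sigma>) = germ X P k p V \<sigma>"
  by (rule germ_eqI[OF assms(3) r_closed assms(1,2,3,5)]) (use assms in \<open>auto simp: r_id r_closed\<close>)

text \<open>Naturality makes all representatives yield one germ, so the union collapses to it. The
  predicate \<open>Q\<close> is for scalar multiplication, where a scalar over \<open>U\<close> can
  be restricted only to open sets inside \<open>U\<close>.\<close>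

lemma germ_unary:
  assumes V: "openin X V" "p \<in> V" "Q V" and \<sigma>: "\<sigma> \<in> carrier (M V k)"
    and closed: "\<And>W \<tau>. openin X W \<Longrightarrow> Q W \<Longrightarrow> \<tau> \<in> carrier (M W k) \<Longrightarrow> f W \<tau> \<in> carrier (M W m)"
    and nat: "\<And>W Z \<tau>. openin X W \<Longrightarrow> Q W \<Longrightarrow> openin X Z \<Longrightarrow> Z \<subseteq> W \<Longrightarrow> \<tau> \<in> carrier (M W k) \<Longrightarrow>
      r W Z m (f W \<tau>) = f Z (r W Z k \<tau>)"
  shows "\<Union>{germ X P m p W (f W \<tau>) | W \<tau>. Q W \<and> (W, \<tau>) \<in> germ X P k p V \<sigma>} = germ X P m p V (f V \<sigma>)"
proof -
  have "germ X P m p W (f W \<tau>) = germ X P m p V (f V \<sigma>)" if Q: "Q W" and W: "(W, \<tau>) \<in> germ X P k p V \<sigma>" for W \<tau>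
  proof -
    note W' = germ_memD[OF W]
    then obtain Z where Z: "openin X Z" "p \<in> Z" "Z \<subseteq> V" "Z \<subseteq> W" "r V Z k \<sigma> = r W Z k \<tau>" by blast
    show ?thesis
      by (rule germ_eqI[OF W'(1) closed[OF W'(1) Q W'(3)] V(1) closed[OF V(1,3) \<sigma>] Z(1,2,4,3)])
         (simp add: nat W' Q Z V \<sigma>)
  qed
  moreover have "(V, \<sigma>) \<in> germ X P k p V \<sigma>" by (rule germ_refl[OF V(1,2) \<sigma>])
  ultimately show ?thesis using V(3) by blast
qed

text \<open>Each of the two sections agrees with its representative on a neighbourhood of its own;
  on the overlap both do, and naturality of \<open>f\<close> concludes there.\<close>

lemma germ_binary:
  assumes V: "openin X V" "p \<in> V" and \<sigma>: "\<sigma> \<in> carrier (M V k)" and \<tau>: "\<tau> \<in> carrier (M V l)"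
    and closed: "\<And>W \<sigma> \<tau>. openin X W \<Longrightarrow> \<sigma> \<in> carrier (M W k) \<Longrightarrow> \<tau> \<in> carrier (M W l) \<Longrightarrow> f W \<sigma> \<tau> \<in> carrier (M W m)"
    and nat: "\<And>W Z \<sigma> \<tau>. openin X W \<Longrightarrow> openin X Z \<Longrightarrow> Z \<subseteq> W \<Longrightarrow> \<sigma> \<in> carrier (M W k) \<Longrightarrow> \<tau> \<in> carrier (M W l) \<Longrightarrow>
      r W Z m (f W \<sigma> \<tau>) = f Z (r W Z k \<sigma>) (r W Z l \<tau>)"
  shows "\<Union>{germ X P m p W (f W \<sigma>' \<tau>') | W \<sigma>' \<tau>'. (W, \<sigma>') \<in> germ X P k p V \<sigma> \<and> (W, \<tau>') \<in> germ X P l p V \<tau>} =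
    germ X P m p V (f V \<sigma> \<tau>)"
proof -
  have "germ X P m p W (f W \<sigma>' \<tau>') = germ X P m p V (f V \<sigma> \<tau>)"
    if W1: "(W, \<sigma>') \<in> germ X P k p V \<sigma>" and W2: "(W, \<tau>') \<in> germ X P l p V \<tau>" for W \<sigma>' \<tau>'
  proof -
    note W1' = germ_memD[OF W1] and W2' = germ_memD[OF W2]
    then obtain Z1 Z2 where Z1: "openin X Z1" "p \<in> Z1" "Z1 \<subseteq> V" "Z1 \<subseteq> W" "r V Z1 k \<sigma> = r W Z1 k \<sigma>'"
      and Z2: "openin X Z2" "p \<in> Z2" "Z2 \<subseteq> V" "Z2 \<subseteq> W" "r V Z2 l \<tau> = r W Z2 l \<tau>'" by blast
    have Z: "openin X (Z1 \<inter> Z2)" using Z1 Z2 by blast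
    have "r V (Z1 \<inter> Z2) k \<sigma> = r W (Z1 \<inter> Z2) k \<sigma>'"
      using r_comp[OF V(1) Z1(1) Z Z1(3) _ \<sigma>] r_comp[OF W1'(1) Z1(1) Z Z1(4) _ W1'(3)] Z1(5) by simp
    moreover have "r V (Z1 \<inter> Z2) l \<tau> = r W (Z1 \<inter> Z2) l \<tau>'"
      using r_comp[OF V(1) Z2(1) Z Z2(3) _ \<tau>] r_comp[OF W2'(1) Z2(1) Z Z2(4) _ W2'(3)] Z2(5) by simp
    ultimately have "r W (Z1 \<inter> Z2) m (f W \<sigma>' \<tau>') = r V (Z1 \<inter> Z2) m (f V \<sigma> \<tau>)"
      using nat[OF W1'(1) Z _ W1'(3) W2'(3)] nat[OF V(1) Z _ \<sigma> \<tau>] Z1(3,4) by (simp add: le_infI1)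
    then show ?thesis
      by (intro germ_eqI[OF W1'(1) closed[OF W1'(1,3) W2'(3)] V(1) closed[OF V(1) \<sigma> \<tau>] Z])
         (use Z1 Z2 in auto)
  qed
  moreover have "(V, \<sigma>) \<in> germ X P k p V \<sigma>" "(V, \<tau>) \<in> germ X P l p V \<tau>" using germ_refl V \<sigma> \<tau> by auto
  ultimately show ?thesis by blast
qed

text \<open>The bookkeeping device that stands in for stalks: over \<open>V\<close> the section
  \<open>s\<close> is the image of the presheaf section \<open>\<sigma>\<close>. Rules such as
  \<open>rep_add\<close> and \<open>rep_prd\<close> compose like the terms they describe.\<close>

definition rep :: "int \<Rightarrow> ('p \<Rightarrow> ('p set \<times> 'w) set) \<Rightarrow> 'p set \<Rightarrow> 'w \<Rightarrow> bool" where
  "rep k s V \<sigma> \<longleftrightarrow> openin X V \<and> \<sigma> \<in> carrier (M V k) \<and> (\<forall>q\<in>V. s q = germ X P k q V \<sigma>)"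

lemma repD: "rep k s V \<sigma> \<Longrightarrow> openin X V" "rep k s V \<sigma> \<Longrightarrow> \<sigma> \<in> carrier (M V k)"
    "rep k s V \<sigma> \<Longrightarrow> q \<in> V \<Longrightarrow> s q = germ X P k q V \<sigma>"
  by (auto simp: rep_def)

lemma rep_res: "rep k s V \<sigma> \<Longrightarrow> openin X W \<Longrightarrow> W \<subseteq> V \<Longrightarrow> rep k s W (r V W k \<sigma>)"
  unfolding rep_def by (auto simp: r_closed germ_res)

lemma rep_cong: "rep k s V \<sigma> \<Longrightarrow> (\<And>q. q \<in> V \<Longrightarrow> t q = s q) \<Longrightarrow> rep k t V \<sigma>"
  unfolding rep_def by auto

abbreviation "S U k \<equiv> sheafified_sections X P k U"

lemma S_iff: "s \<in> S U k \<longleftrightarrow> s \<in> extensional U \<and> (\<forall>p\<in>U. \<exists>V \<sigma>. p \<in> V \<and> V \<subseteq> U \<and> rep k s V \<sigma>)"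
  unfolding sheafified_sections_def rep_def by (simp only: mem_Collect_eq conj_ac)

lemma SI:
  assumes "s \<in> extensional U" "\<And>p. p \<in> U \<Longrightarrow> \<exists>V \<sigma>. p \<in> V \<and> V \<subseteq> U \<and> rep k s V \<sigma>"
  shows "s \<in> S U k"
  using assms S_iff by blast

lemma rep1:
  assumes "s \<in> S U k" "p \<in> U"
  obtains V \<sigma> where "p \<in> V" "V \<subseteq> U" "openin X V" "rep k s V \<sigma>" "\<sigma> \<in> carrier (M V k)"
  using assms S_iff repD by metis

text \<open>Representatives are restricted to the overlap of their domains, because the binary
  operations pair germs over a common open set.\<close>

lemma rep2:
  assumes "s \<in> S U k" "t \<in> S U l" "p \<in> U"
  obtains V \<sigma> \<tau> where "p \<in> V" "V \<subseteq> U" "openin X V" "rep k s V \<sigma>" "rep l t V \<tau>" "\<sigma> \<in> carrier (M V k)" "\<tau> \<in> carrier (M V l)"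
proof -
  obtain V1 \<sigma> where 1: "p \<in> V1" "V1 \<subseteq> U" "openin X V1" "rep k s V1 \<sigma>" using rep1[OF assms(1,3)] .
  obtain V2 \<tau> where 2: "p \<in> V2" "V2 \<subseteq> U" "openin X V2" "rep l t V2 \<tau>" using rep1[OF assms(2,3)] .
  have o: "openin X (V1 \<inter> V2)" using 1 2 by blast
  have "rep k s (V1 \<inter> V2) (r V1 (V1 \<inter> V2) k \<sigma>)" by (rule rep_res[OF 1(4) o]) blast
  moreover have "rep l t (V1 \<inter> V2) (r V2 (V1 \<inter> V2) l \<tau>)" by (rule rep_res[OF 2(4) o]) blast
  ultimately show thesis using that[of "V1 \<inter> V2"] 1 2 o repD(2) by blast
qed

lemma rep3:
  assumes "s \<in> S U k" "t \<in> S U l" "u \<in> S U m" "p \<in> U"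
  obtains V \<sigma> \<tau> \<upsilon> where "p \<in> V" "V \<subseteq> U" "openin X V" "rep k s V \<sigma>" "rep l t V \<tau>" "rep m u V \<upsilon>"
    "\<sigma> \<in> carrier (M V k)" "\<tau> \<in> carrier (M V l)" "\<upsilon> \<in> carrier (M V m)"
proof -
  obtain V1 \<sigma> \<tau> where 1: "p \<in> V1" "V1 \<subseteq> U" "openin X V1" "rep k s V1 \<sigma>" "rep l t V1 \<tau>" using rep2[OF assms(1,2,4)] .
  obtain V2 \<upsilon> where 2: "p \<in> V2" "V2 \<subseteq> U" "openin X V2" "rep m u V2 \<upsilon>" using rep1[OF assms(3,4)] .
  have o: "openin X (V1 \<inter> V2)" using 1 2 by blast
  have "rep k s (V1 \<inter> V2) (r V1 (V1 \<inter> V2) k \<sigma>)" by (rule rep_res[OF 1(4) o]) blast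
  moreover have "rep l t (V1 \<inter> V2) (r V1 (V1 \<inter> V2) l \<tau>)" by (rule rep_res[OF 1(5) o]) blast
  moreover have "rep m u (V1 \<inter> V2) (r V2 (V1 \<inter> V2) m \<upsilon>)" by (rule rep_res[OF 2(4) o]) blast
  ultimately show thesis using that[of "V1 \<inter> V2"] 1 2 o repD(2) by blast
qed

lemma S_ext: "s \<in> S U k \<Longrightarrow> s \<in> extensional U"
  by (simp add: S_iff)

lemma S_eqI:
  assumes "s \<in> S U k" "t \<in> S U k" "\<And>p. p \<in> U \<Longrightarrow> \<exists>V \<sigma>. p \<in> V \<and> rep k s V \<sigma> \<and> rep k t V \<sigma>"
  shows "s = t"
proof (rule extensionalityI[OF S_ext[OF assms(1)] S_ext[OF assms(2)]])
  fix p assume "p \<in> U"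
  then obtain V \<sigma> where "p \<in> V" "rep k s V \<sigma>" "rep k t V \<sigma>" using assms(3) by blast
  then show "s p = t p" using repD(3) by metis
qed

section \<open>Operations on sections in terms of representatives\<close>

abbreviation "SM U k \<equiv> sheafified_deg X A P U k"
abbreviation "SS U \<equiv> sec (sheafify X A P) U"

lemma SM_carrier: "carrier (SM U k) = S U k"
  by (simp add: sheafified_deg_def)

lemma SS_deg: "deg (SS U) = SM U"
  by (simp add: sheafify_def fun_eq_iff)

lemma rep_add:
  assumes "rep k s V \<sigma>" "rep k t V \<tau>" "V \<subseteq> U"
  shows "rep k (s \<oplus>\<^bsub>SM U k\<^esub> t) V (\<sigma> \<oplus>\<^bsub>M V k\<^esub> \<tau>)"
  unfolding rep_def
proof (intro conjI ballI)
  note V = repD(1,2)[OF assms(1)] repD(2)[OF assms(2)]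
  show "openin X V" "\<sigma> \<oplus>\<^bsub>M V k\<^esub> \<tau> \<in> carrier (M V k)" using V M_closed by auto
  fix q assume q: "q \<in> V"
  have "(s \<oplus>\<^bsub>SM U k\<^esub> t) q = \<Union>{germ X P k q W (\<sigma>' \<oplus>\<^bsub>M W k\<^esub> \<tau>') | W \<sigma>' \<tau>'.
      (W, \<sigma>') \<in> germ X P k q V \<sigma> \<and> (W, \<tau>') \<in> germ X P k q V \<tau>}"
    using q assms(3) repD(3)[OF assms(1) q] repD(3)[OF assms(2) q] by (auto simp: sheafified_deg_def)
  also have "\<dots> = germ X P k q V (\<sigma> \<oplus>\<^bsub>M V k\<^esub> \<tau>)"
    by (rule germ_binary[OF V(1) q V(2,3), where f = "\<lambda>W \<sigma> \<tau>. \<sigma> \<oplus>\<^bsub>M W k\<^esub> \<tau>"]) (auto simp: M_closed r_add)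
  finally show "(s \<oplus>\<^bsub>SM U k\<^esub> t) q = \<dots>" .
qed

lemma rep_prd:
  assumes "rep k s V \<sigma>" "rep l t V \<tau>" "V \<subseteq> U"
  shows "rep (k + l) (prd (SS U) k l s t) V (prd (sec P V) k l \<sigma> \<tau>)"
  unfolding rep_def
proof (intro conjI ballI)
  note V = repD(1,2)[OF assms(1)] repD(2)[OF assms(2)]
  show "openin X V" "prd (sec P V) k l \<sigma> \<tau> \<in> carrier (M V (k + l))" using V M_closed by auto
  fix q assume q: "q \<in> V"
  have "prd (SS U) k l s t q = \<Union>{germ X P (k + l) q W (prd (sec P W) k l \<sigma>' \<tau>') | W \<sigma>' \<tau>'.
      (W, \<sigma>') \<in> germ X P k q V \<sigma> \<and> (W, \<tau>') \<in> germ X P l q V \<tau>}"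
    using q assms(3) repD(3)[OF assms(1) q] repD(3)[OF assms(2) q] by (auto simp: sheafify_def)
  also have "\<dots> = germ X P (k + l) q V (prd (sec P V) k l \<sigma> \<tau>)"
    by (rule germ_binary[OF V(1) q V(2,3), where f = "\<lambda>W. prd (sec P W) k l"]) (auto simp: M_closed r_prd)
  finally show "prd (SS U) k l s t q = \<dots>" .
qed

lemma rep_dif:
  assumes "rep k s V \<sigma>" "V \<subseteq> U"
  shows "rep (k + 1) (dif (SS U) k s) V (dif (sec P V) k \<sigma>)"
  unfolding rep_def
proof (intro conjI ballI)
  note V = repD(1,2)[OF assms(1)]
  show "openin X V" "dif (sec P V) k \<sigma> \<in> carrier (M V (k + 1))" using V M_closed by auto
  fix q assume q: "q \<in> V"
  have "dif (SS U) k s q = \<Union>{germ X P (k + 1) q W (dif (sec P W) k \<sigma>') | W \<sigma>'. True \<and> (W, \<sigma>') \<in> germ X P k q V \<sigma>}"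
    using q assms(2) repD(3)[OF assms(1) q] by (auto simp: sheafify_def)
  also have "\<dots> = germ X P (k + 1) q V (dif (sec P V) k \<sigma>)"
    by (rule germ_unary[OF V(1) q, where f = "\<lambda>W. dif (sec P W) k" and Q = "\<lambda>_. True"]) (auto simp: M_closed r_dif V)
  finally show "dif (SS U) k s q = \<dots>" .
qed

lemma rep_smult:
  assumes "rep k s V \<sigma>" "V \<subseteq> U" "openin X U" "a \<in> carrier (rng A U)"
  shows "rep k (a \<odot>\<^bsub>SM U k\<^esub> s) V (rst A U V a \<odot>\<^bsub>M V k\<^esub> \<sigma>)"
  unfolding rep_def
proof (intro conjI ballI)
  note V = repD(1,2)[OF assms(1)]
  show "openin X V" "rst A U V a \<odot>\<^bsub>M V k\<^esub> \<sigma> \<in> carrier (M V k)" using V assms by (auto intro: M_closed A_rst_closed)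
  fix q assume q: "q \<in> V"
  have "(a \<odot>\<^bsub>SM U k\<^esub> s) q = \<Union>{germ X P k q W (rst A U W a \<odot>\<^bsub>M W k\<^esub> \<sigma>') | W \<sigma>'. W \<subseteq> U \<and> (W, \<sigma>') \<in> germ X P k q V \<sigma>}"
    using q assms(2) repD(3)[OF assms(1) q] by (auto simp: sheafified_deg_def)
  also have "\<dots> = germ X P k q V (rst A U V a \<odot>\<^bsub>M V k\<^esub> \<sigma>)"
    by (rule germ_unary[OF V(1) q, where f = "\<lambda>W \<sigma>. rst A U W a \<odot>\<^bsub>M W k\<^esub> \<sigma>" and Q = "\<lambda>W. W \<subseteq> U"])
       (use assms V in \<open>auto simp: r_smult A_rst_closed A_rst_comp intro: M_closed\<close>)
  finally show "(a \<odot>\<^bsub>SM U k\<^esub> s) q = \<dots>" .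
qed

lemma rep_unit: "openin X U \<Longrightarrow> \<sigma> \<in> carrier (M U k) \<Longrightarrow> rep k (sheafify_unit X P U k \<sigma>) U \<sigma>"
  unfolding rep_def sheafify_unit_def by auto

lemma rep_zero: "openin X U \<Longrightarrow> openin X V \<Longrightarrow> V \<subseteq> U \<Longrightarrow> rep k \<zero>\<^bsub>SM U k\<^esub> V \<zero>\<^bsub>M V k\<^esub>"
  using rep_res[OF rep_unit[of U "\<zero>\<^bsub>M U k\<^esub>" k], of V] r_zero M_closed(2) by (simp add: sheafified_deg_def)

lemma unit_closed: "openin X U \<Longrightarrow> \<sigma> \<in> carrier (M U k) \<Longrightarrow> sheafify_unit X P U k \<sigma> \<in> S U k"
  using rep_unit[of U \<sigma> k] by (intro SI) (auto simp: sheafify_unit_def)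

lemma S_add: "s \<in> S U k \<Longrightarrow> t \<in> S U k \<Longrightarrow> s \<oplus>\<^bsub>SM U k\<^esub> t \<in> S U k"
proof (rule SI)
  show "s \<oplus>\<^bsub>SM U k\<^esub> t \<in> extensional U" by (simp add: sheafified_deg_def)
  fix p assume "s \<in> S U k" "t \<in> S U k" "p \<in> U"
  then show "\<exists>V \<sigma>. p \<in> V \<and> V \<subseteq> U \<and> rep k (s \<oplus>\<^bsub>SM U k\<^esub> t) V \<sigma>" using rep2 rep_add by metis
qed

lemma S_prd: "s \<in> S U k \<Longrightarrow> t \<in> S U l \<Longrightarrow> prd (SS U) k l s t \<in> S U (k + l)"
proof (rule SI)
  show "prd (SS U) k l s t \<in> extensional U" by (simp add: sheafify_def)
  fix p assume "s \<in> S U k" "t \<in> S U l" "p \<in> U"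
  then show "\<exists>V \<sigma>. p \<in> V \<and> V \<subseteq> U \<and> rep (k + l) (prd (SS U) k l s t) V \<sigma>" using rep2 rep_prd by metis
qed

lemma S_dif: "s \<in> S U k \<Longrightarrow> dif (SS U) k s \<in> S U (k + 1)"
proof (rule SI)
  show "dif (SS U) k s \<in> extensional U" by (simp add: sheafify_def)
  fix p assume "s \<in> S U k" "p \<in> U"
  then show "\<exists>V \<sigma>. p \<in> V \<and> V \<subseteq> U \<and> rep (k + 1) (dif (SS U) k s) V \<sigma>" using rep1 rep_dif by metis
qed

lemma S_smult: "openin X U \<Longrightarrow> a \<in> carrier (rng A U) \<Longrightarrow> s \<in> S U k \<Longrightarrow> a \<odot>\<^bsub>SM U k\<^esub> s \<in> S U k"
proof (rule SI)
  show "a \<odot>\<^bsub>SM U k\<^esub> s \<in> extensional U" by (simp add: sheafified_deg_def)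
  fix p assume "openin X U" "a \<in> carrier (rng A U)" "s \<in> S U k" "p \<in> U"
  then show "\<exists>V \<sigma>. p \<in> V \<and> V \<subseteq> U \<and> rep k (a \<odot>\<^bsub>SM U k\<^esub> s) V \<sigma>" using rep1 rep_smult by metis
qed

lemma S_zero: "openin X U \<Longrightarrow> \<zero>\<^bsub>SM U k\<^esub> \<in> S U k"
  using unit_closed[OF _ M_closed(2)] by (simp add: sheafified_deg_def)

lemma rst_add:
  assumes "openin X U" "openin X V" "V \<subseteq> U" "a \<in> carrier (rng A U)" "b \<in> carrier (rng A U)"
  shows "rst A U V (a \<oplus>\<^bsub>alg (rng A U)\<^esub> b) = rst A U V a \<oplus>\<^bsub>alg (rng A V)\<^esub> rst A U V b"
    "rst A U V (a \<otimes>\<^bsub>alg (rng A U)\<^esub> b) = rst A U V a \<otimes>\<^bsub>alg (rng A V)\<^esub> rst A U V b"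
    "rst A U V (cconst (rng A U) x) = cconst (rng A V) x"
proof -
  interpret smooth_hom "rng A U" "rng A V" "rst A U V" using assms by (intro smooth_homI A_ring A_hom)
  show "rst A U V (a \<oplus>\<^bsub>alg (rng A U)\<^esub> b) = rst A U V a \<oplus>\<^bsub>alg (rng A V)\<^esub> rst A U V b"
    "rst A U V (a \<otimes>\<^bsub>alg (rng A U)\<^esub> b) = rst A U V a \<otimes>\<^bsub>alg (rng A V)\<^esub> rst A U V b"
    "rst A U V (cconst (rng A U) x) = cconst (rng A V) x"
    using assms by (simp_all add: g_add g_mult g_cconst)
qed

end

text \<open>The record of a module has no field for negatives. Written as multiplication by the
  constant minus one, a negative falls under \<open>rep_smult\<close>; this supplies the inverses in
  \<open>SM_module\<close> and the signs in \<open>rep_minus\<close>.\<close>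

lemma (in smooth_ring) cconst_neg:
  assumes "Module.module (alg C) L" "x \<in> carrier L"
  shows "cconst C (- 1) \<odot>\<^bsub>L\<^esub> x \<oplus>\<^bsub>L\<^esub> x = \<zero>\<^bsub>L\<^esub>" "cconst C (- 1) \<odot>\<^bsub>L\<^esub> x = \<ominus>\<^bsub>L\<^esub> x"
proof -
  interpret L: Module.module "alg C" L by fact
  have "cconst C (- 1) \<oplus>\<^bsub>alg C\<^esub> \<one>\<^bsub>alg C\<^esub> = \<zero>\<^bsub>alg C\<^esub>"
    using alg_add_cop[OF C, of "[]" "\<lambda>_. - 1" "\<lambda>_. 1"] smooth_const
    by (simp add: one_cconst) (simp add: cconst_def alg_def)
  then have "(cconst C (- 1) \<oplus>\<^bsub>alg C\<^esub> \<one>\<^bsub>alg C\<^esub>) \<odot>\<^bsub>L\<^esub> x = \<zero>\<^bsub>L\<^esub>" using assms(2) by simp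
  moreover have "(cconst C (- 1) \<oplus>\<^bsub>alg C\<^esub> \<one>\<^bsub>alg C\<^esub>) \<odot>\<^bsub>L\<^esub> x = cconst C (- 1) \<odot>\<^bsub>L\<^esub> x \<oplus>\<^bsub>L\<^esub> \<one>\<^bsub>alg C\<^esub> \<odot>\<^bsub>L\<^esub> x"
    by (rule L.smult_l_distr) (use assms(2) in \<open>auto simp: cconst_closed\<close>)
  ultimately show *: "cconst C (- 1) \<odot>\<^bsub>L\<^esub> x \<oplus>\<^bsub>L\<^esub> x = \<zero>\<^bsub>L\<^esub>" using assms(2) by simp
  have "cconst C (- 1) \<odot>\<^bsub>L\<^esub> x \<in> carrier L" using assms(2) by (simp add: cconst_closed)
  then show "cconst C (- 1) \<odot>\<^bsub>L\<^esub> x = \<ominus>\<^bsub>L\<^esub> x" using L.minus_equality[OF *] assms(2) by simp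
qed

context presheaf_of_cdgas
begin

text \<open>The two representatives are allowed to differ syntactically, and their equality comes
  last. Thus the rules for \<open>rep\<close> can first compute both sides of an identity, leaving
  exactly that identity in the presheaf.\<close>

lemma S_eqI':
  assumes "s \<in> S U k" "t \<in> S U k"
    "\<And>p. p \<in> U \<Longrightarrow> \<exists>V \<sigma> \<tau>. p \<in> V \<and> rep k s V \<sigma> \<and> rep k t V \<tau> \<and> \<sigma> = \<tau>"
  shows "s = t"
  by (rule S_eqI[OF assms(1,2)]) (use assms(3) in blast)

lemma rep_eqI:
  "p \<in> V \<Longrightarrow> rep k s V \<sigma> \<Longrightarrow> rep k t V \<tau> \<Longrightarrow> \<sigma> = \<tau> \<Longrightarrow> \<exists>V \<sigma> \<tau>. p \<in> V \<and> rep k s V \<sigma> \<and> rep k t V \<tau> \<and> \<sigma> = \<tau>"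
  by blast

lemma smooth_ring_sections: "openin X U \<Longrightarrow> smooth_ring (rng A U)"
  by (rule smooth_ring.intro) (rule A_ring)

lemma rst_cconst: "openin X U \<Longrightarrow> openin X V \<Longrightarrow> V \<subseteq> U \<Longrightarrow> rst A U V (cconst (rng A U) x) = cconst (rng A V) x"
  by (rule rst_add(3)[of _ _ "cconst (rng A U) 0" "cconst (rng A U) 0"]) (auto intro: smooth_ring.cconst_closed smooth_ring_sections)

lemma SM_module:
  assumes U: "openin X U"
  shows "Module.module (alg (rng A U)) (SM U k)"
proof -
  note cl = S_add S_smult[OF U] S_zero[OF U]
  have cc: "cconst (rng A U) x \<in> carrier (rng A U)" for x
    by (rule smooth_ring.cconst_closed[OF smooth_ring_sections[OF U]])
  interpret R: cring "alg (rng A U)" by (rule alg_cring[OF A_ring[OF U]])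
  note RU = A_carrier[OF U]
  have Rcl: "a \<oplus>\<^bsub>alg (rng A U)\<^esub> b \<in> carrier (rng A U)" "a \<otimes>\<^bsub>alg (rng A U)\<^esub> b \<in> carrier (rng A U)"
    if "a \<in> carrier (rng A U)" "b \<in> carrier (rng A U)" for a b
    using R.add.m_closed[of a b] R.m_closed[of a b] that RU by auto
  have one: "\<one>\<^bsub>alg (rng A U)\<^esub> = cconst (rng A U) 1" by (simp add: alg_def)
  show ?thesis
  proof (rule moduleI)
    show "cring (alg (rng A U))" by (rule R.is_cring)
    show "abelian_group (SM U k)"
    proof (rule abelian_groupI)
      fix x y z assume x: "x \<in> carrier (SM U k)" and y: "y \<in> carrier (SM U k)"
      note xy = x[unfolded SM_carrier] y[unfolded SM_carrier]
      show "x \<oplus>\<^bsub>SM U k\<^esub> y \<in> carrier (SM U k)" using xy by (simp add: SM_carrier cl)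
      show "x \<oplus>\<^bsub>SM U k\<^esub> y = y \<oplus>\<^bsub>SM U k\<^esub> x"
      proof (rule S_eqI')
        fix p assume "p \<in> U"
        then obtain V \<sigma> \<tau> where V: "p \<in> V" "V \<subseteq> U" "openin X V" "rep k x V \<sigma>" "rep k y V \<tau>"
          "\<sigma> \<in> carrier (M V k)" "\<tau> \<in> carrier (M V k)" using rep2[OF xy] by metis
        interpret V: Module.module "alg (rng A V)" "M V k" by (rule M_module[OF V(3)])
        show "\<exists>V \<sigma> \<tau>. p \<in> V \<and> rep k (x \<oplus>\<^bsub>SM U k\<^esub> y) V \<sigma> \<and> rep k (y \<oplus>\<^bsub>SM U k\<^esub> x) V \<tau> \<and> \<sigma> = \<tau>"
          by (intro rep_eqI[OF V(1) rep_add[OF V(4,5,2)] rep_add[OF V(5,4,2)]] V.a_comm V)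
      qed (simp_all add: cl xy)
      assume z: "z \<in> carrier (SM U k)"
      note xyz = xy z[unfolded SM_carrier]
      show "x \<oplus>\<^bsub>SM U k\<^esub> y \<oplus>\<^bsub>SM U k\<^esub> z = x \<oplus>\<^bsub>SM U k\<^esub> (y \<oplus>\<^bsub>SM U k\<^esub> z)"
      proof (rule S_eqI')
        fix p assume "p \<in> U"
        then obtain V \<sigma> \<tau> \<upsilon> where V: "p \<in> V" "V \<subseteq> U" "openin X V" "rep k x V \<sigma>" "rep k y V \<tau>" "rep k z V \<upsilon>"
          "\<sigma> \<in> carrier (M V k)" "\<tau> \<in> carrier (M V k)" "\<upsilon> \<in> carrier (M V k)" using rep3[OF xyz] by metis
        interpret V: Module.module "alg (rng A V)" "M V k" by (rule M_module[OF V(3)])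
        show "\<exists>V \<sigma> \<tau>. p \<in> V \<and> rep k (x \<oplus>\<^bsub>SM U k\<^esub> y \<oplus>\<^bsub>SM U k\<^esub> z) V \<sigma> \<and>
            rep k (x \<oplus>\<^bsub>SM U k\<^esub> (y \<oplus>\<^bsub>SM U k\<^esub> z)) V \<tau> \<and> \<sigma> = \<tau>"
          by (intro rep_eqI[OF V(1) rep_add[OF rep_add[OF V(4,5,2)] V(6,2)] rep_add[OF V(4) rep_add[OF V(5,6,2)] V(2)]] V.a_assoc V)
      qed (simp_all add: cl xyz)
    next
      show "\<zero>\<^bsub>SM U k\<^esub> \<in> carrier (SM U k)" by (simp add: SM_carrier cl)
      fix x assume "x \<in> carrier (SM U k)"
      then have x: "x \<in> S U k" by (simp add: SM_carrier)
      show "\<zero>\<^bsub>SM U k\<^esub> \<oplus>\<^bsub>SM U k\<^esub> x = x"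
      proof (rule S_eqI')
        fix p assume "p \<in> U"
        then obtain V \<sigma> where V: "p \<in> V" "V \<subseteq> U" "openin X V" "rep k x V \<sigma>" "\<sigma> \<in> carrier (M V k)" using rep1[OF x] by metis
        interpret V: Module.module "alg (rng A V)" "M V k" by (rule M_module[OF V(3)])
        show "\<exists>V \<sigma> \<tau>. p \<in> V \<and> rep k (\<zero>\<^bsub>SM U k\<^esub> \<oplus>\<^bsub>SM U k\<^esub> x) V \<sigma> \<and> rep k x V \<tau> \<and> \<sigma> = \<tau>"
          by (intro rep_eqI[OF V(1) rep_add[OF rep_zero[OF U V(3,2)] V(4,2)] V(4)] V.l_zero V)
      qed (simp_all add: cl x)
      show "\<exists>y\<in>carrier (SM U k). y \<oplus>\<^bsub>SM U k\<^esub> x = \<zero>\<^bsub>SM U k\<^esub>"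
      proof (rule bexI[of _ "cconst (rng A U) (- 1) \<odot>\<^bsub>SM U k\<^esub> x"], rule S_eqI')
        fix p assume "p \<in> U"
        then obtain V \<sigma> where V: "p \<in> V" "V \<subseteq> U" "openin X V" "rep k x V \<sigma>" "\<sigma> \<in> carrier (M V k)" using rep1[OF x] by metis
        show "\<exists>V \<sigma> \<tau>. p \<in> V \<and> rep k (cconst (rng A U) (- 1) \<odot>\<^bsub>SM U k\<^esub> x \<oplus>\<^bsub>SM U k\<^esub> x) V \<sigma> \<and> rep k \<zero>\<^bsub>SM U k\<^esub> V \<tau> \<and> \<sigma> = \<tau>"
          by (rule rep_eqI[OF V(1) rep_add[OF rep_smult[OF V(4,2) U cc] V(4,2)] rep_zero[OF U V(3,2)]])
             (simp add: rst_cconst[OF U V(3,2)] smooth_ring.cconst_neg(1)[OF smooth_ring_sections[OF V(3)] M_module[OF V(3)] V(5)])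
      qed (simp_all add: SM_carrier cl cc x)
    qed
  next
    fix a x assume "a \<in> carrier (alg (rng A U))" "x \<in> carrier (SM U k)"
    then show "a \<odot>\<^bsub>SM U k\<^esub> x \<in> carrier (SM U k)" by (simp add: SM_carrier RU cl)
  next
    fix a b x assume "a \<in> carrier (alg (rng A U))" "b \<in> carrier (alg (rng A U))" "x \<in> carrier (SM U k)"
    then have ab: "a \<in> carrier (rng A U)" "b \<in> carrier (rng A U)" and x: "x \<in> S U k" by (simp_all add: SM_carrier RU)
    show "(a \<oplus>\<^bsub>alg (rng A U)\<^esub> b) \<odot>\<^bsub>SM U k\<^esub> x = a \<odot>\<^bsub>SM U k\<^esub> x \<oplus>\<^bsub>SM U k\<^esub> b \<odot>\<^bsub>SM U k\<^esub> x"
    proof (rule S_eqI')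
      fix p assume "p \<in> U"
      then obtain V \<sigma> where V: "p \<in> V" "V \<subseteq> U" "openin X V" "rep k x V \<sigma>" "\<sigma> \<in> carrier (M V k)" using rep1[OF x] by metis
      interpret V: Module.module "alg (rng A V)" "M V k" by (rule M_module[OF V(3)])
      show "\<exists>V \<sigma> \<tau>. p \<in> V \<and> rep k ((a \<oplus>\<^bsub>alg (rng A U)\<^esub> b) \<odot>\<^bsub>SM U k\<^esub> x) V \<sigma> \<and>
          rep k (a \<odot>\<^bsub>SM U k\<^esub> x \<oplus>\<^bsub>SM U k\<^esub> b \<odot>\<^bsub>SM U k\<^esub> x) V \<tau> \<and> \<sigma> = \<tau>"
        by (rule rep_eqI[OF V(1) rep_smult[OF V(4,2) U Rcl(1)[OF ab]] rep_add[OF rep_smult[OF V(4,2) U ab(1)] rep_smult[OF V(4,2) U ab(2)] V(2)]])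
           (use ab V in \<open>simp add: rst_add(1)[OF U V(3,2) ab] V.smult_l_distr A_rst_closed[OF U V(3,2)] A_carrier\<close>)
    qed (simp_all add: cl x ab Rcl)
    show "(a \<otimes>\<^bsub>alg (rng A U)\<^esub> b) \<odot>\<^bsub>SM U k\<^esub> x = a \<odot>\<^bsub>SM U k\<^esub> (b \<odot>\<^bsub>SM U k\<^esub> x)"
    proof (rule S_eqI')
      fix p assume "p \<in> U"
      then obtain V \<sigma> where V: "p \<in> V" "V \<subseteq> U" "openin X V" "rep k x V \<sigma>" "\<sigma> \<in> carrier (M V k)" using rep1[OF x] by metis
      interpret V: Module.module "alg (rng A V)" "M V k" by (rule M_module[OF V(3)])
      show "\<exists>V \<sigma> \<tau>. p \<in> V \<and> rep k ((a \<otimes>\<^bsub>alg (rng A U)\<^esub> b) \<odot>\<^bsub>SM U k\<^esub> x) V \<sigma> \<and>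
          rep k (a \<odot>\<^bsub>SM U k\<^esub> (b \<odot>\<^bsub>SM U k\<^esub> x)) V \<tau> \<and> \<sigma> = \<tau>"
        by (rule rep_eqI[OF V(1) rep_smult[OF V(4,2) U Rcl(2)[OF ab]] rep_smult[OF rep_smult[OF V(4,2) U ab(2)] V(2) U ab(1)]])
           (use ab V in \<open>simp add: rst_add(2)[OF U V(3,2) ab] V.smult_assoc1 A_rst_closed[OF U V(3,2)] A_carrier\<close>)
    qed (simp_all add: cl x ab Rcl)
  next
    fix a x y assume "a \<in> carrier (alg (rng A U))" "x \<in> carrier (SM U k)" "y \<in> carrier (SM U k)"
    then have a: "a \<in> carrier (rng A U)" and xy: "x \<in> S U k" "y \<in> S U k" by (simp_all add: SM_carrier RU)
    show "a \<odot>\<^bsub>SM U k\<^esub> (x \<oplus>\<^bsub>SM U k\<^esub> y) = a \<odot>\<^bsub>SM U k\<^esub> x \<oplus>\<^bsub>SM U k\<^esub> a \<odot>\<^bsub>SM U k\<^esub> y"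
    proof (rule S_eqI')
      fix p assume "p \<in> U"
      then obtain V \<sigma> \<tau> where V: "p \<in> V" "V \<subseteq> U" "openin X V" "rep k x V \<sigma>" "rep k y V \<tau>"
        "\<sigma> \<in> carrier (M V k)" "\<tau> \<in> carrier (M V k)" using rep2[OF xy] by metis
      interpret V: Module.module "alg (rng A V)" "M V k" by (rule M_module[OF V(3)])
      show "\<exists>V \<sigma> \<tau>. p \<in> V \<and> rep k (a \<odot>\<^bsub>SM U k\<^esub> (x \<oplus>\<^bsub>SM U k\<^esub> y)) V \<sigma> \<and>
          rep k (a \<odot>\<^bsub>SM U k\<^esub> x \<oplus>\<^bsub>SM U k\<^esub> a \<odot>\<^bsub>SM U k\<^esub> y) V \<tau> \<and> \<sigma> = \<tau>"
        by (rule rep_eqI[OF V(1) rep_smult[OF rep_add[OF V(4,5,2)] V(2) U a] rep_add[OF rep_smult[OF V(4,2) U a] rep_smult[OF V(5,2) U a] V(2)]])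
           (use a V in \<open>simp add: V.smult_r_distr A_rst_closed[OF U V(3,2)] A_carrier\<close>)
    qed (simp_all add: cl a xy)
  next
    fix x assume "x \<in> carrier (SM U k)"
    then have x: "x \<in> S U k" by (simp add: SM_carrier)
    show "\<one>\<^bsub>alg (rng A U)\<^esub> \<odot>\<^bsub>SM U k\<^esub> x = x"
      unfolding one
    proof (rule S_eqI')
      fix p assume "p \<in> U"
      then obtain V \<sigma> where V: "p \<in> V" "V \<subseteq> U" "openin X V" "rep k x V \<sigma>" "\<sigma> \<in> carrier (M V k)" using rep1[OF x] by metis
      interpret V: Module.module "alg (rng A V)" "M V k" by (rule M_module[OF V(3)])
      have one_V: "cconst (rng A V) 1 = \<one>\<^bsub>alg (rng A V)\<^esub>" by (simp add: alg_def)
      show "\<exists>V \<sigma> \<tau>. p \<in> V \<and> rep k (cconst (rng A U) 1 \<odot>\<^bsub>SM U k\<^esub> x) V \<sigma> \<and> rep k x V \<tau> \<and> \<sigma> = \<tau>"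
        by (rule rep_eqI[OF V(1) rep_smult[OF V(4,2) U cc] V(4)]) (use V one_V in \<open>simp add: rst_cconst[OF U V(3,2)]\<close>)
    qed (simp_all add: cl cc x)
  qed
qed

lemma rep_minus:
  assumes "openin X U" "s \<in> S U k" "rep k s V \<sigma>" "V \<subseteq> U"
  shows "rep k (\<ominus>\<^bsub>SM U k\<^esub> s) V (\<ominus>\<^bsub>M V k\<^esub> \<sigma>)"
proof -
  note V = repD(1,2)[OF assms(3)]
  have cc: "cconst (rng A U) x \<in> carrier (rng A U)" for x
    by (rule smooth_ring.cconst_closed[OF smooth_ring_sections[OF assms(1)]])
  have "\<ominus>\<^bsub>SM U k\<^esub> s = cconst (rng A U) (- 1) \<odot>\<^bsub>SM U k\<^esub> s"
    using smooth_ring.cconst_neg(2)[OF smooth_ring_sections[OF assms(1)] SM_module[OF assms(1)], of s k] assms(2) by (simp add: SM_carrier)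
  moreover have "\<ominus>\<^bsub>M V k\<^esub> \<sigma> = cconst (rng A V) (- 1) \<odot>\<^bsub>M V k\<^esub> \<sigma>"
    using smooth_ring.cconst_neg(2)[OF smooth_ring_sections[OF V(1)] M_module[OF V(1)] V(2)] by simp
  ultimately show ?thesis
    using rep_smult[OF assms(3,4,1) cc, of "- 1"] rst_cconst[OF assms(1) V(1) assms(4)] by simp
qed

lemma rep_signed:
  assumes "openin X U" "s \<in> S U k" "rep k s V \<sigma>" "V \<subseteq> U"
  shows "rep k (signed (SM U k) n s) V (signed (M V k) n \<sigma>)"
  using rep_minus[OF assms] assms(3) by (simp add: signed_def)

lemma S_signed: "openin X U \<Longrightarrow> s \<in> S U k \<Longrightarrow> signed (SM U k) n s \<in> S U k"
  using abelian_group.a_inv_closed[OF Module.module.axioms(2)[OF SM_module], of U s k] by (simp add: signed_def SM_carrier)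

text \<open>A variable degree again, for commutativity, associativity and the Leibniz rule, where
  the degrees of the two sides agree only by arithmetic.\<close>

lemma rep_prd': "rep k s V \<sigma> \<Longrightarrow> rep l t V \<tau> \<Longrightarrow> V \<subseteq> U \<Longrightarrow> k + l = n \<Longrightarrow>
    rep n (prd (SS U) k l s t) V (prd (sec P V) k l \<sigma> \<tau>)"
  using rep_prd by auto

lemma S_prd': "s \<in> S U k \<Longrightarrow> t \<in> S U l \<Longrightarrow> k + l = n \<Longrightarrow> prd (SS U) k l s t \<in> S U n"
  using S_prd by auto

section \<open>The CDGA of sections of the sheafification\<close>

lemma SS_graded_algebra:
  assumes U: "openin X U"
  shows "graded_algebra (rng A U) (deg (SS U)) (prd (SS U))"
  unfolding graded_algebra_def SS_deg SM_carrier
proof (intro conjI allI ballI)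
  show "Module.module (alg (rng A U)) (SM U k)" for k by (rule SM_module[OF U])
  fix k l x y assume xy: "x \<in> S U k" "y \<in> S U l"
  show "prd (SS U) k l x y \<in> S U (k + l)" by (rule S_prd[OF xy])
  show "prd (SS U) k l x y = signed (SM U (k + l)) (k * l) (prd (SS U) l k y x)"
  proof (rule S_eqI')
    fix p assume "p \<in> U"
    then obtain V \<sigma> \<tau> where V: "p \<in> V" "V \<subseteq> U" "openin X V" "rep k x V \<sigma>" "rep l y V \<tau>"
      "\<sigma> \<in> carrier (M V k)" "\<tau> \<in> carrier (M V l)" using rep2[OF xy] by metis
    show "\<exists>V \<sigma> \<tau>. p \<in> V \<and> rep (k + l) (prd (SS U) k l x y) V \<sigma> \<and>
        rep (k + l) (signed (SM U (k + l)) (k * l) (prd (SS U) l k y x)) V \<tau> \<and> \<sigma> = \<tau>"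
      by (intro rep_eqI[OF V(1) rep_prd[OF V(4,5,2)] rep_signed[OF U S_prd'[OF xy(2,1)] rep_prd'[OF V(5,4,2)] V(2)]] graded_algebraD(3)[OF graded_algebra[OF V(3)] V(6,7)]) simp_all
  qed (use xy in \<open>auto intro!: S_prd S_signed[OF U] S_prd'\<close>)
next
  fix k l x x' y assume x: "x \<in> S U k" "x' \<in> S U k" "y \<in> S U l"
  show "prd (SS U) k l (x \<oplus>\<^bsub>SM U k\<^esub> x') y = prd (SS U) k l x y \<oplus>\<^bsub>SM U (k + l)\<^esub> prd (SS U) k l x' y"
  proof (rule S_eqI')
    fix p assume "p \<in> U"
    then obtain V \<sigma> \<tau> \<upsilon> where V: "p \<in> V" "V \<subseteq> U" "openin X V" "rep k x V \<sigma>" "rep k x' V \<tau>" "rep l y V \<upsilon>"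
      "\<sigma> \<in> carrier (M V k)" "\<tau> \<in> carrier (M V k)" "\<upsilon> \<in> carrier (M V l)" using rep3[OF x] by metis
    show "\<exists>V \<sigma> \<tau>. p \<in> V \<and> rep (k + l) (prd (SS U) k l (x \<oplus>\<^bsub>SM U k\<^esub> x') y) V \<sigma> \<and>
        rep (k + l) (prd (SS U) k l x y \<oplus>\<^bsub>SM U (k + l)\<^esub> prd (SS U) k l x' y) V \<tau> \<and> \<sigma> = \<tau>"
      by (intro rep_eqI[OF V(1) rep_prd[OF rep_add[OF V(4,5,2)] V(6,2)] rep_add[OF rep_prd[OF V(4,6,2)] rep_prd[OF V(5,6,2)] V(2)]] graded_algebraD(4)[OF graded_algebra[OF V(3)] V(7,8,9)])
  qed (auto intro!: S_prd S_add x)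
next
  fix k l x y y' assume x: "x \<in> S U k" "y \<in> S U l" "y' \<in> S U l"
  show "prd (SS U) k l x (y \<oplus>\<^bsub>SM U l\<^esub> y') = prd (SS U) k l x y \<oplus>\<^bsub>SM U (k + l)\<^esub> prd (SS U) k l x y'"
  proof (rule S_eqI')
    fix p assume "p \<in> U"
    then obtain V \<sigma> \<tau> \<upsilon> where V: "p \<in> V" "V \<subseteq> U" "openin X V" "rep k x V \<sigma>" "rep l y V \<tau>" "rep l y' V \<upsilon>"
      "\<sigma> \<in> carrier (M V k)" "\<tau> \<in> carrier (M V l)" "\<upsilon> \<in> carrier (M V l)" using rep3[OF x] by metis
    show "\<exists>V \<sigma> \<tau>. p \<in> V \<and> rep (k + l) (prd (SS U) k l x (y \<oplus>\<^bsub>SM U l\<^esub> y')) V \<sigma> \<and>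
        rep (k + l) (prd (SS U) k l x y \<oplus>\<^bsub>SM U (k + l)\<^esub> prd (SS U) k l x y') V \<tau> \<and> \<sigma> = \<tau>"
      by (intro rep_eqI[OF V(1) rep_prd[OF V(4) rep_add[OF V(5,6,2)] V(2)] rep_add[OF rep_prd[OF V(4,5,2)] rep_prd[OF V(4,6,2)] V(2)]] graded_algebraD(5)[OF graded_algebra[OF V(3)] V(7,8,9)])
  qed (auto intro!: S_prd S_add x)
next
  fix k l a x y assume a: "a \<in> carrier (rng A U)" and xy: "x \<in> S U k" "y \<in> S U l"
  note c = S_prd S_smult[OF U a] xy
  show "prd (SS U) k l (a \<odot>\<^bsub>SM U k\<^esub> x) y = a \<odot>\<^bsub>SM U (k + l)\<^esub> prd (SS U) k l x y"
  proof (rule S_eqI')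
    fix p assume "p \<in> U"
    then obtain V \<sigma> \<tau> where V: "p \<in> V" "V \<subseteq> U" "openin X V" "rep k x V \<sigma>" "rep l y V \<tau>"
      "\<sigma> \<in> carrier (M V k)" "\<tau> \<in> carrier (M V l)" using rep2[OF xy] by metis
    show "\<exists>V \<sigma> \<tau>. p \<in> V \<and> rep (k + l) (prd (SS U) k l (a \<odot>\<^bsub>SM U k\<^esub> x) y) V \<sigma> \<and>
        rep (k + l) (a \<odot>\<^bsub>SM U (k + l)\<^esub> prd (SS U) k l x y) V \<tau> \<and> \<sigma> = \<tau>"
      by (intro rep_eqI[OF V(1) rep_prd[OF rep_smult[OF V(4,2) U a] V(5,2)] rep_smult[OF rep_prd[OF V(4,5,2)] V(2) U a]] graded_algebraD(6)[OF graded_algebra[OF V(3)] A_rst_closed[OF U V(3,2) a] V(6,7)])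
  qed (auto intro!: c)
  show "prd (SS U) k l x (a \<odot>\<^bsub>SM U l\<^esub> y) = a \<odot>\<^bsub>SM U (k + l)\<^esub> prd (SS U) k l x y"
  proof (rule S_eqI')
    fix p assume "p \<in> U"
    then obtain V \<sigma> \<tau> where V: "p \<in> V" "V \<subseteq> U" "openin X V" "rep k x V \<sigma>" "rep l y V \<tau>"
      "\<sigma> \<in> carrier (M V k)" "\<tau> \<in> carrier (M V l)" using rep2[OF xy] by metis
    show "\<exists>V \<sigma> \<tau>. p \<in> V \<and> rep (k + l) (prd (SS U) k l x (a \<odot>\<^bsub>SM U l\<^esub> y)) V \<sigma> \<and>
        rep (k + l) (a \<odot>\<^bsub>SM U (k + l)\<^esub> prd (SS U) k l x y) V \<tau> \<and> \<sigma> = \<tau>"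
      by (intro rep_eqI[OF V(1) rep_prd[OF V(4) rep_smult[OF V(5,2) U a] V(2)] rep_smult[OF rep_prd[OF V(4,5,2)] V(2) U a]] graded_algebraD(7)[OF graded_algebra[OF V(3)] A_rst_closed[OF U V(3,2) a] V(6,7)])
  qed (auto intro!: c)
next
  fix k l m x y z assume x: "x \<in> S U k" "y \<in> S U l" "z \<in> S U m"
  show "prd (SS U) (k + l) m (prd (SS U) k l x y) z = prd (SS U) k (l + m) x (prd (SS U) l m y z)"
  proof (rule S_eqI'[where k = "k + l + m"])
    fix p assume "p \<in> U"
    then obtain V \<sigma> \<tau> \<upsilon> where V: "p \<in> V" "V \<subseteq> U" "openin X V" "rep k x V \<sigma>" "rep l y V \<tau>" "rep m z V \<upsilon>"
      "\<sigma> \<in> carrier (M V k)" "\<tau> \<in> carrier (M V l)" "\<upsilon> \<in> carrier (M V m)" using rep3[OF x] by metis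
    show "\<exists>V \<sigma> \<tau>. p \<in> V \<and> rep (k + l + m) (prd (SS U) (k + l) m (prd (SS U) k l x y) z) V \<sigma> \<and>
        rep (k + l + m) (prd (SS U) k (l + m) x (prd (SS U) l m y z)) V \<tau> \<and> \<sigma> = \<tau>"
      by (intro rep_eqI[OF V(1) rep_prd[OF rep_prd[OF V(4,5,2)] V(6,2)] rep_prd'[OF V(4) rep_prd[OF V(5,6,2)] V(2)]] graded_algebraD(8)[OF graded_algebra[OF V(3)] V(7,8,9)]) simp
  qed (auto intro!: S_prd S_prd'[where k = k and l = "l + m"] x)
qed

lemma SS_graded_derivation:
  assumes U: "openin X U"
  shows "graded_derivation (rng A U) (deg (SS U)) (prd (SS U)) (dif (SS U))"
  unfolding graded_derivation_def SS_deg SM_carrier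
proof (intro conjI allI ballI)
  show "dif (SS U) k \<in> S U k \<rightarrow> S U (k + 1)" for k by (rule Pi_I) (rule S_dif)
next
  fix k x y assume xy: "x \<in> S U k" "y \<in> S U k"
  show "dif (SS U) k (x \<oplus>\<^bsub>SM U k\<^esub> y) = dif (SS U) k x \<oplus>\<^bsub>SM U (k + 1)\<^esub> dif (SS U) k y"
  proof (rule S_eqI')
    fix p assume "p \<in> U"
    then obtain V \<sigma> \<tau> where V: "p \<in> V" "V \<subseteq> U" "openin X V" "rep k x V \<sigma>" "rep k y V \<tau>"
      "\<sigma> \<in> carrier (M V k)" "\<tau> \<in> carrier (M V k)" using rep2[OF xy] by metis
    show "\<exists>V \<sigma> \<tau>. p \<in> V \<and> rep (k + 1) (dif (SS U) k (x \<oplus>\<^bsub>SM U k\<^esub> y)) V \<sigma> \<and>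
        rep (k + 1) (dif (SS U) k x \<oplus>\<^bsub>SM U (k + 1)\<^esub> dif (SS U) k y) V \<tau> \<and> \<sigma> = \<tau>"
      by (intro rep_eqI[OF V(1) rep_dif[OF rep_add[OF V(4,5,2)] V(2)] rep_add[OF rep_dif[OF V(4,2)] rep_dif[OF V(5,2)] V(2)]] graded_derivationD(2)[OF graded_derivation[OF V(3)] V(6,7)])
  qed (auto intro!: S_dif S_add xy)
next
  fix k and c :: real and x assume x: "x \<in> S U k"
  have cc: "cconst (rng A U) c \<in> carrier (rng A U)"
    by (rule smooth_ring.cconst_closed[OF smooth_ring_sections[OF U]])
  show "dif (SS U) k (cconst (rng A U) c \<odot>\<^bsub>SM U k\<^esub> x) = cconst (rng A U) c \<odot>\<^bsub>SM U (k + 1)\<^esub> dif (SS U) k x"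
  proof (rule S_eqI')
    fix p assume "p \<in> U"
    then obtain V \<sigma> where V: "p \<in> V" "V \<subseteq> U" "openin X V" "rep k x V \<sigma>" "\<sigma> \<in> carrier (M V k)" using rep1[OF x] by metis
    show "\<exists>V \<sigma> \<tau>. p \<in> V \<and> rep (k + 1) (dif (SS U) k (cconst (rng A U) c \<odot>\<^bsub>SM U k\<^esub> x)) V \<sigma> \<and>
        rep (k + 1) (cconst (rng A U) c \<odot>\<^bsub>SM U (k + 1)\<^esub> dif (SS U) k x) V \<tau> \<and> \<sigma> = \<tau>"
      by (rule rep_eqI[OF V(1) rep_dif[OF rep_smult[OF V(4,2) U cc] V(2)] rep_smult[OF rep_dif[OF V(4,2)] V(2) U cc]])
         (simp add: rst_cconst[OF U V(3,2)] graded_derivationD(3)[OF graded_derivation[OF V(3)] V(5)])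
  qed (auto intro!: S_dif S_smult[OF U cc] x)
next
  fix k l x y assume xy: "x \<in> S U k" "y \<in> S U l"
  have ar: "k + 1 + l = k + l + 1" "k + (l + 1) = k + l + 1" by simp_all
  show "dif (SS U) (k + l) (prd (SS U) k l x y) = prd (SS U) (k + 1) l (dif (SS U) k x) y \<oplus>\<^bsub>SM U (k + l + 1)\<^esub>
      signed (SM U (k + l + 1)) k (prd (SS U) k (l + 1) x (dif (SS U) l y))"
  proof (rule S_eqI')
    fix p assume "p \<in> U"
    then obtain V \<sigma> \<tau> where V: "p \<in> V" "V \<subseteq> U" "openin X V" "rep k x V \<sigma>" "rep l y V \<tau>"
      "\<sigma> \<in> carrier (M V k)" "\<tau> \<in> carrier (M V l)" using rep2[OF xy] by metis
    show "\<exists>V \<sigma> \<tau>. p \<in> V \<and> rep (k + l + 1) (dif (SS U) (k + l) (prd (SS U) k l x y)) V \<sigma> \<and>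
        rep (k + l + 1) (prd (SS U) (k + 1) l (dif (SS U) k x) y \<oplus>\<^bsub>SM U (k + l + 1)\<^esub>
          signed (SM U (k + l + 1)) k (prd (SS U) k (l + 1) x (dif (SS U) l y))) V \<tau> \<and> \<sigma> = \<tau>"
      by (intro rep_eqI[OF V(1) rep_dif[OF rep_prd[OF V(4,5,2)] V(2)] rep_add[OF rep_prd'[OF rep_dif[OF V(4,2)] V(5,2) ar(1)] rep_signed[OF U S_prd'[OF xy(1) S_dif[OF xy(2)] ar(2)] rep_prd'[OF V(4) rep_dif[OF V(5,2)] V(2) ar(2)] V(2)] V(2)]] graded_derivationD(4)[OF graded_derivation[OF V(3)] V(6,7)])
  qed (auto intro!: S_dif S_prd S_add S_prd'[OF S_dif[OF xy(1)] xy(2) ar(1)] S_signed[OF U] S_prd'[OF xy(1) S_dif[OF xy(2)] ar(2)] xy)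
qed

lemma SS_square_zero:
  assumes U: "openin X U"
  shows "square_zero (deg (SS U)) (dif (SS U))"
  unfolding square_zero_def SS_deg SM_carrier
proof (intro allI ballI)
  fix k x assume x: "x \<in> S U k"
  have ar: "k + 1 + 1 = k + 2" by simp
  show "dif (SS U) (k + 1) (dif (SS U) k x) = \<zero>\<^bsub>SM U (k + 2)\<^esub>"
  proof (rule S_eqI')
    show "dif (SS U) (k + 1) (dif (SS U) k x) \<in> S U (k + 2)" using S_dif[OF S_dif[OF x]] unfolding ar .
    fix p assume "p \<in> U"
    then obtain V \<sigma> where V: "p \<in> V" "V \<subseteq> U" "openin X V" "rep k x V \<sigma>" "\<sigma> \<in> carrier (M V k)" using rep1[OF x] by metis
    show "\<exists>V \<sigma> \<tau>. p \<in> V \<and> rep (k + 2) (dif (SS U) (k + 1) (dif (SS U) k x)) V \<sigma> \<and>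
        rep (k + 2) \<zero>\<^bsub>SM U (k + 2)\<^esub> V \<tau> \<and> \<sigma> = \<tau>"
      by (rule rep_eqI[OF V(1) rep_dif[OF rep_dif[OF V(4,2)] V(2), unfolded ar] rep_zero[OF U V(3,2)]])
         (use square_zero[OF V(3)] V(5) in \<open>simp add: square_zero_def\<close>)
  qed (rule S_zero[OF U])
qed

lemma SS_cdga: "openin X U \<Longrightarrow> is_cdga (rng A U) (SS U)"
  unfolding is_cdga_def by (intro conjI SS_graded_algebra SS_graded_derivation SS_square_zero)

section \<open>Restriction and gluing of sections\<close>

lemma S_restrict: "s \<in> S U k \<Longrightarrow> openin X V \<Longrightarrow> V \<subseteq> U \<Longrightarrow> restrict s V \<in> S V k"
proof (rule SI)
  fix p assume s: "s \<in> S U k" and V: "openin X V" "V \<subseteq> U" and p: "p \<in> V"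
  from p V have "p \<in> U" by blast
  with s obtain W \<sigma> where W: "p \<in> W" "W \<subseteq> U" "openin X W" "rep k s W \<sigma>" using rep1 by metis
  have "rep k s (V \<inter> W) (r W (V \<inter> W) k \<sigma>)" by (rule rep_res[OF W(4)]) (use V W in auto)
  then have "rep k (restrict s V) (V \<inter> W) (r W (V \<inter> W) k \<sigma>)" by (rule rep_cong) simp
  then show "\<exists>W \<sigma>. p \<in> W \<and> W \<subseteq> V \<and> rep k (restrict s V) W \<sigma>" using p W(1) by blast
qed simp

lemma rep_restrict: "V \<subseteq> U \<Longrightarrow> rep k (restrict s U) V \<sigma> \<longleftrightarrow> rep k s V \<sigma>"
  unfolding rep_def by auto

text \<open>Sums, products and differentials at a point are computed from the germs there and do not
  see \<open>U\<close>. Scalar multiplication does, through the restriction of \<open>a\<close> from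
  \<open>U\<close>, so it alone needs a local argument with functoriality of
  \<open>A\<close>.\<close>

lemma SS_restrict_hom:
  assumes U: "openin X U" and V: "openin X V" "V \<subseteq> U"
  shows "cdga_hom (rng A U) (SS U) (SS V) (rst A U V) (\<lambda>k s. restrict s V)"
  unfolding cdga_hom_def SS_deg SM_carrier
proof (intro conjI allI ballI)
  show "(\<lambda>s. restrict s V) \<in> S U k \<rightarrow> S V k" for k by (rule Pi_I) (rule S_restrict[OF _ V])
  fix k a x assume a: "a \<in> carrier (rng A U)" and x: "x \<in> S U k"
  show "restrict (a \<odot>\<^bsub>SM U k\<^esub> x) V = rst A U V a \<odot>\<^bsub>SM V k\<^esub> restrict x V"
  proof (rule S_eqI')
    fix p assume "p \<in> V"
    then obtain W \<sigma> where W: "p \<in> W" "W \<subseteq> V" "openin X W" "rep k (restrict x V) W \<sigma>" using rep1[OF S_restrict[OF x V]] by metis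
    have WU: "W \<subseteq> U" using W V by blast
    have x': "rep k x W \<sigma>" using W(4) rep_restrict[OF W(2)] by simp
    show "\<exists>W \<sigma> \<tau>. p \<in> W \<and> rep k (restrict (a \<odot>\<^bsub>SM U k\<^esub> x) V) W \<sigma> \<and> rep k (rst A U V a \<odot>\<^bsub>SM V k\<^esub> restrict x V) W \<tau> \<and> \<sigma> = \<tau>"
      by (rule rep_eqI[OF W(1) rep_restrict[OF W(2), THEN iffD2, OF rep_smult[OF x' WU U a]] rep_smult[OF W(4,2) V(1) A_rst_closed[OF U V a]]])
         (simp add: A_rst_comp[OF U V(1) W(3) V(2) W(2) a])
  qed (auto intro!: S_restrict[OF _ V] S_smult A_rst_closed U V a x)
qed (use V(2) in \<open>auto simp: sheafified_deg_def sheafify_def fun_eq_iff subset_iff\<close>)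

lemma sheafify_res: "res (sheafify X A P) U V = (\<lambda>k s. restrict s V)"
  by (simp add: sheafify_def)

lemma set_presheaf_sections: "set_presheaf X (\<lambda>U. S U k) (\<lambda>U V s. restrict s V)"
  unfolding set_presheaf_def by (auto simp: S_restrict S_ext extensional_restrict Int_absorb1)

text \<open>Sections are functions on points, so they glue pointwise, and being locally represented
  is inherited from the members of the family. Extensionality makes the glued section
  unique.\<close>

lemma set_sheaf_sections: "set_sheaf X (\<lambda>U. S U k) (\<lambda>U V s. restrict s V)"
  unfolding set_sheaf_def
proof (intro conjI allI impI set_presheaf_sections)
  fix \<U> s assume *: "(\<forall>U\<in>\<U>. openin X U \<and> s U \<in> S U k) \<and>
      (\<forall>U\<in>\<U>. \<forall>V\<in>\<U>. restrict (s U) (U \<inter> V) = restrict (s V) (U \<inter> V))"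
  \<comment> \<open>Any member of the family containing \<open>p\<close> may be chosen, as
    compatibility on overlaps makes the value independent of the choice.\<close>
  define t where "t = (\<lambda>p\<in>\<Union>\<U>. s (SOME U. U \<in> \<U> \<and> p \<in> U) p)"
  have t: "t p = s U p" if "U \<in> \<U>" "p \<in> U" for U p
  proof -
    define V where "V = (SOME U. U \<in> \<U> \<and> p \<in> U)"
    have V: "V \<in> \<U>" "p \<in> V" using someI[of "\<lambda>U. U \<in> \<U> \<and> p \<in> U" U] that unfolding V_def by auto
    have "restrict (s U) (U \<inter> V) = restrict (s V) (U \<inter> V)" using * that V by blast
    then have "restrict (s U) (U \<inter> V) p = restrict (s V) (U \<inter> V) p" by (rule fun_cong)
    then show ?thesis using that V by (auto simp: t_def V_def[symmetric])
  qed
  show "\<exists>!t. t \<in> S (\<Union>\<U>) k \<and> (\<forall>U\<in>\<U>. restrict t U = s U)"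
  proof (rule ex1I[of _ t], intro conjI ballI)
    show "t \<in> S (\<Union>\<U>) k"
    proof (rule SI)
      fix p assume "p \<in> \<Union>\<U>"
      then obtain U where U: "U \<in> \<U>" "p \<in> U" by blast
      then obtain V \<sigma> where V: "p \<in> V" "V \<subseteq> U" "rep k (s U) V \<sigma>" using * rep1[of "s U" k U p] by metis
      have "rep k t V \<sigma>" by (rule rep_cong[OF V(3)]) (use V(2) U t in blast)
      then show "\<exists>V \<sigma>. p \<in> V \<and> V \<subseteq> \<Union>\<U> \<and> rep k t V \<sigma>" using V U by blast
    qed (simp add: t_def)
    show "restrict t U = s U" if "U \<in> \<U>" for U
      by (rule extensionalityI[of _ U]) (use * that t S_ext in auto)
    fix t' assume t': "t' \<in> S (\<Union>\<U>) k \<and> (\<forall>U\<in>\<U>. restrict t' U = s U)"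
    show "t' = t"
    proof (rule extensionalityI[of _ "\<Union>\<U>"])
      fix p assume "p \<in> \<Union>\<U>"
      then obtain U where U: "U \<in> \<U>" "p \<in> U" by blast
      then have "t' p = restrict t' U p" by simp
      with t' U t show "t' p = t p" by simp
    qed (use t' S_ext in \<open>auto simp: t_def\<close>)
  qed
qed

theorem sheafify_cdga_sheaf: "is_cdga_sheaf X A (sheafify X A P)"
  unfolding is_cdga_sheaf_def is_cdga_presheaf_def sheafify_res SS_deg SM_carrier
  by (intro conjI allI impI SS_cdga SS_restrict_hom set_presheaf_sections set_sheaf_sections) auto

end

section \<open>Direct images and induced maps\<close>

lemma openin_preim: "continuous_map X Y f \<Longrightarrow> openin Y U \<Longrightarrow> openin X (preim X f U)"
  unfolding preim_def by (rule openin_continuous_map_preimage)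

lemma preim_mono: "V \<subseteq> U \<Longrightarrow> preim X f V \<subseteq> preim X f U"
  by (auto simp: preim_def)

lemma set_presheaf_push:
  assumes "continuous_map X Y f" "set_presheaf X S r"
  shows "set_presheaf Y (\<lambda>U. S (preim X f U)) (\<lambda>U V. r (preim X f U) (preim X f V))"
  unfolding set_presheaf_def
proof (intro conjI allI impI)
  note o = openin_preim[OF assms(1)]
  note S = assms(2)[unfolded set_presheaf_def, THEN conjunct1, rule_format]
    assms(2)[unfolded set_presheaf_def, THEN conjunct2, THEN conjunct1, rule_format]
    assms(2)[unfolded set_presheaf_def, THEN conjunct2, THEN conjunct2, rule_format]
  show "r (preim X f U) (preim X f V) \<in> S (preim X f U) \<rightarrow> S (preim X f V)"
    if "openin Y U \<and> openin Y V \<and> V \<subseteq> U" for U V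
    by (rule S(1)) (simp add: that o preim_mono)
  show "\<forall>s\<in>S (preim X f U). r (preim X f U) (preim X f U) s = s" if "openin Y U" for U
    by (simp add: that o S(2))
  show "\<forall>s\<in>S (preim X f U). r (preim X f V) (preim X f W) (r (preim X f U) (preim X f V) s) = r (preim X f U) (preim X f W) s"
    if "openin Y U \<and> openin Y V \<and> openin Y W \<and> V \<subseteq> U \<and> W \<subseteq> V" for U V W
    by (rule ballI, rule S(3)) (simp_all add: that o preim_mono)
qed

lemma set_sheaf_push:
  assumes f: "continuous_map X Y f" and S: "set_sheaf X S r"
  shows "set_sheaf Y (\<lambda>U. S (preim X f U)) (\<lambda>U V. r (preim X f U) (preim X f V))"
  unfolding set_sheaf_def
proof (intro conjI allI impI)
  let ?p = "preim X f"
  have S_pre: "set_presheaf X S r" using S by (simp add: set_sheaf_def)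
  then show "set_presheaf Y (\<lambda>U. S (?p U)) (\<lambda>U V. r (?p U) (?p V))" by (rule set_presheaf_push[OF f])
  fix \<U> s assume *: "(\<forall>U\<in>\<U>. openin Y U \<and> s U \<in> S (?p U)) \<and>
      (\<forall>U\<in>\<U>. \<forall>V\<in>\<U>. r (?p U) (?p (U \<inter> V)) (s U) = r (?p V) (?p (U \<inter> V)) (s V))"
  \<comment> \<open>Distinct members of the family may have the same preimage; compatibility forces their sections to agree.\<close>
  define s' where "s' W = s (SOME U. U \<in> \<U> \<and> ?p U = W)" for W
  have s': "s' (?p U) = s U" if U: "U \<in> \<U>" for U
  proof -
    define V where "V = (SOME V. V \<in> \<U> \<and> ?p V = ?p U)"
    have V: "V \<in> \<U>" "?p V = ?p U" using someI[of "\<lambda>V. V \<in> \<U> \<and> ?p V = ?p U" U] U unfolding V_def by auto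
    have "?p (U \<inter> V) = ?p U" using V(2) by (auto simp: preim_def)
    moreover have "r (?p U) (?p (U \<inter> V)) (s U) = r (?p V) (?p (U \<inter> V)) (s V)" using * U V(1) by blast
    moreover have id: "r (?p W) (?p W) (s W) = s W" if "W \<in> \<U>" for W
      using S_pre * that openin_preim[OF f, of W] unfolding set_presheaf_def by simp
    ultimately have "s U = s V" using id[OF U] id[OF V(1)] V(2) by metis
    then show ?thesis by (simp add: s'_def V_def[symmetric])
  qed
  have un: "\<Union>(?p ` \<U>) = ?p (\<Union>\<U>)" by (auto simp: preim_def)
  have "(\<forall>W\<in>?p ` \<U>. openin X W \<and> s' W \<in> S W) \<and> (\<forall>W\<in>?p ` \<U>. \<forall>W'\<in>?p ` \<U>. r W (W \<inter> W') (s' W) = r W' (W \<inter> W') (s' W'))"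
  proof (intro conjI ballI; elim imageE; hypsubst)
    fix U V assume UV: "U \<in> \<U>" "V \<in> \<U>"
    have "?p U \<inter> ?p V = ?p (U \<inter> V)" by (auto simp: preim_def)
    moreover have "r (?p U) (?p (U \<inter> V)) (s U) = r (?p V) (?p (U \<inter> V)) (s V)" using * UV by blast
    ultimately show "r (?p U) (?p U \<inter> ?p V) (s' (?p U)) = r (?p V) (?p U \<inter> ?p V) (s' (?p V))"
      using UV by (simp add: s')
  qed (use * s' openin_preim[OF f] in auto)
  from S[unfolded set_sheaf_def, THEN conjunct2, THEN spec, THEN spec, THEN mp, OF this]
  have "\<exists>!t. t \<in> S (\<Union>(?p ` \<U>)) \<and> (\<forall>W\<in>?p ` \<U>. r (\<Union>(?p ` \<U>)) W t = s' W)" .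
  then show "\<exists>!t. t \<in> S (?p (\<Union>\<U>)) \<and> (\<forall>U\<in>\<U>. r (?p (\<Union>\<U>)) (?p U) t = s U)"
    unfolding un by (simp add: s')
qed

theorem push_cdga_sheaf:
  assumes f: "continuous_map X Y f" and P: "is_cdga_sheaf X A P"
  shows "is_cdga_sheaf Y (push_cinf X f A) (push_cdga X f P)"
proof -
  note o = openin_preim[OF f]
  have P_pre: "is_cdga_presheaf X A P" using P by (simp add: is_cdga_sheaf_def)
  have sh: "set_sheaf Y (\<lambda>U. carrier (deg (sec (push_cdga X f P) U) k)) (\<lambda>U V. res (push_cdga X f P) U V k)" for k
    using set_sheaf_push[OF f, of "\<lambda>U. carrier (deg (sec P U) k)" "\<lambda>U V. res P U V k"] P
    by (simp add: is_cdga_sheaf_def push_cdga_def)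
  show ?thesis
    unfolding is_cdga_sheaf_def is_cdga_presheaf_def
  proof (intro conjI allI impI sh)
    show "is_cdga (rng (push_cinf X f A) U) (sec (push_cdga X f P) U)" if "openin Y U" for U
      using P_pre o[OF that] by (simp add: is_cdga_presheaf_def push_cinf_def push_cdga_def)
    show "cdga_hom (rng (push_cinf X f A) U) (sec (push_cdga X f P) U) (sec (push_cdga X f P) V)
        (rst (push_cinf X f A) U V) (res (push_cdga X f P) U V)" if "openin Y U \<and> openin Y V \<and> V \<subseteq> U" for U V
      using P_pre o[of U] o[of V] preim_mono[of V U X f] that by (simp add: is_cdga_presheaf_def push_cinf_def push_cdga_def)
    show "set_presheaf Y (\<lambda>U. carrier (deg (sec (push_cdga X f P) U) k)) (\<lambda>U V. res (push_cdga X f P) U V k)" for k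
      using sh[of k] by (simp add: set_sheaf_def)
  qed
qed

section \<open>Maps of presheaves of CDGAs over a continuous map\<close>

locale map_of_presheaves =
  X: presheaf_of_cdgas X A P + Y: presheaf_of_cdgas Y B Q
  for X :: "'p topology" and A :: "('p, 'a) cinf_presheaf" and P :: "('p, 'a, 'w) cdga_presheaf"
    and Y :: "'q topology" and B :: "('q, 'b) cinf_presheaf" and Q :: "('q, 'b, 'v) cdga_presheaf" +
  fixes f :: "'p \<Rightarrow> 'q" and \<phi> :: "'q set \<Rightarrow> 'b \<Rightarrow> 'a" and \<Phi> :: "'q set \<Rightarrow> int \<Rightarrow> 'v \<Rightarrow> 'w"
  assumes f: "continuous_map X Y f"
    and \<phi>_closed: "\<And>U b. openin Y U \<Longrightarrow> b \<in> carrier (rng B U) \<Longrightarrow> \<phi> U b \<in> carrier (rng A (preim X f U))"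
    and \<phi>_natural: "\<And>U V b. openin Y U \<Longrightarrow> openin Y V \<Longrightarrow> V \<subseteq> U \<Longrightarrow> b \<in> carrier (rng B U) \<Longrightarrow>
      \<phi> V (rst B U V b) = rst A (preim X f U) (preim X f V) (\<phi> U b)"
    and \<Phi>_hom: "\<And>U. openin Y U \<Longrightarrow> cdga_hom (rng B U) (sec Q U) (sec P (preim X f U)) (\<phi> U) (\<Phi> U)"
    and \<Phi>_natural: "\<And>U V k x. openin Y U \<Longrightarrow> openin Y V \<Longrightarrow> V \<subseteq> U \<Longrightarrow> x \<in> carrier (deg (sec Q U) k) \<Longrightarrow>
      \<Phi> V k (res Q U V k x) = res P (preim X f U) (preim X f V) k (\<Phi> U k x)"
begin

abbreviation "pre \<equiv> preim X f"

lemmas pre_open = openin_preim[OF f]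
lemmas \<Phi>_closed = cdga_homD(1)[OF \<Phi>_hom]

text \<open>As for the operations of \<open>sheafify\<close>, the union runs over all
  representatives of the germ at \<open>f p\<close>; that they give one germ at \<open>p\<close> is
  part of \<open>rep_F\<close>.\<close>

definition F :: "'q set \<Rightarrow> int \<Rightarrow> ('q \<Rightarrow> ('q set \<times> 'v) set) \<Rightarrow> 'p \<Rightarrow> ('p set \<times> 'w) set" where
  "F U k s = (\<lambda>p\<in>pre U. \<Union>{germ X P k p (pre V) (\<Phi> V k \<sigma>) | V \<sigma>. (V, \<sigma>) \<in> s (f p)})"

text \<open>If two sections agree near \<open>f p\<close> on \<open>Z\<close>, then by naturality
  their images agree on \<open>pre Z\<close>, a neighbourhood of \<open>p\<close>. Hence the image
  of one representative determines the value of \<open>F\<close>, and \<open>F\<close> acquires a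
  rule for \<open>rep\<close> like any other operation.\<close>

lemma rep_F:
  assumes "Y.rep k s V \<sigma>" "V \<subseteq> U"
  shows "X.rep k (F U k s) (pre V) (\<Phi> V k \<sigma>)"
  unfolding X.rep_def
proof (intro conjI ballI)
  note V = Y.repD(1,2)[OF assms(1)]
  show "openin X (pre V)" "\<Phi> V k \<sigma> \<in> carrier (deg (sec P (pre V)) k)" using V by (auto intro: pre_open \<Phi>_closed)
  fix p assume p: "p \<in> pre V"
  have fp: "f p \<in> V" "p \<in> topspace X" using p by (auto simp: preim_def)
  have germs: "germ X P k p (pre W) (\<Phi> W k \<tau>) = germ X P k p (pre V) (\<Phi> V k \<sigma>)"
    if W: "(W, \<tau>) \<in> germ Y Q k (f p) V \<sigma>" for W \<tau>
  proof -
    note W' = Y.germ_memD[OF W]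
    then obtain Z where Z: "openin Y Z" "f p \<in> Z" "Z \<subseteq> V" "Z \<subseteq> W" "res Q V Z k \<sigma> = res Q W Z k \<tau>" by blast
    show ?thesis
    proof (rule X.germ_eqI[where Z = "pre Z"])
      show "p \<in> pre Z" using Z(2) fp by (simp add: preim_def)
      show "res P (pre W) (pre Z) k (\<Phi> W k \<tau>) = res P (pre V) (pre Z) k (\<Phi> V k \<sigma>)"
        using \<Phi>_natural[OF W'(1) Z(1,4) W'(3)] \<Phi>_natural[OF V(1) Z(1,3) V(2)] Z(5) by simp
    qed (use Z V W' in \<open>auto intro: pre_open \<Phi>_closed preim_mono[THEN subsetD]\<close>)
  qed
  have "(V, \<sigma>) \<in> germ Y Q k (f p) V \<sigma>" by (rule Y.germ_refl[OF V(1) fp(1) V(2)])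
  then have "\<Union>{germ X P k p (pre W) (\<Phi> W k \<tau>) | W \<tau>. (W, \<tau>) \<in> germ Y Q k (f p) V \<sigma>} = germ X P k p (pre V) (\<Phi> V k \<sigma>)"
    using germs by blast
  moreover have "p \<in> pre U" using p preim_mono[OF assms(2), of X f] by blast
  ultimately show "F U k s p = germ X P k p (pre V) (\<Phi> V k \<sigma>)"
    using Y.repD(3)[OF assms(1) fp(1)] by (simp add: F_def)
qed

lemma F_closed: "s \<in> Y.S U k \<Longrightarrow> F U k s \<in> X.S (pre U) k"
proof (rule X.SI)
  show "F U k s \<in> extensional (pre U)" by (simp add: F_def)
  fix p assume s: "s \<in> Y.S U k" and p: "p \<in> pre U"
  then have "f p \<in> U" "p \<in> topspace X" by (auto simp: preim_def)
  with Y.rep1[OF s] obtain V \<sigma> where V: "f p \<in> V" "V \<subseteq> U" "Y.rep k s V \<sigma>" by metis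
  have "p \<in> pre V" "pre V \<subseteq> pre U" using V preim_mono \<open>p \<in> topspace X\<close> by (auto simp: preim_def)
  with rep_F[OF V(3,2)] show "\<exists>W \<sigma>. p \<in> W \<and> W \<subseteq> pre U \<and> X.rep k (F U k s) W \<sigma>" by blast
qed

lemma pre_mem: "p \<in> pre U \<Longrightarrow> f p \<in> U" and pre_memI: "p \<in> pre U \<Longrightarrow> f p \<in> V \<Longrightarrow> p \<in> pre V"
  by (auto simp: preim_def)

text \<open>For each operation, computing it before or after \<open>F\<close> yields two
  representatives over the same set \<open>pre V\<close>, and these are equal because
  \<open>\<Phi> V\<close> is a map of CDGAs. For scalars, naturality of \<open>\<phi>\<close> is
  used as well, since the scalar is restricted from \<open>U\<close> to \<open>V\<close>.\<close>

lemma F_hom: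
  assumes U: "openin Y U"
  shows "cdga_hom (rng B U) (sec (sheafify Y B Q) U) (sec (sheafify X A P) (pre U)) (\<phi> U) (F U)"
  unfolding cdga_hom_def Y.SS_deg X.SS_deg Y.SM_carrier X.SM_carrier
proof (intro conjI allI ballI)
  show "F U k \<in> Y.S U k \<rightarrow> X.S (pre U) k" for k by (rule Pi_I) (rule F_closed)
next
  fix k x y assume xy: "x \<in> Y.S U k" "y \<in> Y.S U k"
  show "F U k (x \<oplus>\<^bsub>Y.SM U k\<^esub> y) = F U k x \<oplus>\<^bsub>X.SM (pre U) k\<^esub> F U k y"
  proof (rule X.S_eqI')
    fix p assume p: "p \<in> pre U"
    obtain V \<sigma> \<tau> where V: "f p \<in> V" "V \<subseteq> U" "openin Y V" "Y.rep k x V \<sigma>" "Y.rep k y V \<tau>"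
      "\<sigma> \<in> carrier (deg (sec Q V) k)" "\<tau> \<in> carrier (deg (sec Q V) k)" using Y.rep2[OF xy pre_mem[OF p]] by metis
    show "\<exists>W \<sigma> \<tau>. p \<in> W \<and> X.rep k (F U k (x \<oplus>\<^bsub>Y.SM U k\<^esub> y)) W \<sigma> \<and>
        X.rep k (F U k x \<oplus>\<^bsub>X.SM (pre U) k\<^esub> F U k y) W \<tau> \<and> \<sigma> = \<tau>"
      by (rule X.rep_eqI[OF pre_memI[OF p V(1)] rep_F[OF Y.rep_add[OF V(4,5,2)] V(2)]
            X.rep_add[OF rep_F[OF V(4,2)] rep_F[OF V(5,2)] preim_mono[OF V(2)]] cdga_homD(2)[OF \<Phi>_hom[OF V(3)] V(6,7)]])
  qed (use xy in \<open>auto intro!: F_closed Y.S_add X.S_add\<close>)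
next
  fix k b x assume b: "b \<in> carrier (rng B U)" and x: "x \<in> Y.S U k"
  show "F U k (b \<odot>\<^bsub>Y.SM U k\<^esub> x) = \<phi> U b \<odot>\<^bsub>X.SM (pre U) k\<^esub> F U k x"
  proof (rule X.S_eqI')
    fix p assume p: "p \<in> pre U"
    obtain V \<sigma> where V: "f p \<in> V" "V \<subseteq> U" "openin Y V" "Y.rep k x V \<sigma>"
      "\<sigma> \<in> carrier (deg (sec Q V) k)" using Y.rep1[OF x pre_mem[OF p]] by metis
    show "\<exists>W \<sigma> \<tau>. p \<in> W \<and> X.rep k (F U k (b \<odot>\<^bsub>Y.SM U k\<^esub> x)) W \<sigma> \<and>
        X.rep k (\<phi> U b \<odot>\<^bsub>X.SM (pre U) k\<^esub> F U k x) W \<tau> \<and> \<sigma> = \<tau>"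
      by (rule X.rep_eqI[OF pre_memI[OF p V(1)] rep_F[OF Y.rep_smult[OF V(4,2) U b] V(2)]
            X.rep_smult[OF rep_F[OF V(4,2)] preim_mono[OF V(2)] pre_open[OF U] \<phi>_closed[OF U b]]])
         (simp add: cdga_homD(3)[OF \<Phi>_hom[OF V(3)] Y.A_rst_closed[OF U V(3,2) b] V(5)] \<phi>_natural[OF U V(3,2) b])
  qed (use x U b in \<open>auto intro!: F_closed Y.S_smult X.S_smult \<phi>_closed pre_open\<close>)
next
  fix k l x y assume xy: "x \<in> Y.S U k" "y \<in> Y.S U l"
  show "F U (k + l) (prd (Y.SS U) k l x y) = prd (X.SS (pre U)) k l (F U k x) (F U l y)"
  proof (rule X.S_eqI')
    fix p assume p: "p \<in> pre U"
    obtain V \<sigma> \<tau> where V: "f p \<in> V" "V \<subseteq> U" "openin Y V" "Y.rep k x V \<sigma>" "Y.rep l y V \<tau>"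
      "\<sigma> \<in> carrier (deg (sec Q V) k)" "\<tau> \<in> carrier (deg (sec Q V) l)" using Y.rep2[OF xy pre_mem[OF p]] by metis
    show "\<exists>W \<sigma> \<tau>. p \<in> W \<and> X.rep (k + l) (F U (k + l) (prd (Y.SS U) k l x y)) W \<sigma> \<and>
        X.rep (k + l) (prd (X.SS (pre U)) k l (F U k x) (F U l y)) W \<tau> \<and> \<sigma> = \<tau>"
      by (rule X.rep_eqI[OF pre_memI[OF p V(1)] rep_F[OF Y.rep_prd[OF V(4,5,2)] V(2)]
            X.rep_prd[OF rep_F[OF V(4,2)] rep_F[OF V(5,2)] preim_mono[OF V(2)]] cdga_homD(4)[OF \<Phi>_hom[OF V(3)] V(6,7)]])
  qed (use xy in \<open>auto intro!: F_closed Y.S_prd X.S_prd\<close>)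
next
  fix k x assume x: "x \<in> Y.S U k"
  show "F U (k + 1) (dif (Y.SS U) k x) = dif (X.SS (pre U)) k (F U k x)"
  proof (rule X.S_eqI')
    fix p assume p: "p \<in> pre U"
    obtain V \<sigma> where V: "f p \<in> V" "V \<subseteq> U" "openin Y V" "Y.rep k x V \<sigma>"
      "\<sigma> \<in> carrier (deg (sec Q V) k)" using Y.rep1[OF x pre_mem[OF p]] by metis
    show "\<exists>W \<sigma> \<tau>. p \<in> W \<and> X.rep (k + 1) (F U (k + 1) (dif (Y.SS U) k x)) W \<sigma> \<and>
        X.rep (k + 1) (dif (X.SS (pre U)) k (F U k x)) W \<tau> \<and> \<sigma> = \<tau>"
      by (rule X.rep_eqI[OF pre_memI[OF p V(1)] rep_F[OF Y.rep_dif[OF V(4,2)] V(2)]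
            X.rep_dif[OF rep_F[OF V(4,2)] preim_mono[OF V(2)]] cdga_homD(5)[OF \<Phi>_hom[OF V(3)] V(5)]])
  qed (use x in \<open>auto intro!: F_closed Y.S_dif X.S_dif\<close>)
qed

text \<open>The value of \<open>F\<close> at \<open>p\<close> depends on the germ
  \<open>s (f p)\<close> alone and not on the open set.\<close>

lemma F_restrict:
  assumes "V \<subseteq> U"
  shows "F V k (restrict s V) = restrict (F U k s) (pre V)"
  using preim_mono[OF assms, of X f] by (auto simp: F_def fun_eq_iff preim_def)

lemma F_unit:
  assumes U: "openin Y U" and \<omega>: "\<omega> \<in> carrier (deg (sec Q U) k)"
  shows "F U k (sheafify_unit Y Q U k \<omega>) = sheafify_unit X P (pre U) k (\<Phi> U k \<omega>)"
proof (rule X.S_eqI)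
  note c = \<Phi>_closed[OF U \<omega>]
  show "F U k (sheafify_unit Y Q U k \<omega>) \<in> X.S (pre U) k" by (rule F_closed[OF Y.unit_closed[OF U \<omega>]])
  show "sheafify_unit X P (pre U) k (\<Phi> U k \<omega>) \<in> X.S (pre U) k" by (rule X.unit_closed[OF pre_open[OF U] c])
  show "\<exists>V \<sigma>. p \<in> V \<and> X.rep k (F U k (sheafify_unit Y Q U k \<omega>)) V \<sigma> \<and>
      X.rep k (sheafify_unit X P (pre U) k (\<Phi> U k \<omega>)) V \<sigma>" if "p \<in> pre U" for p
    using that rep_F[OF Y.rep_unit[OF U \<omega>] order.refl] X.rep_unit[OF pre_open[OF U] c] by blast
qed

theorem F_sheaf_map:
  "cdga_sheaf_map Y B (sheafify Y B Q) (push_cinf X f A) (push_cdga X f (sheafify X A P)) \<phi> F"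
  unfolding cdga_sheaf_map_def
proof (intro conjI allI impI ballI)
  show "is_cdga_sheaf Y B (sheafify Y B Q)" by (rule Y.sheafify_cdga_sheaf)
  show "is_cdga_sheaf Y (push_cinf X f A) (push_cdga X f (sheafify X A P))"
    by (rule push_cdga_sheaf[OF f X.sheafify_cdga_sheaf])
  show "cdga_hom (rng B U) (sec (sheafify Y B Q) U) (sec (push_cdga X f (sheafify X A P)) U) (\<phi> U) (F U)"
    if "openin Y U" for U using F_hom[OF that] by (simp add: push_cdga_def)
  show "F V k (res (sheafify Y B Q) U V k x) = res (push_cdga X f (sheafify X A P)) U V k (F U k x)"
    if "openin Y U \<and> openin Y V \<and> V \<subseteq> U" for U V k x
    using F_restrict that by (simp add: push_cdga_def Y.sheafify_res X.sheafify_res)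
qed

text \<open>\<open>G\<close> commutes with restriction, so it may be compared with \<open>F\<close>
  over small open sets, where the assumption on images of presheaf sections decides.\<close>

theorem sheaf_map_unique:
  assumes G: "cdga_sheaf_map Y B (sheafify Y B Q) (push_cinf X f A) (push_cdga X f (sheafify X A P)) \<phi> G"
    and unit: "\<And>U k \<omega>. openin Y U \<Longrightarrow> \<omega> \<in> carrier (deg (sec Q U) k) \<Longrightarrow>
      G U k (sheafify_unit Y Q U k \<omega>) = sheafify_unit X P (pre U) k (\<Phi> U k \<omega>)"
    and U: "openin Y U" and s: "s \<in> Y.S U k"
  shows "G U k s = F U k s"
proof (rule extensionalityI[of _ "pre U"])
  have "G U k s \<in> X.S (pre U) k"
    using G U s cdga_homD(1)[of "rng B U" "Y.SS U" "X.SS (pre U)" "\<phi> U" "G U" s k]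
    by (simp add: cdga_sheaf_map_def push_cdga_def Y.SS_deg Y.SM_carrier X.SS_deg X.SM_carrier)
  then show "G U k s \<in> extensional (pre U)" by (rule X.S_ext)
  show "F U k s \<in> extensional (pre U)" by (rule X.S_ext[OF F_closed[OF s]])
  fix p assume p: "p \<in> pre U"
  obtain V \<sigma> where V: "f p \<in> V" "V \<subseteq> U" "openin Y V" "Y.rep k s V \<sigma>"
    "\<sigma> \<in> carrier (deg (sec Q V) k)" using Y.rep1[OF s pre_mem[OF p]] by metis
  \<comment> \<open>Over \<open>V\<close> the section is the image of a single presheaf section, so
    \<open>unit\<close> applies to it.\<close>
  have sV: "restrict s V = sheafify_unit Y Q V k \<sigma>"
    by (rule extensionalityI[of _ V]) (use Y.repD(3)[OF V(4)] in \<open>auto simp: sheafify_unit_def\<close>)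
  have "restrict (G U k s) (pre V) = G V k (restrict s V)"
    using G U V s by (simp add: cdga_sheaf_map_def push_cdga_def Y.SS_deg Y.SM_carrier Y.sheafify_res X.sheafify_res)
  also have "\<dots> = F V k (restrict s V)" unfolding sV by (simp add: unit F_unit V)
  also have "\<dots> = restrict (F U k s) (pre V)" by (rule F_restrict[OF V(2)])
  finally have "restrict (G U k s) (pre V) p = restrict (F U k s) (pre V) p" by (rule fun_cong)
  then show "G U k s p = F U k s p" using pre_memI[OF p V(1)] by simp
qed

end

section \<open>Application to differential forms\<close>

lemma forms_presheaf_of_cdgas:
  assumes "cinf_ringed_space X A"
  shows "presheaf_of_cdgas X A (forms_presheaf A)"
proof
  show ring: "cinf_ring (rng A U)" if "openin X U" for U
    using assms that by (simp add: cinf_ringed_space_def)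
  show hom: "cinf_hom (rng A U) (rng A V) (rst A U V)" if "openin X U" "openin X V" "V \<subseteq> U" for U V
    using assms that by (simp add: cinf_ringed_space_def)
  show A: "set_presheaf X (\<lambda>U. carrier (rng A U)) (rst A)"
    using assms by (simp add: cinf_ringed_space_def set_sheaf_def)
  have cdga: "is_cdga (rng A U) (forms (rng A U))" if "openin X U" for U
    by (rule smooth_ring.forms_cdga[OF smooth_ring.intro[OF ring[OF that]]])
  have chom: "cdga_hom (rng A U) (forms (rng A U)) (forms (rng A V)) (rst A U V) (forms_map (rng A U) (rng A V) (rst A U V))"
    if "openin X U" "openin X V" "V \<subseteq> U" for U V
    by (rule smooth_hom.forms_cdga_hom[OF smooth_homI[OF ring[OF that(1)] ring[OF that(2)] hom[OF that]]])
  have id: "forms_map (rng A U) (rng A U) (rst A U U) k s = s" if "openin X U" "s \<in> carrier (form_deg (rng A U) k)" for U k s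
    by (rule forms_map_id[OF ring[OF that(1)] hom[OF that(1) that(1) order.refl] _ that(2)])
       (use A that(1) in \<open>simp add: set_presheaf_def\<close>)
  have comp: "forms_map (rng A V) (rng A W) (rst A V W) k (forms_map (rng A U) (rng A V) (rst A U V) k s) =
      forms_map (rng A U) (rng A W) (rst A U W) k s"
    if "openin X U" "openin X V" "openin X W" "V \<subseteq> U" "W \<subseteq> V" "s \<in> carrier (form_deg (rng A U) k)" for U V W k s
    by (rule forms_map_comp[OF ring[OF that(1)] ring[OF that(2)] ring[OF that(3)] hom[OF that(1,2,4)] hom[OF that(2,3,5)] hom[OF that(1,3)] _ that(6)])
       (use A that in \<open>auto simp: set_presheaf_def\<close>)
  show "is_cdga_presheaf X A (forms_presheaf A)"
    unfolding is_cdga_presheaf_def forms_presheaf_def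
  proof (intro conjI allI impI)
    fix k
    show "set_presheaf X (\<lambda>U. carrier (deg (sec \<lparr>sec = \<lambda>U. forms (rng A U), res = \<lambda>U V. forms_map (rng A U) (rng A V) (rst A U V)\<rparr> U) k))
      (\<lambda>U V. res \<lparr>sec = \<lambda>U. forms (rng A U), res = \<lambda>U V. forms_map (rng A U) (rng A V) (rst A U V)\<rparr> U V k)"
      unfolding set_presheaf_def using id comp cdga_homD(1)[OF chom] by (auto simp: forms_def)
  qed (use cdga chom in auto)
qed

text \<open>Mere existence of some map of sheaves would say little, so \<open>induced_by\<close>
  ties the map to \<open>f_sh\<close>. Uniqueness is claimed on sections over open sets, because
  elsewhere a map of sheaves is unconstrained.\<close>

theorem theorem5p9:
  fixes X :: "'p topology" and A :: "('p, 'a) cinf_presheaf"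
    and Y :: "'q topology" and B :: "('q, 'b) cinf_presheaf"
    and f :: "'p \<Rightarrow> 'q" and f_sh :: "'q set \<Rightarrow> 'b \<Rightarrow> 'a"
  assumes "cinf_ringed_space X A"
    and "cinf_ringed_space Y B"
    and "ringed_space_map X A Y B f f_sh"
  shows "\<exists>F. cdga_sheaf_map Y B (forms_sheaf Y B)
               (push_cinf X f A) (push_cdga X f (forms_sheaf X A)) f_sh F \<and>
             induced_by X A Y B f f_sh F \<and>
             (\<forall>G. cdga_sheaf_map Y B (forms_sheaf Y B)
                    (push_cinf X f A) (push_cdga X f (forms_sheaf X A)) f_sh G \<and>
                  induced_by X A Y B f f_sh G \<longrightarrow>
                (\<forall>U k. openin Y U \<longrightarrow>
                   (\<forall>s\<in>carrier (deg (sec (forms_sheaf Y B) U) k). G U k s = F U k s)))"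
proof -
  interpret X: presheaf_of_cdgas X A "forms_presheaf A" by (rule forms_presheaf_of_cdgas[OF assms(1)])
  interpret Y: presheaf_of_cdgas Y B "forms_presheaf B" by (rule forms_presheaf_of_cdgas[OF assms(2)])
  have f: "continuous_map X Y f" and sh: "cinf_sheaf_map Y B (push_cinf X f A) f_sh"
    using assms(3) by (simp_all add: ringed_space_map_def)
  have hom: "cinf_hom (rng B U) (rng A (preim X f U)) (f_sh U)" if "openin Y U" for U
    using sh that by (simp add: cinf_sheaf_map_def push_cinf_def)
  have nat: "f_sh V (rst B U V b) = rst A (preim X f U) (preim X f V) (f_sh U b)"
    if "openin Y U" "openin Y V" "V \<subseteq> U" "b \<in> carrier (rng B U)" for U V b
    using sh that by (simp add: cinf_sheaf_map_def push_cinf_def)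
  note o = openin_preim[OF f]
  let ?\<Phi> = "\<lambda>U. forms_map (rng B U) (rng A (preim X f U)) (f_sh U)"
  interpret map_of_presheaves X A "forms_presheaf A" Y B "forms_presheaf B" f f_sh ?\<Phi>
  proof
    show "continuous_map X Y f" by (rule f)
    show "f_sh U b \<in> carrier (rng A (preim X f U))" if "openin Y U" "b \<in> carrier (rng B U)" for U b
      using hom[OF that(1)] that(2) by (auto simp: cinf_hom_def)
    show "f_sh V (rst B U V b) = rst A (preim X f U) (preim X f V) (f_sh U b)"
      if "openin Y U" "openin Y V" "V \<subseteq> U" "b \<in> carrier (rng B U)" for U V b by (rule nat[OF that])
    show "cdga_hom (rng B U) (sec (forms_presheaf B) U) (sec (forms_presheaf A) (preim X f U)) (f_sh U) (?\<Phi> U)"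
      if "openin Y U" for U
      using smooth_hom.forms_cdga_hom[OF smooth_homI[OF Y.A_ring[OF that] X.A_ring[OF o[OF that]] hom[OF that]]]
      by (simp add: forms_presheaf_def)
    fix U V k x assume UV: "openin Y U" "openin Y V" "V \<subseteq> U" and "x \<in> carrier (deg (sec (forms_presheaf B) U) k)"
    then have x: "x \<in> carrier (form_deg (rng B U) k)" by (simp add: forms_presheaf_def forms_def)
    \<comment> \<open>Both ways around the naturality square are compositions of maps of forms. Each
      is identified with the map of forms of this one homomorphism, by
      \<open>forms_map_comp\<close>.\<close>
    let ?h = "\<lambda>b. f_sh V (rst B U V b)"
    have h: "cinf_hom (rng B U) (rng A (preim X f V)) ?h"
    proof -
      have "map ?h as = map (f_sh V) (map (rst B U V) as)" for as by simp
      moreover have "set (map (rst B U V) as) \<subseteq> carrier (rng B V)" if "set as \<subseteq> carrier (rng B U)" for as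
        using that Y.A_rst_closed[OF UV] by auto
      ultimately show ?thesis
        using hom[OF UV(2)] Y.A_hom[OF UV] Y.A_rst_closed[OF UV] unfolding cinf_hom_def by (auto simp del: map_map)
    qed
    have "?\<Phi> V k (forms_map (rng B U) (rng B V) (rst B U V) k x) = forms_map (rng B U) (rng A (preim X f V)) ?h k x"
      by (rule forms_map_comp[OF Y.A_ring[OF UV(1)] Y.A_ring[OF UV(2)] X.A_ring[OF o[OF UV(2)]] Y.A_hom[OF UV] hom[OF UV(2)] h _ x]) simp
    moreover have "forms_map (rng A (preim X f U)) (rng A (preim X f V)) (rst A (preim X f U) (preim X f V)) k (?\<Phi> U k x) =
        forms_map (rng B U) (rng A (preim X f V)) ?h k x"
      by (rule forms_map_comp[OF Y.A_ring[OF UV(1)] X.A_ring[OF o[OF UV(1)]] X.A_ring[OF o[OF UV(2)]] hom[OF UV(1)]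
            X.A_hom[OF o[OF UV(1)] o[OF UV(2)] preim_mono[OF UV(3)]] h _ x]) (simp add: nat[OF UV])
    ultimately show "?\<Phi> V k (res (forms_presheaf B) U V k x) = res (forms_presheaf A) (preim X f U) (preim X f V) k (?\<Phi> U k x)"
      by (simp add: forms_presheaf_def)
  qed
  have deg: "deg (sec (forms_presheaf B) U) k = form_deg (rng B U) k" for U k by (simp add: forms_presheaf_def forms_def)
  have map: "cdga_sheaf_map Y B (forms_sheaf Y B) (push_cinf X f A) (push_cdga X f (forms_sheaf X A)) f_sh F"
    unfolding forms_sheaf_def by (rule F_sheaf_map)
  have ind: "induced_by X A Y B f f_sh F"
    unfolding induced_by_def using F_unit by (simp add: deg)
  have uniq: "G U k s = F U k s"
    if G: "cdga_sheaf_map Y B (forms_sheaf Y B) (push_cinf X f A) (push_cdga X f (forms_sheaf X A)) f_sh G"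
      "induced_by X A Y B f f_sh G" and U: "openin Y U" and s: "s \<in> carrier (deg (sec (forms_sheaf Y B) U) k)" for G U k s
  proof (rule sheaf_map_unique[OF G(1)[unfolded forms_sheaf_def] _ U])
    show "G U k (sheafify_unit Y (forms_presheaf B) U k \<omega>) = sheafify_unit X (forms_presheaf A) (preim X f U) k (?\<Phi> U k \<omega>)"
      if "openin Y U" "\<omega> \<in> carrier (deg (sec (forms_presheaf B) U) k)" for U k \<omega>
      using G(2)[unfolded induced_by_def, rule_format, OF that(1)] that(2) by (simp add: deg)
    show "s \<in> Y.S U k" using s by (simp add: forms_sheaf_def Y.SS_deg Y.SM_carrier)
  qed
  show ?thesis
  proof (intro exI[of _ F] conjI map ind allI impI ballI)
    fix G U k s assume "cdga_sheaf_map Y B (forms_sheaf Y B) (push_cinf X f A) (push_cdga X f (forms_sheaf X A)) f_sh G \<and>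
        induced_by X A Y B f f_sh G" "openin Y U" "s \<in> carrier (deg (sec (forms_sheaf Y B) U) k)"
    then show "G U k s = F U k s" by (elim conjE) (rule uniq)
  qed
qed

end
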